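(* Let $X$ be a locally compact Hausdorff space, $A$ a closed subspace of $X$, and $G$ an abelian group. Let $\{N\}$ be the system of closed neighborhoods $N$ of $A$ in $X$, directed by inclusion. Write $H^M_*(-)=H^M_*(-,G)$ for Massey homology with coefficients in $G$. Then for every integer $n$ the system $\{N\}$ induces an exact sequence, infinite in both directions, $$\cdots \to \varprojlim{}^{(2k+1)} H^M_{n+k+1}(N) \to \cdots \to \varprojlim{}^{(3)} H^M_{n+2}(N) \to \varprojlim{}^{(1)} H^M_{n+1}(N) \to H^M_n(A) \xrightarrow{\,i_n\,} \varprojlim H^M_n(N) \to \varprojlim{}^{(2)} H^M_{n+1}(N) \to \cdots \to \varprojlim{}^{(2k)} H^M_{n+k}(N) \to \cdots$$ where $i_n$ is the homomorphism induced by the inclusions $A\hookrightarrow N$.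
   Context: Massey cochains: for a locally compact Hausdorff space $X$ and an abelian group $G$, consider functions $\varphi:X^{n+1}\to G$ taking only finitely many values. The support of $\varphi$ is the set of points $x\in X$ such that $\varphi$ does not vanish identically on $U^{n+1}$ for any neighborhood $U$ of $x$. $C_c^n(X,G)$ is the group of such functions with compact support modulo those with empty support, with the usual Alexander–Spanier coboundary $\delta\varphi(x_0,\dots,x_{n+1})=\sum_j(-1)^j\varphi(x_0,\dots,\widehat{x_j},\dots,x_{n+1})$ (and $C_c^n=0$ for $n<0$). Proper maps (continuous maps for which inverse images of compact sets are compact) $f:X\to Y$ induce cochain maps $C_c^*(Y,G)\to C_c^*(X,G)$, $[\varphi]\mapsto[\varphi\circ f^{n+1}]$. Write $C_c^*(X)=C_c^*(X,\mathbb Z)$. Massey homology is $H^M_n(X,G)=H_n(\operatorname{Hom}(C_c^*(X),G))$; it is covariant for proper maps, in particular for inclusions of closed subspaces. Closed neighborhoods $N$ of $A$ with the inclusions $N_1\subset N_2$ yield the inverse system $\{H^M_n(N)\}$. $\varprojlim^{(i)}$ denotes the $i$-th right derived functor of the inverse limit functor on inverse systems of abelian groups indexed by this directed set. *)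

theory Defs
  imports "HOL-Analysis.Analysis" "HOL-Algebra.Product_Groups" "HOL-Algebra.FiniteProduct"
begin

section \<open>Homomorphisms, quotients and exactness\<close>

definition hom_group :: "('a, 'm) monoid_scheme \<Rightarrow> ('b, 'n) monoid_scheme \<Rightarrow> ('a \<Rightarrow> 'b) monoid"
  where "hom_group C G =
    (product_group (carrier C) (\<lambda>_. G))\<lparr>carrier := hom C G \<inter> extensional (carrier C)\<rparr>"

text \<open>The map of quotients \<open>[x] \<mapsto> [f x]\<close>, with values in the cosets of \<open>K\<close> in \<open>H\<close>; it is meant
  for functions \<open>f\<close> that are constant modulo \<open>K\<close> on the cosets in question.\<close>

definition quotient_map :: "('b, 'm) monoid_scheme \<Rightarrow> 'b set \<Rightarrow> ('a \<Rightarrow> 'b) \<Rightarrow> 'a set \<Rightarrow> 'b set"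
  where "quotient_map H K f c = the_elem ((\<lambda>x. K #>\<^bsub>H\<^esub> f x) ` c)"

definition exact_at ::
  "('a, 'm) monoid_scheme \<Rightarrow> ('a \<Rightarrow> 'b) \<Rightarrow> ('b, 'n) monoid_scheme \<Rightarrow> ('b \<Rightarrow> 'c) \<Rightarrow> ('c, 'o) monoid_scheme \<Rightarrow> bool"
  where "exact_at A f B g C \<longleftrightarrow>
    group_hom A B f \<and> group_hom B C g \<and> f ` carrier A = kernel B C g"


section \<open>Massey cochains\<close>

text \<open>The coefficient group is written multiplicatively, as in HOL-Algebra. A point of
  \<open>U\<^sup>n\<^sup>+\<^sup>1\<close> is a list of length \<open>n + 1\<close>.\<close>

definition neighbourhood :: "'a topology \<Rightarrow> 'a set \<Rightarrow> 'a set \<Rightarrow> bool"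
  where "neighbourhood X S U \<longleftrightarrow> U \<subseteq> topspace X \<and> S \<subseteq> X interior_of U"

definition tuples :: "nat \<Rightarrow> 'a set \<Rightarrow> 'a list set"
  where "tuples n U = {xs. length xs = Suc n \<and> set xs \<subseteq> U}"

definition massey_support :: "nat \<Rightarrow> 'a topology \<Rightarrow> ('k, 'm) monoid_scheme \<Rightarrow> ('a list \<Rightarrow> 'k) \<Rightarrow> 'a set"
  where "massey_support n X K \<phi> =
    {x \<in> topspace X. \<forall>U. neighbourhood X {x} U \<longrightarrow> (\<exists>xs \<in> tuples n U. \<phi> xs \<noteq> \<one>\<^bsub>K\<^esub>)}"

definition massey_functions :: "nat \<Rightarrow> 'a topology \<Rightarrow> ('k, 'm) monoid_scheme \<Rightarrow> ('a list \<Rightarrow> 'k) monoid"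
  where "massey_functions n X K =
    (product_group (tuples n (topspace X)) (\<lambda>_. K))
      \<lparr>carrier := {\<phi> \<in> tuples n (topspace X) \<rightarrow>\<^sub>E carrier K.
                    finite (\<phi> ` tuples n (topspace X)) \<and> compactin X (massey_support n X K \<phi>)}\<rparr>"

definition massey_null :: "nat \<Rightarrow> 'a topology \<Rightarrow> ('k, 'm) monoid_scheme \<Rightarrow> ('a list \<Rightarrow> 'k) set"
  where "massey_null n X K = {\<phi> \<in> carrier (massey_functions n X K). massey_support n X K \<phi> = {}}"

definition massey_cochains :: "int \<Rightarrow> 'a topology \<Rightarrow> ('k, 'm) monoid_scheme \<Rightarrow> ('a list \<Rightarrow> 'k) set monoid"
  where "massey_cochains n X K =
    (if n < 0 then singleton_group undefined
     else massey_functions (nat n) X K Mod massey_null (nat n) X K)"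

definition function_coboundary ::
  "nat \<Rightarrow> 'a topology \<Rightarrow> ('k, 'm) monoid_scheme \<Rightarrow> ('a list \<Rightarrow> 'k) \<Rightarrow> 'a list \<Rightarrow> 'k"
  where "function_coboundary n X K \<phi> =
    (\<lambda>xs \<in> tuples (Suc n) (topspace X).
       finprod K (\<lambda>j. \<phi> (take j xs @ drop (Suc j) xs) [^]\<^bsub>K\<^esub> ((-1) ^ j :: int)) {..Suc n})"

definition massey_coboundary ::
  "int \<Rightarrow> 'a topology \<Rightarrow> ('k, 'm) monoid_scheme \<Rightarrow> ('a list \<Rightarrow> 'k) set \<Rightarrow> ('a list \<Rightarrow> 'k) set"
  where "massey_coboundary n X K =
    (if n < 0 then (\<lambda>_. \<one>\<^bsub>massey_cochains (n + 1) X K\<^esub>)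
     else quotient_map (massey_functions (Suc (nat n)) X K) (massey_null (Suc (nat n)) X K)
            (function_coboundary (nat n) X K))"

text \<open>The cochain map from the cochains of \<open>Y\<close> to those of \<open>X\<close> induced by a proper map
  \<open>f\<close> from \<open>X\<close> to \<open>Y\<close>.\<close>

definition massey_pullback ::
  "int \<Rightarrow> 'a topology \<Rightarrow> ('k, 'm) monoid_scheme \<Rightarrow> ('a \<Rightarrow> 'b) \<Rightarrow> ('b list \<Rightarrow> 'k) set \<Rightarrow> ('a list \<Rightarrow> 'k) set"
  where "massey_pullback n X K f =
    (if n < 0 then (\<lambda>_. \<one>\<^bsub>massey_cochains n X K\<^esub>)
     else quotient_map (massey_functions (nat n) X K) (massey_null (nat n) X K)
            (\<lambda>\<phi>. \<lambda>xs \<in> tuples (nat n) (topspace X). \<phi> (map f xs)))"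


section \<open>Massey homology\<close>

definition massey_chains ::
  "int \<Rightarrow> 'a topology \<Rightarrow> ('g, 'm) monoid_scheme \<Rightarrow> (('a list \<Rightarrow> int) set \<Rightarrow> 'g) monoid"
  where "massey_chains n X G = hom_group (massey_cochains n X integer_group) G"

text \<open>This is the differential from degree \<open>n\<close> to degree \<open>n - 1\<close>.\<close>

definition massey_boundary ::
  "int \<Rightarrow> 'a topology \<Rightarrow> (('a list \<Rightarrow> int) set \<Rightarrow> 'g) \<Rightarrow> ('a list \<Rightarrow> int) set \<Rightarrow> 'g"
  where "massey_boundary n X u =
    (\<lambda>c \<in> carrier (massey_cochains (n - 1) X integer_group).
       u (massey_coboundary (n - 1) X integer_group c))"

definition massey_cycles ::
  "int \<Rightarrow> 'a topology \<Rightarrow> ('g, 'm) monoid_scheme \<Rightarrow> (('a list \<Rightarrow> int) set \<Rightarrow> 'g) monoid"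
  where "massey_cycles n X G =
    (massey_chains n X G)
      \<lparr>carrier := kernel (massey_chains n X G) (massey_chains (n - 1) X G) (massey_boundary n X)\<rparr>"

definition massey_boundaries ::
  "int \<Rightarrow> 'a topology \<Rightarrow> ('g, 'm) monoid_scheme \<Rightarrow> (('a list \<Rightarrow> int) set \<Rightarrow> 'g) set"
  where "massey_boundaries n X G = massey_boundary (n + 1) X ` carrier (massey_chains (n + 1) X G)"

definition massey_homology ::
  "int \<Rightarrow> 'a topology \<Rightarrow> ('g, 'm) monoid_scheme \<Rightarrow> (('a list \<Rightarrow> int) set \<Rightarrow> 'g) set monoid"
  where "massey_homology n X G = massey_cycles n X G Mod massey_boundaries n X G"

definition massey_induced ::
  "int \<Rightarrow> 'a topology \<Rightarrow> 'b topology \<Rightarrow> ('g, 'm) monoid_scheme \<Rightarrow> ('a \<Rightarrow> 'b) \<Rightarrow>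
    (('a list \<Rightarrow> int) set \<Rightarrow> 'g) set \<Rightarrow> (('b list \<Rightarrow> int) set \<Rightarrow> 'g) set"
  where "massey_induced n X Y G f =
    quotient_map (massey_cycles n Y G) (massey_boundaries n Y G)
      (\<lambda>u. \<lambda>c \<in> carrier (massey_cochains n Y integer_group).
             u (massey_pullback n X integer_group f c))"


section \<open>Inverse systems and their limits\<close>

text \<open>An inverse system over the index set \<open>I\<close>, preordered by \<open>r\<close>, has the groups \<open>grp S i\<close> and,
  whenever \<open>r i j\<close>, the bonding map \<open>bond S i j\<close> from \<open>grp S j\<close> to \<open>grp S i\<close>.\<close>

record ('i, 'g) inv_sys =
  grp :: "'i \<Rightarrow> 'g monoid"
  bond :: "'i \<Rightarrow> 'i \<Rightarrow> 'g \<Rightarrow> 'g"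

definition inverse_system :: "'i set \<Rightarrow> ('i \<Rightarrow> 'i \<Rightarrow> bool) \<Rightarrow> ('i, 'g) inv_sys \<Rightarrow> bool"
  where "inverse_system I r S \<longleftrightarrow>
    (\<forall>i\<in>I. comm_group (grp S i)) \<and>
    (\<forall>i\<in>I. \<forall>j\<in>I. r i j \<longrightarrow> bond S i j \<in> hom (grp S j) (grp S i)) \<and>
    (\<forall>i\<in>I. \<forall>x\<in>carrier (grp S i). bond S i i x = x) \<and>
    (\<forall>i\<in>I. \<forall>j\<in>I. \<forall>k\<in>I. r i j \<and> r j k \<longrightarrow>
       (\<forall>x\<in>carrier (grp S k). bond S i k x = bond S i j (bond S j k x)))"

definition system_map ::
  "'i set \<Rightarrow> ('i \<Rightarrow> 'i \<Rightarrow> bool) \<Rightarrow> ('i, 'g) inv_sys \<Rightarrow> ('i, 'h) inv_sys \<Rightarrow> ('i \<Rightarrow> 'g \<Rightarrow> 'h) \<Rightarrow> bool"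
  where "system_map I r S T f \<longleftrightarrow>
    (\<forall>i\<in>I. f i \<in> hom (grp S i) (grp T i)) \<and>
    (\<forall>i\<in>I. \<forall>j\<in>I. r i j \<longrightarrow>
       (\<forall>x\<in>carrier (grp S j). f i (bond S i j x) = bond T i j (f j x)))"

definition inverse_limit :: "'i set \<Rightarrow> ('i \<Rightarrow> 'i \<Rightarrow> bool) \<Rightarrow> ('i, 'g) inv_sys \<Rightarrow> ('i \<Rightarrow> 'g) monoid"
  where "inverse_limit I r S =
    (product_group I (grp S))
      \<lparr>carrier := {x \<in> (\<Pi>\<^sub>E i\<in>I. carrier (grp S i)).
                    \<forall>i\<in>I. \<forall>j\<in>I. r i j \<longrightarrow> bond S i j (x j) = x i}\<rparr>"

definition limit_map :: "'i set \<Rightarrow> ('i \<Rightarrow> 'g \<Rightarrow> 'h) \<Rightarrow> ('i \<Rightarrow> 'g) \<Rightarrow> 'i \<Rightarrow> 'h"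
  where "limit_map I f x = (\<lambda>i\<in>I. f i (x i))"


section \<open>Right derived functors of the inverse limit\<close>

text \<open>The test objects \<open>S\<close> and \<open>T\<close> have the same type of group elements as \<open>J\<close>. For an infinite
  element type this is injectivity in the category of all inverse systems: by Baer's
  criterion it suffices to test the subsystems of the systems that are the integers at all
  indices below a given one and zero elsewhere, and these have isomorphic copies over any
  infinite type.\<close>

definition injective_system :: "'i set \<Rightarrow> ('i \<Rightarrow> 'i \<Rightarrow> bool) \<Rightarrow> ('i, 'u) inv_sys \<Rightarrow> bool"
  where "injective_system I r J \<longleftrightarrow>
    inverse_system I r J \<and>
    (\<forall>(S :: ('i, 'u) inv_sys) (T :: ('i, 'u) inv_sys) m f.
       inverse_system I r S \<and> inverse_system I r T \<and>
       system_map I r S T m \<and> (\<forall>i\<in>I. inj_on (m i) (carrier (grp S i))) \<and>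
       system_map I r S J f \<longrightarrow>
       (\<exists>g. system_map I r T J g \<and> (\<forall>i\<in>I. \<forall>x\<in>carrier (grp S i). g i (m i x) = f i x)))"

definition injective_resolution ::
  "'i set \<Rightarrow> ('i \<Rightarrow> 'i \<Rightarrow> bool) \<Rightarrow> ('i, 'g) inv_sys \<Rightarrow>
    ('i \<Rightarrow> 'g \<Rightarrow> 'u) \<times> (nat \<Rightarrow> ('i, 'u) inv_sys) \<times> (nat \<Rightarrow> 'i \<Rightarrow> 'u \<Rightarrow> 'u) \<Rightarrow> bool"
  where "injective_resolution I r S = (\<lambda>(\<epsilon>, J, d).
    (\<forall>k. injective_system I r (J k)) \<and>
    system_map I r S (J 0) \<epsilon> \<and>
    (\<forall>k. system_map I r (J k) (J (Suc k)) (d k)) \<and>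
    (\<forall>i\<in>I. inj_on (\<epsilon> i) (carrier (grp S i)) \<and>
       \<epsilon> i ` carrier (grp S i) = kernel (grp (J 0) i) (grp (J 1) i) (d 0 i) \<and>
       (\<forall>k. d k i ` carrier (grp (J k) i) =
              kernel (grp (J (Suc k)) i) (grp (J (Suc (Suc k))) i) (d (Suc k) i))))"

definition limit_cohomology ::
  "'i set \<Rightarrow> ('i \<Rightarrow> 'i \<Rightarrow> bool) \<Rightarrow> (nat \<Rightarrow> ('i, 'u) inv_sys) \<Rightarrow> (nat \<Rightarrow> 'i \<Rightarrow> 'u \<Rightarrow> 'u) \<Rightarrow>
    nat \<Rightarrow> ('i \<Rightarrow> 'u) set monoid"
  where "limit_cohomology I r J d k =
    (inverse_limit I r (J k))
      \<lparr>carrier := kernel (inverse_limit I r (J k)) (inverse_limit I r (J (Suc k)))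
                    (limit_map I (d k))\<rparr>
    Mod (case k of
           0 \<Rightarrow> {\<one>\<^bsub>inverse_limit I r (J 0)\<^esub>}
         | Suc m \<Rightarrow> limit_map I (d m) ` carrier (inverse_limit I r (J m)))"

text \<open>A type whose cardinality \<open>\<kappa>\<close> is infinite, at least that of \<open>'g\<close>, and satisfies
  \<open>\<kappa> = \<kappa> ^ |'i|\<close>. Every abelian group of cardinality at most \<open>\<kappa>\<close> embeds into a divisible one of
  that size, and the coinduced system with value at \<open>j\<close> the product, over the indices \<open>i\<close>
  below \<open>j\<close>, of divisible groups \<open>D i\<close> of such size is injective and again of such size.
  So every inverse system over \<open>'g\<close> has an injective resolution over this type.\<close>

type_synonym ('i, 'g) resolution_type = "'i list \<Rightarrow> 'g \<times> nat"

text \<open>The value of the \<open>k\<close>-th right derived functor of the inverse limit is the cohomology of the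
  limit of a chosen injective resolution; as usual another choice gives an isomorphic group.\<close>

definition derived_limit ::
  "nat \<Rightarrow> 'i set \<Rightarrow> ('i \<Rightarrow> 'i \<Rightarrow> bool) \<Rightarrow> ('i, 'g) inv_sys \<Rightarrow>
    ('i \<Rightarrow> ('i, 'g) resolution_type) set monoid"
  where "derived_limit k I r S =
    (case SOME R. injective_resolution I r S R of
       (\<epsilon>, J, d) \<Rightarrow> limit_cohomology I r J d k)"


section \<open>The system of closed neighbourhoods\<close>

definition closed_nbhds :: "'a topology \<Rightarrow> 'a set \<Rightarrow> 'a set set"
  where "closed_nbhds X A = {N. closedin X N \<and> neighbourhood X A N}"

definition massey_system ::
  "int \<Rightarrow> 'a topology \<Rightarrow> ('g, 'm) monoid_scheme \<Rightarrow> ('a set, (('a list \<Rightarrow> int) set \<Rightarrow> 'g) set) inv_sys"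
  where "massey_system n X G =
    \<lparr>grp = (\<lambda>N. massey_homology n (subtopology X N) G),
     bond = (\<lambda>N M. massey_induced n (subtopology X M) (subtopology X N) G id)\<rparr>"

text \<open>Smaller neighbourhoods are later in the index set, hence the relation \<open>(\<supseteq>)\<close>.\<close>

definition nbhd_limit ::
  "int \<Rightarrow> 'a topology \<Rightarrow> 'a set \<Rightarrow> ('g, 'm) monoid_scheme \<Rightarrow>
    ('a set \<Rightarrow> (('a list \<Rightarrow> int) set \<Rightarrow> 'g) set) monoid"
  where "nbhd_limit n X A G =
    inverse_limit (closed_nbhds X A) (\<supseteq>) (massey_system n X G)"

definition nbhd_derived_limit ::
  "nat \<Rightarrow> int \<Rightarrow> 'a topology \<Rightarrow> 'a set \<Rightarrow> ('g, 'm) monoid_scheme \<Rightarrow>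
    ('a set \<Rightarrow> ('a set, (('a list \<Rightarrow> int) set \<Rightarrow> 'g) set) resolution_type) set monoid"
  where "nbhd_derived_limit k n X A G =
    derived_limit k (closed_nbhds X A) (\<supseteq>) (massey_system n X G)"

definition nbhd_restriction ::
  "int \<Rightarrow> 'a topology \<Rightarrow> 'a set \<Rightarrow> ('g, 'm) monoid_scheme \<Rightarrow>
    (('a list \<Rightarrow> int) set \<Rightarrow> 'g) set \<Rightarrow> 'a set \<Rightarrow> (('a list \<Rightarrow> int) set \<Rightarrow> 'g) set"
  where "nbhd_restriction n X A G h =
    (\<lambda>N \<in> closed_nbhds X A. massey_induced n (subtopology X A) (subtopology X N) G id h)"

end

theory Submission
  imports Defs "HOL-Library.Function_Algebras" "HOL-Algebra.Multiplicative_Group"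
begin

text \<open>Why the sequence exists. A Massey cochain of a closed subspace \<open>N\<close> is the restriction of one of \<open>X\<close>;
  so the cochains of \<open>N\<close> are \<open>P / K N\<close>, where \<open>P\<close> are the functions on tuples of points of \<open>X\<close> and
  \<open>K N\<close> consists of those vanishing near the diagonal on \<open>N\<close> (\<open>massey_cochains_presented\<close>). Embed the
  coefficients into a divisible group \<open>E\<close> with quotient \<open>F\<close>. Finitely valued functions modulo functions
  supported in an ideal of sets form a free group; hence homomorphisms \<open>P / K N \<rightarrow> F\<close> lift to \<open>E\<close>
  (\<open>hom_lifts\<close>), and the homology of \<open>N\<close> is that of the mapping cone \<open>T\<close> of \<open>Hom(P / K N, E) \<rightarrow>
  Hom(P / K N, F)\<close> (\<open>cone_homology_presented\<close>).

  Derived limits are the cohomology of the complex of functions on chains of indices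
  (\<open>derived_limit_presented\<close>): injective systems are acyclic for it, and every system has an injective
  resolution. Over a directed index set \<open>N \<mapsto> Hom(P / K N, D)\<close> is acyclic for divisible \<open>D\<close>
  (\<open>annih_acyclic\<close>), since derived colimits of \<open>P / K N\<close> vanish. So the systems \<open>T\<close> are acyclic.

  Let \<open>B \<subseteq> Z \<subseteq> T\<close> be boundaries and cycles. The sequence \<open>0 \<rightarrow> Z \<rightarrow> T \<rightarrow> B \<rightarrow> 0\<close>, with \<open>B\<close> one degree lower,
  shifts the derived limits of \<open>B\<close> to those of \<open>Z\<close>. A third acyclic system lies between \<open>B\<close> and \<open>Z\<close>, the cycles
  pairing to zero with cohomology. Through it \<open>B \<rightarrow> Z\<close> induces zero on derived limits, so that
  \<open>0 \<rightarrow> B \<rightarrow> Z \<rightarrow> H \<rightarrow> 0\<close> yields short exact sequences, split by \<open>split_presentation\<close>: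
  in positive degrees \<open>lim\<^sup>k H\<^sub>q\<close> is \<open>lim\<^sup>k Z\<^sub>q \<oplus> lim\<^sup>k\<^sup>+\<^sup>2 Z\<^sub>q\<^sub>+\<^sub>1\<close> (\<open>derived_limit_splitting\<close>). All maps of the
  long sequence are projections to and inclusions of these summands.

  It remains to treat \<open>H(A)\<close>. Every cochain that becomes a cocycle on a neighbourhood of \<open>A\<close> and vanishes near the
  diagonal on \<open>A\<close> is, up to the coboundary of a cochain vanishing there as well, null on a smaller neighbourhood
  (\<open>closed_subspace_taut\<close>). Hence \<open>H(A)\<close> is the homology of the limit of the complexes \<open>T\<close>, and the
  first derived limit of the cycles is the kernel of \<open>i\<close> (\<open>lim1_to_homology\<close>, \<open>limit_from_L\<close>).\<close>

section \<open>Divisible groups and characters\<close>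

definition divisible_group :: "('a, 'm) monoid_scheme => bool"
 where "divisible_group D \<longleftrightarrow> comm_group D &
  (ALL x:carrier D. ALL n>0. EX y:carrier D. y [^]\<^bsub>D\<^esub> (n::nat) = x)"

lemma subgroup_prod_int_pow:
 assumes T: "group T" and D: "group D" and M: "subgroup M (T \<times>\<times> D)" and ab: "(a, b) : M"
 shows "(a [^]\<^bsub>T\<^esub> (k::int), b [^]\<^bsub>D\<^esub> k) : M"
proof -
 interpret T: group T by fact
 interpret D: group D by fact
 interpret P: group "T \<times>\<times> D" using T D by (rule DirProd_group)
 have c: "a : carrier T" "b : carrier D" using M ab subgroup.subset[OF M] by (auto simp: DirProd_def)
 have f: "fst : hom (T \<times>\<times> D) T" and s: "snd : hom (T \<times>\<times> D) D" by (auto simp: hom_def DirProd_def)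
 have "(a, b) [^]\<^bsub>T \<times>\<times> D\<^esub> k : M" using P.subgroup_int_pow_closed[OF M ab] .
 moreover have "fst ((a, b) [^]\<^bsub>T \<times>\<times> D\<^esub> k) = a [^]\<^bsub>T\<^esub> k"
  using group_hom.hom_int_pow[of "T \<times>\<times> D" T fst "(a,b)" k] f c
  by (simp add: group_hom_def group_hom_axioms_def T P.is_group)
 moreover have "snd ((a, b) [^]\<^bsub>T \<times>\<times> D\<^esub> k) = b [^]\<^bsub>D\<^esub> k"
  using group_hom.hom_int_pow[of "T \<times>\<times> D" D snd "(a,b)" k] s c
  by (simp add: group_hom_def group_hom_axioms_def D P.is_group)
 ultimately show ?thesis by (metis prod.collapse)
qed

text \<open>The multiples of \<open>x\<close> in the domain of the graph \<open>M\<close> form an ideal of the integers; a value at its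
 generator is divided by the generator.\<close>

lemma baer_adjoin_value:
 assumes T: "comm_group T" and D: "divisible_group D" and M: "subgroup M (T \<times>\<times> D)"
  and sv: "!!y. (\<one>\<^bsub>T\<^esub>, y) : M ==> y = \<one>\<^bsub>D\<^esub>" and x: "x : carrier T"
 shows "EX y:carrier D. ALL k::int. ALL z. (x [^]\<^bsub>T\<^esub> k, z) : M --> z = y [^]\<^bsub>D\<^esub> k"
proof -
 interpret T: comm_group T by fact
 interpret D: comm_group D using D by (simp add: divisible_group_def)
 have sub: "a : carrier T & b : carrier D" if "(a, b) : M" for a b
  using subgroup.subset[OF M] that by (auto simp: DirProd_def)
 have mult: "(a \<otimes>\<^bsub>T\<^esub> a', b \<otimes>\<^bsub>D\<^esub> b') : M" if "(a, b) : M" "(a', b') : M" for a b a' b'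
  using subgroup.m_closed[OF M that] by simp
 have inv: "(inv\<^bsub>T\<^esub> a, inv\<^bsub>D\<^esub> b) : M" if "(a, b) : M" for a b
  using subgroup_prod_int_pow[OF _ _ M that, of "-1"] sub[OF that] T.group_axioms D.group_axioms
  by (simp add: T.int_pow_neg D.int_pow_neg)
 have uniq: "b = b'" if "(a, b) : M" "(a, b') : M" for a b b'
 proof -
  have "(a \<otimes>\<^bsub>T\<^esub> inv\<^bsub>T\<^esub> a, b \<otimes>\<^bsub>D\<^esub> inv\<^bsub>D\<^esub> b') : M" using mult[OF that(1) inv[OF that(2)]] .
  hence "b \<otimes>\<^bsub>D\<^esub> inv\<^bsub>D\<^esub> b' = \<one>\<^bsub>D\<^esub>" using sv sub[OF that(1)] by simp
  thus ?thesis using D.inv_equality[of b "inv\<^bsub>D\<^esub> b'"] sub[OF that(1)] sub[OF that(2)] by simp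
 qed
 show ?thesis
 proof (cases "EX n::nat. n > 0 & (EX z. (x [^]\<^bsub>T\<^esub> n, z) : M)")
  case False
  have "z = \<one>\<^bsub>D\<^esub> [^]\<^bsub>D\<^esub> k" if z: "(x [^]\<^bsub>T\<^esub> k, z) : M" for k :: int and z
  proof -
   have "k = 0"
   proof (rule ccontr)
    assume "k ~= 0"
    then consider "k > 0" | "k < 0" by linarith
    thus False
    proof cases
     case 1
     hence "(x [^]\<^bsub>T\<^esub> (nat k), z) : M" using z by (simp add: int_pow_int[symmetric])
     thus False using False 1 by (metis zero_less_nat_eq)
    next
     case 2
     have "(x [^]\<^bsub>T\<^esub> (- k), inv\<^bsub>D\<^esub> z) : M" using inv[OF z] x by (simp add: T.int_pow_neg)
     hence "(x [^]\<^bsub>T\<^esub> (nat (-k)), inv\<^bsub>D\<^esub> z) : M" using 2 by (simp add: int_pow_int[symmetric])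
     thus False using False 2 by (metis neg_0_less_iff_less zero_less_nat_eq)
    qed
   qed
   thus ?thesis using z sv by simp
  qed
  thus ?thesis by blast
 next
  case True
  define n where "n = (LEAST n::nat. n > 0 & (EX z. (x [^]\<^bsub>T\<^esub> n, z) : M))"
  have n: "n > 0" "EX z. (x [^]\<^bsub>T\<^esub> n, z) : M" using LeastI_ex[OF True] unfolding n_def by blast+
  have least: "n \<le> m" if "m > 0" "(x [^]\<^bsub>T\<^esub> m, z) : M" for m z
   unfolding n_def using that by (intro Least_le) blast
  obtain c where c: "(x [^]\<^bsub>T\<^esub> n, c) : M" using n by blast
  obtain y where y: "y : carrier D" "y [^]\<^bsub>D\<^esub> n = c"
   using D n sub[OF c] unfolding divisible_group_def by blast
  have "z = y [^]\<^bsub>D\<^esub> k" if z: "(x [^]\<^bsub>T\<^esub> k, z) : M" for k :: int and z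
  proof -
   define q where "q = k div int n"
   define s where "s = k mod int n"
   have k: "k = int n * q + s" and s: "0 \<le> s" "s < int n" using n by (auto simp: q_def s_def)
   have cq: "(x [^]\<^bsub>T\<^esub> (int n * q), y [^]\<^bsub>D\<^esub> (int n * q)) : M"
    using subgroup_prod_int_pow[OF _ _ M c, of q] x y T.group_axioms D.group_axioms
    by (simp add: T.int_pow_pow[symmetric] D.int_pow_pow[symmetric] int_pow_int)
   have "(x [^]\<^bsub>T\<^esub> k \<otimes>\<^bsub>T\<^esub> inv\<^bsub>T\<^esub> (x [^]\<^bsub>T\<^esub> (int n * q)), z \<otimes>\<^bsub>D\<^esub> inv\<^bsub>D\<^esub> (y [^]\<^bsub>D\<^esub> (int n * q))) : M"
    using mult[OF z inv[OF cq]] .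
   moreover have "x [^]\<^bsub>T\<^esub> k \<otimes>\<^bsub>T\<^esub> inv\<^bsub>T\<^esub> (x [^]\<^bsub>T\<^esub> (int n * q)) = x [^]\<^bsub>T\<^esub> s"
    using x k by (simp add: T.int_pow_diff[symmetric])
   ultimately have "EX w. (x [^]\<^bsub>T\<^esub> (nat s), w) : M" using s by (simp add: int_pow_int[symmetric]) blast
   then obtain w where w: "(x [^]\<^bsub>T\<^esub> (nat s), w) : M" by blast
   have "\<not> nat s > 0" using least[OF _ w] s by linarith
   hence "k = int n * q" using s k by simp
   thus ?thesis using uniq z cq by blast
  qed
  thus ?thesis using y by blast
 qed
qed

text \<open>Divisible groups are injective. Homomorphisms are treated as graphs, so that a maximal partial extension
 exists by Zorn's lemma, and \<open>baer_adjoin_value\<close> shows that it is total.\<close>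

theorem divisible_group_extends_graph:
 assumes T: "comm_group T" and D: "divisible_group D" and Gm: "subgroup Gm (T \<times>\<times> D)"
  and sv: "!!y. (\<one>\<^bsub>T\<^esub>, y) : Gm ==> y = \<one>\<^bsub>D\<^esub>"
 shows "EX g:hom T D. ALL x y. (x, y) : Gm --> g x = y"
proof -
 interpret T: comm_group T by fact
 interpret D: comm_group D using D by (simp add: divisible_group_def)
 interpret P: group "T \<times>\<times> D" using T.group_axioms D.group_axioms by (rule DirProd_group)
 define \<A> where "\<A> = {M. subgroup M (T \<times>\<times> D) & Gm <= M & (ALL y. (\<one>\<^bsub>T\<^esub>, y) : M --> y = \<one>\<^bsub>D\<^esub>)}"
 have "EX M:\<A>. ALL M':\<A>. M <= M' --> M' = M"
 proof (rule subset_Zorn_nonempty)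
  show "\<A> ~= {}" using Gm sv unfolding \<A>_def by blast
 next
  fix C assume C: "C ~= {}" "subset.chain \<A> C"
  hence CA: "!!M. M : C ==> M : \<A>" by (auto simp: subset.chain_def)
  have CS: "!!M. M : C ==> subgroup M (T \<times>\<times> D)" using CA unfolding \<A>_def by blast
  have "subgroup (\<Union> C) (T \<times>\<times> D)"
  proof (rule P.subgroupI)
   show "\<Union> C <= carrier (T \<times>\<times> D)" using CS subgroup.subset by blast
   obtain B where B: "B : C" using C(1) by blast
   show "\<Union> C ~= {}" using subgroup.one_closed[OF CS[OF B]] B by fast
   show "inv\<^bsub>T \<times>\<times> D\<^esub> a : \<Union> C" if "a : \<Union> C" for a
   proof -
    from that obtain A where A: "A : C" "a : A" by blast
    show ?thesis using subgroup.m_inv_closed[OF CS[OF A(1)] A(2)] A(1) by (rule UnionI[rotated])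
   qed
   show "a \<otimes>\<^bsub>T \<times>\<times> D\<^esub> b : \<Union> C" if "a : \<Union> C" "b : \<Union> C" for a b
   proof -
    from that obtain A B where AB: "A : C" "a : A" "B : C" "b : B" by blast
    hence "A <= B \<or> B <= A" using C(2) unfolding subset.chain_def by blast
    then obtain E where E: "E : C" "a : E" "b : E" using AB by blast
    show ?thesis using subgroup.m_closed[OF CS[OF E(1)] E(2,3)] E(1) by (rule UnionI[rotated])
   qed
  qed
  thus "\<Union> C : \<A>" using C CA unfolding \<A>_def by blast
 qed
 then obtain M where M: "M : \<A>" and max: "!!M'. M' : \<A> ==> M <= M' ==> M' = M" by blast
 have Ms: "subgroup M (T \<times>\<times> D)" and Msv: "!!y. (\<one>\<^bsub>T\<^esub>, y) : M ==> y = \<one>\<^bsub>D\<^esub>" and MGm: "Gm <= M"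
  using M unfolding \<A>_def by auto
 have sub: "a : carrier T" "b : carrier D" if "(a, b) : M" for a b
  using subgroup.subset[OF Ms] that by (auto simp: DirProd_def)
 have mult: "(a \<otimes>\<^bsub>T\<^esub> a', b \<otimes>\<^bsub>D\<^esub> b') : M" if "(a, b) : M" "(a', b') : M" for a b a' b'
  using subgroup.m_closed[OF Ms that] by simp
 have inv: "(inv\<^bsub>T\<^esub> a, inv\<^bsub>D\<^esub> b) : M" if "(a, b) : M" for a b
  using subgroup_prod_int_pow[OF _ _ Ms that, of "-1"] sub[OF that] T.group_axioms D.group_axioms
  by (simp add: T.int_pow_neg D.int_pow_neg)
 have one: "(\<one>\<^bsub>T\<^esub>, \<one>\<^bsub>D\<^esub>) : M" using subgroup.one_closed[OF Ms] by simp
 have total: "EX y. (x, y) : M" if x: "x : carrier T" for x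
 proof -
  obtain y where y: "y : carrier D" and yk: "!!k z. (x [^]\<^bsub>T\<^esub> (k::int), z) : M ==> z = y [^]\<^bsub>D\<^esub> k"
   using baer_adjoin_value[OF T D Ms Msv x] by blast
  define M' where "M' = {(a \<otimes>\<^bsub>T\<^esub> x [^]\<^bsub>T\<^esub> k, b \<otimes>\<^bsub>D\<^esub> y [^]\<^bsub>D\<^esub> k) | a b (k::int). (a, b) : M}"
  have M'I: "(a \<otimes>\<^bsub>T\<^esub> x [^]\<^bsub>T\<^esub> k, b \<otimes>\<^bsub>D\<^esub> y [^]\<^bsub>D\<^esub> k) : M'" if "(a, b) : M" for a b and k :: int
   using that unfolding M'_def by blast
  have "M <= M'"
  proof
   fix p assume "p : M"
   thus "p : M'" using M'I[of "fst p" "snd p" 0] sub[of "fst p" "snd p"] by (cases p) simp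
  qed
  moreover have "M' : \<A>"
  proof -
   have "subgroup M' (T \<times>\<times> D)"
   proof (rule P.subgroupI)
    show "M' <= carrier (T \<times>\<times> D)" unfolding M'_def using sub x y by auto
    show "M' ~= {}" using M'I one by blast
    fix p assume "p : M'"
    then obtain a b k where p: "p = (a \<otimes>\<^bsub>T\<^esub> x [^]\<^bsub>T\<^esub> (k::int), b \<otimes>\<^bsub>D\<^esub> y [^]\<^bsub>D\<^esub> k)" "(a, b) : M"
     unfolding M'_def by blast
    have "inv\<^bsub>T \<times>\<times> D\<^esub> p = (inv\<^bsub>T\<^esub> a \<otimes>\<^bsub>T\<^esub> x [^]\<^bsub>T\<^esub> (-k), inv\<^bsub>D\<^esub> b \<otimes>\<^bsub>D\<^esub> y [^]\<^bsub>D\<^esub> (-k))"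
     using p sub[OF p(2)] x y T.group_axioms D.group_axioms
     by (simp add: inv_DirProd T.inv_mult D.inv_mult T.int_pow_neg D.int_pow_neg)
    thus "inv\<^bsub>T \<times>\<times> D\<^esub> p : M'" using M'I[OF inv[OF p(2)]] by simp
    fix p' assume "p' : M'"
    then obtain a' b' k' where p': "p' = (a' \<otimes>\<^bsub>T\<^esub> x [^]\<^bsub>T\<^esub> (k'::int), b' \<otimes>\<^bsub>D\<^esub> y [^]\<^bsub>D\<^esub> k')" "(a', b') : M"
     unfolding M'_def by blast
    have "p \<otimes>\<^bsub>T \<times>\<times> D\<^esub> p' = ((a \<otimes>\<^bsub>T\<^esub> a') \<otimes>\<^bsub>T\<^esub> x [^]\<^bsub>T\<^esub> (k+k'), (b \<otimes>\<^bsub>D\<^esub> b') \<otimes>\<^bsub>D\<^esub> y [^]\<^bsub>D\<^esub> (k+k'))"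
     using p p' sub[OF p(2)] sub[OF p'(2)] x y
     by (simp add: T.int_pow_mult D.int_pow_mult T.m_ac D.m_ac)
    thus "p \<otimes>\<^bsub>T \<times>\<times> D\<^esub> p' : M'" using M'I[OF mult[OF p(2) p'(2)]] by simp
   qed
   moreover have "z = \<one>\<^bsub>D\<^esub>" if "(\<one>\<^bsub>T\<^esub>, z) : M'" for z
   proof -
    from that obtain a b k where p: "\<one>\<^bsub>T\<^esub> = a \<otimes>\<^bsub>T\<^esub> x [^]\<^bsub>T\<^esub> (k::int)" "z = b \<otimes>\<^bsub>D\<^esub> y [^]\<^bsub>D\<^esub> k" "(a, b) : M"
     unfolding M'_def by blast
    have "x [^]\<^bsub>T\<^esub> k \<otimes>\<^bsub>T\<^esub> a = \<one>\<^bsub>T\<^esub>" using p(1) sub[OF p(3)] x by (simp add: T.m_comm)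
    hence "x [^]\<^bsub>T\<^esub> k = inv\<^bsub>T\<^esub> a" using T.inv_equality sub[OF p(3)] x by simp
    hence "inv\<^bsub>D\<^esub> b = y [^]\<^bsub>D\<^esub> k" using yk inv[OF p(3)] by metis
    thus ?thesis using p(2) sub[OF p(3)] D.r_inv[of b] by simp
   qed
   ultimately show ?thesis using \<open>M \<subseteq> M'\<close> MGm unfolding \<A>_def by blast
  qed
  ultimately have "M' = M" using max by blast
  hence "(x, y) : M" using M'I[OF one, of 1] x y by simp
  thus ?thesis by blast
 qed
 have uniq: "b = b'" if "(a, b) : M" "(a, b') : M" for a b b'
 proof -
  have "(a \<otimes>\<^bsub>T\<^esub> inv\<^bsub>T\<^esub> a, b \<otimes>\<^bsub>D\<^esub> inv\<^bsub>D\<^esub> b') : M" using mult[OF that(1) inv[OF that(2)]] .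
  hence "b \<otimes>\<^bsub>D\<^esub> inv\<^bsub>D\<^esub> b' = \<one>\<^bsub>D\<^esub>" using Msv sub[OF that(1)] by simp
  thus ?thesis using D.inv_equality[of b "inv\<^bsub>D\<^esub> b'"] sub[OF that(1)] sub[OF that(2)] by simp
 qed
 define g where "g x = (THE y. (x, y) : M)" for x
 have g: "(x, g x) : M" if "x : carrier T" for x
  unfolding g_def using total[OF that] uniq by (metis theI)
 have gM: "g x = y" if "(x, y) : M" for x y using g[of x] uniq that sub by blast
 have "g : hom T D"
 proof (rule homI)
  show "g a : carrier D" if "a : carrier T" for a using g[OF that] sub by blast
  show "g (a \<otimes>\<^bsub>T\<^esub> b) = g a \<otimes>\<^bsub>D\<^esub> g b" if "a : carrier T" "b : carrier T" for a b
   using gM[OF mult[OF g[OF that(1)] g[OF that(2)]]] .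
 qed
 thus ?thesis using gM MGm by blast
qed

section \<open>Subgroups of additive groups\<close>

definition subgrp :: "'a::ab_group_add set => bool"
 where "subgrp S \<longleftrightarrow> 0 : S & (ALL x:S. ALL y:S. x - y : S)"

definition additive :: "'a::ab_group_add set => ('a => 'b::ab_group_add) => bool"
 where "additive S f \<longleftrightarrow> (ALL x:S. ALL y:S. f (x + y) = f x + f y)"

definition group_of :: "'a::ab_group_add set => 'a monoid"
 where "group_of S = \<lparr>carrier = S, monoid.mult = (+), one = 0\<rparr>"

lemma group_of_simps [simp]:
 "carrier (group_of S) = S" "x \<otimes>\<^bsub>group_of S\<^esub> y = x + y" "\<one>\<^bsub>group_of S\<^esub> = 0"
 by (simp_all add: group_of_def)

lemma subgrp_0: "subgrp S ==> 0 : S"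
 and subgrp_diff: "subgrp S ==> x : S ==> y : S ==> x - y : S"
 by (auto simp: subgrp_def)

lemma subgrp_minus: "subgrp S ==> x : S ==> - x : S"
 using subgrp_diff[of S 0 x] subgrp_0 by force

lemma subgrp_add: "subgrp S ==> x : S ==> y : S ==> x + y : S"
 using subgrp_diff[of S x "- y"] subgrp_minus by force

lemmas subgrp_rules = subgrp_0 subgrp_diff subgrp_minus subgrp_add

lemma subgrp_UNIV [simp]: "subgrp UNIV"
 by (simp add: subgrp_def)

lemma subgrp_zero [simp]: "subgrp {0}"
 by (simp add: subgrp_def)

lemma additiveD: "additive S f ==> x : S ==> y : S ==> f (x + y) = f x + f y"
 by (simp add: additive_def)

lemma additive_0: "subgrp S ==> additive S f ==> f 0 = 0"
 using additiveD[of S f 0 0] subgrp_0 by force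

lemma additive_diff:
 assumes "subgrp S" "additive S f" "x : S" "y : S" shows "f (x - y) = f x - f y"
 using additiveD[OF assms(2) subgrp_diff[OF assms(1,3,4)] assms(4)] by simp

lemma additive_subset: "additive T f ==> S <= T ==> additive S f"
 by (auto simp: additive_def)

lemma subgrp_image:
 assumes "subgrp S" "additive S f" shows "subgrp (f ` S)"
 unfolding subgrp_def
proof (intro conjI ballI)
 show "0 : f ` S" using additive_0[OF assms] subgrp_0[OF assms(1)] by force
 fix x y assume "x : f ` S" "y : f ` S"
 then obtain a b where "x = f a" "y = f b" "a : S" "b : S" by blast
 thus "x - y : f ` S"
  using additive_diff[OF assms, of a b] subgrp_diff[OF assms(1), of a b] by force
qed

lemma subgrp_kernel:
 assumes "subgrp S" "additive S f" shows "subgrp {x:S. f x = 0}"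
 using assms by (auto simp: subgrp_def additive_0 additive_diff)

lemma comm_group_group_of:
 assumes "subgrp S" shows "comm_group (group_of S)"
proof (rule comm_groupI)
 show "EX y:carrier (group_of S). y \<otimes>\<^bsub>group_of S\<^esub> x = \<one>\<^bsub>group_of S\<^esub>" if "x : carrier (group_of S)" for x
  using that subgrp_minus[OF assms, of x] by (intro bexI[of _ "- x"]) auto
qed (use assms in \<open>auto simp: subgrp_rules algebra_simps\<close>)

lemma inv_group_of: "subgrp S ==> x : S ==> inv\<^bsub>group_of S\<^esub> x = - x"
 using comm_group_group_of[of S] subgrp_minus[of S x]
 by (intro group.inv_equality) (auto simp: comm_group_def)

lemma hom_group_of: "f : hom (group_of S) (group_of T) \<longleftrightarrow> additive S f & f ` S <= T"
 by (auto simp: hom_def additive_def)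

definition divisible :: "'a::ab_group_add set => bool"
 where "divisible D \<longleftrightarrow> subgrp D & divisible_group (group_of D)"

lemma subgroup_group_of_prod:
 assumes T: "subgrp T" and D: "subgrp D" and "subgrp Gm" and "Gm <= T \<times> D"
 shows "subgroup Gm (group_of T \<times>\<times> group_of D)"
proof -
 have g: "group (group_of T)" "group (group_of D)"
  using comm_group_group_of[OF T] comm_group_group_of[OF D] by (auto simp: comm_group_def)
 interpret P: group "group_of T \<times>\<times> group_of D" using g by (rule DirProd_group)
 show ?thesis
 proof (rule P.subgroupI)
  show "Gm <= carrier (group_of T \<times>\<times> group_of D)" using assms(4) by simp
  show "Gm ~= {}" using subgrp_0[OF assms(3)] by blast
  fix a assume a: "a : Gm"
  thus "inv\<^bsub>group_of T \<times>\<times> group_of D\<^esub> a : Gm"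
   using assms(4) subgrp_minus[OF assms(3) a] g
   by (cases a) (auto simp: inv_DirProd inv_group_of[OF T] inv_group_of[OF D])
  fix b assume b: "b : Gm"
  show "a \<otimes>\<^bsub>group_of T \<times>\<times> group_of D\<^esub> b : Gm"
   using subgrp_add[OF assms(3) a b] by (cases a, cases b) simp
 qed
qed

lemma divisible_extends_graph:
 assumes T: "subgrp T" and D: "divisible D" and Gm: "subgrp Gm" "Gm <= T \<times> D"
  and sv: "!!y. (0, y) : Gm ==> y = 0"
 shows "EX g. additive T g & g ` T <= D & (ALL x y. (x, y) : Gm --> g x = y)"
proof -
 have "EX g:hom (group_of T) (group_of D). ALL x y. (x, y) : Gm --> g x = y"
  using D sv by (intro divisible_group_extends_graph subgroup_group_of_prod comm_group_group_of T Gm)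
   (auto simp: divisible_def)
 thus ?thesis by (auto simp: hom_group_of)
qed

text \<open>The values \<open>h\<close> prescribed along \<open>a\<close> and the value \<open>0\<close> prescribed on \<open>N\<close> are compatible, so they
 define a homomorphism on \<open>a ` S + N\<close>, which extends.\<close>

lemma divisible_extends_along:
 assumes T: "subgrp T" and D: "divisible D" and S: "subgrp S" and N: "subgrp N" "N <= T"
  and a: "additive S a" "a ` S <= T" and h: "additive S h" "h ` S <= D"
  and null: "!!x. x : S ==> a x : N ==> h x = 0"
 shows "EX g. additive T g & g ` T <= D & (ALL x:S. g (a x) = h x) & (ALL \<nu>:N. g \<nu> = 0)"
proof -
 let ?Gm = "{(a x + \<nu>, h x) | x \<nu>. x : S & \<nu> : N}"
 have a0: "a 0 = 0" and h0: "h 0 = 0" using additive_0[OF S] a(1) h(1) by auto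
 have I: "(a x + \<nu>, h x) : ?Gm" if "x : S" "\<nu> : N" for x \<nu> using that by blast
 have Gm: "subgrp ?Gm"
  unfolding subgrp_def
 proof (intro conjI ballI)
  show "0 : ?Gm" using I[OF subgrp_0[OF S] subgrp_0[OF N(1)]] a0 h0 by (simp add: zero_prod_def)
  fix p q assume "p : ?Gm" "q : ?Gm"
  then obtain x \<nu> y \<mu> where pq: "p = (a x + \<nu>, h x)" "q = (a y + \<mu>, h y)" "x : S" "\<nu> : N" "y : S" "\<mu> : N" by blast
  have "p - q = (a (x - y) + (\<nu> - \<mu>), h (x - y))"
   using additive_diff[OF S a(1) pq(3,5)] additive_diff[OF S h(1) pq(3,5)] by (simp add: pq)
  thus "p - q : ?Gm" using I[OF subgrp_diff[OF S pq(3,5)] subgrp_diff[OF N(1) pq(4,6)]] by simp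
 qed
 have GmT: "?Gm <= T \<times> D" using subgrp_add[OF T] a(2) N(2) h(2) by blast
 have sv: "y = 0" if y: "(0, y) : ?Gm" for y
 proof -
  obtain x \<nu> where x: "0 = a x + \<nu>" "y = h x" "x : S" "\<nu> : N" using y by blast
  have "a x = - \<nu>" using x(1) by (simp add: eq_neg_iff_add_eq_0)
  thus ?thesis using null[OF x(3)] subgrp_minus[OF N(1) x(4)] x(2) by simp
 qed
 obtain g where g: "additive T g" "g ` T <= D" "!!x y. (x, y) : ?Gm ==> g x = y"
  using divisible_extends_graph[OF T D Gm GmT sv] by blast
 have "g (a x) = h x" if "x : S" for x using g(3)[OF I[OF that subgrp_0[OF N(1)]]] by simp
 moreover have "g \<nu> = 0" if "\<nu> : N" for \<nu> using g(3)[OF I[OF subgrp_0[OF S] that]] a0 h0 by simp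
 ultimately show ?thesis using g(1,2) by blast
qed

section \<open>The circle group\<close>

quotient_type circle = real / "%x y. x - y : \<int>"
proof (rule equivpI)
 show "reflp (%x y::real. x - y : \<int>)" by (simp add: reflp_def)
 show "symp (%x y::real. x - y : \<int>)" unfolding symp_def using Ints_minus minus_diff_eq by metis
 show "transp (%x y::real. x - y : \<int>)" unfolding transp_def
 proof (intro allI impI)
  fix x y z :: real assume "x - y : \<int>" "y - z : \<int>"
  hence "(x - y) + (y - z) : \<int>" by (rule Ints_add)
  thus "x - z : \<int>" by simp
 qed
qed

instantiation circle :: ab_group_add
begin
lift_definition zero_circle :: circle is 0 .
lift_definition plus_circle :: "circle => circle => circle" is "(+)"
 by (metis Ints_add add_diff_add)
lift_definition uminus_circle :: "circle => circle" is uminus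
 by (metis Ints_minus minus_diff_minus)
lift_definition minus_circle :: "circle => circle => circle" is "(-)"
proof -
 fix a b c d :: real assume "a - b : \<int>" "c - d : \<int>"
 hence "(a - b) - (c - d) : \<int>" by (rule Ints_diff)
 thus "a - c - (b - d) : \<int>" by (simp add: algebra_simps)
qed
instance by standard (transfer; simp add: algebra_simps)+
end

lift_definition circle_of :: "real => circle" is "%x. x" .

lemma circle_of_add: "circle_of (x + y) = circle_of x + circle_of y"
 by transfer simp

lemma circle_of_minus: "circle_of (- x) = - circle_of x"
 by transfer simp

lemma circle_of_eq_0: "circle_of x = 0 \<longleftrightarrow> x : \<int>"
 by transfer simp

lemma circle_of_surj: "EX x. c = circle_of x"
 by transfer (metis Ints_0 diff_self)

lemma pow_group_of_circle: "circle_of x [^]\<^bsub>group_of UNIV\<^esub> (n::nat) = circle_of (real n * x)"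
proof (induction n)
 case 0
 show ?case by (simp add: circle_of_eq_0)
next
 case (Suc n)
 thus ?case by (simp add: circle_of_add[symmetric] algebra_simps)
qed

lemma divisible_circle: "divisible (UNIV :: circle set)"
proof -
 have "EX y. y [^]\<^bsub>group_of UNIV\<^esub> n = x" if "n > 0" for n :: nat and x :: circle
 proof -
  obtain r where "x = circle_of r" using circle_of_surj by blast
  thus ?thesis using that by (intro exI[of _ "circle_of (r / real n)"]) (simp add: pow_group_of_circle)
 qed
 thus ?thesis by (simp add: divisible_def divisible_group_def comm_group_group_of)
qed

lemma pow_group_of_fun: "(y [^]\<^bsub>group_of UNIV\<^esub> (n::nat)) a = y a [^]\<^bsub>group_of UNIV\<^esub> n"
 by (induction n) simp_all

lemma divisible_fun: "divisible (UNIV :: 'b::ab_group_add set) ==> divisible (UNIV :: ('a => 'b) set)"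
proof -
 assume D: "divisible (UNIV :: 'b set)"
 have "EX y::'a=>'b. y [^]\<^bsub>group_of UNIV\<^esub> n = x" if "n > 0" for n :: nat and x :: "'a => 'b"
 proof -
  have "ALL a. EX z. z [^]\<^bsub>group_of UNIV\<^esub> n = x a"
   using D that by (simp add: divisible_def divisible_group_def)
  then obtain z where "ALL a. z a [^]\<^bsub>group_of UNIV\<^esub> n = x a" by metis
  hence "z [^]\<^bsub>group_of UNIV\<^esub> n = x" by (intro ext) (simp add: pow_group_of_fun)
  thus ?thesis by blast
 qed
 thus ?thesis by (simp add: divisible_def divisible_group_def comm_group_group_of)
qed

abbreviation characters :: "('g, 'm) monoid_scheme => ('g => circle) set"
 where "characters G \<equiv> hom G (group_of UNIV)"

text \<open>The subgroup generated by \<open>x\<close> has a character nontrivial at \<open>x\<close>: it sends \<open>x\<close> to \<open>1 / n\<close>, where \<open>n\<close>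
 is the order of \<open>x\<close>, or \<open>2\<close> if that is infinite. It extends because the circle is divisible.\<close>

lemma character_separates:
 assumes G: "comm_group G" and x: "x : carrier G" "x ~= \<one>\<^bsub>G\<^esub>"
 shows "EX ps:characters G. ps x ~= 0"
proof -
 interpret G: comm_group G by fact
 let ?C = "group_of (UNIV :: circle set)"
 interpret C: comm_group ?C by (rule comm_group_group_of) simp
 interpret P: group "G \<times>\<times> ?C" using G.group_axioms C.group_axioms by (rule DirProd_group)
 obtain t :: real where t: "t ~: \<int>" "!!k::int. x [^]\<^bsub>G\<^esub> k = \<one>\<^bsub>G\<^esub> ==> real_of_int k * t : \<int>"
 proof (cases "EX k::int. k ~= 0 & x [^]\<^bsub>G\<^esub> k = \<one>\<^bsub>G\<^esub>")
  case False
  have "(1/2::real) ~: \<int>"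
  proof
   assume "(1/2::real) : \<int>"
   then obtain k :: int where "(1/2::real) = of_int k" by (auto elim: Ints_cases)
   hence "1 = 2 * k" by linarith
   thus False by presburger
  qed
  moreover have "real_of_int k * (1/2) : \<int>" if "x [^]\<^bsub>G\<^esub> k = \<one>\<^bsub>G\<^esub>" for k :: int
  proof -
   have "k = 0" using False that by blast
   thus ?thesis by simp
  qed
  ultimately show thesis using that by blast
 next
  case True
  define n where "n = G.ord x"
  have ord: "x [^]\<^bsub>G\<^esub> k = \<one>\<^bsub>G\<^esub> \<longleftrightarrow> int n dvd k" for k :: int
   unfolding n_def using G.int_pow_eq_id[OF x(1)] by simp
  have "n ~= 0" using True ord by auto
  moreover have "n ~= 1" using x ord[of 1] by auto
  ultimately have n: "n > 1" by linarith
  have "1 / real n ~: \<int>"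
  proof
   assume "1 / real n : \<int>"
   then obtain k :: int where "1 / real n = of_int k" by (auto elim: Ints_cases)
   moreover have "0 < 1 / real n" "1 / real n < 1" using n by auto
   ultimately have "0 < k" "k < 1" by (simp_all only: of_int_0_less_iff of_int_less_1_iff)
   thus False by linarith
  qed
  moreover have "real_of_int k * (1 / real n) : \<int>" if "x [^]\<^bsub>G\<^esub> k = \<one>\<^bsub>G\<^esub>" for k :: int
  proof -
   have "int n dvd k" using that by (simp only: ord)
   then obtain m where "k = int n * m" by (rule dvdE)
   hence "real_of_int k * (1 / real n) = real_of_int m" using n by (simp add: field_simps)
   thus ?thesis by (simp only: Ints_of_int)
  qed
  ultimately show thesis using that by blast
 qed
 define Gm where "Gm = {(x [^]\<^bsub>G\<^esub> k, circle_of (real_of_int k * t)) | k :: int. True}"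
 have "subgroup Gm (G \<times>\<times> ?C)"
 proof (rule P.subgroupI)
  show "Gm <= carrier (G \<times>\<times> ?C)" unfolding Gm_def using x by auto
  show "Gm ~= {}" unfolding Gm_def by blast
  fix a assume "a : Gm"
  then obtain k where a: "a = (x [^]\<^bsub>G\<^esub> k, circle_of (real_of_int k * t))" unfolding Gm_def by blast
  have "inv\<^bsub>G \<times>\<times> ?C\<^esub> a = (x [^]\<^bsub>G\<^esub> (-k), circle_of (real_of_int (-k) * t))"
   using x G.group_axioms C.group_axioms by (simp add: a inv_DirProd G.int_pow_neg inv_group_of circle_of_minus)
  thus "inv\<^bsub>G \<times>\<times> ?C\<^esub> a : Gm" unfolding Gm_def by blast
  fix b assume "b : Gm"
  then obtain l where b: "b = (x [^]\<^bsub>G\<^esub> l, circle_of (real_of_int l * t))" unfolding Gm_def by blast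
  have "a \<otimes>\<^bsub>G \<times>\<times> ?C\<^esub> b = (x [^]\<^bsub>G\<^esub> (k + l), circle_of (real_of_int (k + l) * t))"
   using x by (simp add: a b G.int_pow_mult circle_of_add[symmetric] algebra_simps)
  thus "a \<otimes>\<^bsub>G \<times>\<times> ?C\<^esub> b : Gm" unfolding Gm_def by blast
 qed
 note sub = this
 have sv: "y = \<one>\<^bsub>?C\<^esub>" if "(\<one>\<^bsub>G\<^esub>, y) : Gm" for y
 proof -
  from that obtain k :: int where k: "\<one>\<^bsub>G\<^esub> = x [^]\<^bsub>G\<^esub> k" "y = circle_of (real_of_int k * t)"
   unfolding Gm_def by blast
  thus ?thesis using t(2)[OF k(1)[symmetric]] by (simp add: circle_of_eq_0)
 qed
 have "divisible_group ?C" using divisible_circle by (simp add: divisible_def)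
 from divisible_group_extends_graph[OF G this sub sv]
 obtain ps where ps: "ps : hom G ?C" "!!a y. (a, y) : Gm ==> ps a = y" by blast
 have "(x [^]\<^bsub>G\<^esub> (1::int), circle_of (real_of_int 1 * t)) : Gm" unfolding Gm_def by blast
 hence "ps x = circle_of t" using ps(2) x by simp
 hence "ps x ~= 0" using t(1) by (simp add: circle_of_eq_0)
 thus ?thesis using ps(1) by blast
qed

text \<open>Evaluation at characters embeds an arbitrary abelian group \<open>G\<close> into a divisible group whose
 type carries the additive structure, so that computations can take place in a type class.\<close>

definition char_embed :: "('g, 'm) monoid_scheme => 'g => ('g => circle) => circle"
 where "char_embed G x = (%ps. if ps : characters G then ps x else 0)"

lemma char_embed_mult:
 "x : carrier G ==> y : carrier G ==> char_embed G (x \<otimes>\<^bsub>G\<^esub> y) = char_embed G x + char_embed G y"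
 by (auto simp: char_embed_def hom_def)

lemma char_embed_eq_0:
 assumes "comm_group G" "x : carrier G" shows "char_embed G x = 0 \<longleftrightarrow> x = \<one>\<^bsub>G\<^esub>"
proof
 assume "char_embed G x = 0"
 hence "char_embed G x ps = 0" for ps by simp
 hence "ps x = 0" if "ps : characters G" for ps
  using that by (metis char_embed_def)
 thus "x = \<one>\<^bsub>G\<^esub>" using character_separates[OF assms] by blast
next
 interpret comm_group G by fact
 assume "x = \<one>\<^bsub>G\<^esub>"
 hence "char_embed G x + char_embed G x = char_embed G x" using char_embed_mult[of "\<one>\<^bsub>G\<^esub>" G "\<one>\<^bsub>G\<^esub>"] by simp
 thus "char_embed G x = 0" by (simp only: add_cancel_left_left)
qed

lemma char_embed_inj:
 assumes "comm_group G" shows "inj_on (char_embed G) (carrier G)"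
proof (rule inj_onI)
 interpret comm_group G by fact
 fix x y assume xy: "x : carrier G" "y : carrier G" "char_embed G x = char_embed G y"
 have "char_embed G (x \<otimes>\<^bsub>G\<^esub> inv\<^bsub>G\<^esub> y) + char_embed G y = char_embed G x"
  using char_embed_mult[of "x \<otimes>\<^bsub>G\<^esub> inv\<^bsub>G\<^esub> y" G y] xy by (simp add: m_assoc)
 hence "x \<otimes>\<^bsub>G\<^esub> inv\<^bsub>G\<^esub> y = \<one>\<^bsub>G\<^esub>" using char_embed_eq_0[OF assms, of "x \<otimes>\<^bsub>G\<^esub> inv\<^bsub>G\<^esub> y"] xy by simp
 thus "x = y" using inv_equality[of x "inv\<^bsub>G\<^esub> y"] xy by simp
qed

lemma divisible_char_type: "divisible (UNIV :: (('a => circle) => circle) set)"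
 by (intro divisible_fun divisible_circle)

section \<open>Groups presented as quotients\<close>

text \<open>Quotient groups are handled through the class map \<open>q\<close> from honest elements: \<open>Q\<close> is \<open>Z\<close> modulo
 \<open>B\<close>. Homomorphisms between such quotients are given by additive relations between
 representatives, which is the form in which diagram chases produce them.\<close>

definition presents :: "('q, 'm) monoid_scheme => 'a::ab_group_add set => 'a set => ('a => 'q) => bool"
 where "presents Q Z B q \<longleftrightarrow> comm_group Q & subgrp Z & q ` Z = carrier Q &
  (ALL x:Z. ALL y:Z. q (x + y) = q x \<otimes>\<^bsub>Q\<^esub> q y) & (ALL x:Z. q x = \<one>\<^bsub>Q\<^esub> \<longleftrightarrow> x : B)"

lemma presentsD:
 assumes "presents Q Z B q"
 shows "comm_group Q" "subgrp Z" "!!x. x : Z ==> q x : carrier Q"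
  "!!c. c : carrier Q ==> EX x:Z. q x = c"
  "!!x y. x : Z ==> y : Z ==> q (x + y) = q x \<otimes>\<^bsub>Q\<^esub> q y"
  "!!x. x : Z ==> q x = \<one>\<^bsub>Q\<^esub> \<longleftrightarrow> x : B"
proof -
 have im: "q ` Z = carrier Q" using assms unfolding presents_def by blast
 show "q x : carrier Q" if "x : Z" for x using im that by blast
 show "EX x:Z. q x = c" if "c : carrier Q" for c using im that by (metis imageE)
qed (use assms in \<open>auto simp: presents_def\<close>)

lemma presents_eq_iff:
 assumes P: "presents Q Z B q" and "x : Z" "y : Z"
 shows "q x = q y \<longleftrightarrow> x - y : B"
proof -
 interpret Q: comm_group Q using P by (rule presentsD)
 have d: "x - y : Z" using subgrp_diff presentsD(2)[OF P] assms by blast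
 have "q x = q (x - y) \<otimes>\<^bsub>Q\<^esub> q y" using presentsD(5)[OF P d assms(3)] by simp
 hence "q x = q y \<longleftrightarrow> q (x - y) = \<one>\<^bsub>Q\<^esub>"
  using presentsD(3)[OF P d] presentsD(3)[OF P assms(3)] Q.l_cancel_one' by fastforce
 thus ?thesis using presentsD(6)[OF P d] by blast
qed

definition additive_relation :: "('a::ab_group_add => 'b::ab_group_add => bool) => bool"
 where "additive_relation r \<longleftrightarrow> (ALL x y x' y'. r x y --> r x' y' --> r (x - x') (y - y'))"

lemma additive_relation_diff: "additive_relation r ==> r x y ==> r x' y' ==> r (x - x') (y - y')"
 by (simp add: additive_relation_def)

lemma additive_relation_add:
 assumes "additive_relation r" "r x y" "r x' y'" shows "r (x + x') (y + y')"
proof -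
 have "r 0 0" using additive_relation_diff[OF assms(1,2,2)] by simp
 hence "r (- x') (- y')" using additive_relation_diff[OF assms(1) _ assms(3)] by force
 from additive_relation_diff[OF assms(1,2) this] show ?thesis by simp
qed

text \<open>An additive relation that is total on \<open>Z\<close> and takes \<open>B\<close> to \<open>B'\<close> is single-valued on classes. This replaces
 all constructions of connecting homomorphisms by choices.\<close>

lemma presents_hom_exists:
 assumes P: "presents Q Z B q" and P': "presents Q' Z' B' q'" and r: "additive_relation r"
  and mem: "!!z z'. r z z' ==> z : Z & z' : Z'"
  and tot: "!!z. z : Z ==> EX z'. r z z'"
  and wd: "!!z z'. r z z' ==> z : B ==> z' : B'"
 shows "EX f:hom Q Q'. ALL z z'. r z z' --> f (q z) = q' z'"
proof -
 define f where "f c = q' (SOME z'. EX z. q z = c & r z z')" for c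
 have f: "f (q z) = q' z'" if zz: "r z z'" for z z'
 proof -
  define w' where "w' = (SOME z'. EX w. q w = q z & r w z')"
  have "EX w' w. q w = q z & r w w'" using zz by blast
  hence "EX w. q w = q z & r w w'" unfolding w'_def by (rule someI_ex)
  then obtain w where w: "q w = q z" "r w w'" by blast
  have fq: "f (q z) = q' w'" unfolding f_def w'_def ..
  have "w - z : B" using presents_eq_iff[OF P] mem w zz by blast
  hence "w' - z' : B'" using wd[OF additive_relation_diff[OF r w(2) zz]] by blast
  hence "q' w' = q' z'" using presents_eq_iff[OF P'] mem[OF w(2)] mem[OF zz] by blast
  thus ?thesis using fq by simp
 qed
 have "f : hom Q Q'"
 proof (rule homI)
  fix c assume "c : carrier Q"
  then obtain z z' where z: "z : Z" "c = q z" "r z z'" using presentsD(4)[OF P] tot by metis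
  thus "f c : carrier Q'" using f mem presentsD(3)[OF P'] by metis
  fix d assume "d : carrier Q"
  then obtain w w' where w: "w : Z" "d = q w" "r w w'" using presentsD(4)[OF P] tot by metis
  have "f (c \<otimes>\<^bsub>Q\<^esub> d) = q' (z' + w')"
   using f[OF additive_relation_add[OF r z(3) w(3)]] presentsD(5)[OF P z(1) w(1)] z w by simp
  also have "\<dots> = f c \<otimes>\<^bsub>Q'\<^esub> f d" using f[OF z(3)] f[OF w(3)] z w mem presentsD(5)[OF P'] by metis
  finally show "f (c \<otimes>\<^bsub>Q\<^esub> d) = f c \<otimes>\<^bsub>Q'\<^esub> f d" .
 qed
 thus ?thesis using f by blast
qed

lemma presents_transport:
 assumes P: "presents Q Z B q" and Z': "subgrp Z'" and r: "additive_relation r"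
  and mem: "!!z z'. r z z' ==> z : Z & z' : Z'"
  and tot: "!!z. z : Z ==> EX z'. r z z'" and tot': "!!z'. z' : Z' ==> EX z. r z z'"
  and iff: "!!z z'. r z z' ==> z : B \<longleftrightarrow> z' : B'"
 shows "EX q'. presents Q Z' B' q' & (ALL z z'. r z z' --> q' z' = q z)"
proof -
 interpret Q: comm_group Q using P by (rule presentsD)
 define q' where "q' z' = q (SOME z. r z z')" for z'
 have zB: "0 : B'" using presentsD(6)[OF P, of 0] iff[OF additive_relation_diff[OF r]] 
 proof -
  have Z0: "0 : Z" using presentsD(2)[OF P] subgrp_0 by blast
  have "q 0 = q 0 \<otimes>\<^bsub>Q\<^esub> q 0" using presentsD(5)[OF P Z0 Z0] by simp
  hence "q 0 = \<one>\<^bsub>Q\<^esub>" using presentsD(3)[OF P Z0] by (metis Q.l_cancel_one)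
  hence "0 : B" using presentsD(6)[OF P Z0] by blast
  moreover obtain z' where "r 0 z'" using tot[OF Z0] by blast
  hence "r (0 - 0) (z' - z')" using additive_relation_diff[OF r] by blast
  ultimately show ?thesis using iff by force
 qed
 have q': "q' z' = q z" if zz: "r z z'" for z z'
 proof -
  define w where "w = (SOME z. r z z')"
  have w: "r w z'" unfolding w_def using zz by (rule someI)
  have "r (w - z) 0" using additive_relation_diff[OF r w zz] by simp
  hence "w - z : B" using iff zB by blast
  thus ?thesis unfolding q'_def w_def[symmetric] using presents_eq_iff[OF P] mem w zz by blast
 qed
 have "presents Q Z' B' q'"
  unfolding presents_def
 proof (intro conjI ballI)
  show "comm_group Q" by (rule presentsD(1)[OF P])
  show "subgrp Z'" by fact
  show "q' ` Z' = carrier Q"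
  proof (intro equalityI subsetI)
   fix c assume "c : q' ` Z'"
   then obtain z z' where "r z z'" "c = q' z'" using tot' by blast
   thus "c : carrier Q" using q' mem presentsD(3)[OF P] by metis
  next
   fix c assume "c : carrier Q"
   then obtain z z' where "c = q z" "r z z'" using presentsD(4)[OF P] tot by metis
   thus "c : q' ` Z'" using q'[of z z'] mem[of z z'] by force
  qed
  fix x assume "x : Z'"
  then obtain z where z: "r z x" using tot' by blast
  show "q' x = \<one>\<^bsub>Q\<^esub> \<longleftrightarrow> x : B'" using q'[OF z] iff[OF z] presentsD(6)[OF P] mem[OF z] by metis
  fix y assume "y : Z'"
  then obtain w where w: "r w y" using tot' by blast
  show "q' (x + y) = q' x \<otimes>\<^bsub>Q\<^esub> q' y"
   using q'[OF additive_relation_add[OF r z w]] q'[OF z] q'[OF w] presentsD(5)[OF P] mem[OF z] mem[OF w] by metis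
 qed
 thus ?thesis using q' by blast
qed

lemma presents_FactGroup:
 assumes Z: "subgrp Z" and B: "subgrp B" "B <= Z"
 shows "presents (group_of Z Mod B) Z B (%z. B #>\<^bsub>group_of Z\<^esub> z)"
proof -
 interpret Z: comm_group "group_of Z" by (rule comm_group_group_of[OF Z])
 have sB: "subgroup B (group_of Z)"
  using B subgrp_rules[OF B(1)] by (intro Z.subgroupI) (auto simp: inv_group_of[OF Z])
 hence nB: "B \<lhd> group_of Z" using Z.normal_iff_subgroup by blast
 show ?thesis unfolding presents_def
 proof (intro conjI ballI)
  show "comm_group (group_of Z Mod B)" by (rule Z.abelian_FactGroup[OF sB])
  show "(%z. B #>\<^bsub>group_of Z\<^esub> z) ` Z = carrier (group_of Z Mod B)"
   by (auto simp: FactGroup_def RCOSETS_def)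
  show "B #>\<^bsub>group_of Z\<^esub> (x + y) = (B #>\<^bsub>group_of Z\<^esub> x) \<otimes>\<^bsub>group_of Z Mod B\<^esub> (B #>\<^bsub>group_of Z\<^esub> y)"
   if "x : Z" "y : Z" for x y
   using normal.rcos_sum[OF nB, of x y] that by (simp add: FactGroup_def)
  show "B #>\<^bsub>group_of Z\<^esub> x = \<one>\<^bsub>group_of Z Mod B\<^esub> \<longleftrightarrow> x : B" if "x : Z" for x
  proof -
   have "B #>\<^bsub>group_of Z\<^esub> x = B \<longleftrightarrow> x : B"
    using Z.coset_join1[OF _ _ sB, of x] Z.coset_join2[OF _ sB, of x] B that by auto
   thus ?thesis by (simp add: FactGroup_def)
  qed
 qed fact+
qed

section \<open>Alternating sums of deletions\<close>

text \<open>The alternating sum \<open>\<Sum>j. (-1)^j f (xs without its j-th entry)\<close>, in a recursive form that turns the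
 usual simplicial identities into inductions on lists.\<close>

fun alt_del :: "('a list => 'b::ab_group_add) => 'a list => 'b" where
 "alt_del f [] = 0"
| "alt_del f (x # xs) = f xs - alt_del (%ys. f (x # ys)) xs"

fun deletions :: "'a list => 'a list set" where
 "deletions [] = {}"
| "deletions (x # xs) = insert xs ((#) x ` deletions xs)"

lemma alt_del_cong:
 "(!!ys. ys : deletions xs ==> f ys = g ys) ==> alt_del f xs = alt_del g xs"
proof (induction xs arbitrary: f g)
 case (Cons x xs)
 have "alt_del (%ys. f (x # ys)) xs = alt_del (%ys. g (x # ys)) xs"
  by (rule Cons.IH) (use Cons.prems in auto)
 thus ?case using Cons.prems by simp
qed simp

lemma alt_del_add: "alt_del (%ys. f ys + g ys) xs = alt_del f xs + alt_del g xs"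
 by (induction xs arbitrary: f g) simp_all

lemma alt_del_diff: "alt_del (%ys. f ys - g ys) xs = alt_del f xs - alt_del g xs"
 by (induction xs arbitrary: f g) simp_all

lemma alt_del_minus: "alt_del (%ys. - f ys) xs = - alt_del f xs"
 by (induction xs arbitrary: f) simp_all

lemma alt_del_0 [simp]: "alt_del (%ys. 0) xs = 0"
 by (induction xs) simp_all

lemma alt_del_zero:
 assumes "!!ys. ys : deletions xs ==> f ys = 0" shows "alt_del f xs = 0"
 using alt_del_cong[of xs f "%_. 0"] assms by simp

lemma alt_del_alt_del [simp]: "alt_del (alt_del f) xs = 0"
proof (induction xs arbitrary: f)
 case (Cons x xs)
 have "alt_del (%ys. alt_del f (x # ys)) xs = alt_del f xs - alt_del (alt_del (%ys. f (x # ys))) xs"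
  by (simp add: alt_del_diff)
 thus ?case using Cons.IH by simp
qed simp

lemma deletionsD:
 "ys : deletions xs ==> length xs = Suc (length ys) & set ys <= set xs & (sorted_wrt r xs --> sorted_wrt r ys)"
proof (induction xs arbitrary: ys)
 case (Cons x xs)
 show ?case
 proof (cases "ys = xs")
  case False
  then obtain zs where z: "zs : deletions xs" "ys = x # zs" using Cons.prems by auto
  from Cons.IH[OF z(1)] show ?thesis unfolding z(2) by auto
 qed auto
qed simp

lemma alt_del_in:
 assumes S: "subgrp S" and "!!ys. ys : deletions xs ==> f ys : S" shows "alt_del f xs : S"
 using assms(2)
proof (induction xs arbitrary: f)
 case (Cons x xs)
 have "alt_del (%ys. f (x # ys)) xs : S" by (rule Cons.IH) (use Cons.prems in auto)
 thus ?case using Cons.prems subgrp_diff[OF S] by simp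
qed (simp add: subgrp_0[OF S])

lemma alt_del_hom:
 assumes S: "subgrp S" and h: "additive S h" and "!!ys. ys : deletions xs ==> f ys : S"
 shows "h (alt_del f xs) = alt_del (%ys. h (f ys)) xs"
 using assms(3)
proof (induction xs arbitrary: f)
 case Nil
 thus ?case using additive_0[OF S h] by simp
next
 case (Cons x xs)
 have "alt_del (%ys. f (x # ys)) xs : S" by (rule alt_del_in[OF S]) (use Cons.prems in auto)
 moreover have "h (alt_del (%ys. f (x # ys)) xs) = alt_del (%ys. h (f (x # ys))) xs"
  by (rule Cons.IH) (use Cons.prems in auto)
 ultimately show ?case using Cons.prems additive_diff[OF S h] by simp
qed

lemma alt_del_apply: "alt_del f xs a = alt_del (%ys. f ys a) xs"
 by (induction xs arbitrary: f) simp_all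

lemma alt_del_map: "alt_del f (map g xs) = alt_del (%ys. f (map g ys)) xs"
 by (induction xs arbitrary: f) simp_all

text \<open>Appending one fixed entry: the deletion of that entry contributes the last term.\<close>

lemma alt_del_snoc:
 "alt_del f (xs @ [a]) = alt_del (%ys. f (ys @ [a])) xs + (if even (length xs) then f xs else - f xs)"
 by (induction xs arbitrary: f) simp_all

section \<open>The cochain complex of an inverse system\<close>

locale preordered_index =
 fixes I :: "'i set" and r :: "'i => 'i => bool"
 assumes index_refl: "i : I ==> r i i"
  and index_trans: "i : I ==> j : I ==> k : I ==> r i j ==> r j k ==> r i k"
begin

definition chains :: "nat => 'i list set"
 where "chains k = {xs. length xs = Suc k & set xs <= I & sorted_wrt r xs}"

lemma chains_hd: "xs : chains k ==> hd xs : I"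
 by (cases xs) (auto simp: chains_def)

lemma chains_Suc_cases:
 assumes "xs : chains (Suc k)"
 obtains i j zs where "xs = i # j # zs" "j # zs : chains k" "i : I" "j : I" "r i j"
  "!!ys. ys : deletions (j # zs) ==> i # ys : chains k"
proof -
 obtain i j zs where xs: "xs = i # j # zs"
  using assms by (cases xs; cases "tl xs") (auto simp: chains_def)
 have "i # ys : chains k" if "ys : deletions (j # zs)" for ys
 proof -
  have "length (j # zs) = Suc (length ys)" "set ys <= set (j # zs)"
   "sorted_wrt r (j # zs) --> sorted_wrt r ys" using deletionsD[OF that, of r] by blast+
  thus ?thesis using assms unfolding xs chains_def by auto
 qed
 thus ?thesis using that[OF xs] assms unfolding xs by (auto simp: chains_def)
qed

definition system :: "('i => 'x::ab_group_add set) => ('i => 'i => 'x => 'x) => bool"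
 where "system S b \<longleftrightarrow> (ALL i:I. subgrp (S i)) &
  (ALL i:I. ALL j:I. r i j --> additive (S j) (b i j) & b i j ` S j <= S i) &
  (ALL i:I. ALL j:I. ALL k:I. r i j --> r j k --> (ALL x:S k. b i j (b j k x) = b i k x))"

lemma systemD:
 assumes "system S b"
 shows "i : I ==> subgrp (S i)"
  "i : I ==> j : I ==> r i j ==> additive (S j) (b i j)"
  "i : I ==> j : I ==> r i j ==> x : S j ==> b i j x : S i"
  "i : I ==> j : I ==> k : I ==> r i j ==> r j k ==> x : S k ==> b i j (b j k x) = b i k x"
 using assms unfolding system_def by blast+

definition cochains :: "nat => ('i => 'x::ab_group_add set) => ('i list => 'x) set"
 where "cochains k S = {f. ALL xs. f xs : (if xs : chains k then S (hd xs) else {0})}"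

lemma cochainsI:
 "(!!xs. xs : chains k ==> f xs : S (hd xs)) ==> (!!xs. xs ~: chains k ==> f xs = 0) ==> f : cochains k S"
 by (auto simp: cochains_def)

lemma cochainsD: "f : cochains k S ==> xs : chains k ==> f xs : S (hd xs)"
 and cochains_off: "f : cochains k S ==> xs ~: chains k ==> f xs = 0"
 by (auto simp: cochains_def split: if_splits dest!: spec[of _ xs])

lemma cochains_mono: "(!!i. i : I ==> S i <= T i) ==> cochains k S <= cochains k T"
proof
 fix f assume ST: "!!i. i : I ==> S i <= T i" and f: "f : cochains k S"
 show "f : cochains k T"
 proof (rule cochainsI)
  show "f xs : T (hd xs)" if "xs : chains k" for xs
   using ST[OF chains_hd[OF that]] cochainsD[OF f that] by blast
 qed (rule cochains_off[OF f])
qed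

lemma cochains_subgroup:
 assumes "!!i. i : I ==> subgrp (S i)" shows "subgrp (cochains k S)"
 unfolding subgrp_def
proof (intro conjI ballI)
 show "0 : cochains k S" using assms chains_hd subgrp_0 by (intro cochainsI) auto
 fix f g assume fg: "f : cochains k S" "g : cochains k S"
 show "f - g : cochains k S"
 proof (rule cochainsI)
  fix xs assume xs: "xs : chains k"
  show "(f - g) xs : S (hd xs)"
   using subgrp_diff[OF assms[OF chains_hd[OF xs]] cochainsD[OF fg(1) xs] cochainsD[OF fg(2) xs]] by simp
 next
  fix xs assume "xs ~: chains k"
  thus "(f - g) xs = 0" using cochains_off[OF fg(1)] cochains_off[OF fg(2)] by simp
 qed
qed

lemma cochains_zero: "f : cochains k (%i. {0}) \<longleftrightarrow> f = 0"
proof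
 assume "f : cochains k (%i. {0})"
 hence "f xs = 0" for xs using cochainsD[of f k _ xs] cochains_off[of f k _ xs] by fastforce
 thus "f = 0" by (simp add: fun_eq_iff)
qed (auto intro: cochainsI)

text \<open>Cochains live on ascending lists of indices, with values over the first index. Deleting the first index
 moves the value along a bonding map; this term is kept apart from the other deletions.\<close>

definition diff :: "('i => 'i => 'x => 'x::ab_group_add) => nat => ('i list => 'x) => 'i list => 'x"
 where "diff b k f = (%xs. if xs : chains (Suc k)
   then b (hd xs) (hd (tl xs)) (f (tl xs)) - alt_del (%ys. f (hd xs # ys)) (tl xs) else 0)"

lemma diff_Cons:
 "i # j # zs : chains (Suc k) ==>
  diff b k f (i # j # zs) = b i j (f (j # zs)) - alt_del (%ys. f (i # ys)) (j # zs)"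
 by (simp add: diff_def)

lemma diff_off: "xs ~: chains (Suc k) ==> diff b k f xs = 0"
 by (simp add: diff_def)

lemma diff_cochain:
 assumes S: "system S b" and f: "f : cochains k S" shows "diff b k f : cochains (Suc k) S"
proof (rule cochainsI)
 fix xs assume xs: "xs : chains (Suc k)"
 then obtain i j zs where x: "xs = i # j # zs" "j # zs : chains k" "i : I" "j : I" "r i j"
  and del: "!!ys. ys : deletions (j # zs) ==> i # ys : chains k" by (rule chains_Suc_cases) blast
 have "b i j (f (j # zs)) : S i" using systemD(3)[OF S x(3,4,5)] cochainsD[OF f x(2)] by simp
 moreover have "alt_del (%ys. f (i # ys)) (j # zs) : S i"
  using cochainsD[OF f del] by (intro alt_del_in systemD(1)[OF S x(3)]) auto
 ultimately show "diff b k f xs : S (hd xs)"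
  using xs x subgrp_diff[OF systemD(1)[OF S x(3)]] by (simp add: diff_Cons del: alt_del.simps)
qed (rule diff_off)

lemma diff_additive:
 assumes S: "system S b" shows "additive (cochains k S) (diff b k)"
 unfolding additive_def
proof (intro ballI ext)
 fix f g xs assume f: "f : cochains k S" and g: "g : cochains k S"
 show "diff b k (f + g) xs = (diff b k f + diff b k g) xs"
 proof (cases "xs : chains (Suc k)")
  case True
  then obtain i j zs where x: "xs = i # j # zs" "j # zs : chains k" "i : I" "j : I" "r i j"
   by (rule chains_Suc_cases) blast
  have "b i j (f (j # zs) + g (j # zs)) = b i j (f (j # zs)) + b i j (g (j # zs))"
   using additiveD[OF systemD(2)[OF S x(3,4,5)]] cochainsD[OF f x(2)] cochainsD[OF g x(2)] by simp
  thus ?thesis using True by (simp add: x diff_Cons alt_del_add del: alt_del.simps)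
 qed (simp add: diff_off)
qed

lemma diff_sub:
 assumes S: "system S b" "f : cochains k S" "g : cochains k S"
 shows "diff b k (f - g) = diff b k f - diff b k g"
 by (rule additive_diff[OF cochains_subgroup diff_additive]) (use assms systemD(1) in auto)

lemma diff_add:
 assumes S: "system S b" "f : cochains k S" "g : cochains k S"
 shows "diff b k (f + g) = diff b k f + diff b k g"
 using additiveD[OF diff_additive] assms by blast

lemma diff_diff:
 assumes S: "system S b" and f: "f : cochains k S" shows "diff b (Suc k) (diff b k f) = 0"
proof
 fix xs
 show "diff b (Suc k) (diff b k f) xs = 0 xs"
 proof (cases "xs : chains (Suc (Suc k))")
  case True
  then obtain i j ws where x: "xs = i # j # ws" "j # ws : chains (Suc k)" "i : I" "j : I" "r i j"
   and del: "!!ys. ys : deletions (j # ws) ==> i # ys : chains (Suc k)" by (rule chains_Suc_cases) blast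
  from x(2) obtain l zs where w: "ws = l # zs" "l # zs : chains k" "l : I" "r j l"
   and del2: "!!ys. ys : deletions ws ==> j # ys : chains k"
   by (rule chains_Suc_cases) blast
  let ?D = "diff b k f"
  let ?bf = "%ys. b i (hd ys) (f ys)" and ?a = "alt_del (%ys. f (j # ys)) ws"
  have fS: "f ws : S l" "!!ys. ys : deletions ws ==> f (j # ys) : S j"
   using cochainsD[OF f w(2)] cochainsD[OF f del2] w by auto
  have aS: "?a : S j" by (rule alt_del_in[OF systemD(1)[OF S x(4)] fS(2)])
  have "?D (i # ys) = ?bf ys - alt_del (%vs. f (i # vs)) ys" if ys: "ys : deletions (j # ws)" for ys
  proof -
   obtain m vs where "ys = m # vs" using del[OF ys] by (cases ys) (auto simp: chains_def)
   thus ?thesis using del[OF ys] by (simp add: diff_Cons del: alt_del.simps)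
  qed
  hence "alt_del (%ys. ?D (i # ys)) (j # ws) = alt_del (%ys. ?bf ys - alt_del (%vs. f (i # vs)) ys) (j # ws)"
   by (rule alt_del_cong)
  also have "\<dots> = alt_del ?bf (j # ws)" by (simp add: alt_del_diff del: alt_del.simps)
  also have "\<dots> = b i l (f ws) - alt_del (%ys. b i j (f (j # ys))) ws" using w by simp
  also have "alt_del (%ys. b i j (f (j # ys))) ws = b i j ?a"
   by (rule alt_del_hom[OF systemD(1)[OF S x(4)] systemD(2)[OF S x(3,4,5)] fS(2), symmetric])
  finally have 1: "alt_del (%ys. ?D (i # ys)) (j # ws) = b i l (f ws) - b i j ?a" .
  have "?D (j # ws) = b j l (f ws) - ?a" using x(2) w(1) by (simp add: diff_Cons del: alt_del.simps)
  hence "b i j (?D (j # ws)) = b i j (b j l (f ws)) - b i j ?a"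
   using additive_diff[OF systemD(1)[OF S x(4)] systemD(2)[OF S x(3,4,5)] systemD(3)[OF S x(4) w(3,4) fS(1)] aS]
   by simp
  also have "b i j (b j l (f ws)) = b i l (f ws)" by (rule systemD(4)[OF S x(3,4) w(3) x(5) w(4) fS(1)])
  finally show ?thesis using True 1 unfolding x(1) by (simp add: diff_Cons del: alt_del.simps)
 qed (simp add: diff_off)
qed

text \<open>Postcomposition with a family of maps.\<close>

definition capp :: "nat => ('i => 'x => 'y::zero) => ('i list => 'x) => 'i list => 'y"
 where "capp k e f = (%xs. if xs : chains k then e (hd xs) (f xs) else 0)"

definition natural :: "('i => 'x::ab_group_add set) => ('i => 'i => 'x => 'x) =>
  ('i => 'y::ab_group_add set) => ('i => 'i => 'y => 'y) => ('i => 'x => 'y) => bool"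
 where "natural S b T c e \<longleftrightarrow> (ALL i:I. additive (S i) (e i) & e i ` S i <= T i) &
  (ALL i:I. ALL j:I. r i j --> (ALL x:S j. e i (b i j x) = c i j (e j x)))"

lemma naturalD:
 assumes "natural S b T c e"
 shows "i : I ==> additive (S i) (e i)" "i : I ==> x : S i ==> e i x : T i"
  "i : I ==> j : I ==> r i j ==> x : S j ==> e i (b i j x) = c i j (e j x)"
 using assms unfolding natural_def by blast+

lemma capp_cochain: "natural S b T c e ==> f : cochains k S ==> capp k e f : cochains k T"
 by (intro cochainsI) (auto simp: capp_def chains_hd cochainsD naturalD(2))

lemma capp_additive: "natural S b T c e ==> additive (cochains k S) (capp k e)"
 unfolding additive_def
 by (auto simp: capp_def fun_eq_iff intro!: additiveD[OF naturalD(1)] chains_hd dest: cochainsD)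

lemma capp_sub:
 assumes "system S b" "natural S b T c e" "f : cochains k S" "g : cochains k S"
 shows "capp k e (f - g) = capp k e f - capp k e g"
 by (rule additive_diff[OF cochains_subgroup capp_additive]) (use assms systemD(1) in auto)

lemma diff_capp:
 assumes S: "system S b" and e: "natural S b T c e" and f: "f : cochains k S"
 shows "diff c k (capp k e f) = capp (Suc k) e (diff b k f)"
proof
 fix xs
 show "diff c k (capp k e f) xs = capp (Suc k) e (diff b k f) xs"
 proof (cases "xs : chains (Suc k)")
  case True
  then obtain i j zs where x: "xs = i # j # zs" "j # zs : chains k" "i : I" "j : I" "r i j"
   and del: "!!ys. ys : deletions (j # zs) ==> i # ys : chains k" by (rule chains_Suc_cases) blast
  let ?a = "alt_del (%ys. f (i # ys)) (j # zs)"
  have fS: "f (j # zs) : S j" "!!ys. ys : deletions (j # zs) ==> f (i # ys) : S i"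
   using cochainsD[OF f x(2)] cochainsD[OF f del] by auto
  have aS: "?a : S i" by (rule alt_del_in[OF systemD(1)[OF S x(3)] fS(2)])
  have "alt_del (%ys. capp k e f (i # ys)) (j # zs) = alt_del (%ys. e i (f (i # ys))) (j # zs)"
   by (rule alt_del_cong) (simp add: capp_def del)
  also have "\<dots> = e i ?a"
   by (rule alt_del_hom[OF systemD(1)[OF S x(3)] naturalD(1)[OF e x(3)] fS(2), symmetric])
  finally have 1: "alt_del (%ys. capp k e f (i # ys)) (j # zs) = e i ?a" .
  have 2: "c i j (capp k e f (j # zs)) = e i (b i j (f (j # zs)))"
   using naturalD(3)[OF e x(3,4,5) fS(1)] x(2) by (simp add: capp_def)
  have "e i (b i j (f (j # zs)) - ?a) = e i (b i j (f (j # zs))) - e i ?a"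
   by (rule additive_diff[OF systemD(1)[OF S x(3)] naturalD(1)[OF e x(3)] systemD(3)[OF S x(3,4,5) fS(1)] aS])
  thus ?thesis using True 1 2 unfolding x(1) by (simp add: diff_Cons capp_def del: alt_del.simps)
 qed (simp add: diff_off capp_def)
qed

lemma capp_lift:
 assumes "g : cochains k (%i. e i ` S i)" "!!i. i : I ==> 0 : S i"
 shows "EX f:cochains k S. capp k e f = g"
proof -
 define f where "f xs = (if xs : chains k then SOME x. x : S (hd xs) & e (hd xs) x = g xs else 0)" for xs
 have f: "f xs : S (hd xs) & e (hd xs) (f xs) = g xs" if "xs : chains k" for xs
 proof -
  have "EX x. x : S (hd xs) & e (hd xs) x = g xs" using cochainsD[OF assms(1) that] by auto
  from someI_ex[OF this] show ?thesis unfolding f_def using that by simp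
 qed
 have "f : cochains k S" by (rule cochainsI) (auto simp: f, auto simp: f_def)
 moreover have "capp k e f = g" using f cochains_off[OF assms(1)] by (auto simp: capp_def fun_eq_iff)
 ultimately show ?thesis by blast
qed

section \<open>Cohomology of inverse systems\<close>

definition acyclic_system :: "('i => 'x::ab_group_add set) => ('i => 'i => 'x => 'x) => bool"
 where "acyclic_system S b \<longleftrightarrow> (ALL k. ALL f:cochains (Suc k) S. diff b (Suc k) f = 0 -->
  (EX g:cochains k S. diff b k g = f))"

lemma acyclic_systemD:
 "acyclic_system S b ==> f : cochains (Suc k) S ==> diff b (Suc k) f = 0 ==> EX g:cochains k S. diff b k g = f"
 unfolding acyclic_system_def by blast

text \<open>Cocycles of the quotient system \<open>S / S'\<close>, represented by cochains of \<open>S\<close> whose differential has values in \<open>S'\<close>.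
 This avoids forming quotient systems.\<close>

definition rcocycles :: "('i => 'x::ab_group_add set) => ('i => 'x set) => ('i => 'i => 'x => 'x) => nat => ('i list => 'x) set"
 where "rcocycles S S' b k = {f : cochains k S. diff b k f : cochains (Suc k) S'}"

definition rboundaries :: "('i => 'x::ab_group_add set) => ('i => 'x set) => ('i => 'i => 'x => 'x) => nat => ('i list => 'x) set"
 where "rboundaries S S' b k = {f : cochains (Suc k) S. EX g:cochains k S. f - diff b k g : cochains (Suc k) S'}"

definition subsystem :: "('i => 'x::ab_group_add set) => ('i => 'x set) => ('i => 'i => 'x => 'x) => bool"
 where "subsystem S S' b \<longleftrightarrow> system S b & system S' b & (ALL i:I. S' i <= S i)"

lemma rcocycles_subgroup:
 assumes "subsystem S S' b" shows "subgrp (rcocycles S S' b k)"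
proof -
 have S: "system S b" and S': "system S' b" using assms by (auto simp: subsystem_def)
 have c: "subgrp (cochains k S)" "subgrp (cochains (Suc k) S')"
  using systemD(1)[OF S] systemD(1)[OF S'] by (auto intro: cochains_subgroup)
 have "0 = diff b k 0" using additive_0[OF c(1) diff_additive[OF S]] by simp
 thus ?thesis using c diff_sub[OF S] unfolding rcocycles_def subgrp_def by auto
qed

text \<open>The connecting isomorphism of \<open>0 \<rightarrow> S / S' \<rightarrow> J \<rightarrow> im p \<rightarrow> 0\<close> with \<open>J\<close> acyclic: a cocycle of the image lifts to
 \<open>J\<close>, and the differential of the lift comes from \<open>S\<close>.\<close>

lemma connecting_presentation:
 assumes SS: "subsystem S S' b" and J: "system J bJ" and acyc: "acyclic_system J bJ"
  and J': "system J' bJ'" and e: "natural S b J bJ e" and p: "natural J bJ J' bJ' p"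
  and ker_e: "!!i x. i : I ==> x : S i ==> e i x = 0 \<longleftrightarrow> x : S' i"
  and exact: "!!i. i : I ==> {y : J i. p i y = 0} = e i ` S i"
  and Q: "presents Q {c : cochains k (%i. p i ` J i). diff bJ' k c = 0}
       {capp k p w | w. w : cochains k J & diff bJ k w = 0} q"
 shows "EX q'. presents Q (rcocycles S S' b (Suc k)) (rboundaries S S' b k) q' &
  (ALL w:cochains k J. ALL f:cochains (Suc k) S. diff bJ k w = capp (Suc k) e f --> q' f = q (capp k p w))"
proof -
 have S: "system S b" and S': "system S' b" and sub: "!!i. i : I ==> S' i <= S i"
  using SS by (auto simp: subsystem_def)
 have cS: "subgrp (cochains k S)" for k using systemD(1)[OF S] by (rule cochains_subgroup)
 have cJ: "subgrp (cochains k J)" for k using systemD(1)[OF J] by (rule cochains_subgroup)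
 have S0: "!!i. i : I ==> 0 : S i" and J0: "!!i. i : I ==> 0 : J i"
  using systemD(1)[OF S] systemD(1)[OF J] subgrp_0 by blast+
 have e0: "capp m e f = 0 \<longleftrightarrow> f : cochains m S'" if "f : cochains m S" for m f
 proof
  assume c0: "capp m e f = 0"
  have "e (hd xs) (f xs) = 0" if "xs : chains m" for xs
   using fun_cong[OF c0, of xs] that by (simp add: capp_def)
  thus "f : cochains m S'" using ker_e chains_hd cochainsD[OF that] cochains_off[OF that] by (intro cochainsI) auto
 next
  assume "f : cochains m S'"
  thus "capp m e f = 0" using ker_e chains_hd cochainsD[OF that] cochainsD[of f m S'] by (auto simp: capp_def fun_eq_iff)
 qed
 have p0: "EX f:cochains m S. capp m e f = w" if w: "w : cochains m J" "capp m p w = 0" for m w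
 proof (rule capp_lift[where S=S and e=e, OF _ S0])
  show "w : cochains m (%i. e i ` S i)"
  proof (rule cochainsI)
   fix xs assume xs: "xs : chains m"
   have "p (hd xs) (w xs) = 0" using fun_cong[OF w(2), of xs] xs by (simp add: capp_def)
   thus "w xs : e (hd xs) ` S (hd xs)" using exact[OF chains_hd[OF xs]] cochainsD[OF w(1) xs] by blast
  qed (rule cochains_off[OF w(1)])
 qed
 have pe: "capp m p (capp m e f) = 0" if "f : cochains m S" for m f
 proof -
  have "p (hd xs) (e (hd xs) (f xs)) = 0" if "xs : chains m" for xs
   using exact[OF chains_hd[OF that]] cochainsD[OF \<open>f \<in> cochains m S\<close> that] by blast
  thus ?thesis by (auto simp: capp_def fun_eq_iff)
 qed
 let ?C = "{c : cochains k (%i. p i ` J i). diff bJ' k c = 0}"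
 let ?B = "{capp k p w | w. w : cochains k J & diff bJ k w = 0}"
 define rel where "rel c f \<longleftrightarrow> c : ?C & f : rcocycles S S' b (Suc k) &
  (EX w:cochains k J. capp k p w = c & diff bJ k w = capp (Suc k) e f)" for c f
 have relI: "rel (capp k p w) f" if w: "w : cochains k J" and f: "f : cochains (Suc k) S"
  and wf: "diff bJ k w = capp (Suc k) e f" for w f
 proof -
  have "capp k p w : cochains k (%i. p i ` J i)"
   by (rule cochainsI) (auto simp: capp_def dest: cochainsD[OF w])
  moreover have "diff bJ' k (capp k p w) = 0"
   using diff_capp[OF J p w] pe[OF f] wf by simp
  moreover have "f : rcocycles S S' b (Suc k)"
  proof -
   have "capp (Suc (Suc k)) e (diff b (Suc k) f) = 0"
    using diff_capp[OF S e f] diff_diff[OF J w] wf by simp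
   thus ?thesis using e0[OF diff_cochain[OF S f]] f by (simp add: rcocycles_def)
  qed
  ultimately show ?thesis using w wf unfolding rel_def by blast
 qed
 have rel_add: "additive_relation rel"
  unfolding additive_relation_def
 proof (intro allI impI)
  fix c f c' f' assume "rel c f" "rel c' f'"
  then obtain w w' where w: "w : cochains k J" "capp k p w = c" "diff bJ k w = capp (Suc k) e f" "f : cochains (Suc k) S"
   and w': "w' : cochains k J" "capp k p w' = c'" "diff bJ k w' = capp (Suc k) e f'" "f' : cochains (Suc k) S"
   unfolding rel_def rcocycles_def by blast
  have "rel (capp k p (w - w')) (f - f')"
   by (rule relI) (use w w' subgrp_diff[OF cJ] subgrp_diff[OF cS] diff_sub[OF J] capp_sub[OF S e] in auto)
  thus "rel (c - c') (f - f')" using capp_sub[OF J p w(1) w'(1)] w w' by simp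
 qed
 have "EX q'. presents Q (rcocycles S S' b (Suc k)) (rboundaries S S' b k) q' & (ALL z z'. rel z z' --> q' z' = q z)"
 proof (rule presents_transport[OF Q rcocycles_subgroup[OF SS] rel_add])
  fix c assume c: "c : ?C"
  then obtain w where w: "w : cochains k J" "capp k p w = c" using capp_lift[where S=J and e=p, OF _ J0] by blast
  have "capp (Suc k) p (diff bJ k w) = 0" using diff_capp[OF J p w(1)] w c by simp
  then obtain f where "f : cochains (Suc k) S" "capp (Suc k) e f = diff bJ k w"
   using p0 diff_cochain[OF J w(1)] by blast
  thus "EX f. rel c f" using relI[OF w(1)] w(2) by metis
 next
  fix f assume f: "f : rcocycles S S' b (Suc k)"
  hence fS: "f : cochains (Suc k) S" and df: "diff b (Suc k) f : cochains (Suc (Suc k)) S'" by (auto simp: rcocycles_def)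
  have "diff bJ (Suc k) (capp (Suc k) e f) = 0"
   using diff_capp[OF S e fS] e0[OF diff_cochain[OF S fS]] df by simp
  then obtain w where "w : cochains k J" "diff bJ k w = capp (Suc k) e f"
   using acyclic_systemD[OF acyc capp_cochain[OF e fS]] by blast
  thus "EX c. rel c f" using relI fS by blast
 next
  fix c f assume "rel c f"
  then obtain w where w: "w : cochains k J" "capp k p w = c" "diff bJ k w = capp (Suc k) e f" and fS: "f : cochains (Suc k) S"
   unfolding rel_def rcocycles_def by blast
  show "c : ?B \<longleftrightarrow> f : rboundaries S S' b k"
  proof
   assume "c : ?B"
   then obtain v where v: "v : cochains k J" "diff bJ k v = 0" "c = capp k p v" by blast
   have "capp k p (w - v) = 0" using capp_sub[OF J p w(1) v(1)] w v by simp
   then obtain g where g: "g : cochains k S" "capp k e g = w - v"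
    using p0 subgrp_diff[OF cJ w(1) v(1)] by blast
   have "capp (Suc k) e (diff b k g) = diff bJ k (w - v)" using diff_capp[OF S e g(1)] g by simp
   also have "\<dots> = capp (Suc k) e f" using diff_sub[OF J w(1) v(1)] v w by simp
   finally have "capp (Suc k) e (f - diff b k g) = 0" using capp_sub[OF S e fS diff_cochain[OF S g(1)]] by simp
   hence "f - diff b k g : cochains (Suc k) S'"
    using e0 subgrp_diff[OF cS fS diff_cochain[OF S g(1)]] by blast
   thus "f : rboundaries S S' b k" using fS g by (auto simp: rboundaries_def)
  next
   assume "f : rboundaries S S' b k"
   then obtain g where g: "g : cochains k S" "f - diff b k g : cochains (Suc k) S'" by (auto simp: rboundaries_def)
   have dg: "diff b k g : cochains (Suc k) S" by (rule diff_cochain[OF S g(1)])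
   have "capp (Suc k) e (f - diff b k g) = 0"
    using e0[OF subgrp_diff[OF cS fS dg]] g by blast
   hence "capp (Suc k) e f = diff bJ k (capp k e g)" using capp_sub[OF S e fS dg] diff_capp[OF S e g(1)] by simp
   hence "diff bJ k (w - capp k e g) = 0" using diff_sub[OF J w(1) capp_cochain[OF e g(1)]] w by simp
   moreover have "capp k p (w - capp k e g) = c"
    using capp_sub[OF J p w(1) capp_cochain[OF e g(1)]] pe[OF g(1)] w by simp
   ultimately show "c : ?B" using subgrp_diff[OF cJ w(1) capp_cochain[OF e g(1)]] by blast
  qed
 qed (auto simp: rel_def)
 thus ?thesis using relI by blast
qed

lemma rcocycles_image:
 assumes J: "system J bJ" and p: "natural J bJ J' bJ' p" and acyc: "acyclic_system J bJ"
 shows "rcocycles (%i. p i ` J i) (%i. {0}) bJ' k = {c : cochains k (%i. p i ` J i). diff bJ' k c = 0}"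
  and "rboundaries (%i. p i ` J i) (%i. {0}) bJ' k = {capp (Suc k) p w | w. w : cochains (Suc k) J & diff bJ (Suc k) w = 0}"
proof -
 have J0: "!!i. i : I ==> 0 : J i" using systemD(1)[OF J] subgrp_0 by blast
 show "rcocycles (%i. p i ` J i) (%i. {0}) bJ' k = {c : cochains k (%i. p i ` J i). diff bJ' k c = 0}"
  by (simp add: rcocycles_def cochains_zero)
 have im: "capp k p w : cochains k (%i. p i ` J i)" if "w : cochains k J" for w k
  by (rule cochainsI) (auto simp: capp_def dest: cochainsD[OF that])
 show "rboundaries (%i. p i ` J i) (%i. {0}) bJ' k = {capp (Suc k) p w | w. w : cochains (Suc k) J & diff bJ (Suc k) w = 0}"
 proof (intro equalityI subsetI)
  fix c assume "c : rboundaries (%i. p i ` J i) (%i. {0}) bJ' k"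
  then obtain g where g: "g : cochains k (%i. p i ` J i)" "c = diff bJ' k g"
   by (auto simp: rboundaries_def cochains_zero)
  obtain v where v: "v : cochains k J" "capp k p v = g" using capp_lift[where S=J and e=p, OF g(1) J0] by blast
  have "c = capp (Suc k) p (diff bJ k v)" using diff_capp[OF J p v(1)] v g by simp
  thus "c : {capp (Suc k) p w | w. w : cochains (Suc k) J & diff bJ (Suc k) w = 0}"
   using diff_cochain[OF J v(1)] diff_diff[OF J v(1)] by blast
 next
  fix c assume "c : {capp (Suc k) p w | w. w : cochains (Suc k) J & diff bJ (Suc k) w = 0}"
  then obtain w where w: "c = capp (Suc k) p w" "w : cochains (Suc k) J" "diff bJ (Suc k) w = 0" by blast
  then obtain v where v: "v : cochains k J" "diff bJ k v = w" using acyclic_systemD[OF acyc] by blast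
  have "c = diff bJ' k (capp k p v)" using diff_capp[OF J p v(1)] v w by simp
  thus "c : rboundaries (%i. p i ` J i) (%i. {0}) bJ' k"
   using im[OF w(2)] im[OF v(1)] w(1) by (force simp: rboundaries_def cochains_zero)
 qed
qed

end

section \<open>Acyclic systems\<close>

context preordered_index
begin

lemma deletions_chain:
 assumes "xs : chains (Suc k)" "ys : deletions xs" shows "ys : chains k"
 using assms deletionsD[OF assms(2), of r] unfolding chains_def by auto

lemma diff_inclusion:
 "xs : chains (Suc k) ==> diff (%i j x. x) k f xs = alt_del f xs"
proof -
 assume xs: "xs : chains (Suc k)"
 obtain i j zs where "xs = i # j # zs" using xs by (rule chains_Suc_cases) blast
 thus ?thesis using xs by (simp add: diff_Cons)
qed

lemma acyclic_retract:
 assumes J: "system J bJ" and C: "system C bC" and acyc: "acyclic_system C bC"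
  and m: "natural J bJ C bC m" and g: "natural C bC J bJ g"
  and gm: "!!i x. i : I ==> x : J i ==> g i (m i x) = x"
 shows "acyclic_system J bJ"
 unfolding acyclic_system_def
proof (intro allI ballI impI)
 fix k f assume f: "f : cochains (Suc k) J" "diff bJ (Suc k) f = 0"
 have "diff bC (Suc k) (capp (Suc k) m f) = 0"
  using diff_capp[OF J m f(1)] additive_0[OF cochains_subgroup capp_additive[OF m]] systemD(1)[OF J] f(2) by simp
 then obtain h where h: "h : cochains k C" "diff bC k h = capp (Suc k) m f"
  using acyclic_systemD[OF acyc capp_cochain[OF m f(1)]] by blast
 have "diff bJ k (capp k g h) = capp (Suc k) g (capp (Suc k) m f)" using diff_capp[OF C g h(1)] h(2) by simp
 also have "\<dots> = f"
 proof
  fix xs show "capp (Suc k) g (capp (Suc k) m f) xs = f xs"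
   using gm[OF chains_hd] cochainsD[OF f(1)] cochains_off[OF f(1)] by (simp add: capp_def)
 qed
 finally show "EX g:cochains k J. diff bJ k g = f" using capp_cochain[OF g h(1)] by blast
qed

text \<open>A coinduced system: its elements at \<open>i\<close> are the families of elements of \<open>J l\<close> for \<open>l\<close> below \<open>i\<close>,
 read off by \<open>ev\<close>, and its bonding maps restrict families. Prepending an index is a contraction of its
 cochain complex.\<close>

lemma coinduced_acyclic:
 fixes ev :: "'i => 'x::ab_group_add => 'i => 'y::ab_group_add"
 assumes C: "system C bC"
  and add: "!!i l. i : I ==> l : I ==> r l i ==> additive (C i) (%x. ev i x l)"
  and mem: "!!i l x. i : I ==> l : I ==> r l i ==> x : C i ==> ev i x l : J l"
  and bond: "!!i j l x. i : I ==> j : I ==> l : I ==> r i j ==> r l i ==> x : C j ==> ev i (bC i j x) l = ev j x l"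
  and ex: "!!i h. i : I ==> (!!l. l : I ==> r l i ==> h l : J l) ==>
   EX x:C i. ALL l:I. r l i --> ev i x l = h l"
  and ext: "!!i x y. i : I ==> x : C i ==> y : C i ==> (!!l. l : I ==> r l i ==> ev i x l = ev i y l) ==> x = y"
 shows "acyclic_system C bC"
 unfolding acyclic_system_def
proof (intro allI ballI impI)
 fix k f assume f: "f : cochains (Suc k) C" and df: "diff bC (Suc k) f = 0"
 have cons: "l # xs : chains (Suc m)" if xs: "xs : chains m" and l: "l : I" "r l (hd xs)" for l xs m
 proof -
  have "r l x" if x: "x : set xs" for x
  proof (cases xs)
   case (Cons a ys)
   have "x = a \<or> r a x" using x xs Cons by (auto simp: chains_def)
   thus ?thesis using index_trans[of l a x] xs l x Cons by (auto simp: chains_def)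
  qed (use x in simp)
  thus ?thesis using xs l by (auto simp: chains_def)
 qed
 have "EX x:C (hd xs). ALL l:I. r l (hd xs) --> ev (hd xs) x l = ev l (f (l # xs)) l" if xs: "xs : chains k" for xs
  using cochainsD[OF f cons[OF xs]] mem index_refl by (intro ex chains_hd[OF xs]) fastforce
 then obtain h0 where h0: "!!xs. xs : chains k ==> h0 xs : C (hd xs)"
  "!!xs l. xs : chains k ==> l : I ==> r l (hd xs) ==> ev (hd xs) (h0 xs) l = ev l (f (l # xs)) l" by metis
 define h where "h xs = (if xs : chains k then h0 xs else 0)" for xs
 have h: "h : cochains k C" by (rule cochainsI) (simp_all add: h_def h0)
 have "diff bC k h xs = f xs" for xs
 proof (cases "xs : chains (Suc k)")
  case True
  then obtain i j zs where x: "xs = i # j # zs" "j # zs : chains k" "i : I" "j : I" "r i j"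
   and del: "!!ys. ys : deletions (j # zs) ==> i # ys : chains k" by (rule chains_Suc_cases) blast
  let ?a = "alt_del (%ys. h (i # ys)) (j # zs)"
  have hC: "h (i # ys) : C i" if "ys : deletions (j # zs)" for ys using cochainsD[OF h del[OF that]] by simp
  have aC: "?a : C i" by (rule alt_del_in[OF systemD(1)[OF C x(3)] hC])
  have bh: "bC i j (h (j # zs)) : C i" using systemD(3)[OF C x(3,4,5)] cochainsD[OF h x(2)] by simp
  show ?thesis
  proof (rule ext[OF x(3)])
   show "diff bC k h xs : C i" "f xs : C i"
    using cochainsD[OF diff_cochain[OF C h] True] cochainsD[OF f True] x(1) by auto
   fix l assume l: "l : I" "r l i"
   have lj: "r l j" by (rule index_trans[OF l(1) x(3,4) l(2) x(5)])
   have lxs: "l # xs : chains (Suc (Suc k))" using cons[OF True l(1)] l(2) x(1) by simp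
   have del': "l # ys : chains (Suc k)" if "ys : deletions xs" for ys
    using lxs by (rule chains_Suc_cases) (use that x in auto)
   have fl: "f (l # ys) : C l" if "ys : deletions xs" for ys using cochainsD[OF f del'[OF that]] by simp
   have ljzs: "l # j # zs : chains (Suc k)" using del'[of "j # zs"] x(1) by simp
   have add_l: "additive (C l) (%x. ev l x l)" by (rule add[OF l(1) l(1) index_refl[OF l(1)]])
   have "ev i (diff bC k h xs) l = ev i (bC i j (h (j # zs))) l - ev i ?a l"
    using additive_diff[OF systemD(1)[OF C x(3)] add[OF x(3) l] bh aC] True x(1)
    by (simp add: diff_Cons del: alt_del.simps)
   also have "ev i (bC i j (h (j # zs))) l = ev l (f (l # j # zs)) l"
    using bond[OF x(3,4) l(1) x(5) l(2)] cochainsD[OF h x(2)] h0(2)[OF x(2) l(1)] lj x(2) by (simp add: h_def)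
   also have "ev i ?a l = alt_del (%ys. ev i (h (i # ys)) l) (j # zs)"
    by (rule alt_del_hom[OF systemD(1)[OF C x(3)] add[OF x(3) l] hC])
   also have "\<dots> = alt_del (%ys. ev l (f (l # i # ys)) l) (j # zs)"
    by (rule alt_del_cong) (use h0(2)[OF del] l del in \<open>simp add: h_def\<close>)
   also have "\<dots> = ev l (alt_del (%ys. f (l # i # ys)) (j # zs)) l"
    by (rule alt_del_hom[OF systemD(1)[OF C l(1)] add_l, symmetric]) (use fl x(1) in auto)
   also have "ev l (f (l # j # zs)) l - \<dots> = ev l (alt_del (%ys. f (l # ys)) xs) l"
   proof -
    have "f (l # j # zs) : C l" "alt_del (%ys. f (l # i # ys)) (j # zs) : C l"
     using fl x(1) by (auto intro!: alt_del_in[OF systemD(1)[OF C l(1)]] simp del: alt_del.simps)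
    from additive_diff[OF systemD(1)[OF C l(1)] add_l this] show ?thesis using x(1) by simp
   qed
   also have "alt_del (%ys. f (l # ys)) xs = bC l i (f xs)"
    using fun_cong[OF df, of "l # xs"] lxs unfolding x(1) by (simp add: diff_Cons del: alt_del.simps)
   also have "ev l (bC l i (f xs)) l = ev i (f xs) l"
    using bond[OF l(1) x(3) l(1) l(2) index_refl[OF l(1)]] cochainsD[OF f True] x(1) by simp
   finally show "ev i (diff bC k h xs) l = ev i (f xs) l" .
  qed
 qed (simp add: diff_off cochains_off[OF f])
 thus "EX g:cochains k C. diff bC k g = f" using h by blast
qed

text \<open>Two cases of the long exact sequence: correct a cocycle by a primitive of its image in \<open>U\<close>, then
 use a primitive in \<open>V\<close> of the rest.\<close>

lemma acyclic_extension:
 assumes S: "system S b" and V: "system V bV" "acyclic_system V bV" and U: "system U bU" "acyclic_system U bU"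
  and e: "natural V bV S b e" and p: "natural S b U bU p"
  and inj: "!!i x. i : I ==> x : V i ==> e i x = 0 ==> x = 0"
  and surj: "!!i. i : I ==> U i <= p i ` S i"
  and exact: "!!i. i : I ==> {y : S i. p i y = 0} = e i ` V i"
 shows "acyclic_system S b"
 unfolding acyclic_system_def
proof (intro allI ballI impI)
 fix k f assume f: "f : cochains (Suc k) S" "diff b (Suc k) f = 0"
 have cS: "subgrp (cochains k S)" for k using systemD(1)[OF S] by (rule cochains_subgroup)
 have S0: "!!i. i : I ==> 0 : S i" and V0: "!!i. i : I ==> 0 : V i"
  using systemD(1)[OF S] systemD(1)[OF V(1)] subgrp_0 by blast+
 have "diff bU (Suc k) (capp (Suc k) p f) = 0"
  using diff_capp[OF S p f(1)] additive_0[OF cS capp_additive[OF p]] f(2) by simp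
 then obtain u where u: "u : cochains k U" "diff bU k u = capp (Suc k) p f"
  using acyclic_systemD[OF U(2) capp_cochain[OF p f(1)]] by blast
 have "u : cochains k (%i. p i ` S i)" using u(1) cochains_mono[of U "%i. p i ` S i"] surj by blast
 then obtain s where s: "s : cochains k S" "capp k p s = u" using capp_lift[where S=S and e=p, OF _ S0] by blast
 have ds: "diff b k s : cochains (Suc k) S" by (rule diff_cochain[OF S s(1)])
 define w where "w = f - diff b k s"
 have w: "w : cochains (Suc k) S" unfolding w_def by (rule subgrp_diff[OF cS f(1) ds])
 have pw: "capp (Suc k) p w = 0"
  unfolding w_def using capp_sub[OF S p f(1) ds] diff_capp[OF S p s(1)] s u by simp
 have dw: "diff b (Suc k) w = 0"
  unfolding w_def using diff_sub[OF S f(1) ds] f(2) diff_diff[OF S s(1)] by simp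
 have "w : cochains (Suc k) (%i. e i ` V i)"
 proof (rule cochainsI)
  fix xs assume xs: "xs : chains (Suc k)"
  have "p (hd xs) (w xs) = 0" using fun_cong[OF pw, of xs] xs by (simp add: capp_def)
  thus "w xs : e (hd xs) ` V (hd xs)" using exact[OF chains_hd[OF xs]] cochainsD[OF w xs] by blast
 qed (rule cochains_off[OF w])
 then obtain v where v: "v : cochains (Suc k) V" "capp (Suc k) e v = w" using capp_lift[where S=V and e=e, OF _ V0] by blast
 have dv: "diff bV (Suc k) v : cochains (Suc (Suc k)) V" by (rule diff_cochain[OF V(1) v(1)])
 have edv: "capp (Suc (Suc k)) e (diff bV (Suc k) v) = 0" using diff_capp[OF V(1) e v(1)] v(2) dw by simp
 have "diff bV (Suc k) v xs = 0" for xs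
 proof (cases "xs : chains (Suc (Suc k))")
  case True
  have "e (hd xs) (diff bV (Suc k) v xs) = 0" using fun_cong[OF edv, of xs] True by (simp add: capp_def)
  thus ?thesis using inj[OF chains_hd[OF True] cochainsD[OF dv True]] by blast
 qed (rule diff_off)
 hence "diff bV (Suc k) v = 0" by (simp add: fun_eq_iff)
 then obtain v' where v': "v' : cochains k V" "diff bV k v' = v" using acyclic_systemD[OF V(2) v(1)] by blast
 have "diff b k (s + capp k e v') = f"
  using diff_add[OF S s(1) capp_cochain[OF e v'(1)]] diff_capp[OF V(1) e v'(1)] v' v w_def by simp
 thus "EX g:cochains k S. diff b k g = f"
  using subgrp_add[OF cS s(1) capp_cochain[OF e v'(1)]] by blast
qed

end

section \<open>Annihilators\<close>

definition homs :: "'p::ab_group_add set => 'e::ab_group_add set => ('p => 'e) set"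
 where "homs P D = {f. additive P f & f ` P <= D & (ALL x. x ~: P --> f x = 0)}"

definition annih :: "'p::ab_group_add set => 'p set => 'e::ab_group_add set => ('p => 'e) set"
 where "annih P K D = {f : homs P D. ALL x:K. f x = 0}"

lemma homs_subgroup:
 assumes D: "subgrp D" shows "subgrp (homs P D)"
 unfolding subgrp_def homs_def additive_def
 using subgrp_0[OF D] subgrp_diff[OF D] by (auto simp: image_subset_iff)

lemma annih_subgroup: "subgrp D ==> subgrp (annih P K D)"
 using homs_subgroup[of D P] unfolding annih_def subgrp_def by auto

lemma annihD:
 assumes "f : annih P K D"
 shows "additive P f" "x : P ==> f x : D" "x ~: P ==> f x = 0" "x : K ==> f x = 0"
 using assms unfolding annih_def homs_def by auto

lemma annihI:
 assumes "additive P f" "!!x. x : P ==> f x : D" "!!x. x ~: P ==> f x = 0" "!!x. x : K ==> f x = 0"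
 shows "f : annih P K D"
 using assms unfolding annih_def homs_def by auto

definition single :: "'c => 'p::zero => 'c => 'p"
 where "single c x = (%c'. if c' = c then x else 0)"

definition fin_supp :: "'p::ab_group_add set => ('c => 'p) set"
 where "fin_supp P = {w. finite {c. w c ~= 0} & (ALL c. w c : P)}"

definition pairing :: "('c => 'p::ab_group_add => 'e::ab_group_add) => ('c => 'p) => 'e"
 where "pairing g w = (\<Sum>c | w c ~= 0. g c (w c))"

lemma fin_supp_subgroup: assumes P: "subgrp P" shows "subgrp (fin_supp P :: ('c => 'p::ab_group_add) set)"
 unfolding subgrp_def
proof (intro conjI ballI)
 show "0 : fin_supp P" using subgrp_0[OF P] by (simp add: fin_supp_def)
 fix v w :: "'c => 'p" assume v: "v : fin_supp P" "w : fin_supp P"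
 have "finite {c. (v - w) c ~= 0}"
  by (rule finite_subset[of _ "{c. v c ~= 0} Un {c. w c ~= 0}"]) (use v in \<open>auto simp: fin_supp_def\<close>)
 thus "v - w : fin_supp P" using v subgrp_diff[OF P] by (simp add: fin_supp_def)
qed

lemma single_in: "subgrp P ==> x : P ==> single c x : fin_supp P"
 using finite_subset[of "{c'. single c x c' ~= 0}" "{c}"] subgrp_0
 by (auto simp: fin_supp_def single_def split: if_splits)

lemma pairing_additive:
 fixes g :: "'c => 'p::ab_group_add => 'e::ab_group_add"
 assumes P: "subgrp P" and g: "!!c. additive P (g c)"
 shows "additive (fin_supp P) (pairing g)"
 unfolding additive_def
proof (intro ballI)
 fix v w :: "'c => 'p" assume v: "v : fin_supp P" and w: "w : fin_supp P"
 let ?U = "{c. v c ~= 0} Un {c. w c ~= 0}"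
 have U: "finite ?U" using v w by (simp add: fin_supp_def)
 have g0: "g c 0 = 0" for c by (rule additive_0[OF P g])
 have eq: "pairing g u = (\<Sum>c\<in>?U. g c (u c))" if "{c. u c ~= 0} <= ?U" for u
  unfolding pairing_def by (rule sum.mono_neutral_left[OF U that]) (use g0 in auto)
 have "pairing g (v + w) = (\<Sum>c\<in>?U. g c (v c + w c))" by (subst eq) auto
 also have "\<dots> = (\<Sum>c\<in>?U. g c (v c) + g c (w c))"
  by (rule sum.cong) (use v w additiveD[OF g] in \<open>auto simp: fin_supp_def\<close>)
 also have "\<dots> = pairing g v + pairing g w" by (subst (1 2) eq) (auto simp: sum.distrib)
 finally show "pairing g (v + w) = pairing g v + pairing g w" .
qed

lemma pairing_single:
 assumes "g c 0 = 0" shows "pairing g (single c x) = g c x"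
proof (cases "x = 0")
 case False
 hence "{c'. single c x c' ~= 0} = {c}" by (auto simp: single_def)
 thus ?thesis by (simp add: pairing_def single_def)
qed (use assms in \<open>simp add: pairing_def single_def\<close>)

locale directed_index = preordered_index I r for I :: "'i set" and r +
 assumes index_nonempty: "I ~= {}"
  and index_directed: "i : I ==> j : I ==> EX k:I. r i k & r j k"
begin

lemma finite_upper_bound: "finite F ==> F <= I ==> EX j:I. ALL i:F. r i j"
proof (induction F rule: finite_induct)
 case empty
 thus ?case using index_nonempty by blast
next
 case (insert a F)
 then obtain j where j: "j : I" "ALL i:F. r i j" by blast
 obtain k where k: "k : I" "r a k" "r j k" using index_directed[of a j] insert j by blast
 have "r i k" if "i : F" for i using index_trans[of i j k] insert j k that by blast
 thus ?case using k by blast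
qed

text \<open>The cochain complex of \<open>i \<mapsto> Hom (P / K i, D)\<close> is dual to the complex computing the derived
 colimits of \<open>i \<mapsto> P / K i\<close>. The latter vanish because the index set is directed: appending a late
 index to every chain is a contraction on any finite part. Injectivity of \<open>D\<close> transfers the
 vanishing to the dual.\<close>

theorem annih_acyclic:
 fixes P :: "'p::ab_group_add set" and D :: "'e::ab_group_add set"
 assumes P: "subgrp P" and KP: "!!i. i : I ==> K i <= P"
  and D: "divisible D"
 shows "acyclic_system (%i. annih P (K i) D) (%i j x. x)"
 unfolding acyclic_system_def
proof (intro allI ballI impI)
 fix k f assume f: "f : cochains (Suc k) (%i. annih P (K i) D)" and df: "diff (%i j x. x) (Suc k) f = 0"
 have D0: "subgrp D" using D by (simp add: divisible_def)
 let ?W = "fin_supp P :: ('i list => 'p) set"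
 have W: "subgrp ?W" by (rule fin_supp_subgroup[OF P])
 have fann: "additive P (f c)" "x : P ==> f c x : D" "x ~: P ==> f c x = 0" for c x
  using annihD[OF cochainsD[OF f, of c]] cochains_off[OF f, of c] subgrp_0[OF D0]
  by (cases "c : chains (Suc k)"; simp add: additive_def)+
 define bd where "bd c x = alt_del (%ys. single ys x) c" for c :: "'i list" and x :: 'p
 have bdW: "bd c x : ?W" if "x : P" for c x
  unfolding bd_def by (rule alt_del_in[OF W single_in[OF P that]])
 define gens where "gens = {(bd c x, f c x) | c x. c : chains (Suc k) & x : P}
  Un {(single c x, 0) | c x. c : chains k & x : K (hd c)}"
 define Gm where "Gm = \<Inter>{S. subgrp S & gens <= S}"
 have Gm: "subgrp Gm" and gens: "gens <= Gm" unfolding Gm_def subgrp_def by blast+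
 have least: "Gm <= S" if "subgrp S" "gens <= S" for S using that unfolding Gm_def by blast
 define \<sigma> where "\<sigma> y = (if even k then - y else y)" for y :: 'e
 have \<sigma>: "\<sigma> (x - y) = \<sigma> x - \<sigma> y" "\<sigma> 0 = 0" for x y by (auto simp: \<sigma>_def)
 define ph where "ph j w = \<sigma> (pairing (%c. f (c @ [j])) w)" for j w
 define \<S> where "\<S> = {(w, y). w : ?W & y : D & (EX j0:I. ALL j:I. r j0 j --> y = ph j w)}"
 have pa: "additive ?W (pairing (%c. f (c @ [j])))" for j by (rule pairing_additive[OF P fann(1)])
 have ph_diff: "ph j (v - w) = ph j v - ph j w" if "v : ?W" "w : ?W" for j v w
  using additive_diff[OF W pa that] by (simp add: ph_def \<sigma>)
 have ph_single: "ph j (single c x) = \<sigma> (f (c @ [j]) x)" for j c x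
  using pairing_single[of "%c. f (c @ [j])" c x] additive_0[OF P fann(1)] by (simp add: ph_def)
 have "subgrp \<S>"
  unfolding subgrp_def
 proof (intro conjI ballI)
  have "ph j 0 = 0" for j using ph_diff[of 0 0 j] subgrp_0[OF W] by simp
  thus "0 : \<S>" using index_nonempty subgrp_0[OF W] subgrp_0[OF D0]
   by (auto simp: \<S>_def zero_prod_def)
  fix p q assume pq: "p : \<S>" "q : \<S>"
  obtain v x w y where vx: "p = (v, x)" "q = (w, y)" by (cases p, cases q)
  from pq obtain j1 j2 where j: "j1 : I" "!!j. j : I ==> r j1 j ==> x = ph j v"
   "j2 : I" "!!j. j : I ==> r j2 j ==> y = ph j w" and m: "v : ?W" "x : D" "w : ?W" "y : D"
   unfolding \<S>_def vx by blast
  obtain j0 where j0: "j0 : I" "r j1 j0" "r j2 j0" using index_directed[OF j(1,3)] by blast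
  have "x - y = ph j (v - w)" if jj: "j : I" "r j0 j" for j
  proof -
   have "x = ph j v" by (rule j(2)[OF jj(1) index_trans[OF j(1) j0(1) jj(1) j0(2) jj(2)]])
   moreover have "y = ph j w" by (rule j(4)[OF jj(1) index_trans[OF j(3) j0(1) jj(1) j0(3) jj(2)]])
   ultimately show ?thesis using ph_diff[OF m(1,3)] by simp
  qed
  thus "p - q : \<S>" using j0(1) subgrp_diff[OF W m(1,3)] subgrp_diff[OF D0 m(2,4)]
   by (auto simp: \<S>_def vx)
 qed
 moreover have "gens <= \<S>"
 proof
  fix p assume "p : gens"
  then consider (1) c x where "p = (bd c x, f c x)" "c : chains (Suc k)" "x : P"
   | (2) c x where "p = (single c x, 0)" "c : chains k" "x : K (hd c)" unfolding gens_def by blast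
  thus "p : \<S>"
  proof cases
   case 1
   have c: "set c <= I" "length c = Suc (Suc k)" "sorted_wrt r c" using 1 by (auto simp: chains_def)
   obtain j0 where j0: "j0 : I" "ALL i:set c. r i j0" using finite_upper_bound[of "set c"] c by blast
   have "f c x = ph j (bd c x)" if j: "j : I" "r j0 j" for j
   proof -
    have "ALL i:set c. r i j" using j0 j c index_trans[of _ j0 j] by blast
    hence "c @ [j] : chains (Suc (Suc k))" using c j by (auto simp: chains_def sorted_wrt_append)
    hence "alt_del f (c @ [j]) = 0"
     using fun_cong[OF df, of "c @ [j]"] diff_inclusion[of "c @ [j]" "Suc k" f] by simp
    hence "alt_del f (c @ [j]) x = 0" by simp
    hence "alt_del (%ys. f (ys @ [j]) x) c = (if even k then - f c x else f c x)"
     using c(2) by (auto simp: alt_del_snoc alt_del_apply add_eq_0_iff add_eq_0_iff2 split: if_splits)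
    hence "\<sigma> (alt_del (%ys. f (ys @ [j]) x) c) = f c x" by (auto simp: \<sigma>_def)
    moreover have "pairing (%c. f (c @ [j])) (bd c x) = alt_del (%ys. pairing (%c. f (c @ [j])) (single ys x)) c"
     unfolding bd_def by (rule alt_del_hom[OF W pa single_in[OF P 1(3)]])
    moreover have "\<dots> = alt_del (%ys. f (ys @ [j]) x) c"
     using pairing_single[of "%c. f (c @ [j])"] additive_0[OF P fann(1)] by simp
    ultimately show ?thesis by (simp add: ph_def)
   qed
   thus ?thesis using 1 bdW fann(2) j0(1) by (auto simp: \<S>_def)
  next
   case 2
   have c: "set c <= I" "length c = Suc k" "sorted_wrt r c" using 2 by (auto simp: chains_def)
   obtain j0 where j0: "j0 : I" "ALL i:set c. r i j0" using finite_upper_bound[of "set c"] c by blast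
   have xP: "x : P" using KP[OF chains_hd[OF 2(2)]] 2(3) by blast
   have "0 = ph j (single c x)" if j: "j : I" "r j0 j" for j
   proof -
    have "ALL i:set c. r i j" using j0 j c index_trans[of _ j0 j] by blast
    hence "c @ [j] : chains (Suc k)" using c j by (auto simp: chains_def sorted_wrt_append)
    moreover have "hd (c @ [j]) = hd c" using c(2) by (cases c) auto
    ultimately have "f (c @ [j]) x = 0" using annihD(4)[OF cochainsD[OF f]] 2(3) by metis
    thus ?thesis by (simp add: ph_single \<sigma>)
   qed
   thus ?thesis using 2 single_in[OF P xP] subgrp_0[OF D0] j0(1) by (auto simp: \<S>_def)
  qed
 qed
 ultimately have Gm\<S>: "Gm <= \<S>" by (rule least)
 hence sub: "Gm <= ?W \<times> D" by (auto simp: \<S>_def)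
 have sv: "y = 0" if "(0, y) : Gm" for y
 proof -
  have "(0, y) : \<S>" using that Gm\<S> by blast
  then obtain j0 where "j0 : I" "ALL j:I. r j0 j --> y = ph j 0" unfolding \<S>_def by blast
  hence "y = ph j0 0" using index_refl by blast
  thus ?thesis using ph_diff[of 0 0 j0] subgrp_0[OF W] by simp
 qed
 obtain \<gamma> where \<gamma>: "additive ?W \<gamma>" "\<gamma> ` ?W <= D" "!!x y. (x, y) : Gm ==> \<gamma> x = y"
  using divisible_extends_graph[OF W D Gm sub sv] by blast
 define g where "g c = (if c : chains k then (%x. if x : P then \<gamma> (single c x) else 0) else 0)" for c
 have g: "g : cochains k (%i. annih P (K i) D)"
 proof (rule cochainsI)
  fix c assume c: "c : chains k"
  show "g c : annih P (K (hd c)) D"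
  proof (rule annihI)
   show "additive P (g c)"
    unfolding additive_def
   proof (intro ballI)
    fix x y assume xy: "x : P" "y : P"
    have "single c (x + y) = single c x + single c y" by (auto simp: single_def)
    thus "g c (x + y) = g c x + g c y"
     using additiveD[OF \<gamma>(1) single_in[OF P xy(1)] single_in[OF P xy(2)]] subgrp_add[OF P xy] xy c
     by (simp add: g_def)
   qed
   show "g c x : D" if "x : P" for x using \<gamma>(2) single_in[OF P that, of c] c that by (auto simp: g_def)
   show "g c x = 0" if "x ~: P" for x using that by (simp add: g_def)
   show "g c x = 0" if "x : K (hd c)" for x
   proof -
    have "(single c x, 0) : Gm" using gens that c unfolding gens_def by blast
    thus ?thesis using \<gamma>(3) by (simp add: g_def)
   qed
  qed
 qed (simp add: g_def)
 have "diff (%i j x. x) k g c = f c" for c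
 proof (cases "c : chains (Suc k)")
  case True
  have "alt_del g c x = f c x" for x
  proof (cases "x : P")
   case xP: True
   have "alt_del (%ys. g ys x) c = alt_del (%ys. \<gamma> (single ys x)) c"
    by (rule alt_del_cong) (use deletions_chain[OF True] xP in \<open>simp add: g_def\<close>)
   also have "\<dots> = \<gamma> (bd c x)" unfolding bd_def by (rule alt_del_hom[OF W \<gamma>(1) single_in[OF P xP], symmetric])
   also have "\<dots> = f c x" by (rule \<gamma>(3)) (use gens True xP in \<open>auto simp: gens_def\<close>)
   finally show ?thesis by (simp add: alt_del_apply)
  next
   case False
   have "alt_del (%ys. g ys x) c = 0" by (rule alt_del_zero) (simp add: g_def False)
   thus ?thesis using fann(3)[OF False] by (simp add: alt_del_apply)
  qed
  hence "alt_del g c = f c" by (rule ext)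
  thus ?thesis by (simp only: diff_inclusion[OF True])
 qed (simp add: diff_off cochains_off[OF f])
 thus "EX g:cochains k (%i. annih P (K i) D). diff (%i j x. x) k g = f" using g by blast
qed

end

section \<open>Injective systems\<close>

lemma comm_group_image:
 assumes H: "comm_group H" and im: "ph ` carrier H = carrier K"
  and mult: "!!x y. x : carrier H ==> y : carrier H ==> ph (x \<otimes>\<^bsub>H\<^esub> y) = ph x \<otimes>\<^bsub>K\<^esub> ph y"
  and one: "\<one>\<^bsub>K\<^esub> = ph \<one>\<^bsub>H\<^esub>"
 shows "comm_group K"
proof -
 interpret H: comm_group H by fact
 have ex: "EX a:carrier H. x = ph a" if "x : carrier K" for x using that im by blast
 have mem: "ph a : carrier K" if "a : carrier H" for a using that im by blast
 show ?thesis
 proof (rule comm_groupI)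
  show "\<one>\<^bsub>K\<^esub> : carrier K" using mem one by simp
  fix x assume "x : carrier K"
  then obtain a where a: "a : carrier H" "x = ph a" using ex by blast
  show "\<one>\<^bsub>K\<^esub> \<otimes>\<^bsub>K\<^esub> x = x" using mult[of "\<one>\<^bsub>H\<^esub>" a] a one by simp
  have "ph (inv\<^bsub>H\<^esub> a) \<otimes>\<^bsub>K\<^esub> x = \<one>\<^bsub>K\<^esub>" using mult[of "inv\<^bsub>H\<^esub> a" a] a one by simp
  thus "EX y:carrier K. y \<otimes>\<^bsub>K\<^esub> x = \<one>\<^bsub>K\<^esub>" using mem[of "inv\<^bsub>H\<^esub> a"] a by blast
  fix y assume "y : carrier K"
  then obtain b where b: "b : carrier H" "y = ph b" using ex by blast
  show "x \<otimes>\<^bsub>K\<^esub> y : carrier K" using mult[of a b] mem[of "a \<otimes>\<^bsub>H\<^esub> b"] a b by simp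
  show "x \<otimes>\<^bsub>K\<^esub> y = y \<otimes>\<^bsub>K\<^esub> x" using mult[of a b] mult[of b a] H.m_comm[of a b] a b by simp
  fix z assume "z : carrier K"
  then obtain c where c: "c : carrier H" "z = ph c" using ex by blast
  have "ph (a \<otimes>\<^bsub>H\<^esub> b \<otimes>\<^bsub>H\<^esub> c) = x \<otimes>\<^bsub>K\<^esub> y \<otimes>\<^bsub>K\<^esub> z" using mult[of "a \<otimes>\<^bsub>H\<^esub> b" c] mult[of a b] a b c by simp
  moreover have "ph (a \<otimes>\<^bsub>H\<^esub> (b \<otimes>\<^bsub>H\<^esub> c)) = x \<otimes>\<^bsub>K\<^esub> (y \<otimes>\<^bsub>K\<^esub> z)" using mult[of a "b \<otimes>\<^bsub>H\<^esub> c"] mult[of b c] a b c by simp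
  ultimately show "x \<otimes>\<^bsub>K\<^esub> y \<otimes>\<^bsub>K\<^esub> z = x \<otimes>\<^bsub>K\<^esub> (y \<otimes>\<^bsub>K\<^esub> z)" using H.m_assoc[of a b c] a b c by simp
 qed
qed

lemma comm_group_product_group:
 assumes "!!i. i : I ==> comm_group (H i)" shows "comm_group (product_group I H)"
proof -
 have "group (product_group I H)" using assms by (intro product_group) (auto simp: comm_group_def)
 moreover have "x \<otimes>\<^bsub>product_group I H\<^esub> y = y \<otimes>\<^bsub>product_group I H\<^esub> x"
  if xy: "x : carrier (product_group I H)" "y : carrier (product_group I H)" for x y
 proof -
  have "x i \<otimes>\<^bsub>H i\<^esub> y i = y i \<otimes>\<^bsub>H i\<^esub> x i" if i: "i : I" for i
  proof -
   interpret comm_group "H i" using assms[OF i] .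
   show ?thesis using xy i by (intro m_comm) auto
  qed
  thus ?thesis by (auto intro!: restrict_ext)
 qed
 ultimately show ?thesis by (intro group.group_comm_groupI)
qed

lemma divisible_group_extends_hom:
 assumes D: "divisible_group D" and T: "comm_group T" and S: "group S"
  and m: "m : hom S T" "inj_on m (carrier S)" and f: "f : hom S D"
 shows "EX g:hom T D. ALL x:carrier S. g (m x) = f x"
proof -
 interpret S: group S by fact
 interpret T: comm_group T by fact
 interpret D: comm_group D using D by (simp add: divisible_group_def)
 interpret P: group "T \<times>\<times> D" using T.group_axioms D.group_axioms by (rule DirProd_group)
 interpret m: group_hom S T m by unfold_locales (rule m)
 interpret f: group_hom S D f by unfold_locales (rule f)
 define Gm where "Gm = (%x. (m x, f x)) ` carrier S"
 have sub: "subgroup Gm (T \<times>\<times> D)"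
 proof (rule P.subgroupI)
  show "Gm <= carrier (T \<times>\<times> D)" unfolding Gm_def by auto
  show "Gm ~= {}" unfolding Gm_def using S.one_closed by blast
  fix a assume "a : Gm"
  then obtain x where x: "x : carrier S" "a = (m x, f x)" unfolding Gm_def by blast
  have eq: "inv\<^bsub>T \<times>\<times> D\<^esub> a = (m (inv\<^bsub>S\<^esub> x), f (inv\<^bsub>S\<^esub> x))"
   using x T.group_axioms D.group_axioms by (simp add: inv_DirProd)
  show "inv\<^bsub>T \<times>\<times> D\<^esub> a : Gm" unfolding eq Gm_def by (rule imageI[OF S.inv_closed[OF x(1)]])
  fix b assume "b : Gm"
  then obtain y where y: "y : carrier S" "b = (m y, f y)" unfolding Gm_def by blast
  have eq: "a \<otimes>\<^bsub>T \<times>\<times> D\<^esub> b = (m (x \<otimes>\<^bsub>S\<^esub> y), f (x \<otimes>\<^bsub>S\<^esub> y))" using x y by simp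
  show "a \<otimes>\<^bsub>T \<times>\<times> D\<^esub> b : Gm" unfolding eq Gm_def by (rule imageI[OF S.m_closed[OF x(1) y(1)]])
 qed
 have sv: "y = \<one>\<^bsub>D\<^esub>" if "(\<one>\<^bsub>T\<^esub>, y) : Gm" for y
 proof -
  from that obtain x where x: "x : carrier S" "m x = \<one>\<^bsub>T\<^esub>" "y = f x"
   unfolding Gm_def by auto
  have "m x = m \<one>\<^bsub>S\<^esub>" using x(2) by simp
  hence "x = \<one>\<^bsub>S\<^esub>" using inj_onD[OF m(2)] x(1) by simp
  thus ?thesis using x(3) by simp
 qed
 from divisible_group_extends_graph[OF T D sub sv]
 obtain g where g: "g : hom T D" "!!x y. (x, y) : Gm ==> g x = y" by blast
 have "g (m x) = f x" if "x : carrier S" for x by (rule g(2)) (use that in \<open>simp add: Gm_def\<close>)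
 thus ?thesis using g(1) by blast
qed

definition transport :: "('a => 'b) => ('a, 'm) monoid_scheme => 'b monoid"
 where "transport e H = \<lparr>carrier = e ` carrier H,
  monoid.mult = (%x y. e (inv_into (carrier H) e x \<otimes>\<^bsub>H\<^esub> inv_into (carrier H) e y)), one = e \<one>\<^bsub>H\<^esub>\<rparr>"

lemma transport_simps [simp]:
 "carrier (transport e H) = e ` carrier H" "\<one>\<^bsub>transport e H\<^esub> = e \<one>\<^bsub>H\<^esub>"
 by (simp_all add: transport_def)

lemma transport_mult:
 "inj_on e (carrier H) ==> x : carrier H ==> y : carrier H ==>
  e x \<otimes>\<^bsub>transport e H\<^esub> e y = e (x \<otimes>\<^bsub>H\<^esub> y)"
 by (simp add: transport_def)

lemma transport_hom: "inj_on e (carrier H) ==> e : hom H (transport e H)"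
 by (auto simp: hom_def transport_mult)

lemma comm_group_transport:
 "comm_group H ==> inj_on e (carrier H) ==> comm_group (transport e H)"
 by (rule comm_group_image[of H e]) (auto simp: transport_mult)

lemma divisible_group_transport:
 assumes H: "divisible_group H" and e: "inj_on e (carrier H)" shows "divisible_group (transport e H)"
proof -
 have cH: "comm_group H" using H by (simp add: divisible_group_def)
 have cT: "comm_group (transport e H)" by (rule comm_group_transport[OF cH e])
 interpret e: group_hom H "transport e H" e
  using cH cT transport_hom[OF e] by (auto simp: group_hom_def group_hom_axioms_def comm_group_def)
 have "EX y:e ` carrier H. y [^]\<^bsub>transport e H\<^esub> n = e x" if n: "n > 0" and x: "x : carrier H" for n :: nat and x
 proof -
  obtain y where "y : carrier H" "y [^]\<^bsub>H\<^esub> n = x" using H n x unfolding divisible_group_def by blast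
  thus ?thesis using e.hom_nat_pow[of y n] by (metis imageI)
 qed
 thus ?thesis using cT by (auto simp: divisible_group_def)
qed

subsection \<open>Divisible hulls\<close>

lemma pow_group_of: "x [^]\<^bsub>group_of S\<^esub> (n::nat) = x [^]\<^bsub>group_of T\<^esub> n"
 by (induction n) simp_all

lemma infinite_triple_code:
 assumes "infinite (UNIV :: 'u set)" shows "EX p :: nat \<times> 'u \<times> 'u => 'u. inj p"
proof -
 have "EX q. inj_on q ((UNIV :: 'u set) \<times> (UNIV :: 'u set)) & q ` (UNIV \<times> UNIV) <= (UNIV :: 'u set)"
  unfolding card_of_ordLeq by (rule ordIso_imp_ordLeq[OF card_of_Times_same_infinite[OF assms]])
 then obtain q :: "'u \<times> 'u => 'u" where q: "inj q" by auto
 obtain n :: "nat => 'u" where n: "inj n" using assms infinite_iff_countable_subset[of "UNIV :: 'u set"] by auto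
 have "inj (%(k, a, b). q (n k, q (a, b)))"
 proof (rule injI)
  fix x y :: "nat \<times> 'u \<times> 'u"
  assume eq: "(case x of (k, a, b) => q (n k, q (a, b))) = (case y of (k, a, b) => q (n k, q (a, b)))"
  obtain k a b k' a' b' where xy: "x = (k, a, b)" "y = (k', a', b')" by (cases x, cases y)
  have "(n k, q (a, b)) = (n k', q (a', b'))" by (rule injD[OF q]) (use eq xy in simp)
  thus "x = y" using injD[OF n, of k k'] injD[OF q, of "(a, b)" "(a', b')"] xy by simp
 qed
 thus ?thesis by (rule exI[where x="%(k, a, b). q (n k, q (a, b))"])
qed

text \<open>The hull must be carried by the given infinite type. It is built inside the divisible group of functions on
 characters as a countable union of sets indexed by that type.\<close>

lemma divisible_hull:
 fixes M :: "('u, 'm) monoid_scheme"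
 assumes inf: "infinite (UNIV :: 'u set)" and M: "comm_group M"
 shows "EX (D :: 'u monoid) e. divisible_group D & e : hom M D & inj_on e (carrier M)"
proof -
 interpret M: comm_group M by fact
 let ?U = "group_of (UNIV :: (('u => circle) => circle) set)"
 interpret U: comm_group ?U by (rule comm_group_group_of) simp
 obtain p :: "nat \<times> 'u \<times> 'u => 'u" where p: "inj p" using infinite_triple_code[OF inf] by blast
 have dec: "inv_into UNIV p (p x) = x" for x using p by simp
 define dv where "dv n x = (SOME z. z [^]\<^bsub>?U\<^esub> Suc n = x)" for n x
 have dv: "dv n x [^]\<^bsub>?U\<^esub> Suc n = x" for n x
 proof -
  have "ALL x:carrier ?U. ALL k>0. EX z:carrier ?U. z [^]\<^bsub>?U\<^esub> (k::nat) = x"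
   using divisible_char_type[where ?'a='u] unfolding divisible_def divisible_group_def by blast
  from this[THEN bspec, of x, THEN spec, of "Suc n"] have "EX z. z [^]\<^bsub>?U\<^esub> Suc n = x"
   by (simp del: U.nat_pow_Suc) 
  thus ?thesis unfolding dv_def by (rule someI_ex)
 qed
 have dv0: "dv 0 x = x" for x using dv[of 0 x] by simp
 (* Stage k + 1 adjoins all differences x / n - y of elements of stage k; every stage is an image of 'u. *)
 define s where "s = rec_nat (%x. if x : carrier M then char_embed M x else 0)
  (%_ t x. case inv_into UNIV p x of (n, a, b) => dv n (t a) - t b)"
 have s0: "s 0 x = (if x : carrier M then char_embed M x else 0)" for x by (simp add: s_def)
 have sS: "s (Suc k) (p (n, a, b)) = dv n (s k a) - s k b" for k n a b by (simp add: s_def dec)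
 have z: "0 : range (s k)" for k
 proof (induction k)
  case 0
  have "s 0 \<one>\<^bsub>M\<^esub> = 0" using char_embed_eq_0[OF M] by (simp add: s0)
  thus ?case by (metis rangeI)
 next
  case (Suc k)
  then obtain a where "s k a = 0" by (metis rangeE)
  hence "s (Suc k) (p (0, a, a)) = 0" by (simp add: sS dv0)
  thus ?case by (metis rangeI)
 qed
 have step: "dv n x - y : range (s (Suc k))" if "x : range (s k)" "y : range (s k)" for n x y k
 proof -
  from that obtain a b where "x = s k a" "y = s k b" by blast
  thus ?thesis using sS[of k n a b] by (metis rangeI)
 qed
 have mono1: "range (s k) <= range (s (Suc k))" for k
  using step[OF _ z, of _ k 0] by (auto simp: dv0)
 have mono: "range (s k) <= range (s l)" if "k \<le> l" for k l
  using that mono1 by (rule lift_Suc_mono_le[rotated])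
 define D' where "D' = (\<Union>k. range (s k))"
 have D': "subgrp D'"
  unfolding subgrp_def
 proof (intro conjI ballI)
  show "0 : D'" using z unfolding D'_def by blast
  fix x y assume "x : D'" "y : D'"
  then obtain k l where "x : range (s k)" "y : range (s l)" unfolding D'_def by blast
  hence "x : range (s (max k l))" "y : range (s (max k l))" using mono[of k "max k l"] mono[of l "max k l"] by auto
  from step[OF this, of 0] show "x - y : D'" unfolding D'_def dv0 by blast
 qed
 have div: "divisible_group (group_of D')"
  unfolding divisible_group_def
 proof (intro conjI ballI allI impI)
  show "comm_group (group_of D')" by (rule comm_group_group_of[OF D'])
  fix x and n :: nat assume x: "x : carrier (group_of D')" and n: "0 < n"
  obtain m where m: "n = Suc m" using n by (cases n) auto
  obtain k where "x : range (s k)" using x unfolding D'_def by auto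
  from step[OF this z, of m] have "dv m x : D'" unfolding D'_def by auto
  moreover have "dv m x [^]\<^bsub>group_of D'\<^esub> n = x" using dv[of m x] m pow_group_of[where S=D' and T=UNIV and n=n and x="dv m x"] by simp
  ultimately show "EX y:carrier (group_of D'). y [^]\<^bsub>group_of D'\<^esub> n = x" by auto
 qed
 define pick where "pick x = (SOME ka. s (fst ka) (snd ka) = x)" for x
 have pick: "s (fst (pick x)) (snd (pick x)) = x" if x: "x : D'" for x
 proof -
  have "EX ka. s (fst ka) (snd ka) = x" using x unfolding D'_def by auto
  thus ?thesis unfolding pick_def by (rule someI_ex)
 qed
 define e where "e x = p (fst (pick x), snd (pick x), snd (pick x))" for x
 have e: "inj_on e D'"
 proof (rule inj_onI)
  fix x y assume xy: "x : D'" "y : D'" "e x = e y"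
  hence "(fst (pick x), snd (pick x), snd (pick x)) = (fst (pick y), snd (pick y), snd (pick y))"
   unfolding e_def by (intro injD[OF p])
  hence eq: "fst (pick x) = fst (pick y)" "snd (pick x) = snd (pick y)" by blast+
  have "x = s (fst (pick x)) (snd (pick x))" by (rule pick[OF xy(1), symmetric])
  also have "\<dots> = s (fst (pick y)) (snd (pick y))" by (simp only: eq)
  also have "\<dots> = y" by (rule pick[OF xy(2)])
  finally show "x = y" .
 qed
 have MD: "char_embed M x : D'" if "x : carrier M" for x
 proof -
  have "s 0 x : D'" unfolding D'_def by blast
  thus ?thesis using that by (simp add: s0)
 qed
 have "divisible_group (transport e (group_of D'))" by (rule divisible_group_transport[OF div]) (simp add: e)
 moreover have "(%x. e (char_embed M x)) : hom M (transport e (group_of D'))"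
  using MD e by (auto simp: hom_def char_embed_mult transport_mult[of e "group_of D'", simplified])
 moreover have "inj_on (%x. e (char_embed M x)) (carrier M)"
  using char_embed_inj[OF M] e MD by (auto simp: inj_on_def)
 ultimately show ?thesis by blast
qed

subsection \<open>Coinduced systems\<close>

lemma inverse_systemD:
 assumes "inverse_system I r S"
 shows "i : I ==> comm_group (grp S i)"
  "i : I ==> j : I ==> r i j ==> bond S i j : hom (grp S j) (grp S i)"
  "i : I ==> x : carrier (grp S i) ==> bond S i i x = x"
  "i : I ==> j : I ==> k : I ==> r i j ==> r j k ==> x : carrier (grp S k) ==> bond S i k x = bond S i j (bond S j k x)"
  "i : I ==> j : I ==> r i j ==> x : carrier (grp S j) ==> bond S i j x : carrier (grp S i)"
 using assms unfolding inverse_system_def hom_def by blast+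

lemma system_mapD:
 assumes "system_map I r S T f"
 shows "i : I ==> f i : hom (grp S i) (grp T i)"
  "i : I ==> j : I ==> r i j ==> x : carrier (grp S j) ==> f i (bond S i j x) = bond T i j (f j x)"
  "i : I ==> x : carrier (grp S i) ==> f i x : carrier (grp T i)"
 using assms unfolding system_map_def hom_def by blast+

definition fam_code :: "('i => 'i list => 'b) => 'i list => 'b"
 where "fam_code h = (%xs. case xs of [] => undefined | i # ys => h i ys)"

definition fam_decode :: "('i list => 'b) => 'i => 'i list => 'b"
 where "fam_decode y = (%i ys. y (i # ys))"

lemma fam_decode_code [simp]: "fam_decode (fam_code h) = h"
 by (simp add: fam_decode_def fam_code_def)

context preordered_index
begin

definition below :: "'i => 'i set"
 where "below j = {l : I. r l j}"

definition coinduced :: "('i => ('i list => 'b) monoid) => ('i, 'i list => 'b) inv_sys"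
 where "coinduced D = \<lparr>grp = (%j. \<lparr>carrier = fam_code ` (\<Pi>\<^sub>E l\<in>below j. carrier (D l)),
    monoid.mult = (%x y. fam_code (\<lambda>l\<in>below j. fam_decode x l \<otimes>\<^bsub>D l\<^esub> fam_decode y l)),
    one = fam_code (\<lambda>l\<in>below j. \<one>\<^bsub>D l\<^esub>)\<rparr>),
   bond = (%i j y. fam_code (restrict (fam_decode y) (below i)))\<rparr>"

lemma coinduced_simps:
 "carrier (grp (coinduced D) j) = fam_code ` (\<Pi>\<^sub>E l\<in>below j. carrier (D l))"
 "x \<otimes>\<^bsub>grp (coinduced D) j\<^esub> y = fam_code (\<lambda>l\<in>below j. fam_decode x l \<otimes>\<^bsub>D l\<^esub> fam_decode y l)"
 "\<one>\<^bsub>grp (coinduced D) j\<^esub> = fam_code (\<lambda>l\<in>below j. \<one>\<^bsub>D l\<^esub>)"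
 "bond (coinduced D) i j y = fam_code (restrict (fam_decode y) (below i))"
 by (simp_all add: coinduced_def)

lemma below_mono: "i : I ==> j : I ==> r i j ==> below i <= below j"
 unfolding below_def using index_trans by blast

lemma below_self: "i : I ==> i : below i"
 unfolding below_def using index_refl by blast

lemma below_I: "l : below i ==> l : I" and below_r: "l : below i ==> r l i"
 by (auto simp: below_def)

lemma inverse_system_coinduced:
 assumes D: "!!i. i : I ==> comm_group (D i)" shows "inverse_system I r (coinduced D)"
 unfolding inverse_system_def
proof (intro conjI ballI allI impI)
 fix j assume j: "j : I"
 show "comm_group (grp (coinduced D) j)"
  by (rule comm_group_image[of "product_group (below j) D" fam_code])
   (use D below_I in \<open>auto intro!: comm_group_product_group simp: coinduced_simps\<close>)
 show "bond (coinduced D) j j x = x" if "x : carrier (grp (coinduced D) j)" for x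
  using that by (auto simp: coinduced_simps PiE_iff extensional_restrict)
next
 fix i j assume ij: "i : I" "j : I" "r i j"
 show "bond (coinduced D) i j : hom (grp (coinduced D) j) (grp (coinduced D) i)"
  using below_mono[OF ij]
  by (auto simp: hom_def coinduced_simps subset_iff PiE_iff intro!: arg_cong[of _ _ fam_code] imageI restrict_ext)
next
 fix i j k x assume "i : I" "j : I" "k : I" "r i j & r j k" "x : carrier (grp (coinduced D) k)"
 thus "bond (coinduced D) i k x = bond (coinduced D) i j (bond (coinduced D) j k x)"
  using below_mono[of i j] by (auto simp: coinduced_simps subset_iff intro!: arg_cong[of _ _ fam_code] restrict_ext)
qed

definition into_coinduced :: "('i, 'h) inv_sys => ('i => 'h => 'i list => 'b) => 'i => 'h => 'i list => 'b"
 where "into_coinduced S f j x = fam_code (\<lambda>l\<in>below j. f l (bond S l j x))"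

lemma into_coinduced_map:
 assumes S: "inverse_system I r S" and f: "!!i. i : I ==> f i : hom (grp S i) (D i)"
 shows "system_map I r S (coinduced D) (into_coinduced S f)"
 unfolding system_map_def
proof (intro conjI ballI allI impI)
 fix j assume j: "j : I"
 show "into_coinduced S f j : hom (grp S j) (grp (coinduced D) j)"
 proof (rule homI)
  fix x assume x: "x : carrier (grp S j)"
  have b: "bond S l j y : carrier (grp S l)" if "l : below j" "y : carrier (grp S j)" for l y
   using inverse_systemD(5)[OF S below_I[OF that(1)] j below_r[OF that(1)] that(2)] .
  show "into_coinduced S f j x : carrier (grp (coinduced D) j)"
   unfolding into_coinduced_def coinduced_simps
   by (rule imageI) (use b[OF _ x] f below_I in \<open>auto simp: hom_def Pi_iff\<close>)
  fix y assume y: "y : carrier (grp S j)"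
  have "f l (bond S l j (x \<otimes>\<^bsub>grp S j\<^esub> y)) = f l (bond S l j x) \<otimes>\<^bsub>D l\<^esub> f l (bond S l j y)" if l: "l : below j" for l
  proof -
   have "bond S l j (x \<otimes>\<^bsub>grp S j\<^esub> y) = bond S l j x \<otimes>\<^bsub>grp S l\<^esub> bond S l j y"
    using hom_mult[OF inverse_systemD(2)[OF S below_I[OF l] j below_r[OF l]] x y] .
   thus ?thesis using hom_mult[OF f[OF below_I[OF l]] b[OF l x] b[OF l y]] by simp
  qed
  thus "into_coinduced S f j (x \<otimes>\<^bsub>grp S j\<^esub> y) = into_coinduced S f j x \<otimes>\<^bsub>grp (coinduced D) j\<^esub> into_coinduced S f j y"
   unfolding into_coinduced_def coinduced_simps by (auto intro!: arg_cong[of _ _ fam_code] restrict_ext)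
 qed
next
 fix i j x assume ij: "i : I" "j : I" "r i j" and x: "x : carrier (grp S j)"
 have "f l (bond S l i (bond S i j x)) = f l (bond S l j x)" if l: "l : below i" for l
  using inverse_systemD(4)[OF S below_I[OF l] ij(1,2) below_r[OF l] ij(3) x] by simp
 thus "into_coinduced S f i (bond S i j x) = bond (coinduced D) i j (into_coinduced S f j x)"
  unfolding into_coinduced_def coinduced_simps using below_mono[OF ij]
  by (auto simp: subset_iff intro!: arg_cong[of _ _ fam_code] restrict_ext)
qed

lemma into_coinduced_inj:
 assumes S: "inverse_system I r S" and i: "i : I" and f: "inj_on (f i) (carrier (grp S i))"
 shows "inj_on (into_coinduced S f i) (carrier (grp S i))"
proof (rule inj_onI)
 fix x y assume xy: "x : carrier (grp S i)" "y : carrier (grp S i)" and "into_coinduced S f i x = into_coinduced S f i y"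
 hence "fam_decode (into_coinduced S f i x) i = fam_decode (into_coinduced S f i y) i" by simp
 hence "f i (bond S i i x) = f i (bond S i i y)" by (simp add: into_coinduced_def below_self[OF i])
 thus "x = y" using inverse_systemD(3)[OF S i] xy inj_onD[OF f] by simp
qed

text \<open>A map into a coinduced system is a family of homomorphisms \<open>S i \<rightarrow> D i\<close>; each extends since \<open>D i\<close> is divisible.\<close>

lemma injective_coinduced:
 assumes D: "!!i. i : I ==> divisible_group (D i)"
 shows "injective_system I r (coinduced D)"
 unfolding injective_system_def
proof (intro conjI allI impI)
 show "inverse_system I r (coinduced D)"
  by (rule inverse_system_coinduced) (use D in \<open>simp add: divisible_group_def\<close>)
 fix S T :: "('i, 'i list => 'b) inv_sys" and m f
 assume a: "inverse_system I r S & inverse_system I r T & system_map I r S T m &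
  (ALL i:I. inj_on (m i) (carrier (grp S i))) & system_map I r S (coinduced D) f"
 hence S: "inverse_system I r S" and T: "inverse_system I r T" and m: "system_map I r S T m"
  and mi: "!!i. i : I ==> inj_on (m i) (carrier (grp S i))" and f: "system_map I r S (coinduced D) f" by blast+
 have "EX g:hom (grp T i) (D i). ALL x:carrier (grp S i). g (m i x) = fam_decode (f i x) i" if i: "i : I" for i
 proof (rule divisible_group_extends_hom[OF D[OF i] inverse_systemD(1)[OF T i] _ system_mapD(1)[OF m i] mi[OF i]])
  show "group (grp S i)" using inverse_systemD(1)[OF S i] by (simp add: comm_group_def)
  show "(%x. fam_decode (f i x) i) : hom (grp S i) (D i)"
  proof (rule homI)
   fix x assume x: "x : carrier (grp S i)"
   show "fam_decode (f i x) i : carrier (D i)"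
    using system_mapD(3)[OF f i x] below_self[OF i] by (auto simp: coinduced_simps)
   fix y assume y: "y : carrier (grp S i)"
   show "fam_decode (f i (x \<otimes>\<^bsub>grp S i\<^esub> y)) i = fam_decode (f i x) i \<otimes>\<^bsub>D i\<^esub> fam_decode (f i y) i"
    using hom_mult[OF system_mapD(1)[OF f i] x y] below_self[OF i] by (simp add: coinduced_simps)
  qed
 qed
 then obtain g where g: "!!i. i : I ==> g i : hom (grp T i) (D i)"
  "!!i x. i : I ==> x : carrier (grp S i) ==> g i (m i x) = fam_decode (f i x) i" by metis
 have "into_coinduced T g j (m j x) = f j x" if j: "j : I" and x: "x : carrier (grp S j)" for j x
 proof -
  obtain h where h: "f j x = fam_code h" "h : (\<Pi>\<^sub>E l\<in>below j. carrier (D l))"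
   using system_mapD(3)[OF f j x] by (auto simp: coinduced_simps)
  have "g l (bond T l j (m j x)) = h l" if l: "l : below j" for l
  proof -
   note lj = below_I[OF l] j below_r[OF l]
   have "g l (bond T l j (m j x)) = g l (m l (bond S l j x))" using system_mapD(2)[OF m lj x] by simp
   also have "\<dots> = fam_decode (f l (bond S l j x)) l" by (rule g(2)[OF lj(1) inverse_systemD(5)[OF S lj x]])
   also have "\<dots> = h l" using system_mapD(2)[OF f lj x] below_self[OF lj(1)] by (simp add: coinduced_simps h)
   finally show ?thesis .
  qed
  hence "(\<lambda>l\<in>below j. g l (bond T l j (m j x))) = h" using h(2) by (auto simp: fun_eq_iff PiE_iff extensional_def)
  thus ?thesis by (simp add: into_coinduced_def h)
 qed
 thus "EX g. system_map I r T (coinduced D) g & (ALL i:I. ALL x:carrier (grp S i). g i (m i x) = f i x)"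
  using into_coinduced_map[OF T g(1)] by blast
qed

end

context preordered_index
begin

subsection \<open>Passage to additive notation\<close>

abbreviation emb :: "('i, 'h) inv_sys => 'i => 'h => ('h => circle) => circle"
 where "emb T i \<equiv> char_embed (grp T i)"

definition unemb :: "('i, 'h) inv_sys => 'i => (('h => circle) => circle) => 'h"
 where "unemb T i = inv_into (carrier (grp T i)) (emb T i)"

definition esys :: "('i, 'h) inv_sys => 'i => (('h => circle) => circle) set"
 where "esys T i = emb T i ` carrier (grp T i)"

definition ebond :: "('i, 'h) inv_sys => 'i => 'i => (('h => circle) => circle) => (('h => circle) => circle)"
 where "ebond T i j y = emb T i (bond T i j (unemb T j y))"

definition emap :: "('i, 'h) inv_sys => ('i, 'k) inv_sys => ('i => 'h => 'k) => 'i =>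
  (('h => circle) => circle) => (('k => circle) => circle)"
 where "emap S T f i y = emb T i (f i (unemb S i y))"

lemma unemb_emb: "inverse_system I r T ==> i : I ==> x : carrier (grp T i) ==> unemb T i (emb T i x) = x"
 unfolding unemb_def by (intro inv_into_f_f char_embed_inj inverse_systemD(1))

lemma emb_unemb: "y : esys T i ==> emb T i (unemb T i y) = y"
 and unemb_in: "y : esys T i ==> unemb T i y : carrier (grp T i)"
 unfolding unemb_def esys_def by (auto intro: f_inv_into_f inv_into_into)

lemma emb_in: "x : carrier (grp T i) ==> emb T i x : esys T i"
 by (simp add: esys_def)

lemma esys_subgroup: 
 assumes "inverse_system I r T" "i : I" shows "subgrp (esys T i)"
proof -
 interpret comm_group "grp T i" using inverse_systemD(1)[OF assms] .
 show ?thesis unfolding subgrp_def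
 proof (intro conjI ballI)
  have "emb T i \<one>\<^bsub>grp T i\<^esub> = 0" using char_embed_eq_0[OF inverse_systemD(1)[OF assms]] by simp
  thus "0 : esys T i" using emb_in[of "\<one>\<^bsub>grp T i\<^esub>" T i] by simp
  fix x y assume "x : esys T i" "y : esys T i"
  then obtain a b where ab: "x = emb T i a" "y = emb T i b" "a : carrier (grp T i)" "b : carrier (grp T i)"
   unfolding esys_def by blast
  have "emb T i (a \<otimes>\<^bsub>grp T i\<^esub> inv\<^bsub>grp T i\<^esub> b) + emb T i b = emb T i a"
   using char_embed_mult[of "a \<otimes>\<^bsub>grp T i\<^esub> inv\<^bsub>grp T i\<^esub> b" "grp T i" b] ab by (simp add: m_assoc)
  hence "x - y = emb T i (a \<otimes>\<^bsub>grp T i\<^esub> inv\<^bsub>grp T i\<^esub> b)" using ab by (simp add: diff_eq_eq)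
  thus "x - y : esys T i" using ab by (simp add: emb_in)
 qed
qed

lemma unemb_add:
 assumes "inverse_system I r T" "i : I" "x : esys T i" "y : esys T i"
 shows "unemb T i (x + y) = unemb T i x \<otimes>\<^bsub>grp T i\<^esub> unemb T i y"
proof -
 interpret comm_group "grp T i" using inverse_systemD(1)[OF assms(1,2)] .
 have "x + y = emb T i (unemb T i x \<otimes>\<^bsub>grp T i\<^esub> unemb T i y)"
  using char_embed_mult[OF unemb_in[OF assms(3)] unemb_in[OF assms(4)]] emb_unemb[OF assms(3)] emb_unemb[OF assms(4)] by simp
 thus ?thesis using unemb_emb[OF assms(1,2)] unemb_in[OF assms(3)] unemb_in[OF assms(4)] by simp
qed

lemma unemb_eq_one:
 assumes "inverse_system I r T" "i : I" "x : esys T i"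
 shows "unemb T i x = \<one>\<^bsub>grp T i\<^esub> \<longleftrightarrow> x = 0"
 using char_embed_eq_0[OF inverse_systemD(1)[OF assms(1,2)] unemb_in[OF assms(3)]] emb_unemb[OF assms(3)] by simp

lemma system_esys:
 assumes T: "inverse_system I r T" shows "system (esys T) (ebond T)"
 unfolding system_def
proof (intro conjI ballI allI impI)
 show "subgrp (esys T i)" if "i : I" for i by (rule esys_subgroup[OF T that])
next
 fix i j assume ij: "i : I" "j : I" "r i j"
 have b: "bond T i j (unemb T j x) : carrier (grp T i)" if "x : esys T j" for x
  by (rule inverse_systemD(5)[OF T ij unemb_in[OF that]])
 show "ebond T i j ` esys T j <= esys T i" unfolding ebond_def by (rule image_subsetI, rule emb_in, rule b)
 show "additive (esys T j) (ebond T i j)"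
  unfolding additive_def
 proof (intro ballI)
  fix x y assume xy: "x : esys T j" "y : esys T j"
  show "ebond T i j (x + y) = ebond T i j x + ebond T i j y"
   using hom_mult[OF inverse_systemD(2)[OF T ij] unemb_in[OF xy(1)] unemb_in[OF xy(2)]]
    char_embed_mult[OF b[OF xy(1)] b[OF xy(2)]] unemb_add[OF T ij(2) xy] by (simp add: ebond_def)
 qed
next
 fix i j k x assume a: "i : I" "j : I" "k : I" "r i j" "r j k" "x : esys T k"
 have "unemb T j (emb T j (bond T j k (unemb T k x))) = bond T j k (unemb T k x)"
  by (rule unemb_emb[OF T a(2) inverse_systemD(5)[OF T a(2,3,5) unemb_in[OF a(6)]]])
 thus "ebond T i j (ebond T j k x) = ebond T i k x"
  using inverse_systemD(4)[OF T a(1-5) unemb_in[OF a(6)]] by (simp add: ebond_def)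
qed

lemma natural_emap:
 assumes S: "inverse_system I r S" and T: "inverse_system I r T" and f: "system_map I r S T f"
 shows "natural (esys S) (ebond S) (esys T) (ebond T) (emap S T f)"
 unfolding natural_def
proof (intro conjI ballI impI)
 fix i assume i: "i : I"
 have b: "f i (unemb S i x) : carrier (grp T i)" if "x : esys S i" for x
  by (rule system_mapD(3)[OF f i unemb_in[OF that]])
 show "emap S T f i ` esys S i <= esys T i" unfolding emap_def by (rule image_subsetI, rule emb_in, rule b)
 show "additive (esys S i) (emap S T f i)"
  unfolding additive_def
 proof (intro ballI)
  fix x y assume xy: "x : esys S i" "y : esys S i"
  show "emap S T f i (x + y) = emap S T f i x + emap S T f i y"
   using hom_mult[OF system_mapD(1)[OF f i] unemb_in[OF xy(1)] unemb_in[OF xy(2)]]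
    char_embed_mult[OF b[OF xy(1)] b[OF xy(2)]] unemb_add[OF S i xy] by (simp add: emap_def)
 qed
next
 fix i j x assume ij: "i : I" "j : I" "r i j" and x: "x : esys S j"
 have 1: "unemb S i (emb S i (bond S i j (unemb S j x))) = bond S i j (unemb S j x)"
  by (rule unemb_emb[OF S ij(1) inverse_systemD(5)[OF S ij unemb_in[OF x]]])
 have 2: "unemb T j (emb T j (f j (unemb S j x))) = f j (unemb S j x)"
  by (rule unemb_emb[OF T ij(2) system_mapD(3)[OF f ij(2) unemb_in[OF x]]])
 show "emap S T f i (ebond S i j x) = ebond T i j (emap S T f j x)"
  using system_mapD(2)[OF f ij unemb_in[OF x]] by (simp add: emap_def ebond_def 1 2)
qed

lemma emap_emb:
 "inverse_system I r S ==> i : I ==> x : carrier (grp S i) ==> emap S T f i (emb S i x) = emb T i (f i x)"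
 by (simp add: emap_def unemb_emb)

lemma acyclic_esys_coinduced:
 assumes D: "!!i. i : I ==> comm_group (D i)"
 shows "acyclic_system (esys (coinduced D)) (ebond (coinduced D))"
proof -
 let ?C = "coinduced D"
 have C: "inverse_system I r ?C" by (rule inverse_system_coinduced[OF D])
 define ev where "ev i y l = char_embed (D l) (fam_decode (unemb ?C i y) l)" for i y l
 have dec: "fam_decode c l : carrier (D l)" if "c : carrier (grp ?C i)" "l : below i" for c l i
  using that by (auto simp: coinduced_simps)
 have dec_ext: "c = c'" if cc: "c : carrier (grp ?C i)" "c' : carrier (grp ?C i)"
  and eq: "!!l. l : below i ==> fam_decode c l = fam_decode c' l" for c c' i
 proof -
  obtain h h' where h: "c = fam_code h" "h : (\<Pi>\<^sub>E l\<in>below i. carrier (D l))"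
   "c' = fam_code h'" "h' : (\<Pi>\<^sub>E l\<in>below i. carrier (D l))"
   using cc unfolding coinduced_simps by blast
  have "h = h'" by (rule PiE_ext[OF h(2,4)]) (use eq h in simp)
  thus ?thesis using h by simp
 qed
 have lb: "l : I ==> r l i ==> l : below i" for l i by (simp add: below_def)
 show ?thesis
 proof (rule coinduced_acyclic[where ev=ev and J="%l. char_embed (D l) ` carrier (D l)"])
  show "system (esys ?C) (ebond ?C)" by (rule system_esys[OF C])
 next
  fix i l assume i: "i : I" and l: "l : I" "r l i"
  show "additive (esys ?C i) (%x. ev i x l)"
   unfolding additive_def
  proof (intro ballI)
   fix x y assume xy: "x : esys ?C i" "y : esys ?C i"
   show "ev i (x + y) l = ev i x l + ev i y l"
    unfolding ev_def unemb_add[OF C i xy] coinduced_simps fam_decode_code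
    using lb[OF l] char_embed_mult[OF dec[OF unemb_in[OF xy(1)] lb[OF l]] dec[OF unemb_in[OF xy(2)] lb[OF l]]] by simp
  qed
 next
  fix i l x assume "i : I" and l: "l : I" "r l i" and x: "x : esys ?C i"
  show "ev i x l : char_embed (D l) ` carrier (D l)"
   unfolding ev_def by (rule imageI[OF dec[OF unemb_in[OF x] lb[OF l]]])
 next
  fix i j l x assume ij: "i : I" "j : I" and l: "l : I" and rij: "r i j" and rl: "r l i" and x: "x : esys ?C j"
  have "unemb ?C i (emb ?C i (bond ?C i j (unemb ?C j x))) = bond ?C i j (unemb ?C j x)"
   by (rule unemb_emb[OF C ij(1) inverse_systemD(5)[OF C ij rij unemb_in[OF x]]])
  thus "ev i (ebond ?C i j x) l = ev j x l"
   using lb[OF l rl] by (simp add: ev_def ebond_def coinduced_simps)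
 next
  fix i h assume i: "i : I" and h: "!!l. l : I ==> r l i ==> h l : char_embed (D l) ` carrier (D l)"
  have "EX a. a : carrier (D l) & char_embed (D l) a = h l" if l: "l : below i" for l
  proof -
   obtain b where b: "h l = char_embed (D l) b" "b : carrier (D l)"
    by (rule imageE[OF h[OF below_I[OF l] below_r[OF l]]])
   thus ?thesis by (intro exI[of _ b]) simp
  qed
  then obtain a where a: "!!l. l : below i ==> a l : carrier (D l) & char_embed (D l) (a l) = h l" by metis
  define c where "c = fam_code (restrict a (below i))"
  have c: "c : carrier (grp ?C i)" unfolding c_def coinduced_simps by (rule imageI) (use a in auto)
  have "ev i (emb ?C i c) l = h l" if l: "l : I" "r l i" for l
   unfolding ev_def unemb_emb[OF C i c] using a[OF lb[OF l]] lb[OF l] by (simp add: c_def)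
  thus "EX x:esys ?C i. ALL l:I. r l i --> ev i x l = h l" using emb_in[OF c] by blast
 next
  fix i x y assume i: "i : I" and xy: "x : esys ?C i" "y : esys ?C i"
   and eq: "!!l. l : I ==> r l i ==> ev i x l = ev i y l"
  have "unemb ?C i x = unemb ?C i y"
  proof (rule dec_ext[OF unemb_in[OF xy(1)] unemb_in[OF xy(2)]])
   fix l assume l: "l : below i"
   show "fam_decode (unemb ?C i x) l = fam_decode (unemb ?C i y) l"
    using eq[OF below_I[OF l] below_r[OF l]] unfolding ev_def
    by (rule inj_onD[OF char_embed_inj[OF D[OF below_I[OF l]]] _ dec[OF unemb_in[OF xy(1)] l] dec[OF unemb_in[OF xy(2)] l]])
  qed
  thus "x = y" by (rule box_equals[OF arg_cong[of _ _ "emb ?C i"] emb_unemb[OF xy(1)] emb_unemb[OF xy(2)]])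
 qed
qed

text \<open>An injective system is a direct summand of the coinduced system in which it embeds, and coinduced systems are
 acyclic.\<close>

lemma injective_acyclic:
 fixes J :: "('i, 'i list => 'b) inv_sys"
 assumes inj: "injective_system I r J" shows "acyclic_system (esys J) (ebond J)"
proof -
 have J: "inverse_system I r J" using inj by (simp add: injective_system_def)
 let ?C = "coinduced (grp J)"
 have C: "inverse_system I r ?C" by (rule inverse_system_coinduced[OF inverse_systemD(1)[OF J]])
 let ?m = "into_coinduced J (%i x. x) :: 'i => ('i list => 'b) => ('i list => 'b)"
 have m: "system_map I r J ?C ?m" by (rule into_coinduced_map[OF J]) (simp add: hom_def)
 have mi: "ALL i:I. inj_on (?m i) (carrier (grp J i))" by (intro ballI into_coinduced_inj[OF J]) auto
 have id: "system_map I r J J (%i x. x)" by (simp add: system_map_def hom_def)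
 have "EX g. system_map I r ?C J g & (ALL i:I. ALL x:carrier (grp J i). g i (?m i x) = x)"
  using inj J C m mi id unfolding injective_system_def by blast
 then obtain g where g: "system_map I r ?C J g" "!!i x. i : I ==> x : carrier (grp J i) ==> g i (?m i x) = x" by blast
 show ?thesis
 proof (rule acyclic_retract[OF system_esys[OF J] system_esys[OF C] _ natural_emap[OF J C m] natural_emap[OF C J g(1)]])
  show "acyclic_system (esys ?C) (ebond ?C)" by (rule acyclic_esys_coinduced[OF inverse_systemD(1)[OF J]])
  fix i x assume i: "i : I" and x: "x : esys J i"
  have "emap ?C J g i (emap J ?C ?m i x) = emb J i (g i (?m i (unemb J i x)))"
   unfolding emap_def by (simp add: unemb_emb[OF C i system_mapD(3)[OF m i unemb_in[OF x]]])
  thus "emap ?C J g i (emap J ?C ?m i x) = x" using g(2)[OF i unemb_in[OF x]] emb_unemb[OF x] by simp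
 qed
qed

end

subsection \<open>Existence of injective resolutions\<close>

context preordered_index
begin

lemma injective_embedding:
 fixes S :: "('i, 'h) inv_sys" and c :: "'h => 'i list => 'b"
 assumes inf: "infinite (UNIV :: ('i list => 'b) set)" and c: "inj c" and S: "inverse_system I r S"
 shows "EX (J :: ('i, 'i list => 'b) inv_sys) m. injective_system I r J & system_map I r S J m &
  (ALL i:I. inj_on (m i) (carrier (grp S i)))"
proof -
 have "EX (D :: ('i list => 'b) monoid) e. divisible_group D & e : hom (grp S i) D & inj_on e (carrier (grp S i))"
  if i: "i : I" for i
 proof -
  have ci: "inj_on c (carrier (grp S i))" using c inj_on_subset by blast
  have "comm_group (transport c (grp S i))" by (rule comm_group_transport[OF inverse_systemD(1)[OF S i] ci])
  from divisible_hull[OF inf this] obtain D :: "('i list => 'b) monoid" and e where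
   D: "divisible_group D" "e : hom (transport c (grp S i)) D" "inj_on e (carrier (transport c (grp S i)))" by blast
  have "e \<circ> c : hom (grp S i) D" by (rule hom_compose[OF transport_hom[OF ci] D(2)])
  moreover have "inj_on (e \<circ> c) (carrier (grp S i))" using D(3) ci by (simp add: comp_inj_on)
  ultimately show ?thesis using D(1) by blast
 qed
 hence "ALL i. EX (D :: ('i list => 'b) monoid) e. i : I --> divisible_group D & e : hom (grp S i) D & inj_on e (carrier (grp S i))"
  by blast
 then obtain D :: "'i => ('i list => 'b) monoid" and e where
  De: "ALL i. i : I --> divisible_group (D i) & e i : hom (grp S i) (D i) & inj_on (e i) (carrier (grp S i))" by metis
 have "injective_system I r (coinduced D)" by (rule injective_coinduced) (use De in blast)
 moreover have "system_map I r S (coinduced D) (into_coinduced S e)" by (rule into_coinduced_map[OF S]) (use De in blast)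
 moreover have "ALL i:I. inj_on (into_coinduced S e i) (carrier (grp S i))" using into_coinduced_inj[OF S] De by blast
 ultimately show ?thesis by blast
qed

lemma cokernel_exists:
 fixes J :: "('i, 'h) inv_sys"
 assumes S: "inverse_system I r S" and J: "inverse_system I r J" and m: "system_map I r S J m"
 shows "EX (K :: ('i, 'h) inv_sys) p. inverse_system I r K & system_map I r J K p &
  (ALL i:I. p i ` carrier (grp J i) = carrier (grp K i) &
   kernel (grp J i) (grp K i) (p i) = m i ` carrier (grp S i))"
proof -
 define N where "N i = m i ` carrier (grp S i)" for i
 define rep where "rep i x = (SOME y. y : N i #>\<^bsub>grp J i\<^esub> x)" for i x
 have cJ: "comm_group (grp J i)" if "i : I" for i using inverse_systemD(1)[OF J that] .
 have N: "subgroup (N i) (grp J i)" if i: "i : I" for i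
 proof -
  interpret group_hom "grp S i" "grp J i" "m i"
   using cJ[OF i] inverse_systemD(1)[OF S i] system_mapD(1)[OF m i]
   by (simp add: group_hom_def group_hom_axioms_def comm_group_def)
  show ?thesis unfolding N_def by (rule img_is_subgroup)
 qed
 have rep: "rep i x : N i #>\<^bsub>grp J i\<^esub> x" if i: "i : I" and x: "x : carrier (grp J i)" for i x
 proof -
  interpret comm_group "grp J i" by (rule cJ[OF i])
  have "x : N i #>\<^bsub>grp J i\<^esub> x" by (rule rcos_self[OF x N[OF i]])
  thus ?thesis unfolding rep_def by (rule someI)
 qed
 have rep_in: "rep i x : carrier (grp J i)" if i: "i : I" and x: "x : carrier (grp J i)" for i x
 proof -
  interpret comm_group "grp J i" by (rule cJ[OF i])
  show ?thesis using rep[OF i x] r_coset_subset_G[OF subgroup.subset[OF N[OF i]] x] by blast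
 qed
 have coset_rep: "N i #>\<^bsub>grp J i\<^esub> rep i x = N i #>\<^bsub>grp J i\<^esub> x" if i: "i : I" and x: "x : carrier (grp J i)" for i x
 proof -
  interpret comm_group "grp J i" by (rule cJ[OF i])
  show ?thesis using repr_independence[OF rep[OF i x] x N[OF i]] by simp
 qed
 have rep_cong: "rep i x = rep i y" if "N i #>\<^bsub>grp J i\<^esub> x = N i #>\<^bsub>grp J i\<^esub> y" for i x y
  using that by (simp add: rep_def)
 have rep_mult: "rep i (rep i x \<otimes>\<^bsub>grp J i\<^esub> rep i y) = rep i (x \<otimes>\<^bsub>grp J i\<^esub> y)"
  if i: "i : I" and x: "x : carrier (grp J i)" and y: "y : carrier (grp J i)" for i x y
 proof -
  interpret comm_group "grp J i" by (rule cJ[OF i])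
  interpret normal "N i" "grp J i" using N[OF i] by (simp add: normal_iff_subgroup)
  show ?thesis
   using rcos_sum[OF rep_in[OF i x] rep_in[OF i y]] rcos_sum[OF x y] coset_rep[OF i x] coset_rep[OF i y]
   by (intro rep_cong) simp
 qed
 have rep_one: "rep i x = rep i \<one>\<^bsub>grp J i\<^esub> \<longleftrightarrow> x : N i" if i: "i : I" and x: "x : carrier (grp J i)" for i x
 proof
  interpret comm_group "grp J i" by (rule cJ[OF i])
  assume eq: "rep i x = rep i \<one>\<^bsub>grp J i\<^esub>"
  have "N i #>\<^bsub>grp J i\<^esub> x = N i #>\<^bsub>grp J i\<^esub> \<one>\<^bsub>grp J i\<^esub>"
   using coset_rep[OF i x] coset_rep[OF i one_closed] eq by simp
  also have "\<dots> = N i" using subgroup.subset[OF N[OF i]] by (rule coset_mult_one)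
  finally show "x : N i" using rcos_self[OF x N[OF i]] by simp
 next
  interpret comm_group "grp J i" by (rule cJ[OF i])
  assume "x : N i"
  hence "N i #>\<^bsub>grp J i\<^esub> x = N i" by (rule coset_join2[OF x N[OF i]])
  also have "\<dots> = N i #>\<^bsub>grp J i\<^esub> \<one>\<^bsub>grp J i\<^esub>" using coset_mult_one[OF subgroup.subset[OF N[OF i]]] by simp
  finally show "rep i x = rep i \<one>\<^bsub>grp J i\<^esub>" by (rule rep_cong)
 qed
 have rep_bond: "rep i (bond J i j (rep j x)) = rep i (bond J i j x)"
  if ij: "i : I" "j : I" "r i j" and x: "x : carrier (grp J j)" for i j x
 proof -
  interpret Jj: comm_group "grp J j" by (rule cJ[OF ij(2)])
  interpret Ji: comm_group "grp J i" by (rule cJ[OF ij(1)])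
  have b: "bond J i j y : carrier (grp J i)" if "y : carrier (grp J j)" for y
   by (rule inverse_systemD(5)[OF J ij that])
  obtain n where n: "n : N j" "rep j x = n \<otimes>\<^bsub>grp J j\<^esub> x" using rep[OF ij(2) x] unfolding r_coset_def by blast
  have nJ: "n : carrier (grp J j)" using subgroup.subset[OF N[OF ij(2)]] n by blast
  obtain s where s: "s : carrier (grp S j)" "n = m j s" using n unfolding N_def by blast
  have "bond J i j n = m i (bond S i j s)" using system_mapD(2)[OF m ij s(1)] s by simp
  hence bn: "bond J i j n : N i" unfolding N_def using inverse_systemD(5)[OF S ij s(1)] by blast
  have "bond J i j (rep j x) = bond J i j n \<otimes>\<^bsub>grp J i\<^esub> bond J i j x"
   using hom_mult[OF inverse_systemD(2)[OF J ij] nJ x] n by simp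
  hence "bond J i j (rep j x) : N i #>\<^bsub>grp J i\<^esub> bond J i j x" using bn unfolding r_coset_def by blast
  from Ji.repr_independence[OF this b[OF x] N[OF ij(1)]] show ?thesis by (intro rep_cong) simp
 qed
 define K where "K = \<lparr>grp = (%i. \<lparr>carrier = rep i ` carrier (grp J i),
   monoid.mult = (%x y. rep i (x \<otimes>\<^bsub>grp J i\<^esub> y)), one = rep i \<one>\<^bsub>grp J i\<^esub>\<rparr>),
  bond = (%i j y. rep i (bond J i j y))\<rparr>"
 have Ks: "carrier (grp K i) = rep i ` carrier (grp J i)" "x \<otimes>\<^bsub>grp K i\<^esub> y = rep i (x \<otimes>\<^bsub>grp J i\<^esub> y)"
  "\<one>\<^bsub>grp K i\<^esub> = rep i \<one>\<^bsub>grp J i\<^esub>" "bond K i j y = rep i (bond J i j y)" for i j x y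
  by (simp_all add: K_def)
 have p: "rep i : hom (grp J i) (grp K i)" if i: "i : I" for i
  by (rule homI) (simp_all add: Ks rep_mult[OF i])
 have "inverse_system I r K"
  unfolding inverse_system_def
 proof (intro conjI ballI allI impI)
  fix i assume i: "i : I"
  show "comm_group (grp K i)"
   by (rule comm_group_image[OF cJ[OF i], of "rep i"]) (simp_all add: Ks rep_mult[OF i])
  fix x assume "x : carrier (grp K i)"
  then obtain y where y: "y : carrier (grp J i)" "x = rep i y" unfolding Ks by blast
  show "bond K i i x = x" using rep_bond[OF i i index_refl[OF i] y(1)] inverse_systemD(3)[OF J i y(1)] y by (simp add: Ks)
 next
  fix i j assume ij: "i : I" "j : I" "r i j"
  show "bond K i j : hom (grp K j) (grp K i)"
  proof (rule homI)
   fix x assume "x : carrier (grp K j)"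
   then obtain a where a: "a : carrier (grp J j)" "x = rep j a" unfolding Ks by blast
   have ba: "bond J i j a : carrier (grp J i)" by (rule inverse_systemD(5)[OF J ij a(1)])
   show "bond K i j x : carrier (grp K i)" unfolding Ks a(2) rep_bond[OF ij a(1)] using ba by blast
   fix y assume "y : carrier (grp K j)"
   then obtain b where b: "b : carrier (grp J j)" "y = rep j b" unfolding Ks by blast
   have bb: "bond J i j b : carrier (grp J i)" by (rule inverse_systemD(5)[OF J ij b(1)])
   have ab: "a \<otimes>\<^bsub>grp J j\<^esub> b : carrier (grp J j)"
    using cJ[OF ij(2)] a b by (simp add: comm_group_def group_def monoid.m_closed)
   have "bond K i j (x \<otimes>\<^bsub>grp K j\<^esub> y) = rep i (bond J i j (rep j (a \<otimes>\<^bsub>grp J j\<^esub> b)))"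
    unfolding Ks a(2) b(2) rep_mult[OF ij(2) a(1) b(1)] ..
   also have "\<dots> = rep i (bond J i j a \<otimes>\<^bsub>grp J i\<^esub> bond J i j b)"
    unfolding rep_bond[OF ij ab] hom_mult[OF inverse_systemD(2)[OF J ij] a(1) b(1)] ..
   also have "\<dots> = bond K i j x \<otimes>\<^bsub>grp K i\<^esub> bond K i j y"
    unfolding Ks a(2) b(2) rep_bond[OF ij a(1)] rep_bond[OF ij b(1)] rep_mult[OF ij(1) ba bb] ..
   finally show "bond K i j (x \<otimes>\<^bsub>grp K j\<^esub> y) = bond K i j x \<otimes>\<^bsub>grp K i\<^esub> bond K i j y" .
  qed
 next
  fix i j k x assume ijk: "i : I" "j : I" "k : I" "r i j & r j k" and "x : carrier (grp K k)"
  then obtain a where a: "a : carrier (grp J k)" "x = rep k a" unfolding Ks by blast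
  have rik: "r i k" using index_trans ijk by blast
  have ba: "bond J j k a : carrier (grp J j)" using inverse_systemD(5)[OF J] ijk a by blast
  have "bond K i k x = rep i (bond J i k a)" unfolding Ks a(2) using rep_bond[OF ijk(1,3) rik a(1)] .
  also have "\<dots> = rep i (bond J i j (bond J j k a))" using inverse_systemD(4)[OF J ijk(1,2,3)] ijk(4) a(1) by simp
  also have "\<dots> = bond K i j (bond K j k x)"
   using rep_bond[OF ijk(2,3) _ a(1)] rep_bond[OF ijk(1,2) _ ba] ijk(4) unfolding Ks a(2) by simp
  finally show "bond K i k x = bond K i j (bond K j k x)" .
 qed
 moreover have "system_map I r J K rep"
  unfolding system_map_def using p rep_bond by (simp add: Ks)
 moreover have "kernel (grp J i) (grp K i) (rep i) = m i ` carrier (grp S i)" if i: "i : I" for i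
  using rep_one[OF i] subgroup.subset[OF N[OF i]] unfolding kernel_def Ks N_def[symmetric] by blast
 ultimately show ?thesis using Ks(1) by blast
qed

text \<open>Iterated embedding of cokernels into coinduced systems, all over one infinite type that absorbs families
 over the index set.\<close>

theorem injective_resolution_exists:
 fixes S :: "('i, 'h) inv_sys" and c :: "'h => 'i list => 'b"
 assumes inf: "infinite (UNIV :: ('i list => 'b) set)" and c: "inj c" and S: "inverse_system I r S"
 shows "EX R :: ('i => 'h => 'i list => 'b) \<times> (nat => ('i, 'i list => 'b) inv_sys) \<times> (nat => 'i => ('i list => 'b) => 'i list => 'b).
  injective_resolution I r S R"
proof -
 let ?inj = "%S J m. injective_system I r J & system_map I r S J m & (ALL i:I. inj_on (m i) (carrier (grp S i)))"
 let ?cok = "%S J m K p. inverse_system I r K & system_map I r J K p &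
  (ALL i:I. p i ` carrier (grp J i) = carrier (grp K i) & kernel (grp J i) (grp K i) (p i) = m i ` carrier (grp S i))"
 obtain J0 :: "('i, 'i list => 'b) inv_sys" and \<epsilon> where J0: "?inj S J0 \<epsilon>" using injective_embedding[OF inf c S] by blast
 obtain K0 :: "('i, 'i list => 'b) inv_sys" and p0 where K0: "?cok S J0 \<epsilon> K0 p0"
  using cokernel_exists[OF S, of J0 \<epsilon>] J0 unfolding injective_system_def by blast
 have ex: "EX q :: ('i, 'i list => 'b) inv_sys \<times> _ \<times> ('i, 'i list => 'b) inv_sys \<times> _.
   inverse_system I r T --> ?inj T (fst q) (fst (snd q)) & ?cok T (fst q) (fst (snd q)) (fst (snd (snd q))) (snd (snd (snd q)))"
  for T :: "('i, 'i list => 'b) inv_sys"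
 proof (cases "inverse_system I r T")
  case True
  obtain J :: "('i, 'i list => 'b) inv_sys" and m where J: "?inj T J m" using injective_embedding[OF inf inj_on_id True] by blast
  obtain K :: "('i, 'i list => 'b) inv_sys" and p where K: "?cok T J m K p"
   using cokernel_exists[OF True, of J m] J unfolding injective_system_def by blast
  show ?thesis by (rule exI[of _ "(J, m, K, p)"]) (unfold fst_conv snd_conv, use J K in blast)
 qed simp
 obtain q :: "('i, 'i list => 'b) inv_sys => ('i, 'i list => 'b) inv_sys \<times> _ \<times> ('i, 'i list => 'b) inv_sys \<times> _" where
  q: "!!T. inverse_system I r T ==> ?inj T (fst (q T)) (fst (snd (q T)))"
    "!!T. inverse_system I r T ==> ?cok T (fst (q T)) (fst (snd (q T))) (fst (snd (snd (q T)))) (snd (snd (snd (q T))))"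
  using ex by metis
 define T where "T = rec_nat K0 (%_ T. fst (snd (snd (q T))))"
 have T0: "T 0 = K0" and TS: "T (Suc k) = fst (snd (snd (q (T k))))" for k by (simp_all add: T_def)
 have T: "inverse_system I r (T k)" for k
  by (induction k) (use K0 q(2) in \<open>simp_all add: T0 TS\<close>)
 define J where "J k = (case k of 0 => J0 | Suc k => fst (q (T k)))" for k
 define p where "p k = (case k of 0 => p0 | Suc k => snd (snd (snd (q (T k)))))" for k
 define m where "m k = fst (snd (q (T k)))" for k
 have p: "system_map I r (J k) (T k) (p k)" "!!i. i : I ==> p k i ` carrier (grp (J k) i) = carrier (grp (T k) i)" for k
  using K0 q(2)[OF T] by (cases k; simp add: J_def p_def T0 TS)+
 have m: "?inj (T k) (J (Suc k)) (m k)" for k using q(1)[OF T[of k]] by (simp add: J_def m_def)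
 have ker: "kernel (grp (J (Suc k)) i) (grp (T (Suc k)) i) (p (Suc k) i) = m k i ` carrier (grp (T k) i)" if "i : I" for k i
  using q(2)[OF T[of k]] that by (simp add: J_def m_def p_def TS)
 have ker0: "kernel (grp (J 0) i) (grp (T 0) i) (p 0 i) = \<epsilon> i ` carrier (grp S i)" if "i : I" for i
  using K0 that by (simp add: J_def p_def T0)
 have injJ: "injective_system I r (J k)" for k
  using J0 m[of "k - 1"] by (cases k) (simp_all add: J_def)
 have Jk: "inverse_system I r (J k)" for k using injJ by (simp add: injective_system_def)
 define d where "d k i x = m k i (p k i x)" for k i x
 have d: "system_map I r (J k) (J (Suc k)) (d k)" for k
  unfolding system_map_def
 proof (intro conjI ballI impI)
  fix i assume i: "i : I"
  have "m k i \<circ> p k i : hom (grp (J k) i) (grp (J (Suc k)) i)"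
   using m[of k] system_mapD(1)[OF _ i] p(1)[of k] by (intro hom_compose) blast+
  moreover have "d k i = m k i \<circ> p k i" by (rule ext) (simp add: d_def)
  ultimately show "d k i : hom (grp (J k) i) (grp (J (Suc k)) i)" by (simp only:)
 next
  fix i j x assume ij: "i : I" "j : I" "r i j" and x: "x : carrier (grp (J k) j)"
  have mk: "system_map I r (T k) (J (Suc k)) (m k)" using m[of k] by blast
  show "d k i (bond (J k) i j x) = bond (J (Suc k)) i j (d k j x)"
   unfolding d_def system_mapD(2)[OF p(1) ij x]
   by (rule system_mapD(2)[OF mk ij system_mapD(3)[OF p(1) ij(2) x]])
 qed
 have kd: "kernel (grp (J k) i) (grp (J (Suc k)) i) (d k i) = kernel (grp (J k) i) (grp (T k) i) (p k i)" if i: "i : I" for k i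
 proof -
  have mk: "system_map I r (T k) (J (Suc k)) (m k)" and mi: "inj_on (m k i) (carrier (grp (T k) i))" using m[of k] i by blast+
  interpret m: group_hom "grp (T k) i" "grp (J (Suc k)) i" "m k i"
   using inverse_systemD(1)[OF T i] inverse_systemD(1)[OF Jk i] system_mapD(1)[OF mk i]
   by (simp add: group_hom_def group_hom_axioms_def comm_group_def)
  have "m k i y = \<one>\<^bsub>grp (J (Suc k)) i\<^esub> \<longleftrightarrow> y = \<one>\<^bsub>grp (T k) i\<^esub>" if "y : carrier (grp (T k) i)" for y
   using m.hom_one inj_onD[OF mi _ that m.G.one_closed] by metis
  thus ?thesis unfolding kernel_def d_def using system_mapD(3)[OF p(1) i] by blast
 qed
 have di: "d k i ` carrier (grp (J k) i) = m k i ` carrier (grp (T k) i)" if "i : I" for k i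
 proof -
  have "m k i ` carrier (grp (T k) i) = m k i ` (p k i ` carrier (grp (J k) i))" by (simp only: p(2)[OF that])
  also have "\<dots> = d k i ` carrier (grp (J k) i)" unfolding image_image d_def ..
  finally show ?thesis by simp
 qed
 have "injective_resolution I r S (\<epsilon>, J, d)"
  unfolding injective_resolution_def prod.case
 proof (intro conjI allI ballI)
  show "system_map I r S (J 0) \<epsilon>" using J0 by (simp add: J_def)
  fix i assume i: "i : I"
  show "inj_on (\<epsilon> i) (carrier (grp S i))" using J0 i by blast
  show "\<epsilon> i ` carrier (grp S i) = kernel (grp (J 0) i) (grp (J 1) i) (d 0 i)" using kd[OF i, of 0] ker0[OF i] by simp
  show "d k i ` carrier (grp (J k) i) = kernel (grp (J (Suc k)) i) (grp (J (Suc (Suc k))) i) (d (Suc k) i)" for k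
   using kd[OF i, of "Suc k"] ker[OF i, of k] di[OF i, of k] by simp
 qed (rule injJ d)+
 thus ?thesis by blast
qed

end

section \<open>Derived limits through cochains\<close>

lemma presents_Mod:
 assumes H: "comm_group H" and N: "subgroup N H" and Z: "subgrp Z"
  and im: "ph ` Z = carrier H"
  and mult: "!!x y. x : Z ==> y : Z ==> ph (x + y) = ph x \<otimes>\<^bsub>H\<^esub> ph y"
 shows "presents (H Mod N) Z {z : Z. ph z : N} (%z. N #>\<^bsub>H\<^esub> ph z)"
 unfolding presents_def
proof (intro conjI ballI)
 interpret H: comm_group H by fact
 interpret normal N H using N by (simp add: H.normal_iff_subgroup)
 have mem: "ph x : carrier H" if "x : Z" for x using im that by blast
 show "comm_group (H Mod N)" by (rule H.abelian_FactGroup[OF N])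
 show "subgrp Z" by fact
 show "(%z. N #>\<^bsub>H\<^esub> ph z) ` Z = carrier (H Mod N)"
  unfolding FactGroup_def RCOSETS_def im[symmetric] by auto
 show "N #>\<^bsub>H\<^esub> ph (x + y) = (N #>\<^bsub>H\<^esub> ph x) \<otimes>\<^bsub>H Mod N\<^esub> (N #>\<^bsub>H\<^esub> ph y)" if "x : Z" "y : Z" for x y
  using rcos_sum[OF mem[OF that(1)] mem[OF that(2)]] mult[OF that] by (simp add: FactGroup_def)
 show "N #>\<^bsub>H\<^esub> ph x = \<one>\<^bsub>H Mod N\<^esub> \<longleftrightarrow> x : {z : Z. ph z : N}" if x: "x : Z" for x
 proof -
  have "N #>\<^bsub>H\<^esub> ph x = N \<longleftrightarrow> ph x : N"
   using H.coset_join1[OF _ mem[OF x] N] H.coset_join2[OF mem[OF x] N] subset by blast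
  thus ?thesis using x by (simp add: FactGroup_def)
 qed
qed

context preordered_index
begin

lemma chains_0: "xs : chains 0 \<longleftrightarrow> (EX i:I. xs = [i])"
 by (cases xs) (auto simp: chains_def)

lemma diff_0_eq_0:
 "diff b 0 c = 0 \<longleftrightarrow> (ALL i:I. ALL j:I. r i j --> b i j (c [j]) = c [i])"
proof
 assume d: "diff b 0 c = 0"
 show "ALL i:I. ALL j:I. r i j --> b i j (c [j]) = c [i]"
 proof (intro ballI impI)
  fix i j assume "i : I" "j : I" "r i j"
  hence "[i, j] : chains (Suc 0)" by (simp add: chains_def)
  thus "b i j (c [j]) = c [i]" using fun_cong[OF d, of "[i, j]"] by (simp add: diff_Cons)
 qed
next
 assume a: "ALL i:I. ALL j:I. r i j --> b i j (c [j]) = c [i]"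
 show "diff b 0 c = 0"
 proof
  fix xs show "diff b 0 c xs = 0 xs"
  proof (cases "xs : chains (Suc 0)")
   case True
   then obtain i j zs where x: "xs = i # j # zs" "i : I" "j : I" "r i j" by (rule chains_Suc_cases) blast
   have "zs = []" using True x by (simp add: chains_def)
   thus ?thesis using True x a by (simp add: diff_Cons)
  qed (simp add: diff_off)
 qed
qed

lemma cochain_0_in: "c : cochains 0 S ==> i : I ==> c [i] : S i"
 using cochainsD[of c 0 S "[i]"] by (simp add: chains_0)

lemma family_cochain:
 assumes "!!i. i : I ==> h i : S i"
 shows "(%xs. if xs : chains 0 then h (hd xs) else 0) : cochains 0 S"
 by (rule cochainsI) (use assms chains_hd in auto)

lemma inverse_limit_simps:
 "carrier (inverse_limit I r S) = {x : (\<Pi>\<^sub>E i\<in>I. carrier (grp S i)). ALL i:I. ALL j:I. r i j --> bond S i j (x j) = x i}"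
 "x \<otimes>\<^bsub>inverse_limit I r S\<^esub> y = (\<lambda>i\<in>I. x i \<otimes>\<^bsub>grp S i\<^esub> y i)"
 "\<one>\<^bsub>inverse_limit I r S\<^esub> = (\<lambda>i\<in>I. \<one>\<^bsub>grp S i\<^esub>)"
 by (simp_all add: inverse_limit_def)

text \<open>A limit of a presented system: compatible families of classes are 0-cochains whose differential is
 a family of relations.\<close>

lemma inverse_limit_presented:
 assumes S: "inverse_system I r S" and ZB: "subsystem Z B b"
  and h: "!!i. i : I ==> presents (grp S i) (Z i) (B i) (h i)"
  and nat: "!!i j x. i : I ==> j : I ==> r i j ==> x : Z j ==> h i (b i j x) = bond S i j (h j x)"
 shows "presents (inverse_limit I r S) (rcocycles Z B b 0) (cochains 0 B) (%c. \<lambda>i\<in>I. h i (c [i]))"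
proof -
 have Z: "system Z b" and B: "system B b" and BZ: "!!i. i : I ==> B i <= Z i" using ZB by (auto simp: subsystem_def)
 let ?L = "inverse_limit I r S" and ?ph = "%c. \<lambda>i\<in>I. h i (c [i])"
 have sub: "subgrp (rcocycles Z B b 0)" by (rule rcocycles_subgroup[OF ZB])
 have compat: "bond S i j (h j (c [j])) = h i (c [i]) \<longleftrightarrow> b i j (c [j]) - c [i] : B i"
  if c: "c : cochains 0 Z" and ij: "i : I" "j : I" "r i j" for c i j
  using presents_eq_iff[OF h[OF ij(1)] systemD(3)[OF Z ij cochain_0_in[OF c ij(2)]] cochain_0_in[OF c ij(1)]]
   nat[OF ij cochain_0_in[OF c ij(2)]] by simp
 have coc: "c : rcocycles Z B b 0 \<longleftrightarrow> (ALL i:I. ALL j:I. r i j --> b i j (c [j]) - c [i] : B i)" if c: "c : cochains 0 Z" for c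
 proof
  assume "c : rcocycles Z B b 0"
  hence d: "diff b 0 c : cochains (Suc 0) B" by (simp add: rcocycles_def)
  show "ALL i:I. ALL j:I. r i j --> b i j (c [j]) - c [i] : B i"
  proof (intro ballI impI)
   fix i j assume "i : I" "j : I" "r i j"
   hence ch: "[i, j] : chains (Suc 0)" by (simp add: chains_def)
   show "b i j (c [j]) - c [i] : B i" using cochainsD[OF d ch] ch by (simp add: diff_Cons)
  qed
 next
  assume a: "ALL i:I. ALL j:I. r i j --> b i j (c [j]) - c [i] : B i"
  have "diff b 0 c : cochains (Suc 0) B"
  proof (rule cochainsI)
   fix xs assume xs: "xs : chains (Suc 0)"
   then obtain i j zs where x: "xs = i # j # zs" "i : I" "j : I" "r i j" by (rule chains_Suc_cases) blast
   have "zs = []" using xs x by (simp add: chains_def)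
   thus "diff b 0 c xs : B (hd xs)" using xs x a by (simp add: diff_Cons)
  qed (rule diff_off)
  thus "c : rcocycles Z B b 0" using c by (simp add: rcocycles_def)
 qed
 have cZ: "c : cochains 0 Z" if "c : rcocycles Z B b 0" for c using that by (simp add: rcocycles_def)
 have hc: "h i (c [i]) : carrier (grp S i)" if "c : cochains 0 Z" "i : I" for c i
  by (rule presentsD(3)[OF h[OF that(2)] cochain_0_in[OF that]])
 have mult: "?ph (c + c') = ?ph c \<otimes>\<^bsub>?L\<^esub> ?ph c'" if "c : rcocycles Z B b 0" "c' : rcocycles Z B b 0" for c c'
  unfolding inverse_limit_simps
  by (rule restrict_ext) (use presentsD(5)[OF h cochain_0_in[OF cZ[OF that(1)]] cochain_0_in[OF cZ[OF that(2)]]] in simp)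
 have im: "?ph ` rcocycles Z B b 0 = carrier ?L"
 proof (intro equalityI subsetI)
  fix x assume "x : ?ph ` rcocycles Z B b 0"
  then obtain c where c: "c : rcocycles Z B b 0" "x = ?ph c" by blast
  have "ALL i:I. ALL j:I. r i j --> bond S i j (h j (c [j])) = h i (c [i])"
   using coc[OF cZ[OF c(1)]] c(1) compat[OF cZ[OF c(1)]] by simp
  thus "x : carrier ?L" unfolding inverse_limit_simps c(2) using hc[OF cZ[OF c(1)]] by simp
 next
  fix x assume x: "x : carrier ?L"
  have "EX z. z : Z i & h i z = x i" if i: "i : I" for i
  proof -
   have "x i : carrier (grp S i)" using x i by (auto simp: inverse_limit_simps)
   from presentsD(4)[OF h[OF i] this] show ?thesis by blast
  qed
  then obtain z where z: "!!i. i : I ==> z i : Z i & h i (z i) = x i" by metis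
  define c where "c xs = (if xs : chains 0 then z (hd xs) else 0)" for xs
  have c: "c : cochains 0 Z" unfolding c_def by (rule family_cochain) (use z in blast)
  have ci: "c [i] = z i" if "i : I" for i using that by (auto simp: c_def chains_0)
  have "bond S i j (h j (c [j])) = h i (c [i])" if "i : I" "j : I" "r i j" for i j
   using x that z by (simp add: ci inverse_limit_simps)
  hence "c : rcocycles Z B b 0" using coc[OF c] compat[OF c] by blast
  moreover have "?ph c = x"
  proof
   fix i show "?ph c i = x i" using x z ci by (cases "i : I") (auto simp: inverse_limit_simps PiE_def extensional_def)
  qed
  ultimately show "x : ?ph ` rcocycles Z B b 0" by blast
 qed
 have ker: "?ph c = \<one>\<^bsub>?L\<^esub> \<longleftrightarrow> c : cochains 0 B" if c: "c : rcocycles Z B b 0" for c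
 proof -
  have "?ph c = \<one>\<^bsub>?L\<^esub> \<longleftrightarrow> (ALL i:I. h i (c [i]) = \<one>\<^bsub>grp S i\<^esub>)"
   unfolding inverse_limit_simps by (auto simp: restrict_def fun_eq_iff)
  also have "\<dots> \<longleftrightarrow> (ALL i:I. c [i] : B i)" using presentsD(6)[OF h cochain_0_in[OF cZ[OF c]]] by blast
  also have "\<dots> \<longleftrightarrow> c : cochains 0 B"
  proof
   assume a: "ALL i:I. c [i] : B i"
   show "c : cochains 0 B" by (rule cochainsI) (use a cochains_off[OF cZ[OF c]] in \<open>auto simp: chains_0\<close>)
  qed (use cochain_0_in in blast)
  finally show ?thesis .
 qed
 have "comm_group ?L"
 proof (rule comm_group_image[of "group_of (rcocycles Z B b 0)" ?ph])
  have "0 : rcocycles Z B b 0" "0 : cochains 0 B"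
   using subgrp_0[OF sub] subgrp_0[OF cochains_subgroup[of B 0, OF systemD(1)[OF B]]] by auto
  thus "\<one>\<^bsub>?L\<^esub> = ?ph \<one>\<^bsub>group_of (rcocycles Z B b 0)\<^esub>" using ker[of 0] by simp
 qed (use im mult comm_group_group_of[OF sub] in simp_all)
 thus ?thesis unfolding presents_def using sub im mult ker by blast
qed

lemma unemb_presents:
 assumes T: "inverse_system I r T" and i: "i : I"
 shows "presents (grp T i) (esys T i) {0} (unemb T i)"
 unfolding presents_def
proof (intro conjI ballI)
 show "comm_group (grp T i)" by (rule inverse_systemD(1)[OF T i])
 show "subgrp (esys T i)" by (rule esys_subgroup[OF T i])
 show "unemb T i ` esys T i = carrier (grp T i)"
 proof (intro equalityI subsetI)
  fix x assume "x : carrier (grp T i)"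
  thus "x : unemb T i ` esys T i" using unemb_emb[OF T i] emb_in[of x T i] by (metis imageI)
 qed (auto intro: unemb_in)
qed (use unemb_add[OF T i] unemb_eq_one[OF T i] in auto)

text \<open>A class of a cocycle of limits is a compatible family of elements of the image of the preceding map; boundaries are
 the images of compatible families.\<close>

lemma limit_cohomology_presented:
 assumes J: "!!k. inverse_system I r (J k)" and d: "!!k. system_map I r (J k) (J (Suc k)) (d k)"
  and exact: "!!i k. i : I ==> d k i ` carrier (grp (J k) i) = kernel (grp (J (Suc k)) i) (grp (J (Suc (Suc k))) i) (d (Suc k) i)"
 defines "p \<equiv> %k. emap (J k) (J (Suc k)) (d k)"
 shows "EX q. presents (limit_cohomology I r J d (Suc k))
   {c : cochains 0 (%i. p k i ` esys (J k) i). diff (ebond (J (Suc k))) 0 c = 0}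
   {capp 0 (p k) w | w. w : cochains 0 (esys (J k)) & diff (ebond (J k)) 0 w = 0} q"
proof -
 let ?b = "ebond (J (Suc k))" and ?E = "esys (J (Suc k))"
 let ?Z = "{c : cochains 0 (%i. p k i ` esys (J k) i). diff ?b 0 c = 0}"
 let ?Bd = "{capp 0 (p k) w | w. w : cochains 0 (esys (J k)) & diff (ebond (J k)) 0 w = 0}"
 let ?L = "%k. inverse_limit I r (J k)"
 let ?ph = "%k c. \<lambda>i\<in>I. unemb (J k) i (c [i])"
 have zero_sub: "subsystem (esys (J k)) (%i. {0}) (ebond (J k))" for k
 proof -
  have s: "system (esys (J k)) (ebond (J k))" by (rule system_esys[OF J])
  have z: "ebond (J k) i j 0 = 0" if "i : I" "j : I" "r i j" for i j
   by (rule additive_0[OF systemD(1)[OF s that(2)] systemD(2)[OF s that]])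
  have "system (%i. {0}) (ebond (J k))"
   unfolding system_def
  proof (intro conjI ballI allI impI)
   show "additive {0} (ebond (J k) i j)" "ebond (J k) i j ` {0} <= {0}" if "i : I" "j : I" "r i j" for i j
    using z[OF that] by (auto simp: additive_def)
   show "ebond (J k) i j (ebond (J k) j l x) = ebond (J k) i l x"
    if "i : I" "j : I" "l : I" "r i j" "r j l" "x : {0}" for i j l x
    using z[OF that(1,2,4)] z[OF that(2,3,5)] z[OF that(1,3) index_trans[OF that(1-5)]] that(6) by simp
  qed simp
  thus ?thesis using s subgrp_0[OF systemD(1)[OF s]] by (simp add: subsystem_def)
 qed
 have lim: "presents (?L k) (rcocycles (esys (J k)) (%i. {0}) (ebond (J k)) 0) (cochains 0 (%i. {0})) (?ph k)" for k
 proof (rule inverse_limit_presented[OF J zero_sub unemb_presents[OF J]])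
  fix i j x assume ij: "i : I" "j : I" "r i j" and x: "x : esys (J k) j"
  show "unemb (J k) i (ebond (J k) i j x) = bond (J k) i j (unemb (J k) j x)"
   unfolding ebond_def by (rule unemb_emb[OF J ij(1) inverse_systemD(5)[OF J ij unemb_in[OF x]]])
 qed
 have rc: "rcocycles (esys (J k)) (%i. {0}) (ebond (J k)) 0 = {c : cochains 0 (esys (J k)). diff (ebond (J k)) 0 c = 0}" for k
  by (simp add: rcocycles_def cochains_zero)
 have nat: "natural (esys (J k)) (ebond (J k)) (esys (J (Suc k))) (ebond (J (Suc k))) (p k)" for k
  unfolding p_def by (rule natural_emap[OF J J d])
 have unp: "unemb (J (Suc k)) i (p k i y) = d k i (unemb (J k) i y)" if "i : I" "y : esys (J k) i" for i y k
  unfolding p_def emap_def by (rule unemb_emb[OF J that(1) system_mapD(3)[OF d that(1) unemb_in[OF that(2)]]])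
 have pim: "y : p k i ` esys (J k) i \<longleftrightarrow> y : ?E i & d (Suc k) i (unemb (J (Suc k)) i y) = \<one>\<^bsub>grp (J (Suc (Suc k))) i\<^esub>" if i: "i : I" for i y
 proof
  assume "y : p k i ` esys (J k) i"
  then obtain x where x: "x : esys (J k) i" "y = p k i x" by blast
  have "unemb (J (Suc k)) i y : d k i ` carrier (grp (J k) i)" using unp[OF i x(1)] unemb_in[OF x(1)] x(2) by simp
  thus "y : ?E i & d (Suc k) i (unemb (J (Suc k)) i y) = \<one>\<^bsub>grp (J (Suc (Suc k))) i\<^esub>"
   using naturalD(2)[OF nat i x(1)] x(2) unfolding exact[OF i] kernel_def by simp
 next
  assume y: "y : ?E i & d (Suc k) i (unemb (J (Suc k)) i y) = \<one>\<^bsub>grp (J (Suc (Suc k))) i\<^esub>"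
  hence "unemb (J (Suc k)) i y : d k i ` carrier (grp (J k) i)"
   using unemb_in[of y "J (Suc k)" i] unfolding exact[OF i] kernel_def by blast
  then obtain a where a: "a : carrier (grp (J k) i)" "unemb (J (Suc k)) i y = d k i a" by blast
  have "p k i (emb (J k) i a) = emb (J (Suc k)) i (unemb (J (Suc k)) i y)" unfolding p_def a(2) by (rule emap_emb[OF J i a(1)])
  also have "\<dots> = y" by (rule emb_unemb) (use y in blast)
  finally show "y : p k i ` esys (J k) i" using emb_in[OF a(1)] by (metis imageI)
 qed
 have psub: "p k i ` esys (J k) i <= ?E i" if "i : I" for i using pim[OF that] by blast
 have ZE: "c : rcocycles ?E (%i. {0}) ?b 0" if "c : ?Z" for c
  using that cochains_mono[of "%i. p k i ` esys (J k) i" ?E 0] psub unfolding rc by blast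
 define H where "H = (?L (Suc k))\<lparr>carrier := kernel (?L (Suc k)) (?L (Suc (Suc k))) (limit_map I (d (Suc k)))\<rparr>"
 define N where "N = limit_map I (d k) ` carrier (?L k)"
 have Hc: "carrier H = {x : carrier (?L (Suc k)). ALL i:I. d (Suc k) i (x i) = \<one>\<^bsub>grp (J (Suc (Suc k))) i\<^esub>}"
 proof -
  have "limit_map I (d (Suc k)) x = \<one>\<^bsub>?L (Suc (Suc k))\<^esub> \<longleftrightarrow> (ALL i:I. d (Suc k) i (x i) = \<one>\<^bsub>grp (J (Suc (Suc k))) i\<^esub>)" for x
   by (auto simp: limit_map_def inverse_limit_simps(3) restrict_def fun_eq_iff)
  thus ?thesis by (simp add: H_def kernel_def)
 qed
 have Hs: "carrier H = {x : carrier (?L (Suc k)). ALL i:I. d (Suc k) i (x i) = \<one>\<^bsub>grp (J (Suc (Suc k))) i\<^esub>}"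
  "!!x y. x \<otimes>\<^bsub>H\<^esub> y = x \<otimes>\<^bsub>?L (Suc k)\<^esub> y" "\<one>\<^bsub>H\<^esub> = \<one>\<^bsub>?L (Suc k)\<^esub>"
  by (rule Hc, simp_all add: H_def)
 have Zsub: "subgrp ?Z"
 proof -
  have sE: "system ?E ?b" by (rule system_esys[OF J])
  have imsub: "subgrp (p k i ` esys (J k) i)" if "i : I" for i
   by (rule subgrp_image[OF esys_subgroup[OF J that] naturalD(1)[OF nat that]])
  have cs: "subgrp (cochains 0 (%i. p k i ` esys (J k) i))" by (rule cochains_subgroup[OF imsub])
  have sub: "cochains 0 (%i. p k i ` esys (J k) i) <= cochains 0 ?E" by (rule cochains_mono[OF psub])
  show ?thesis by (rule subgrp_kernel[OF cs additive_subset[OF diff_additive[OF sE] sub]])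
 qed
 have im: "?ph (Suc k) ` ?Z = carrier H"
 proof (intro equalityI subsetI)
  fix x assume "x : ?ph (Suc k) ` ?Z"
  then obtain c where c: "c : ?Z" "x = ?ph (Suc k) c" by blast
  have "x : carrier (?L (Suc k))" using presentsD(3)[OF lim ZE[OF c(1)]] c(2) by simp
  moreover have "d (Suc k) i (x i) = \<one>\<^bsub>grp (J (Suc (Suc k))) i\<^esub>" if i: "i : I" for i
   using cochain_0_in[of c "%i. p k i ` esys (J k) i" i] c i pim[OF i] by simp
  ultimately show "x : carrier H" by (simp add: Hs)
 next
  fix x assume x: "x : carrier H"
  then obtain c where c: "c : rcocycles ?E (%i. {0}) ?b 0" "?ph (Suc k) c = x"
   using presentsD(4)[OF lim[of "Suc k"], of x] by (auto simp: Hs)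
  have "c : cochains 0 (%i. p k i ` esys (J k) i)"
  proof (rule cochainsI)
   fix xs assume "xs : chains 0"
   then obtain i where i: "i : I" "xs = [i]" unfolding chains_0 by blast
   have "c [i] : ?E i" using c(1) cochain_0_in[of c ?E i] i by (simp add: rcocycles_def)
   moreover have "d (Suc k) i (unemb (J (Suc k)) i (c [i])) = \<one>\<^bsub>grp (J (Suc (Suc k))) i\<^esub>"
    using x c(2) i(1) by (auto simp: Hs)
   ultimately show "c xs : p k (hd xs) ` esys (J k) (hd xs)" using pim[OF i(1)] i(2) by simp
  qed (use c cochains_off in \<open>auto simp: rcocycles_def\<close>)
  hence "c : ?Z" using c(1) unfolding rc by blast
  thus "x : ?ph (Suc k) ` ?Z" using c(2) by blast
 qed
 have mult: "?ph (Suc k) (x + y) = ?ph (Suc k) x \<otimes>\<^bsub>H\<^esub> ?ph (Suc k) y" if "x : ?Z" "y : ?Z" for x y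
  unfolding Hs(2) by (rule presentsD(5)[OF lim ZE[OF that(1)] ZE[OF that(2)]])
 have z0: "0 : rcocycles ?E (%i. {0}) ?b 0" "0 : cochains 0 (%i. {0::(('b => circle) => circle)})"
  using subgrp_0[OF Zsub] ZE by (auto simp: cochains_zero)
 have H: "comm_group H"
 proof (rule comm_group_image[of "group_of ?Z" "?ph (Suc k)"])
  have "\<one>\<^bsub>?L (Suc k)\<^esub> = ?ph (Suc k) 0" by (rule sym, rule presentsD(6)[OF lim z0(1), THEN iffD2]) (simp add: cochains_zero)
  thus "\<one>\<^bsub>H\<^esub> = ?ph (Suc k) \<one>\<^bsub>group_of ?Z\<^esub>" by (simp only: Hs(3) group_of_simps)
 qed (use im mult comm_group_group_of[OF Zsub] in simp_all)
 have php: "?ph (Suc k) (capp 0 (p k) w) = limit_map I (d k) (?ph k w)" if w: "w : cochains 0 (esys (J k))" for w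
  unfolding limit_map_def
  by (rule restrict_ext) (use unp cochain_0_in[OF w] in \<open>simp add: capp_def chains_0\<close>)
 have Nph: "N = ?ph (Suc k) ` ?Bd"
 proof -
  have "carrier (?L k) = ?ph k ` {c : cochains 0 (esys (J k)). diff (ebond (J k)) 0 c = 0}"
   using lim[of k] unfolding presents_def rc by simp
  hence "N = (%w. limit_map I (d k) (?ph k w)) ` {c : cochains 0 (esys (J k)). diff (ebond (J k)) 0 c = 0}"
   unfolding N_def by (simp add: image_image)
  also have "\<dots> = (%w. ?ph (Suc k) (capp 0 (p k) w)) ` {c : cochains 0 (esys (J k)). diff (ebond (J k)) 0 c = 0}"
   by (rule image_cong[OF refl]) (simp only: php mem_Collect_eq)
  also have "\<dots> = ?ph (Suc k) ` ?Bd" by blast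
  finally show ?thesis .
 qed
 have BdZ: "?Bd <= ?Z"
 proof
  fix c assume "c : ?Bd"
  then obtain w where w: "w : cochains 0 (esys (J k))" "diff (ebond (J k)) 0 w = 0" "c = capp 0 (p k) w" by blast
  have "c : cochains 0 (%i. p k i ` esys (J k) i)" unfolding w(3)
   by (rule cochainsI) (auto simp: capp_def dest: cochainsD[OF w(1)])
  moreover have "capp (Suc 0) (p k) 0 = 0"
   using additive_0[OF cochains_subgroup capp_additive[OF nat, of 1]] esys_subgroup[OF J] by simp
  hence "diff ?b 0 c = 0" unfolding w(3) using diff_capp[OF system_esys[OF J] nat w(1)] w(2) by simp
  ultimately show "c : ?Z" by blast
 qed
 have Bds: "subgrp ?Bd"
 proof -
  have cs: "subgrp {w : cochains 0 (esys (J k)). diff (ebond (J k)) 0 w = 0}"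
   by (rule subgrp_kernel[OF cochains_subgroup diff_additive[OF system_esys[OF J]]]) (rule esys_subgroup[OF J])
  have "?Bd = capp 0 (p k) ` {w : cochains 0 (esys (J k)). diff (ebond (J k)) 0 w = 0}" by blast
  thus ?thesis
   using subgrp_image[OF cs additive_subset[OF capp_additive[OF nat]]] by auto
 qed
 interpret H: comm_group H by (rule H)
 have ph0: "?ph (Suc k) c = \<one>\<^bsub>H\<^esub> \<longleftrightarrow> c = 0" if "c : ?Z" for c
  unfolding Hs(3) using presentsD(6)[OF lim ZE[OF that]] by (simp add: cochains_zero)
 have mem: "?ph (Suc k) c : carrier H" if "c : ?Z" for c using im that by blast
 have inj: "c = c'" if c: "c : ?Z" "c' : ?Z" "?ph (Suc k) c = ?ph (Suc k) c'" for c c'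
 proof -
  have "c - c' : cochains 0 (%i. {0})"
   using presents_eq_iff[OF lim ZE[OF c(1)] ZE[OF c(2)]] c(3) by simp
  thus ?thesis by (simp add: cochains_zero)
 qed
 have N: "subgroup N H"
 proof (rule H.subgroupI)
  show "N <= carrier H" unfolding Nph using BdZ mem by blast
  show "N ~= {}" unfolding Nph using subgrp_0[OF Bds] by blast
  fix a assume "a : N"
  then obtain c where c: "c : ?Bd" "a = ?ph (Suc k) c" unfolding Nph by blast
  have cZ: "c : ?Z" "- c : ?Z" "- c : ?Bd"
   using c(1) BdZ subgrp_minus[OF Bds c(1)] by blast+
  have "?ph (Suc k) (- c + c) = ?ph (Suc k) (- c) \<otimes>\<^bsub>H\<^esub> a" unfolding c(2) by (rule mult[OF cZ(2,1)])
  moreover have "?ph (Suc k) (- c + c) = \<one>\<^bsub>H\<^esub>" using ph0[OF subgrp_0[OF Zsub]] by simp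
  ultimately have "inv\<^bsub>H\<^esub> a = ?ph (Suc k) (- c)"
   by (intro H.inv_equality) (simp_all only: c(2) mem[OF cZ(1)] mem[OF cZ(2)])
  thus "inv\<^bsub>H\<^esub> a : N" unfolding Nph using cZ(3) by blast
  fix a' assume "a' : N"
  then obtain c' where c': "c' : ?Bd" "a' = ?ph (Suc k) c'" unfolding Nph by blast
  have "a \<otimes>\<^bsub>H\<^esub> a' = ?ph (Suc k) (c + c')" unfolding c(2) c'(2)
   by (rule mult[symmetric]) (use c(1) c'(1) BdZ in blast)+
  thus "a \<otimes>\<^bsub>H\<^esub> a' : N" unfolding Nph using subgrp_add[OF Bds c(1) c'(1)] by blast
 qed
 have "presents (H Mod N) ?Z {z : ?Z. ?ph (Suc k) z : N} (%z. N #>\<^bsub>H\<^esub> ?ph (Suc k) z)"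
  by (rule presents_Mod[where ph="?ph (Suc k)", OF H N Zsub im mult])
 moreover have "{z : ?Z. ?ph (Suc k) z : N} = ?Bd"
 proof (intro equalityI subsetI)
  fix z assume z: "z : {z : ?Z. ?ph (Suc k) z : N}"
  then obtain c where c: "c : ?Bd" "?ph (Suc k) z = ?ph (Suc k) c" unfolding Nph by blast
  have "z : ?Z" using z by blast
  hence "z = c" using inj[OF _ _ c(2)] c(1) BdZ by blast
  thus "z : ?Bd" using c(1) by simp
 next
  fix z assume z: "z : ?Bd"
  hence "?ph (Suc k) z : N" unfolding Nph by (rule imageI)
  thus "z : {z : ?Z. ?ph (Suc k) z : N}" using z BdZ by blast
 qed
 moreover have "limit_cohomology I r J d (Suc k) = H Mod N"
  by (simp add: limit_cohomology_def H_def N_def)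
 ultimately show ?thesis by auto
qed

end

context preordered_index
begin

lemma emap_exact:
 assumes S: "inverse_system I r S" and T: "inverse_system I r T" and U: "inverse_system I r U"
  and f: "system_map I r S T f" and g: "system_map I r T U g" and i: "i : I"
  and exact: "f i ` carrier (grp S i) = kernel (grp T i) (grp U i) (g i)"
 shows "{y : esys T i. emap T U g i y = 0} = emap S T f i ` esys S i"
proof -
 have im: "emap S T f i ` esys S i = emb T i ` f i ` carrier (grp S i)"
  unfolding esys_def image_image by (rule image_cong[OF refl]) (rule emap_emb[OF S i])
 have "emap T U g i y = 0 \<longleftrightarrow> g i (unemb T i y) = \<one>\<^bsub>grp U i\<^esub>" if "y : esys T i" for y
  unfolding emap_def
  by (rule char_embed_eq_0[OF inverse_systemD(1)[OF U i] system_mapD(3)[OF g i unemb_in[OF that]]])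
 hence "{y : esys T i. emap T U g i y = 0} = {y : esys T i. g i (unemb T i y) = \<one>\<^bsub>grp U i\<^esub>}" by blast
 also have "\<dots> = emb T i ` kernel (grp T i) (grp U i) (g i)"
 proof (intro equalityI subsetI)
  fix y assume "y : {y : esys T i. g i (unemb T i y) = \<one>\<^bsub>grp U i\<^esub>}"
  hence "y : esys T i" "unemb T i y : kernel (grp T i) (grp U i) (g i)" using unemb_in[of y T i] by (auto simp: kernel_def)
  thus "y : emb T i ` kernel (grp T i) (grp U i) (g i)" using emb_unemb[of y T i] by (metis imageI)
 next
  fix y assume "y : emb T i ` kernel (grp T i) (grp U i) (g i)"
  then obtain x where x: "x : carrier (grp T i)" "g i x = \<one>\<^bsub>grp U i\<^esub>" "y = emb T i x" by (auto simp: kernel_def)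
  thus "y : {y : esys T i. g i (unemb T i y) = \<one>\<^bsub>grp U i\<^esub>}" using emb_in[OF x(1)] unemb_emb[OF T i x(1)] by simp
 qed
 finally show ?thesis using im exact by simp
qed

lemma system_image:
 assumes S: "system S b" and T: "system T c" and p: "natural S b T c p"
 shows "system (%i. p i ` S i) c"
 unfolding system_def
proof (intro conjI ballI allI impI)
 show "subgrp (p i ` S i)" if "i : I" for i by (rule subgrp_image[OF systemD(1)[OF S that] naturalD(1)[OF p that]])
 have sub: "p i ` S i <= T i" if "i : I" for i using naturalD(2)[OF p that] by blast
 show "additive (p j ` S j) (c i j)" if "i : I" "j : I" "r i j" for i j
  by (rule additive_subset[OF systemD(2)[OF T that] sub[OF that(2)]])
 show "c i j ` p j ` S j <= p i ` S i" if ij: "i : I" "j : I" "r i j" for i j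
 proof (rule image_subsetI)
  fix y assume "y : p j ` S j"
  then obtain x where x: "x : S j" "y = p j x" by blast
  show "c i j y : p i ` S i" using naturalD(3)[OF p ij x(1)] systemD(3)[OF S ij x(1)] x(2) by (metis imageI)
 qed
 show "c i j (c j k y) = c i k y" if "i : I" "j : I" "k : I" "r i j" "r j k" "y : p k ` S k" for i j k y
  using systemD(4)[OF T that(1-5)] sub[OF that(3)] that(6) by blast
qed

lemma zero_subsystem:
 assumes S: "system S b" shows "subsystem S (%i. {0}) b"
proof -
 have z: "b i j 0 = 0" if "i : I" "j : I" "r i j" for i j
  by (rule additive_0[OF systemD(1)[OF S that(2)] systemD(2)[OF S that]])
 have "system (%i. {0}) b"
  unfolding system_def
 proof (intro conjI ballI allI impI)
  show "additive {0} (b i j)" "b i j ` {0} <= {0}" if "i : I" "j : I" "r i j" for i j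
   using z[OF that] by (auto simp: additive_def)
  show "b i j (b j l x) = b i l x"
   if "i : I" "j : I" "l : I" "r i j" "r j l" "x : {0}" for i j l x
   using z[OF that(1,2,4)] z[OF that(2,3,5)] z[OF that(1,3) index_trans[OF that(1-5)]] that(6) by simp
 qed simp
 thus ?thesis using S subgrp_0[OF systemD(1)[OF S]] by (simp add: subsystem_def)
qed

text \<open>Dimension shifting along the resolution: each step to the left in the resolution raises the degree of the cochains on
 chains of indices by one, until the system itself is reached.\<close>

theorem derived_limit_presented:
 fixes S :: "('i, 'h) inv_sys"
 assumes S: "inverse_system I r S" and ZB: "subsystem Z B b"
  and h: "!!i. i : I ==> presents (grp S i) (Z i) (B i) (h i)"
  and nat: "!!i j x. i : I ==> j : I ==> r i j ==> x : Z j ==> h i (b i j x) = bond S i j (h j x)"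
 shows "EX q. presents (derived_limit (Suc k) I r S) (rcocycles Z B b (Suc k)) (rboundaries Z B b k) q"
proof -
 have "inj (%n::nat. %_::'i list. (undefined::'h, n))" by (rule injI) (simp add: fun_eq_iff)
 hence inf: "infinite (UNIV :: ('i, 'h) resolution_type set)"
  using finite_imageD[of "%n::nat. %_::'i list. (undefined::'h, n)" UNIV] finite_subset[OF subset_UNIV] by blast
 have inj: "inj (%x::'h. %_::'i list. (x, 0::nat))" by (rule injI) (simp add: fun_eq_iff)
 let ?R = "SOME R :: ('i => 'h => ('i, 'h) resolution_type) \<times> (nat => ('i, ('i, 'h) resolution_type) inv_sys) \<times>
   (nat => 'i => ('i, 'h) resolution_type => ('i, 'h) resolution_type). injective_resolution I r S R"
 have R: "injective_resolution I r S ?R" by (rule someI_ex[OF injective_resolution_exists[OF inf inj S]])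
 obtain \<epsilon> J d where R_eq: "?R = (\<epsilon>, J, d)" by (metis prod_cases3)
 let ?L = "limit_cohomology I r J d (Suc k)"
 have L: "derived_limit (Suc k) I r S = ?L" unfolding derived_limit_def R_eq by simp
 note R' = R[unfolded R_eq, unfolded injective_resolution_def prod.case]
 have injJ: "injective_system I r (J m)" for m using R' by blast
 have J: "inverse_system I r (J m)" for m using injJ[of m] by (simp add: injective_system_def)
 have \<epsilon>: "system_map I r S (J 0) \<epsilon>" using R' by blast
 have d: "system_map I r (J m) (J (Suc m)) (d m)" for m using R' by blast
 have \<epsilon>i: "inj_on (\<epsilon> i) (carrier (grp S i))" "\<epsilon> i ` carrier (grp S i) = kernel (grp (J 0) i) (grp (J (Suc 0)) i) (d 0 i)"
  if "i : I" for i using R' that by simp_all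
 have exact: "d m i ` carrier (grp (J m) i) = kernel (grp (J (Suc m)) i) (grp (J (Suc (Suc m))) i) (d (Suc m) i)"
  if "i : I" for i m using R' that by blast
 define p where "p m = emap (J m) (J (Suc m)) (d m)" for m
 have np: "natural (esys (J m)) (ebond (J m)) (esys (J (Suc m))) (ebond (J (Suc m))) (p m)" for m
  unfolding p_def by (rule natural_emap[OF J J d])
 have sJ: "system (esys (J m)) (ebond (J m))" for m by (rule system_esys[OF J])
 have aJ: "acyclic_system (esys (J m)) (ebond (J m))" for m by (rule injective_acyclic[OF injJ])
 have pexact: "{y : esys (J (Suc m)) i. p (Suc m) i y = 0} = p m i ` esys (J m) i" if "i : I" for i m
  unfolding p_def by (rule emap_exact[OF J J J d d that exact[OF that]])
 define C where "C j \<longleftrightarrow> (EX q. presents ?L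
   {c : cochains j (%i. p (k - j) i ` esys (J (k - j)) i). diff (ebond (J (Suc (k - j)))) j c = 0}
   {capp j (p (k - j)) w | w. w : cochains j (esys (J (k - j))) & diff (ebond (J (k - j))) j w = 0} q)" for j
 have claim: "j \<le> k ==> C j" for j
 proof (induct j)
  case 0
  show ?case unfolding C_def using limit_cohomology_presented[where J=J and d=d and k=k, OF J d exact] by (simp add: p_def)
 next
  case (Suc j)
  define m where "m = k - Suc j"
  have m: "k - j = Suc m" "k - Suc j = m" using Suc(2) by (auto simp: m_def)
  obtain q where q: "presents ?L
   {c : cochains j (%i. p (Suc m) i ` esys (J (Suc m)) i). diff (ebond (J (Suc (Suc m)))) j c = 0}
   {capp j (p (Suc m)) w | w. w : cochains j (esys (J (Suc m))) & diff (ebond (J (Suc m))) j w = 0} q"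
   using Suc Suc_leD unfolding C_def m(1) by blast
  let ?K = "%i. p m i ` esys (J m) i"
  have K: "system ?K (ebond (J (Suc m)))" by (rule system_image[OF sJ sJ np])
  have "EX q'. presents ?L (rcocycles ?K (%i. {0}) (ebond (J (Suc m))) (Suc j))
    (rboundaries ?K (%i. {0}) (ebond (J (Suc m))) j) q' &
    (ALL w:cochains j (esys (J (Suc m))). ALL f:cochains (Suc j) ?K.
     diff (ebond (J (Suc m))) j w = capp (Suc j) (%i x. x) f --> q' f = q (capp j (p (Suc m)) w))"
  proof (rule connecting_presentation[OF zero_subsystem[OF K] sJ aJ sJ _ np _ _ q])
   show "natural ?K (ebond (J (Suc m))) (esys (J (Suc m))) (ebond (J (Suc m))) (%i x. x)"
    unfolding natural_def additive_def using naturalD(2)[OF np] by auto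
   show "{y : esys (J (Suc m)) i. p (Suc m) i y = 0} = (%x. x) ` ?K i" if "i : I" for i using pexact[OF that] by simp
  qed simp
  thus ?case unfolding C_def using rcocycles_image[OF sJ np aJ, of m "Suc j"] rcocycles_image[OF sJ np aJ, of m j] m by auto
 qed
 obtain q where q: "presents ?L {c : cochains k (%i. p 0 i ` esys (J 0) i). diff (ebond (J (Suc 0))) k c = 0}
   {capp k (p 0) w | w. w : cochains k (esys (J 0)) & diff (ebond (J 0)) k w = 0} q"
  using claim[of k] unfolding C_def by auto
 define e where "e i x = emb (J 0) i (\<epsilon> i (h i x))" for i x
 have hS: "h i x : carrier (grp S i)" if "i : I" "x : Z i" for i x by (rule presentsD(3)[OF h[OF that(1)] that(2)])
 have e: "natural Z b (esys (J 0)) (ebond (J 0)) e"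
  unfolding natural_def
 proof (intro conjI ballI impI)
  fix i assume i: "i : I"
  have eJ: "\<epsilon> i (h i x) : carrier (grp (J 0) i)" if "x : Z i" for x by (rule system_mapD(3)[OF \<epsilon> i hS[OF i that]])
  show "e i ` Z i <= esys (J 0) i" unfolding e_def by (rule image_subsetI, rule emb_in, rule eJ)
  show "additive (Z i) (e i)"
   unfolding additive_def
  proof (intro ballI)
   fix x y assume xy: "x : Z i" "y : Z i"
   show "e i (x + y) = e i x + e i y"
    unfolding e_def presentsD(5)[OF h[OF i] xy] hom_mult[OF system_mapD(1)[OF \<epsilon> i] hS[OF i xy(1)] hS[OF i xy(2)]]
    by (rule char_embed_mult[OF eJ[OF xy(1)] eJ[OF xy(2)]])
  qed
 next
  fix i j x assume ij: "i : I" "j : I" "r i j" and x: "x : Z j"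
  have "unemb (J 0) j (e j x) = \<epsilon> j (h j x)" unfolding e_def
   by (rule unemb_emb[OF J ij(2) system_mapD(3)[OF \<epsilon> ij(2) hS[OF ij(2) x]]])
  thus "e i (b i j x) = ebond (J 0) i j (e j x)"
   unfolding ebond_def using nat[OF ij x] system_mapD(2)[OF \<epsilon> ij hS[OF ij(2) x]] by (simp add: e_def)
 qed
 have "EX q'. presents ?L (rcocycles Z B b (Suc k)) (rboundaries Z B b k) q' &
   (ALL w:cochains k (esys (J 0)). ALL f:cochains (Suc k) Z. diff (ebond (J 0)) k w = capp (Suc k) e f --> q' f = q (capp k (p 0) w))"
 proof (rule connecting_presentation[OF ZB sJ aJ sJ e np _ _ q])
  fix i assume i: "i : I"
  show "e i x = 0 \<longleftrightarrow> x : B i" if x: "x : Z i" for x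
  proof -
   have "group_hom (grp S i) (grp (J 0) i) (\<epsilon> i)"
    using inverse_systemD(1)[OF S i] inverse_systemD(1)[OF J i] system_mapD(1)[OF \<epsilon> i]
    by (simp add: group_hom_def group_hom_axioms_def comm_group_def)
   then interpret \<epsilon>: group_hom "grp S i" "grp (J 0) i" "\<epsilon> i" .
   have "e i x = 0 \<longleftrightarrow> \<epsilon> i (h i x) = \<one>\<^bsub>grp (J 0) i\<^esub>"
    unfolding e_def by (rule char_embed_eq_0[OF inverse_systemD(1)[OF J i] system_mapD(3)[OF \<epsilon> i hS[OF i x]]])
   also have "\<dots> \<longleftrightarrow> h i x = \<one>\<^bsub>grp S i\<^esub>"
    using inj_on_eq_iff[OF \<epsilon>i(1)[OF i] hS[OF i x] group.is_monoid[THEN monoid.one_closed, OF comm_group.axioms(2)[OF inverse_systemD(1)[OF S i]]]] \<epsilon>.hom_one by simp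
   also have "\<dots> \<longleftrightarrow> x : B i" by (rule presentsD(6)[OF h[OF i] x])
   finally show ?thesis .
  qed
  have "{y : esys (J 0) i. p 0 i y = 0} = emap S (J 0) \<epsilon> i ` esys S i"
   unfolding p_def by (rule emap_exact[OF S J J \<epsilon> d i \<epsilon>i(2)[OF i]])
  also have "\<dots> = (%x. emb (J 0) i (\<epsilon> i x)) ` carrier (grp S i)"
   unfolding esys_def image_image by (rule image_cong[OF refl]) (rule emap_emb[OF S i])
  also have "carrier (grp S i) = h i ` Z i" using h[OF i] by (simp add: presents_def)
  finally show "{y : esys (J 0) i. p 0 i y = 0} = e i ` Z i" by (simp only: image_image e_def[abs_def])
 qed
 thus ?thesis unfolding L by blast
qed

end

section \<open>Chain complexes of systems of subgroups\<close>

abbreviation incl :: "'i => 'i => 'x => 'x"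
 where "incl \<equiv> %i j x. x"

context preordered_index
begin

lemma system_inclusion:
 assumes "!!i. i : I ==> subgrp (S i)" "!!i j. i : I ==> j : I ==> r i j ==> S j <= S i"
 shows "system S incl"
 unfolding system_def additive_def using assms by auto

text \<open>As \<open>N\<close> is acyclic, a cocycle modulo \<open>B\<close>, hence modulo \<open>N\<close>, can be corrected by a cochain of \<open>N\<close> to a cocycle of \<open>Z\<close>.
 The class of the correction does not depend on choices, which gives \<open>\<rho>\<close>.\<close>

lemma split_presentation:
 assumes Z: "system Z incl" and B: "system B incl" and N: "system N incl" "acyclic_system N incl"
  and BN: "!!i. i : I ==> B i <= N i" and NZ: "!!i. i : I ==> N i <= Z i"
  and Q: "presents Q (rcocycles Z B incl (Suc k)) (rboundaries Z B incl k) q"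
  and P: "presents P (rcocycles Z (%i. {0}) incl (Suc k)) (rboundaries Z (%i. {0}) incl k) u"
 shows "EX \<iota>:hom P Q. EX \<rho>:hom Q P. (ALL z:rcocycles Z (%i. {0}) incl (Suc k). \<iota> (u z) = q z) & (ALL c:carrier P. \<rho> (\<iota> c) = c)"
proof -
 let ?d = "diff incl"
 let ?ZB = "rcocycles Z B incl (Suc k)" and ?Z0 = "rcocycles Z (%i. {0}) incl (Suc k)"
 have cZ: "subgrp (cochains m Z)" for m using systemD(1)[OF Z] by (rule cochains_subgroup)
 have cN: "subgrp (cochains m N)" for m using systemD(1)[OF N(1)] by (rule cochains_subgroup)
 have NZc: "cochains m N <= cochains m Z" for m by (rule cochains_mono[OF NZ])
 have BNc: "cochains m B <= cochains m N" for m by (rule cochains_mono[OF BN])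
 have Z0: "z : ?Z0 \<longleftrightarrow> z : cochains (Suc k) Z & ?d (Suc k) z = 0" for z by (simp add: rcocycles_def cochains_zero)
 have Z0B: "z : ?ZB" if "z : ?Z0" for z
  using that subgrp_0[OF cochains_subgroup[OF systemD(1)[OF B]]] unfolding Z0 by (simp add: rcocycles_def)
 have R0: "z : rboundaries Z (%i. {0}) incl k \<longleftrightarrow> z : cochains (Suc k) Z & (EX g:cochains k Z. z = ?d k g)" for z
  by (simp add: rboundaries_def cochains_zero)
 have "EX \<iota>:hom P Q. ALL z z'. (z : ?Z0 & z' = z) --> \<iota> (u z) = q z'"
 proof (rule presents_hom_exists[OF P Q])
  show "additive_relation (%z z'. z : ?Z0 & z' = z)"
   using subgrp_diff[OF presentsD(2)[OF P]] by (auto simp: additive_relation_def)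
  show "z' : rboundaries Z B incl k" if zz: "z : ?Z0 & z' = z" and b: "z : rboundaries Z (%i. {0}) incl k" for z z'
  proof -
   obtain g where g: "g : cochains k Z" "z = ?d k g" "z : cochains (Suc k) Z" using b unfolding R0 by blast
   have "z - ?d k g : cochains (Suc k) B" using g subgrp_0[OF cochains_subgroup[OF systemD(1)[OF B]]] by simp
   hence "EX g:cochains k Z. z - ?d k g : cochains (Suc k) B" using g(1) by blast
   thus ?thesis using g(3) zz unfolding rboundaries_def by blast
  qed
 qed (use Z0B in auto)
 then obtain \<iota> where \<iota>: "\<iota> : hom P Q" "!!z. z : ?Z0 ==> \<iota> (u z) = q z" by blast
 let ?r = "%z z0. z : ?ZB & z0 : ?Z0 & z - z0 : cochains (Suc k) N"
 have "EX \<rho>:hom Q P. ALL z z0. ?r z z0 --> \<rho> (q z) = u z0"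
 proof (rule presents_hom_exists[OF Q P])
  show "additive_relation ?r"
   unfolding additive_relation_def
  proof (intro allI impI conjI; elim conjE)
   fix x y x' y' assume a: "x : ?ZB" "y : ?Z0" "x - y : cochains (Suc k) N" "x' : ?ZB" "y' : ?Z0" "x' - y' : cochains (Suc k) N"
   show "x - x' : ?ZB" by (rule subgrp_diff[OF presentsD(2)[OF Q] a(1,4)])
   show "y - y' : ?Z0" by (rule subgrp_diff[OF presentsD(2)[OF P] a(2,5)])
   have "(x - x') - (y - y') = (x - y) - (x' - y')" by simp
   thus "(x - x') - (y - y') : cochains (Suc k) N" using subgrp_diff[OF cN a(3,6)] by (simp only:)
  qed
  show "EX z0. ?r z z0" if z: "z : ?ZB" for z
  proof -
   have zZ: "z : cochains (Suc k) Z" and dz: "?d (Suc k) z : cochains (Suc (Suc k)) N"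
    using z BNc unfolding rcocycles_def by blast+
   obtain \<nu> where \<nu>: "\<nu> : cochains (Suc k) N" "?d (Suc k) \<nu> = ?d (Suc k) z"
    using acyclic_systemD[OF N(2) dz diff_diff[OF Z zZ]] by blast
   have \<nu>Z: "\<nu> : cochains (Suc k) Z" using \<nu>(1) NZc by blast
   have "z - \<nu> : ?Z0" unfolding Z0 using subgrp_diff[OF cZ zZ \<nu>Z] diff_sub[OF Z zZ \<nu>Z] \<nu>(2) by simp
   thus ?thesis using z \<nu>(1) by (intro exI[of _ "z - \<nu>"]) simp
  qed
  show "z0 : rboundaries Z (%i. {0}) incl k" if zz: "?r z z0" and b: "z : rboundaries Z B incl k" for z z0
  proof -
   obtain g where g: "g : cochains k Z" "z - ?d k g : cochains (Suc k) B" using b by (auto simp: rboundaries_def)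
   have z0: "z0 : cochains (Suc k) Z" "?d (Suc k) z0 = 0" and zN: "z - z0 : cochains (Suc k) N" using zz unfolding Z0 by blast+
   have dgZ: "?d k g : cochains (Suc k) Z" by (rule diff_cochain[OF Z g(1)])
   have gN: "z - ?d k g : cochains (Suc k) N" using g(2) BNc by blast
   have "(z - ?d k g) - (z - z0) = z0 - ?d k g" by simp
   hence y: "z0 - ?d k g : cochains (Suc k) N" using subgrp_diff[OF cN gN zN] by (simp only:)
   have "?d (Suc k) (z0 - ?d k g) = 0" using diff_sub[OF Z z0(1) dgZ] z0(2) diff_diff[OF Z g(1)] by simp
   then obtain \<nu> where \<nu>: "\<nu> : cochains k N" "?d k \<nu> = z0 - ?d k g" using acyclic_systemD[OF N(2) y] by blast
   have \<nu>Z: "\<nu> : cochains k Z" using \<nu>(1) NZc by blast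
   have "z0 = ?d k (g + \<nu>)" using diff_add[OF Z g(1) \<nu>Z] \<nu>(2) by simp
   thus ?thesis unfolding R0 using z0(1) subgrp_add[OF cZ g(1) \<nu>Z] by blast
  qed
 qed auto
 then obtain \<rho> where \<rho>: "\<rho> : hom Q P" "!!z z0. ?r z z0 ==> \<rho> (q z) = u z0" by blast
 have "\<rho> (\<iota> c) = c" if c: "c : carrier P" for c
 proof -
  obtain z where z: "z : ?Z0" "u z = c" using presentsD(4)[OF P c] by blast
  have "\<rho> (q z) = u z" by (rule \<rho>(2)) (use z(1) Z0B subgrp_0[OF cN] in simp)
  thus ?thesis using \<iota>(2)[OF z(1)] z(2) by simp
 qed
 thus ?thesis using \<iota> \<rho>(1) by blast
qed

text \<open>Two connecting maps in a row: from cochains modulo boundaries, through the boundaries \<open>B\<close>, to the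
 cycles \<open>Z'\<close> of the next degree.\<close>

lemma double_connecting_hom:
 assumes Z: "system Z incl" and B: "system B incl" and N: "system N incl" "acyclic_system N incl"
  and BN: "!!i. i : I ==> B i <= N i" and NZ: "!!i. i : I ==> N i <= Z i"
  and T: "system T incl" "acyclic_system T incl" and Z': "system Z' incl"
  and bdry: "!!i. i : I ==> additive (T i) bdry" "!!i. i : I ==> bdry ` T i = B i"
   "!!i. i : I ==> {t : T i. bdry t = 0} = Z' i"
  and Q: "presents Q (rcocycles Z B incl k) Bd q"
  and Bd: "!!z. z : Bd ==> z : rcocycles Z B incl k ==>
   EX y:cochains k Z. diff incl k y = 0 & z - y : cochains k B"
  and P: "presents P (rcocycles Z' (%i. {0}) incl (Suc (Suc k))) (rboundaries Z' (%i. {0}) incl (Suc k)) u"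
 shows "EX p:hom Q P. p ` carrier Q = carrier P & (ALL z:rcocycles Z B incl k.
  p (q z) = \<one>\<^bsub>P\<^esub> \<longleftrightarrow> (EX y:cochains k Z. diff incl k y = 0 & z - y : cochains k B))"
proof -
 let ?d = "diff incl"
 let ?ZB = "rcocycles Z B incl k" and ?P = "rcocycles Z' (%i. {0}) incl (Suc (Suc k))"
 let ?D = "%m. capp m (%i. bdry)"
 have cZ: "subgrp (cochains m Z)" for m using systemD(1)[OF Z] by (rule cochains_subgroup)
 have cB: "subgrp (cochains m B)" for m using systemD(1)[OF B] by (rule cochains_subgroup)
 have cT: "subgrp (cochains m T)" for m using systemD(1)[OF T(1)] by (rule cochains_subgroup)
 have cZ': "subgrp (cochains m Z')" for m using systemD(1)[OF Z'] by (rule cochains_subgroup)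
 have NZc: "cochains m N <= cochains m Z" for m by (rule cochains_mono[OF NZ])
 have BNc: "cochains m B <= cochains m N" for m by (rule cochains_mono[OF BN])
 have ZT: "cochains m Z' <= cochains m T" for m by (rule cochains_mono) (use bdry(3) in blast)
 have T0: "!!i. i : I ==> 0 : T i" using systemD(1)[OF T(1)] subgrp_0 by blast
 have nD: "natural T incl B incl (%i. bdry)" unfolding natural_def using bdry(1,2) by auto
 have kerD: "?D m t = 0 \<longleftrightarrow> t : cochains m Z'" if t: "t : cochains m T" for m t
 proof
  assume D0: "?D m t = 0"
  show "t : cochains m Z'"
  proof (rule cochainsI)
   fix xs assume xs: "xs : chains m"
   have "bdry (t xs) = 0" using fun_cong[OF D0, of xs] xs by (simp add: capp_def)
   thus "t xs : Z' (hd xs)" using cochainsD[OF t xs] bdry(3)[OF chains_hd[OF xs]] by blast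
  qed (rule cochains_off[OF t])
 next
  assume tZ: "t : cochains m Z'"
  have "bdry (t xs) = 0" if "xs : chains m" for xs using cochainsD[OF tZ that] bdry(3)[OF chains_hd[OF that]] by blast
  thus "?D m t = 0" by (auto simp: capp_def)
 qed
 have liftD: "EX t:cochains m T. ?D m t = c" if c: "c : cochains m B" for m c
  by (rule capp_lift[where S=T and e="%i. bdry", OF _ T0]) (use c cochains_mono[of B "%i. bdry ` T i" m] bdry(2) in blast)+
 have Zd: "z : cochains k Z" "?d k z : cochains (Suc k) B" if "z : ?ZB" for z using that by (auto simp: rcocycles_def)
 have P0: "z : ?P \<longleftrightarrow> z : cochains (Suc (Suc k)) Z' & ?d (Suc (Suc k)) z = 0" for z by (simp add: rcocycles_def cochains_zero)
 have R0: "z : rboundaries Z' (%i. {0}) incl (Suc k) \<longleftrightarrow> z : cochains (Suc (Suc k)) Z' & (EX g:cochains (Suc k) Z'. z = ?d (Suc k) g)" for z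
  by (simp add: rboundaries_def cochains_zero)
 let ?r = "%z z'. z : ?ZB & (EX t:cochains (Suc k) T. ?D (Suc k) t = ?d k z & z' = ?d (Suc k) t)"
 have dtP: "?d (Suc k) t : ?P" if z: "z : ?ZB" and t: "t : cochains (Suc k) T" "?D (Suc k) t = ?d k z" for z t
 proof -
  have "?D (Suc (Suc k)) (?d (Suc k) t) = ?d (Suc k) (?d k z)" using diff_capp[OF T(1) nD t(1)] t(2) by simp
  hence "?D (Suc (Suc k)) (?d (Suc k) t) = 0" using diff_diff[OF Z Zd(1)[OF z]] by simp
  thus ?thesis unfolding P0 using kerD[OF diff_cochain[OF T(1) t(1)]] diff_diff[OF T(1) t(1)] by blast
 qed
 have wd: "?d (Suc k) t : rboundaries Z' (%i. {0}) incl (Suc k)"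
  if z: "z : ?ZB" and t: "t : cochains (Suc k) T" "?D (Suc k) t = ?d k z"
   and y: "y : cochains k Z" "?d k y = 0" "z - y : cochains k B" for z t y
 proof -
  obtain s where s: "s : cochains k T" "?D k s = z - y" using liftD[OF y(3)] by blast
  have ds: "?d k s : cochains (Suc k) T" by (rule diff_cochain[OF T(1) s(1)])
  have "?D (Suc k) (?d k s) = ?d k (z - y)" using diff_capp[OF T(1) nD s(1)] s(2) by simp
  also have "\<dots> = ?d k z" using diff_sub[OF Z Zd(1)[OF z] y(1)] y(2) by simp
  finally have "?D (Suc k) (t - ?d k s) = 0" using capp_sub[OF T(1) nD t(1) ds] t(2) by simp
  hence g: "t - ?d k s : cochains (Suc k) Z'" using kerD[OF subgrp_diff[OF cT t(1) ds]] by blast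
  have "?d (Suc k) (t - ?d k s) = ?d (Suc k) t" using diff_sub[OF T(1) t(1) ds] diff_diff[OF T(1) s(1)] by simp
  thus ?thesis unfolding R0 using g dtP[OF z t] unfolding P0 by metis
 qed
 have "EX p:hom Q P. ALL z z'. ?r z z' --> p (q z) = u z'"
 proof (rule presents_hom_exists[OF Q P])
  show "additive_relation ?r"
   unfolding additive_relation_def
  proof (intro allI impI conjI; elim conjE bexE)
   fix x y x' y' t t' assume a: "x : ?ZB" "x' : ?ZB" "t : cochains (Suc k) T" "?D (Suc k) t = ?d k x" "y = ?d (Suc k) t"
    "t' : cochains (Suc k) T" "?D (Suc k) t' = ?d k x'" "y' = ?d (Suc k) t'"
   show "x - x' : ?ZB" by (rule subgrp_diff[OF presentsD(2)[OF Q] a(1,2)])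
   show "EX t:cochains (Suc k) T. ?D (Suc k) t = ?d k (x - x') & y - y' = ?d (Suc k) t"
    using subgrp_diff[OF cT a(3,6)] capp_sub[OF T(1) nD a(3,6)] diff_sub[OF T(1) a(3,6)]
     diff_sub[OF Z Zd(1)[OF a(1)] Zd(1)[OF a(2)]] a(4,5,7,8) by (intro bexI[of _ "t - t'"]) simp_all
  qed
  show "z : ?ZB & z' : ?P" if "?r z z'" for z z' using that dtP by blast
  show "EX z'. ?r z z'" if "z : ?ZB" for z using liftD[OF Zd(2)[OF that]] that by blast
  show "z' : rboundaries Z' (%i. {0}) incl (Suc k)" if rz: "?r z z'" and b: "z : Bd" for z z'
  proof -
   obtain t where t: "t : cochains (Suc k) T" "?D (Suc k) t = ?d k z" "z' = ?d (Suc k) t" using rz by blast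
   obtain y where y: "y : cochains k Z" "?d k y = 0" "z - y : cochains k B" using Bd[OF b] rz by blast
   show ?thesis unfolding t(3) by (rule wd[OF _ t(1,2) y]) (use rz in blast)
  qed
 qed
 then obtain p where p: "p : hom Q P" "!!z z'. ?r z z' ==> p (q z) = u z'" by blast
 have "c : p ` carrier Q" if c: "c : carrier P" for c
 proof -
  obtain z' where z': "z' : cochains (Suc (Suc k)) Z'" "?d (Suc (Suc k)) z' = 0" "u z' = c"
   using presentsD(4)[OF P c] unfolding rcocycles_def by (auto simp: cochains_zero)
  have zT: "z' : cochains (Suc (Suc k)) T" using z'(1) ZT by blast
  obtain t where t: "t : cochains (Suc k) T" "?d (Suc k) t = z'" using acyclic_systemD[OF T(2) zT z'(2)] by blast
  have DtB: "?D (Suc k) t : cochains (Suc k) B" by (rule capp_cochain[OF nD t(1)])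
  have "?d (Suc k) (?D (Suc k) t) = 0" using diff_capp[OF T(1) nD t(1)] kerD[OF zT] z'(1) t(2) by simp
  then obtain \<nu> where \<nu>: "\<nu> : cochains k N" "?d k \<nu> = ?D (Suc k) t" using acyclic_systemD[OF N(2)] DtB BNc by blast
  have "\<nu> : ?ZB" unfolding rcocycles_def using \<nu> NZc DtB by auto
  hence "?r \<nu> z'" using t \<nu>(2) by auto
  thus ?thesis using p(2) z'(3) presentsD(3)[OF Q \<open>\<nu> \<in> ?ZB\<close>] by (metis imageI)
 qed
 hence surj: "p ` carrier Q = carrier P" using hom_carrier[OF p(1)] by blast
 have "p (q z) = \<one>\<^bsub>P\<^esub> \<longleftrightarrow> (EX y:cochains k Z. ?d k y = 0 & z - y : cochains k B)" if z: "z : ?ZB" for z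
 proof -
  obtain t where t: "t : cochains (Suc k) T" "?D (Suc k) t = ?d k z" using liftD[OF Zd(2)[OF z]] by blast
  have "?r z (?d (Suc k) t)" using z t by blast
  have "p (q z) = \<one>\<^bsub>P\<^esub> \<longleftrightarrow> ?d (Suc k) t : rboundaries Z' (%i. {0}) incl (Suc k)"
   unfolding p(2)[OF \<open>?r z (?d (Suc k) t)\<close>] by (rule presentsD(6)[OF P dtP[OF z t]])
  also have "\<dots> \<longleftrightarrow> (EX y:cochains k Z. ?d k y = 0 & z - y : cochains k B)"
  proof
   assume "?d (Suc k) t : rboundaries Z' (%i. {0}) incl (Suc k)"
   then obtain g where g: "g : cochains (Suc k) Z'" "?d (Suc k) t = ?d (Suc k) g" unfolding R0 by blast
   have gT: "g : cochains (Suc k) T" using g(1) ZT by blast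
   have "?d (Suc k) (t - g) = 0" using diff_sub[OF T(1) t(1) gT] g(2) by simp
   then obtain s where s: "s : cochains k T" "?d k s = t - g" using acyclic_systemD[OF T(2) subgrp_diff[OF cT t(1) gT]] by blast
   have DsB: "?D k s : cochains k B" by (rule capp_cochain[OF nD s(1)])
   hence DsZ: "?D k s : cochains k Z" using BNc NZc by blast
   have "?d k (?D k s) = ?D (Suc k) (t - g)" using diff_capp[OF T(1) nD s(1)] s(2) by simp
   also have "\<dots> = ?d k z" using capp_sub[OF T(1) nD t(1) gT] kerD[OF gT] g(1) t(2) by simp
   finally have "?d k (z - ?D k s) = 0" using diff_sub[OF Z Zd(1)[OF z] DsZ] by simp
   thus "EX y:cochains k Z. ?d k y = 0 & z - y : cochains k B"
    using subgrp_diff[OF cZ Zd(1)[OF z] DsZ] DsB by (intro bexI[of _ "z - ?D k s"]) simp_all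
  next
   assume "EX y:cochains k Z. ?d k y = 0 & z - y : cochains k B"
   thus "?d (Suc k) t : rboundaries Z' (%i. {0}) incl (Suc k)" using wd[OF z t] by blast
  qed
  finally show ?thesis .
 qed
 thus ?thesis using p(1) surj by blast
qed

end

section \<open>Dual chains of a filtered cochain complex\<close>

locale cochain_complex =
 fixes P :: "int => 'p::ab_group_add set" and \<delta> :: "'p => 'p"
  and \<pi> :: "'e::ab_group_add => 'f::ab_group_add"
 assumes P: "subgrp (P q)" and \<delta>_add: "additive (P q) \<delta>"
  and \<delta>_in: "ph : P q ==> \<delta> ph : P (q + 1)" and \<delta>_\<delta>: "ph : P q ==> \<delta> (\<delta> ph) = 0"
  and divE: "divisible (UNIV :: 'e set)" and \<pi>_add: "additive UNIV \<pi>" and divF: "divisible (range \<pi>)"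
begin

definition subcomplex :: "(int => 'p set) => bool"
 where "subcomplex K \<longleftrightarrow> (ALL q. subgrp (K q) & K q <= P q & \<delta> ` K q <= K (q + 1))"

lemma subcomplexD:
 assumes "subcomplex K"
 shows "subgrp (K q)" "ph : K q ==> ph : P q" "ph : K q ==> \<delta> ph : K (q + 1)"
 using assms unfolding subcomplex_def by blast+

definition codiff :: "int => ('p => 'x) => 'p => 'x::ab_group_add"
 where "codiff q f = (%ph. if ph : P q then f (\<delta> ph) else 0)"

definition push :: "int => ('p => 'e) => 'p => 'f"
 where "push q f = (%ph. if ph : P q then \<pi> (f ph) else 0)"

text \<open>These are the chains of the mapping cone of \<open>Hom(P / K, E) \<rightarrow> Hom(P / K, F)\<close>, which has both
 components divisible and replaces the complex of homomorphisms into the kernel of \<open>\<pi>\<close>.\<close>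

definition cone :: "(int => 'p set) => int => (('p => 'e) \<times> ('p => 'f)) set"
 where "cone K q = annih (P q) (K q) UNIV \<times> annih (P (q + 1)) (K (q + 1)) (range \<pi>)"

definition bd :: "int => ('p => 'e) \<times> ('p => 'f) => ('p => 'e) \<times> ('p => 'f)"
 where "bd q t = (codiff (q - 1) (fst t), push q (fst t) - codiff q (snd t))"

definition cone_cycles :: "(int => 'p set) => int => (('p => 'e) \<times> ('p => 'f)) set"
 where "cone_cycles K q = {t : cone K q. bd q t = 0}"

definition cone_boundaries :: "(int => 'p set) => int => (('p => 'e) \<times> ('p => 'f)) set"
 where "cone_boundaries K q = bd (q + 1) ` cone K (q + 1)"

text \<open>The cycles whose class pairs to zero with the cohomology of \<open>P / K\<close>. They lie between the
 boundaries and the cycles and, unlike these, form an acyclic system.\<close>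

definition null_cycles :: "(int => 'p set) => int => (('p => 'e) \<times> ('p => 'f)) set"
 where "null_cycles K q = {t : cone_cycles K q. ALL ph:P q. \<delta> ph : K (q + 1) --> fst t ph = 0}"

lemma \<pi>0: "\<pi> 0 = 0" by (rule additive_0[OF subgrp_UNIV \<pi>_add])
lemma \<pi>_diff: "\<pi> (x - y) = \<pi> x - \<pi> y" by (rule additive_diff[OF subgrp_UNIV \<pi>_add]) simp_all
lemma \<pi>_plus: "\<pi> (x + y) = \<pi> x + \<pi> y" by (rule additiveD[OF \<pi>_add]) simp_all
lemma P0: "0 : P q" by (rule subgrp_0[OF P])
lemma \<delta>0: "\<delta> 0 = 0" by (rule additive_0[OF P \<delta>_add[of undefined]])
lemma \<delta>_diff: "ph : P q ==> ps : P q ==> \<delta> (ph - ps) = \<delta> ph - \<delta> ps" by (rule additive_diff[OF P \<delta>_add])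
lemma \<delta>_plus: "ph : P q ==> ps : P q ==> \<delta> (ph + ps) = \<delta> ph + \<delta> ps" by (rule additiveD[OF \<delta>_add])
lemma \<delta>_pred: "ph : P (q - 1) ==> \<delta> ph : P q" using \<delta>_in[of ph "q - 1"] by simp
lemma subE: "subgrp (UNIV :: 'e set)" and subF: "subgrp (range \<pi>)"
 using divF by (simp_all add: divisible_def)

lemma codiff_diff: "codiff q (f - g) = codiff q f - codiff q g"
 by (simp add: codiff_def fun_eq_iff)
lemma push_diff: "push q (f - g) = push q f - push q g"
 by (simp add: push_def fun_eq_iff \<pi>_diff)
lemma bd_diff: "bd q (s - t) = bd q s - bd q t"
 by (simp add: bd_def codiff_diff push_diff minus_prod_def)
lemma bd_additive: "additive S (bd q)"
proof -
 have "bd q (s + t) = bd q s + bd q t" for s t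
  using bd_diff[of q "s + t" t] by (simp add: algebra_simps)
 thus ?thesis by (simp add: additive_def)
qed
lemma codiff_in:
 assumes K: "subcomplex K" and f: "f : annih (P (q + 1)) (K (q + 1)) D" and D: "0 : D"
 shows "codiff q f : annih (P q) (K q) D"
proof (rule annihI)
 show "additive (P q) (codiff q f)"
  unfolding additive_def
  using additiveD[OF annihD(1)[OF f] \<delta>_in \<delta>_in] by (simp add: codiff_def subgrp_add[OF P] \<delta>_plus)
 show "codiff q f x : D" if "x : P q" for x using annihD(2)[OF f \<delta>_in[OF that]] D by (simp add: codiff_def)
 show "codiff q f x = 0" if "x : K q" for x
  using annihD(4)[OF f subcomplexD(3)[OF K that]] by (simp add: codiff_def)
qed (simp add: codiff_def)

lemma push_in:
 assumes f: "f : annih (P q) L UNIV"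
 shows "push q f : annih (P q) L (range \<pi>)"
proof (rule annihI)
 show "additive (P q) (push q f)"
  unfolding additive_def
  using additiveD[OF annihD(1)[OF f]] by (simp add: push_def subgrp_add[OF P] \<pi>_plus)
 show "push q f x = 0" if "x : L" for x using annihD(4)[OF f that] by (simp add: push_def \<pi>0)
qed (simp_all add: push_def)

lemma coneD:
 assumes "t : cone K q"
 shows "fst t : annih (P q) (K q) UNIV" "snd t : annih (P (q + 1)) (K (q + 1)) (range \<pi>)"
 using assms by (auto simp: cone_def)

lemma coneI:
 "f : annih (P q) (K q) UNIV ==> g : annih (P (q + 1)) (K (q + 1)) (range \<pi>) ==> (f, g) : cone K q"
 by (simp add: cone_def)

lemma cone_fst: "f : annih (P q) (K q) UNIV ==> (f, 0) : cone K q"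
 using subgrp_0[OF annih_subgroup[OF subF]] by (simp add: cone_def)

lemma cone_subgroup: "subgrp (cone K q)"
 using annih_subgroup[OF subE, of "P q" "K q"] annih_subgroup[OF subF, of "P (q + 1)" "K (q + 1)"]
 unfolding cone_def subgrp_def by (auto simp: zero_prod_def minus_prod_def)

lemma bd_fst: "bd q (f, 0) = (codiff (q - 1) f, push q f)"
 by (simp add: bd_def codiff_def fun_eq_iff)

lemma bd_in:
 assumes K: "subcomplex K" and t: "t : cone K q" shows "bd q t : cone K (q - 1)"
proof -
 have f: "fst t : annih (P (q - 1 + 1)) (K (q - 1 + 1)) UNIV" using coneD(1)[OF t] by simp
 have "push q (fst t) - codiff q (snd t) : annih (P q) (K q) (range \<pi>)"
  by (rule subgrp_diff[OF annih_subgroup[OF subF] push_in[OF coneD(1)[OF t]]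
     codiff_in[OF K coneD(2)[OF t] subgrp_0[OF subF]]])
 thus ?thesis unfolding bd_def using codiff_in[OF K f] by (intro coneI) simp_all
qed

lemma bd_bd:
 assumes t: "t : cone K q" shows "bd (q - 1) (bd q t) = 0"
proof -
 have "fst t 0 = 0" "snd t 0 = 0"
  using additive_0[OF P annihD(1)[OF coneD(1)[OF t]]] additive_0[OF P annihD(1)[OF coneD(2)[OF t]]] by simp_all
 thus ?thesis using \<delta>_\<delta> \<delta>_pred P0
  by (auto simp: bd_def codiff_def push_def zero_prod_def fun_eq_iff)
qed

lemma cone_cycles_subgroup: "subgrp (cone_cycles K q)"
 unfolding cone_cycles_def by (rule subgrp_kernel[OF cone_subgroup bd_additive])

lemma cone_boundaries_subgroup: "subgrp (cone_boundaries K q)"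
 unfolding cone_boundaries_def by (rule subgrp_image[OF cone_subgroup bd_additive])

lemma null_cycles_subgroup: "subgrp (null_cycles K q)"
 using cone_cycles_subgroup[of K q] unfolding null_cycles_def subgrp_def by (auto simp: zero_prod_def)

lemma null_cycles_le: "null_cycles K q <= cone_cycles K q"
 by (auto simp: null_cycles_def)

lemma boundaries_null:
 assumes K: "subcomplex K" shows "cone_boundaries K q <= null_cycles K q"
proof
 fix x assume "x : cone_boundaries K q"
 then obtain t where t: "t : cone K (q + 1)" "x = bd (q + 1) t" by (auto simp: cone_boundaries_def)
 have "fst x ph = 0" if "ph : P q" "\<delta> ph : K (q + 1)" for ph
  using annihD(4)[OF coneD(1)[OF t(1)] that(2)] by (simp add: t(2) bd_def codiff_def)
 thus "x : null_cycles K q"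
  using bd_in[OF K t(1)] bd_bd[OF t(1)] by (simp add: null_cycles_def cone_cycles_def t(2))
qed

lemma annih_antimono: "L <= K ==> annih Q K D <= annih Q L D"
 by (auto simp: annih_def)

lemma cone_antimono: "(!!q. L q <= K q) ==> cone K q <= cone L q"
 unfolding cone_def by (intro Sigma_mono annih_antimono)

lemma cone_boundaries_antimono: "(!!q. L q <= K q) ==> cone_boundaries K q <= cone_boundaries L q"
 unfolding cone_boundaries_def by (intro image_mono cone_antimono)

lemma cone_cycles_antimono: "(!!q. L q <= K q) ==> cone_cycles K q <= cone_cycles L q"
 using cone_antimono[of L K q] by (auto simp: cone_cycles_def)

lemma null_cycles_antimono: "(!!q. L q <= K q) ==> null_cycles K q <= null_cycles L q"
 using cone_cycles_antimono[of L K q] unfolding null_cycles_def by blast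

text \<open>A homomorphism killing all relative cocycles factors through \<open>\<delta>\<close>; its image under \<open>\<pi>\<close> then extends from the
 coboundaries since \<open>F\<close> is divisible.\<close>

lemma null_cycles_fst:
 assumes K: "subcomplex K" and u: "u : annih (P q) {ph : P q. \<delta> ph : K (q + 1)} UNIV"
 shows "EX v. (u, v) : null_cycles K q"
proof -
 let ?K = "K (q + 1)"
 note sK = subcomplexD[OF K]
 have u0: "u ph = 0" if "ph : P q" "\<delta> ph : ?K" for ph using annihD(4)[OF u] that by simp
 have KP: "?K <= P (q + 1)" using sK(2) by blast
 have pu: "additive (P q) (%ph. \<pi> (u ph))" using annihD(1)[OF u] by (simp add: additive_def \<pi>_plus)
 have "EX G. additive (P (q + 1)) G & G ` P (q + 1) <= range \<pi> & (ALL ph:P q. G (\<delta> ph) = \<pi> (u ph)) & (ALL \<kappa>:?K. G \<kappa> = 0)"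
  by (rule divisible_extends_along[OF P divF P sK(1) KP \<delta>_add _ pu]) (use \<delta>_in u0 \<pi>0 in auto)
 then obtain G where G: "additive (P (q + 1)) G" "G ` P (q + 1) <= range \<pi>"
  and GD: "!!ph. ph : P q ==> G (\<delta> ph) = \<pi> (u ph)" and GK: "!!\<kappa>. \<kappa> : ?K ==> G \<kappa> = 0" by blast
 define v where "v = (%x. if x : P (q + 1) then G x else 0)"
 have v: "v : annih (P (q + 1)) ?K (range \<pi>)"
 proof (rule annihI)
  show "additive (P (q + 1)) v"
   using G(1) subgrp_add[OF P] unfolding additive_def v_def by simp
 qed (use G(2) GK in \<open>auto simp: v_def\<close>)
 have uK: "u : annih (P q) (K q) UNIV"
  using u annih_antimono[of "K q" "{ph : P q. \<delta> ph : ?K}"] sK(2,3) by blast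
 have "u (\<delta> ps) = 0" if "ps : P (q - 1)" for ps
  using u0[OF \<delta>_pred[OF that]] \<delta>_\<delta>[OF that] subgrp_0[OF sK(1)] by simp
 moreover have "v (\<delta> ph) = \<pi> (u ph)" if "ph : P q" for ph
  using GD[OF that] \<delta>_in[OF that] by (simp add: v_def)
 ultimately have "bd q (u, v) = 0"
  by (auto simp: bd_def codiff_def push_def zero_prod_def fun_eq_iff)
 thus ?thesis using coneI[OF uK v] u0 by (auto simp: null_cycles_def cone_cycles_def)
qed

text \<open>The comparison of two subcomplexes \<open>K \<subseteq> L\<close> whose quotient is acyclic.\<close>

lemma annih_correction:
 fixes D :: "'x::ab_group_add set"
 assumes K: "subcomplex K" and L: "subcomplex L"
  and taut: "!!ph. ph : L q ==> \<delta> ph : K (q + 1) ==> EX ps:L (q - 1). ph - \<delta> ps : K q"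
  and D: "divisible D" and h: "h : annih (P q) (K q) D" and h\<delta>: "!!ps. ps : L (q - 1) ==> h (\<delta> ps) = 0"
 shows "EX a:annih (P (q + 1)) (K (q + 1)) D. ALL ph:L q. a (\<delta> ph) = h ph"
proof -
 let ?K = "K (q + 1)"
 note sK = subcomplexD[OF K] and sL = subcomplexD[OF L]
 have LP: "L q <= P q" and KP: "?K <= P (q + 1)" using sL(2) sK(2) by blast+
 have null: "h ph = 0" if ph: "ph : L q" "\<delta> ph : ?K" for ph
 proof -
  obtain ps where ps: "ps : L (q - 1)" "ph - \<delta> ps : K q" using taut[OF ph] by blast
  have "h (ph - \<delta> ps) = h ph - h (\<delta> ps)"
   by (rule additive_diff[OF P annihD(1)[OF h] sL(2)[OF ph(1)] \<delta>_pred[OF sL(2)[OF ps(1)]]])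
  thus ?thesis using annihD(4)[OF h ps(2)] h\<delta>[OF ps(1)] by simp
 qed
 have "EX G. additive (P (q + 1)) G & G ` P (q + 1) <= D & (ALL ph:L q. G (\<delta> ph) = h ph) & (ALL \<kappa>:?K. G \<kappa> = 0)"
  by (rule divisible_extends_along[OF P D sL(1) sK(1) KP additive_subset[OF \<delta>_add LP] _ additive_subset[OF annihD(1)[OF h] LP] _ null])
   (use \<delta>_in LP annihD(2)[OF h] in auto)
 then obtain G where G: "additive (P (q + 1)) G" "G ` P (q + 1) <= D"
  and G\<delta>: "!!ph. ph : L q ==> G (\<delta> ph) = h ph" and GK: "!!\<kappa>. \<kappa> : ?K ==> G \<kappa> = 0" by blast
 define a where "a = (%x. if x : P (q + 1) then G x else 0)"
 have "a : annih (P (q + 1)) ?K D"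
 proof (rule annihI)
  show "additive (P (q + 1)) a"
   using G(1) subgrp_add[OF P] unfolding additive_def a_def by simp
 qed (use G(2) GK in \<open>auto simp: a_def\<close>)
 moreover have "a (\<delta> ph) = h ph" if "ph : L q" for ph
  using G\<delta>[OF that] \<delta>_in[OF sL(2)[OF that]] by (simp add: a_def)
 ultimately show ?thesis by blast
qed

lemma cone_correction:
 assumes K: "subcomplex K" and L: "subcomplex L" and KL: "!!q. K q <= L q"
  and taut: "!!q ph. ph : L q ==> \<delta> ph : K (q + 1) ==> EX ps:L (q - 1). ph - \<delta> ps : K q"
  and t: "t : cone K q" "bd q t : cone L (q - 1)"
 shows "EX s:cone K (q + 1). t - bd (q + 1) s : cone L q"
proof -
 obtain f g where fg: "t = (f, g)" by (cases t)
 have f: "f : annih (P q) (K q) UNIV" and g: "g : annih (P (q + 1)) (K (q + 1)) (range \<pi>)"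
  using coneD[OF t(1)] by (simp_all add: fg)
 note sL = subcomplexD[OF L]
 have f\<delta>: "f (\<delta> ps) = 0" if "ps : L (q - 1)" for ps
  using annihD(4)[OF coneD(1)[OF t(2)] that] sL(2)[OF that] by (simp add: fg bd_def codiff_def)
 have g\<delta>: "\<pi> (f ps) = g (\<delta> ps)" if "ps : L q" for ps
  using annihD(4)[OF coneD(2)[OF t(2)], of ps] that sL(2)[OF that] by (simp add: fg bd_def codiff_def push_def)
 obtain a where a: "a : annih (P (q + 1)) (K (q + 1)) UNIV" "!!ph. ph : L q ==> a (\<delta> ph) = f ph"
  using annih_correction[OF K L taut divE f f\<delta>] by blast
 let ?h = "push (q + 1) a - g"
 have h: "?h : annih (P (q + 1)) (K (q + 1)) (range \<pi>)"
  by (rule subgrp_diff[OF annih_subgroup[OF subF] push_in[OF a(1)] g])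
 have h\<delta>: "?h (\<delta> ps) = 0" if "ps : L (q + 1 - 1)" for ps
  using that a(2) g\<delta> \<delta>_in[OF sL(2)] by (simp add: push_def)
 obtain b where b: "b : annih (P (q + 1 + 1)) (K (q + 1 + 1)) (range \<pi>)" "!!ph. ph : L (q + 1) ==> b (\<delta> ph) = ?h ph"
  using annih_correction[OF K L taut divF h h\<delta>] by blast
 have s: "(a, b) : cone K (q + 1)" by (rule coneI[OF a(1) b(1)])
 let ?t = "t - bd (q + 1) (a, b)"
 have tK: "?t : cone K q" using subgrp_diff[OF cone_subgroup t(1)] bd_in[OF K s] by simp
 have "fst ?t ph = 0" if "ph : L q" for ph
  using a(2)[OF that] sL(2)[OF that] by (simp add: fg bd_def codiff_def)
 moreover have "snd ?t ph = 0" if "ph : L (q + 1)" for ph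
  using b(2)[OF that] sL(2)[OF that] by (simp add: fg bd_def codiff_def)
 ultimately have "?t : cone L q"
  using coneD[OF tK] unfolding cone_def annih_def by (cases ?t) simp
 thus ?thesis using s by blast
qed

text \<open>Lifting along \<open>\<pi>\<close> identifies the homology of the homomorphisms into the kernel of \<open>\<pi>\<close>
 with that of the cone.\<close>

definition dual_cycles :: "(int => 'p set) => int => ('p => 'e) set"
 where "dual_cycles K q = {f : annih (P q) (K q) {x. \<pi> x = 0}. codiff (q - 1) f = 0}"

definition dual_boundaries :: "(int => 'p set) => int => ('p => 'e) set"
 where "dual_boundaries K q = codiff q ` annih (P (q + 1)) (K (q + 1)) {x. \<pi> x = 0}"

definition homologous :: "(int => 'p set) => int => ('p => 'e) => ('p => 'e) \<times> ('p => 'f) => bool"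
 where "homologous K q f t \<longleftrightarrow> f : dual_cycles K q & t : cone_cycles K q & (f, 0) - t : cone_boundaries K q"

lemma cone_homology_presented:
 assumes K: "subcomplex K"
  and lifts: "!!m g. g : annih (P m) (K m) (range \<pi>) ==> EX f:annih (P m) (K m) UNIV. push m f = g"
  and Q: "presents Q (dual_cycles K q) (dual_boundaries K q) h"
 shows "EX h'. presents Q (cone_cycles K q) (cone_boundaries K q) h' &
  (ALL f t. homologous K q f t --> h' t = h f) & (ALL t:cone_cycles K q. EX f. homologous K q f t)"
proof -
 have ker: "f : annih (P m) (K m) {x. \<pi> x = 0} \<longleftrightarrow> f : annih (P m) (K m) UNIV & push m f = 0" for f m
  by (auto simp: annih_def homs_def push_def fun_eq_iff)
 have cyc: "(f, 0) : cone_cycles K q" if f: "f : dual_cycles K q" for f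
  using f ker subgrp_0[OF annih_subgroup[OF subF]]
  by (auto simp: cone_cycles_def cone_def dual_cycles_def bd_fst zero_prod_def)
  have tot': "EX f. homologous K q f t" if t: "t : cone_cycles K q" for t
  proof -
   have tK: "t : cone K q" and bt: "bd q t = 0" using t by (auto simp: cone_cycles_def)
   obtain a where a: "a : annih (P (q + 1)) (K (q + 1)) UNIV" "push (q + 1) a = snd t"
    using lifts[OF coneD(2)[OF tK]] by blast
   have s: "(a, 0) : cone K (q + 1)"
    by (rule cone_fst, rule a(1))
   let ?f = "fst t - codiff q a"
   have eq: "(?f, 0) = t - bd (q + 1) (a, 0)" by (cases t) (use a(2) in \<open>simp add: bd_fst minus_prod_def\<close>)
   have b: "bd (q + 1) (a, 0) : cone_boundaries K q" using s by (auto simp: cone_boundaries_def)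
   have "(?f, 0) : cone_cycles K q" unfolding eq
    by (rule subgrp_diff[OF cone_cycles_subgroup t])
     (use b boundaries_null[OF K] null_cycles_le in blast)
   hence "?f : dual_cycles K q" using ker
    by (auto simp: cone_cycles_def cone_def dual_cycles_def bd_fst zero_prod_def)
   moreover have "(?f, 0) - t : cone_boundaries K q"
    unfolding eq using subgrp_minus[OF cone_boundaries_subgroup b] by simp
   ultimately show ?thesis using t by (auto simp: homologous_def)
  qed
 have "EX h'. presents Q (cone_cycles K q) (cone_boundaries K q) h' & (ALL f t. homologous K q f t --> h' t = h f)"
 proof (rule presents_transport[OF Q cone_cycles_subgroup])
  show "additive_relation (homologous K q)"
   unfolding additive_relation_def homologous_def
  proof (intro allI impI conjI; elim conjE)
   fix f t f' t' assume a: "f : dual_cycles K q" "f' : dual_cycles K q" "t : cone_cycles K q" "t' : cone_cycles K q"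
    "(f, 0) - t : cone_boundaries K q" "(f', 0) - t' : cone_boundaries K q"
   show "f - f' : dual_cycles K q" by (rule subgrp_diff[OF presentsD(2)[OF Q] a(1,2)])
   show "t - t' : cone_cycles K q" by (rule subgrp_diff[OF cone_cycles_subgroup a(3,4)])
   have "((f, 0) - t) - ((f', 0) - t') = (f - f', 0) - (t - t')" by (simp add: minus_prod_def)
   thus "(f - f', 0) - (t - t') : cone_boundaries K q"
    using subgrp_diff[OF cone_boundaries_subgroup a(5,6)] by (simp only:)
  qed
  show "f : dual_cycles K q & t : cone_cycles K q" if "homologous K q f t" for f t
   using that by (simp add: homologous_def)
  show "EX t. homologous K q f t" if "f : dual_cycles K q" for f
   using that cyc[OF that] subgrp_0[OF cone_boundaries_subgroup] by (intro exI[of _ "(f, 0)"]) (simp add: homologous_def)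
  show "EX f. homologous K q f t" if "t : cone_cycles K q" for t by (rule tot'[OF that])
  show "f : dual_boundaries K q \<longleftrightarrow> t : cone_boundaries K q" if ft: "homologous K q f t" for f t
  proof -
   have d: "(f, 0) - t : cone_boundaries K q" using ft by (simp add: homologous_def)
   have "t : cone_boundaries K q \<longleftrightarrow> (f, 0) : cone_boundaries K q"
    using subgrp_add[OF cone_boundaries_subgroup d, of t] subgrp_diff[OF cone_boundaries_subgroup _ d, of "(f, 0)"]
    by auto
   also have "\<dots> \<longleftrightarrow> f : dual_boundaries K q"
   proof
    assume "(f, 0) : cone_boundaries K q"
    then obtain a b where ab: "(a, b) : cone K (q + 1)" "bd (q + 1) (a, b) = (f, 0)"
     unfolding cone_boundaries_def by (metis imageE surj_pair)
    have b: "b : annih (P (q + 1 + 1)) (K (q + 1 + 1)) (range \<pi>)" and a: "a : annih (P (q + 1)) (K (q + 1)) UNIV"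
     using coneD[OF ab(1)] by simp_all
    obtain b' where b': "b' : annih (P (q + 1 + 1)) (K (q + 1 + 1)) UNIV" "push (q + 1 + 1) b' = b"
     using lifts[OF b] by blast
    let ?a = "a - codiff (q + 1) b'"
    have aU: "?a : annih (P (q + 1)) (K (q + 1)) UNIV"
     by (rule subgrp_diff[OF annih_subgroup[OF subE] a codiff_in[OF K b'(1)]]) simp
    have "push (q + 1) (codiff (q + 1) b') = codiff (q + 1) b"
     unfolding b'(2)[symmetric] using \<delta>_in[of _ "q + 1"] by (auto simp: push_def codiff_def fun_eq_iff)
    hence "push (q + 1) ?a = 0" using ab(2) by (simp add: bd_def push_diff)
    hence "?a : annih (P (q + 1)) (K (q + 1)) {x. \<pi> x = 0}" using ker aU by blast
    moreover have "codiff q (codiff (q + 1) b') = 0"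
     using \<delta>_\<delta> \<delta>_in additive_0[OF P annihD(1)[OF b'(1)]] by (auto simp: codiff_def fun_eq_iff)
    hence "codiff q ?a = f" using ab(2) by (simp add: bd_def codiff_diff)
    ultimately show "f : dual_boundaries K q" unfolding dual_boundaries_def by blast
   next
    assume "f : dual_boundaries K q"
    then obtain a where a: "a : annih (P (q + 1)) (K (q + 1)) {x. \<pi> x = 0}" "f = codiff q a"
     unfolding dual_boundaries_def by blast
    have "(a, 0) : cone K (q + 1)"
     using a(1) ker cone_fst by blast
    moreover have "bd (q + 1) (a, 0) = (f, 0)" using a ker by (simp add: bd_fst)
    ultimately show "(f, 0) : cone_boundaries K q" unfolding cone_boundaries_def by (metis imageI)
   qed
   finally show ?thesis by blast
  qed
 qed
 thus ?thesis using tot' by blast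
qed

lemma homologous_antimono:
 assumes "homologous K q f t" "!!q. L q <= K q" shows "homologous L q f t"
 using assms(1) cone_cycles_antimono[of L K q, OF assms(2)] cone_boundaries_antimono[of L K q, OF assms(2)]
  annih_antimono[of "L q" "K q" "P q" "{x. \<pi> x = 0}", OF assms(2)]
 unfolding homologous_def dual_cycles_def by blast

end

section \<open>The exact sequence of a tautly filtered complex\<close>

lemma exact_atI:
 assumes "group A" "group B" "group C" "f : hom A B" "g : hom B C"
  and "!!y. y : carrier B ==> g y = \<one>\<^bsub>C\<^esub> \<longleftrightarrow> y : f ` carrier A"
 shows "exact_at A f B g C"
 unfolding exact_at_def group_hom_def group_hom_axioms_def kernel_def
 using assms hom_carrier[OF assms(4)] by blast

text \<open>If \<open>B\<close> splits as \<open>\<iota> A \<oplus> ker \<rho>\<close> and \<open>p\<close> is a surjection with kernel \<open>\<iota> A\<close>, then \<open>p\<close> has a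
 section with values in the complement \<open>ker \<rho>\<close>.\<close>

lemma section_into_complement:
 assumes A: "comm_group A" and B: "comm_group B" and C: "comm_group C"
  and \<iota>: "\<iota> : hom A B" and \<rho>: "\<rho> : hom B A" and \<rho>\<iota>: "!!c. c : carrier A ==> \<rho> (\<iota> c) = c"
  and p: "p : hom B C" "p ` carrier B = carrier C"
  and ker: "!!y. y : carrier B ==> p y = \<one>\<^bsub>C\<^esub> \<longleftrightarrow> y : \<iota> ` carrier A"
 shows "EX s:hom C B. (ALL c:carrier C. s c = \<one>\<^bsub>B\<^esub> \<longleftrightarrow> c = \<one>\<^bsub>C\<^esub>) &
  (ALL y:carrier B. \<rho> y = \<one>\<^bsub>A\<^esub> \<longleftrightarrow> y : s ` carrier C)"
proof -
 interpret A: comm_group A by (rule A)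
 interpret B: comm_group B by (rule B)
 interpret C: comm_group C by (rule C)
 interpret \<iota>: group_hom A B \<iota> by unfold_locales (rule \<iota>)
 interpret \<rho>: group_hom B A \<rho> by unfold_locales (rule \<rho>)
 interpret p: group_hom B C p by unfold_locales (rule p(1))
 have pinj: "y = y'" if y: "y : carrier B" "y' : carrier B" "\<rho> y = \<one>\<^bsub>A\<^esub>" "\<rho> y' = \<one>\<^bsub>A\<^esub>" "p y = p y'" for y y'
 proof -
  have "p (y \<otimes>\<^bsub>B\<^esub> inv\<^bsub>B\<^esub> y') = \<one>\<^bsub>C\<^esub>" using y by simp
  then obtain a where a: "a : carrier A" "y \<otimes>\<^bsub>B\<^esub> inv\<^bsub>B\<^esub> y' = \<iota> a"
   using ker[OF B.m_closed[OF y(1) B.inv_closed[OF y(2)]]] by blast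
  have "\<rho> (y \<otimes>\<^bsub>B\<^esub> inv\<^bsub>B\<^esub> y') = \<one>\<^bsub>A\<^esub>" using y by simp
  hence "a = \<one>\<^bsub>A\<^esub>" using a \<rho>\<iota> by simp
  hence "y \<otimes>\<^bsub>B\<^esub> inv\<^bsub>B\<^esub> y' = \<one>\<^bsub>B\<^esub>" using a(2) by simp
  thus ?thesis using y(1,2) by (metis B.inv_closed B.inv_equality B.inv_inv)
 qed
 have ex: "EX y. y : carrier B & \<rho> y = \<one>\<^bsub>A\<^esub> & p y = c" if c: "c : carrier C" for c
 proof -
  obtain x where x: "x : carrier B" "p x = c" using c p(2) by (metis imageE)
  have p1: "p (\<iota> (\<rho> x)) = \<one>\<^bsub>C\<^esub>" using ker x(1) by simp
  have "\<rho> (x \<otimes>\<^bsub>B\<^esub> inv\<^bsub>B\<^esub> \<iota> (\<rho> x)) = \<one>\<^bsub>A\<^esub>" using x(1) \<rho>\<iota> by simp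
  moreover have "p (x \<otimes>\<^bsub>B\<^esub> inv\<^bsub>B\<^esub> \<iota> (\<rho> x)) = c" using x c p1 by simp
  ultimately show ?thesis using x(1) by (intro exI[of _ "x \<otimes>\<^bsub>B\<^esub> inv\<^bsub>B\<^esub> \<iota> (\<rho> x)"]) simp
 qed
 define s where "s c = (SOME y. y : carrier B & \<rho> y = \<one>\<^bsub>A\<^esub> & p y = c)" for c
 have s: "s c : carrier B" "\<rho> (s c) = \<one>\<^bsub>A\<^esub>" "p (s c) = c" if "c : carrier C" for c
  using someI_ex[OF ex[OF that]] by (simp_all add: s_def)
 have s_eq: "s (p y) = y" if "y : carrier B" "\<rho> y = \<one>\<^bsub>A\<^esub>" for y
  by (rule pinj) (use that s[OF p.hom_closed[OF that(1)]] in simp_all)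
 have "s : hom C B"
 proof (rule homI)
  fix c d assume c: "c : carrier C" and d: "d : carrier C"
  show "s (c \<otimes>\<^bsub>C\<^esub> d) = s c \<otimes>\<^bsub>B\<^esub> s d"
   using s_eq[of "s c \<otimes>\<^bsub>B\<^esub> s d"] s[OF c] s[OF d] by simp
 qed (rule s(1))
 moreover have "s c = \<one>\<^bsub>B\<^esub> \<longleftrightarrow> c = \<one>\<^bsub>C\<^esub>" if "c : carrier C" for c
  using s(3)[OF that] s_eq[of "\<one>\<^bsub>B\<^esub>"] by auto
 moreover have "\<rho> y = \<one>\<^bsub>A\<^esub> \<longleftrightarrow> y : s ` carrier C" if "y : carrier B" for y
  using s(2) s_eq[OF that] that by (metis imageE imageI p.hom_closed)
 ultimately show ?thesis by blast
qed

locale filtered_complex = cochain_complex P \<delta> \<pi> + directed_index I r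
 for P :: "int => 'p::ab_group_add set" and \<delta> and \<pi> :: "'e::ab_group_add => 'f::ab_group_add"
  and I :: "'i set" and r +
 fixes K :: "'i => int => 'p set" and L :: "int => 'p set"
 assumes sub: "i : I ==> subcomplex (K i)"
  and mono: "i : I ==> j : I ==> r i j ==> K i q <= K j q"
  and subL: "subcomplex L" and KL: "i : I ==> K i q <= L q"
  and taut: "ph : L q ==> i : I ==> \<delta> ph : K i (q + 1) ==> EX ps:L (q - 1). EX j:I. ph - \<delta> ps : K j q"
begin

definition T :: "int => 'i => (('p => 'e) \<times> ('p => 'f)) set" where "T q i = cone (K i) q"
definition Z :: "int => 'i => (('p => 'e) \<times> ('p => 'f)) set" where "Z q i = cone_cycles (K i) q"
definition B :: "int => 'i => (('p => 'e) \<times> ('p => 'f)) set" where "B q i = cone_boundaries (K i) q"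
definition N :: "int => 'i => (('p => 'e) \<times> ('p => 'f)) set" where "N q i = null_cycles (K i) q"

lemma sys:
 "system (T q) incl" "system (Z q) incl" "system (B q) incl" "system (N q) incl"
 unfolding T_def Z_def B_def N_def
 by (rule system_inclusion, rule cone_subgroup cone_cycles_subgroup cone_boundaries_subgroup null_cycles_subgroup,
   rule cone_antimono cone_cycles_antimono cone_boundaries_antimono null_cycles_antimono, rule mono, assumption+)+

lemma BN: "i : I ==> B q i <= N q i" and NZ: "N q i <= Z q i" and ZT: "Z q i <= T q i"
 unfolding B_def N_def Z_def T_def using boundaries_null[OF sub] null_cycles_le
 by (auto simp: cone_cycles_def)

text \<open>The first component exhibits such a system as an extension of two systems of annihilators.\<close>

lemma acyclic_ext:
 fixes S :: "'i => (('p => 'e) \<times> ('p => 'f)) set"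
 assumes S: "system S incl"
  and U: "!!i. i : I ==> U i <= P m" "!!i j. i : I ==> j : I ==> r i j ==> U i <= U j"
  and V: "!!i. i : I ==> V i <= P l" "!!i j. i : I ==> j : I ==> r i j ==> V i <= V j"
  and fst: "!!i. i : I ==> fst ` S i = annih (P m) (U i) UNIV"
  and ker: "!!i g. i : I ==> (0, g) : S i \<longleftrightarrow> g : annih (P l) (V i) (range \<pi>)"
 shows "acyclic_system S incl"
proof (rule acyclic_extension[OF S, where p="%i. fst" and e="%i g. (0, g)"])
 show "system (%i. annih (P l) (V i) (range \<pi>)) incl"
  by (rule system_inclusion[OF annih_subgroup[OF subF] annih_antimono[OF V(2)]])
 show "system (%i. annih (P m) (U i) (UNIV :: 'e set)) incl"
  by (rule system_inclusion[OF annih_subgroup[OF subE] annih_antimono[OF U(2)]])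
 show "acyclic_system (%i. annih (P l) (V i) (range \<pi>)) incl" by (rule annih_acyclic[OF P V(1) divF])
 show "acyclic_system (%i. annih (P m) (U i) (UNIV :: 'e set)) incl" by (rule annih_acyclic[OF P U(1) divE])
 show "natural (%i. annih (P l) (V i) (range \<pi>)) incl S incl (%i g. (0, g))"
  unfolding natural_def additive_def using ker by (auto simp: plus_prod_def)
 show "natural S incl (%i. annih (P m) (U i) UNIV) incl (%i. fst)"
  unfolding natural_def additive_def using fst by auto
 show "{y : S i. fst y = 0} = (%g. (0, g)) ` annih (P l) (V i) (range \<pi>)" if "i : I" for i
  using ker[OF that] by (auto simp: image_iff)
qed (use fst in \<open>auto simp: zero_prod_def\<close>)

lemma acyclic_T: "acyclic_system (T q) incl"
proof (rule acyclic_ext[OF sys(1), where m=q and l="q + 1" and U="%i. K i q" and V="%i. K i (q + 1)"])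
 fix i assume "i : I"
 show "fst ` T q i = annih (P q) (K i q) (UNIV :: 'e set)"
 proof (intro equalityI subsetI)
  fix f assume "f : annih (P q) (K i q) (UNIV :: 'e set)"
  hence "(f, 0) : T q i" unfolding T_def by (rule cone_fst)
  thus "f : fst ` T q i" by force
 qed (auto dest: coneD(1) simp: T_def)
 show "(0, g) : T q i \<longleftrightarrow> g : annih (P (q + 1)) (K i (q + 1)) (range \<pi>)" for g
  using subgrp_0[OF annih_subgroup[OF subE], of "P q" "K i q"] by (simp add: T_def cone_def)
qed (use sub mono subcomplexD(2) in blast)+

lemma acyclic_N: "acyclic_system (N q) incl"
proof (rule acyclic_ext[OF sys(4), where m=q and l="q + 1" and U="%i. {ph : P q. \<delta> ph : K i (q + 1)}"
   and V="%i. \<delta> ` P q Un K i (q + 1)"])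
 fix i assume i: "i : I"
 let ?U = "{ph : P q. \<delta> ph : K i (q + 1)}" and ?V = "\<delta> ` P q Un K i (q + 1)"
 show "?V <= P (q + 1)" using \<delta>_in subcomplexD(2)[OF sub[OF i]] by blast
 show "fst ` N q i = annih (P q) ?U (UNIV :: 'e set)"
 proof (intro equalityI subsetI)
  fix f assume "f : annih (P q) ?U (UNIV :: 'e set)"
  then obtain v where "(f, v) : N q i" using null_cycles_fst[OF sub[OF i]] unfolding N_def by blast
  thus "f : fst ` N q i" by force
 qed (auto simp: N_def null_cycles_def cone_cycles_def cone_def annih_def)
 fix g
 have c0: "codiff (q - 1) (0 :: 'p => 'e) = 0" "push q 0 = 0" by (auto simp: codiff_def push_def \<pi>0 fun_eq_iff)
 have "(0, g) : N q i \<longleftrightarrow> g : annih (P (q + 1)) (K i (q + 1)) (range \<pi>) & codiff q g = 0"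
  using subgrp_0[OF annih_subgroup[OF subE], of "P q" "K i q"]
  by (simp add: N_def null_cycles_def cone_cycles_def cone_def bd_def c0 zero_prod_def)
 also have "\<dots> \<longleftrightarrow> g : annih (P (q + 1)) ?V (range \<pi>)"
  by (auto simp: annih_def codiff_def fun_eq_iff)
 finally show "(0, g) : N q i \<longleftrightarrow> g : annih (P (q + 1)) ?V (range \<pi>)" .
qed (use mono in blast)+

definition K_lim :: "int => 'p set" where "K_lim q = (\<Union>i\<in>I. K i q)"

lemma K_limD: "ph : K_lim q ==> EX i:I. ph : K i q" by (auto simp: K_lim_def)

lemma sub_lim: "subcomplex K_lim"
 unfolding subcomplex_def
proof (intro allI conjI)
 fix q
 show "subgrp (K_lim q)" unfolding subgrp_def
 proof (intro conjI ballI)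
  show "0 : K_lim q" using index_nonempty subgrp_0[OF subcomplexD(1)[OF sub]] by (auto simp: K_lim_def)
  fix x y assume "x : K_lim q" "y : K_lim q"
  then obtain i j where ij: "i : I" "j : I" "x : K i q" "y : K j q" by (auto simp: K_lim_def)
  then obtain k where k: "k : I" "r i k" "r j k" using index_directed by blast
  hence "x : K k q" "y : K k q" using ij mono by blast+
  thus "x - y : K_lim q" using subgrp_diff[OF subcomplexD(1)[OF sub[OF k(1)]]] k(1) by (auto simp: K_lim_def)
 qed
 show "K_lim q <= P q" "\<delta> ` K_lim q <= K_lim (q + 1)" using subcomplexD(2,3)[OF sub] by (auto simp: K_lim_def)
qed

lemma cone_lim: "t : cone K_lim q \<longleftrightarrow> (ALL i:I. t : T q i)"
 using index_nonempty by (auto simp: T_def cone_def annih_def K_lim_def)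

lemma cone_L: "t : cone L q ==> i : I ==> t : T q i"
 unfolding T_def using cone_antimono[of "K i" L q] KL by blast

lemma L_correction:
 assumes "t : cone K_lim q" "bd q t : cone L (q - 1)"
 shows "EX s:cone K_lim (q + 1). t - bd (q + 1) s : cone L q"
proof (rule cone_correction[OF sub_lim subL _ _ assms])
 show "K_lim q <= L q" for q using KL by (auto simp: K_lim_def)
 show "EX ps:L (q - 1). ph - \<delta> ps : K_lim q" if "ph : L q" "\<delta> ph : K_lim (q + 1)" for q ph
  using K_limD[OF that(2)] taut[OF that(1)] unfolding K_lim_def by blast
qed

text \<open>The chains dual to the filtration with its union divided out, modulo boundaries of such
 chains, are the homology of \<open>L\<close>.\<close>

lemma cycle_from_L:
 assumes z: "!!i. i : I ==> z : Z q i"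
 shows "EX z':cone_cycles L q. EX s:cone K_lim (q + 1). z = z' + bd (q + 1) s"
proof -
 have zl: "z : cone K_lim q" using z ZT cone_lim by blast
 obtain i where "i : I" using index_nonempty by blast
 hence bz: "bd q z = 0" using z by (auto simp: Z_def cone_cycles_def)
 obtain s where s: "s : cone K_lim (q + 1)" "z - bd (q + 1) s : cone L q"
  using L_correction[OF zl] subgrp_0[OF cone_subgroup] bz by auto
 have "bd q (z - bd (q + 1) s) = 0" using bz bd_bd[OF s(1)] by (simp add: bd_diff)
 thus ?thesis using s by (intro bexI[of _ "z - bd (q + 1) s"] bexI[of _ s]) (simp_all add: cone_cycles_def)
qed

lemma boundary_from_L:
 assumes t: "t : cone K_lim (q + 1)" "bd (q + 1) t : cone_cycles L q"
 shows "bd (q + 1) t : cone_boundaries L q"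
proof -
 have "bd (q + 1) t : cone L (q + 1 - 1)" using t(2) by (simp add: cone_cycles_def)
 then obtain s where s: "s : cone K_lim (q + 1 + 1)" "t - bd (q + 1 + 1) s : cone L (q + 1)"
  using L_correction[OF t(1)] by blast
 have "bd (q + 1) (bd (q + 1 + 1) s) = 0" using bd_bd[OF s(1)] by (simp only: add_diff_cancel_right')
 hence "bd (q + 1) t = bd (q + 1) (t - bd (q + 1 + 1) s)" by (simp add: bd_diff)
 thus ?thesis unfolding cone_boundaries_def using s(2) by blast
qed

lemma cycles_L_Z: "z : cone_cycles L q ==> i : I ==> z : Z q i"
 using cone_L by (auto simp: Z_def T_def cone_cycles_def)

definition const :: "'x::zero => 'i list => 'x"
 where "const z = (%xs. if xs : chains 0 then z else 0)"

lemma const_cochain: "(!!i. i : I ==> z : S i) ==> const z : cochains 0 S"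
 unfolding const_def by (rule family_cochain[of "%_. z"])

lemma const_at: "i : I ==> const z [i] = z"
 by (simp add: const_def chains_0)

lemma constant_cochain:
 fixes c :: "'i list => 'x::ab_group_add"
 assumes c: "c : cochains 0 S" and d: "diff incl 0 c = 0"
 shows "EX z. c = const z & (ALL i:I. z : S i)"
proof -
 obtain i where i: "i : I" using index_nonempty by blast
 have eq: "c [j] = c [i]" if j: "j : I" for j
 proof -
  obtain k where "k : I" "r i k" "r j k" using index_directed[OF i j] by blast
  thus ?thesis using d i j unfolding diff_0_eq_0 by metis
 qed
 have "c = const (c [i])"
 proof
  fix xs show "c xs = const (c [i]) xs"
   using eq cochains_off[OF c] by (cases "xs : chains 0") (auto simp: const_def chains_0)
 qed
 moreover have "ALL j:I. c [i] : S j" using eq cochain_0_in[OF c] by metis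
 ultimately show ?thesis by blast
qed

lemma const_diff: "diff incl 0 (const z) = 0"
 unfolding diff_0_eq_0 by (simp add: const_at)

lemma natural_bd: "natural (T (q + 1)) incl (B q) incl (%i. bd (q + 1))"
 unfolding natural_def using bd_additive by (auto simp: B_def T_def cone_boundaries_def)

end

lemma hom_comp: "f : hom U V ==> g : hom V W ==> (%x. g (f x)) : hom U W"
 unfolding hom_def by (auto simp: Pi_iff)

lemma retraction_hom:
 assumes A: "group A" and B: "group B" and \<iota>: "\<iota> : hom A B" and \<rho>: "\<rho> : hom B A"
  and \<rho>\<iota>: "!!c. c : carrier A ==> \<rho> (\<iota> c) = c"
 shows "\<rho> ` carrier B = carrier A" "!!c. c : carrier A ==> \<iota> c = \<one>\<^bsub>B\<^esub> \<longleftrightarrow> c = \<one>\<^bsub>A\<^esub>"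
proof -
 show "\<rho> ` carrier B = carrier A"
 proof (intro equalityI subsetI)
  fix c assume c: "c : carrier A"
  thus "c : \<rho> ` carrier B" using \<rho>\<iota>[OF c] hom_in_carrier[OF \<iota> c] by (metis imageI)
 qed (use hom_in_carrier[OF \<rho>] in blast)
 show "\<iota> c = \<one>\<^bsub>B\<^esub> \<longleftrightarrow> c = \<one>\<^bsub>A\<^esub>" if "c : carrier A" for c
  using \<rho>\<iota>[OF that] hom_one[OF \<rho> B A] hom_one[OF \<iota> A B] by metis
qed

context filtered_complex
begin

lemma cochains_subgroups:
 "subgrp (cochains m (T q))" "subgrp (cochains m (Z q))" "subgrp (cochains m (B q))"
 by (rule cochains_subgroup, rule systemD(1)[OF sys(1)], assumption, rule cochains_subgroup, rule systemD(1)[OF sys(2)], assumption,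
   rule cochains_subgroup, rule systemD(1)[OF sys(3)], assumption)

text \<open>A \<open>1\<close>-cocycle of cycles is the coboundary of a cochain of chains, whose boundary is the same
 cycle at all indices; this gives a class in the homology of \<open>L\<close>.\<close>

lemma lim1_to_homology:
 assumes Q: "presents Q (rcocycles (Z (q + 1)) (%i. {0}) incl (Suc 0)) (rboundaries (Z (q + 1)) (%i. {0}) incl 0) u"
  and H: "presents H (cone_cycles L q) (cone_boundaries L q) h"
 shows "EX \<theta>:hom Q H. (ALL c:carrier Q. \<theta> c = \<one>\<^bsub>H\<^esub> \<longleftrightarrow> c = \<one>\<^bsub>Q\<^esub>) &
  (ALL z:cone_cycles L q. h z : \<theta> ` carrier Q \<longleftrightarrow> (ALL i:I. z : B q i))"
proof -
 let ?Z = "Z (q + 1)" and ?T = "T (q + 1)" and ?d = "diff incl 0" and ?D = "capp 0 (%i. bd (q + 1))"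
 let ?C = "rcocycles ?Z (%i. {0}) incl (Suc 0)"
 have C: "c : ?C \<longleftrightarrow> c : cochains (Suc 0) ?Z & diff incl (Suc 0) c = 0" for c
  by (simp add: rcocycles_def cochains_zero)
 have R: "c : rboundaries ?Z (%i. {0}) incl 0 \<longleftrightarrow> (EX g:cochains 0 ?Z. c = ?d g)" if "c : ?C" for c
  using that C by (auto simp: rboundaries_def cochains_zero)
 have ZTc: "cochains m ?Z <= cochains m ?T" for m by (rule cochains_mono) (rule ZT)
 have Z_iff: "t : ?Z i \<longleftrightarrow> t : ?T i & bd (q + 1) t = 0" for t i by (simp add: Z_def T_def cone_cycles_def)
 define rel where "rel c z \<longleftrightarrow> c : ?C & z : cone_cycles L q & (EX t:cochains 0 ?T. ?d t = c & ?D t = const z)" for c z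
 have cT: "subgrp (cochains 0 ?T)" by (rule cochains_subgroups(1))
 have tZ: "t : cochains 0 ?Z" if t: "t : cochains 0 ?T" "?D t = 0" for t
 proof (rule cochainsI)
  fix xs assume xs: "xs : chains 0"
  have "bd (q + 1) (t xs) = 0" using fun_cong[OF t(2), of xs] xs by (simp add: capp_def)
  thus "t xs : ?Z (hd xs)" using cochainsD[OF t(1) xs] Z_iff by blast
 qed (rule cochains_off[OF t(1)])
 have Zt: "?D t = 0" if t: "t : cochains 0 ?Z" for t
  using cochainsD[OF t] Z_iff by (auto simp: capp_def fun_eq_iff)
 have Dsub: "?D (t - t') = ?D t - ?D t'" if "t : cochains 0 ?T" "t' : cochains 0 ?T" for t t'
  by (rule capp_sub[OF sys(1) natural_bd that])
 have tot: "EX z. rel c z" if c: "c : ?C" for c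
 proof -
  obtain t where t: "t : cochains 0 ?T" "?d t = c"
   using acyclic_systemD[OF acyclic_T, of c 0] c C ZTc by blast
  have "diff incl 0 (?D t) = capp (Suc 0) (%i. bd (q + 1)) c" using diff_capp[OF sys(1) natural_bd t(1)] t(2) by simp
  also have "\<dots> = 0"
   using c cochainsD[of c "Suc 0" ?Z] by (auto simp: C Z_iff capp_def fun_eq_iff)
  finally have "diff incl 0 (?D t) = 0" .
  then obtain z where z: "?D t = const z" "ALL i:I. z : B q i"
   using constant_cochain[OF capp_cochain[OF natural_bd t(1)]] by blast
  hence "!!i. i : I ==> z : Z q i" using BN NZ by blast
  then obtain z' s where z': "z' : cone_cycles L q" "s : cone K_lim (q + 1)" "z = z' + bd (q + 1) s"
   using cycle_from_L by blast
  have s: "const s : cochains 0 ?T" by (rule const_cochain) (use z'(2) cone_lim in blast)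
  have t': "t - const s : cochains 0 ?T" by (rule subgrp_diff[OF cT t(1) s])
  have "?d (t - const s) = c" using diff_sub[OF sys(1) t(1) s] t(2) by (simp add: const_diff)
  moreover have "?D (const s) = const (bd (q + 1) s)" by (auto simp: capp_def const_def)
  hence "?D (t - const s) = const z'" using Dsub[OF t(1) s] z(1) z'(3) by (simp add: const_def fun_eq_iff)
  ultimately show ?thesis using t' c z'(1) unfolding rel_def by blast
 qed
 have add: "additive_relation rel"
  unfolding additive_relation_def
 proof (intro allI impI)
  fix c z c' z' assume a: "rel c z" "rel c' z'"
  then obtain t t' where t: "t : cochains 0 ?T" "?d t = c" "?D t = const z" and t': "t' : cochains 0 ?T" "?d t' = c'" "?D t' = const z'"
   unfolding rel_def by blast
  have "c - c' : ?C" by (rule subgrp_diff[OF presentsD(2)[OF Q]]) (use a in \<open>simp_all add: rel_def\<close>)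
  moreover have "z - z' : cone_cycles L q"
   by (rule subgrp_diff[OF cone_cycles_subgroup]) (use a in \<open>simp_all add: rel_def\<close>)
  moreover have "t - t' : cochains 0 ?T" by (rule subgrp_diff[OF cT t(1) t'(1)])
  moreover have "?d (t - t') = c - c'" using diff_sub[OF sys(1) t(1) t'(1)] t(2) t'(2) by simp
  moreover have "?D (t - t') = const (z - z')" using Dsub[OF t(1) t'(1)] t(3) t'(3) by (simp add: const_def fun_eq_iff)
  ultimately show "rel (c - c') (z - z')" unfolding rel_def by blast
 qed
 have iff: "c : rboundaries ?Z (%i. {0}) incl 0 \<longleftrightarrow> z : cone_boundaries L q" if cz: "rel c z" for c z
 proof -
  have c: "c : ?C" and z: "z : cone_cycles L q" using cz by (auto simp: rel_def)
  obtain t where t: "t : cochains 0 ?T" "?d t = c" "?D t = const z" using cz unfolding rel_def by blast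
  show ?thesis unfolding R[OF c]
  proof
   assume "EX g:cochains 0 ?Z. c = ?d g"
   then obtain g where g: "g : cochains 0 ?Z" "c = ?d g" by blast
   have gT: "g : cochains 0 ?T" using g(1) ZTc by blast
   have "?d (t - g) = 0" using diff_sub[OF sys(1) t(1) gT] t(2) g(2) by simp
   then obtain w where w: "t - g = const w" "ALL i:I. w : ?T i"
    using constant_cochain[OF subgrp_diff[OF cT t(1) gT]] by blast
   obtain i where i: "i : I" using index_nonempty by blast
   have "?D (t - g) = const z" using Dsub[OF t(1) gT] t(3) Zt[OF g(1)] by simp
   hence "?D (const w) [i] = const z [i]" unfolding w(1) by simp
   hence "bd (q + 1) w = z" using i by (simp add: capp_def const_at chains_0)
   thus "z : cone_boundaries L q" using boundary_from_L[of w q] w(2) z cone_lim by auto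
  next
   assume "z : cone_boundaries L q"
   then obtain a where a: "a : cone L (q + 1)" "z = bd (q + 1) a" by (auto simp: cone_boundaries_def)
   have aT: "const a : cochains 0 ?T" by (rule const_cochain) (rule cone_L[OF a(1)])
   have "?D (const a) = const z" by (auto simp: capp_def const_def a(2))
   hence "?D (t - const a) = 0" using Dsub[OF t(1) aT] t(3) by simp
   hence "t - const a : cochains 0 ?Z" by (rule tZ[OF subgrp_diff[OF cT t(1) aT]])
   moreover have "?d (t - const a) = c" using diff_sub[OF sys(1) t(1) aT] t(2) by (simp add: const_diff)
   ultimately show "EX g:cochains 0 ?Z. c = ?d g" by blast
  qed
 qed
 have "EX f:hom Q H. ALL z z'. rel z z' --> f (u z) = h z'"
 proof (rule presents_hom_exists[OF Q H add])
  show "c : ?C & z : cone_cycles L q" if "rel c z" for c z using that by (simp add: rel_def)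
 qed (use tot iff in blast)+
 then obtain \<theta> where \<theta>: "\<theta> : hom Q H" "!!c z. rel c z ==> \<theta> (u c) = h z" by blast
 have inj: "\<theta> x = \<one>\<^bsub>H\<^esub> \<longleftrightarrow> x = \<one>\<^bsub>Q\<^esub>" if x: "x : carrier Q" for x
 proof -
  obtain c where c: "c : ?C" "u c = x" using presentsD(4)[OF Q x] by blast
  obtain z where z: "rel c z" using tot[OF c(1)] by blast
  have zL: "z : cone_cycles L q" using z by (simp add: rel_def)
  have "\<theta> x = h z" using \<theta>(2)[OF z] c(2) by simp
  thus ?thesis using presentsD(6)[OF H zL] presentsD(6)[OF Q c(1)] iff[OF z] c(2) by simp
 qed
 have img: "h z : \<theta> ` carrier Q \<longleftrightarrow> (ALL i:I. z : B q i)" if z: "z : cone_cycles L q" for z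
 proof
  assume "h z : \<theta> ` carrier Q"
  then obtain x where x: "x : carrier Q" "h z = \<theta> x" by blast
  obtain c where c: "c : ?C" "u c = x" using presentsD(4)[OF Q x(1)] by blast
  obtain z1 where z1: "rel c z1" using tot[OF c(1)] by blast
  then obtain t where z1L: "z1 : cone_cycles L q" and t: "t : cochains 0 ?T" "?D t = const z1" unfolding rel_def by blast
  have "h z = h z1" using \<theta>(2)[OF z1] x c by simp
  hence d: "z - z1 : cone_boundaries L q" using presents_eq_iff[OF H z z1L] by simp
  show "ALL i:I. z : B q i"
  proof
   fix i assume i: "i : I"
   have "z1 : B q i" using cochain_0_in[OF capp_cochain[OF natural_bd t(1)] i] t(2) const_at[OF i, of z1] by simp
   moreover have "z - z1 : B q i" using d cone_boundaries_antimono[of "K i" L q] KL[OF i] by (auto simp: B_def)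
   ultimately show "z : B q i" using subgrp_add[OF systemD(1)[OF sys(3) i], of "z - z1" q z1] by simp
  qed
 next
  assume zB: "ALL i:I. z : B q i"
  have "const z : cochains 0 (%i. bd (q + 1) ` ?T i)" by (rule const_cochain) (use zB in \<open>simp add: B_def T_def cone_boundaries_def\<close>)
  hence "EX t:cochains 0 ?T. ?D t = const z" by (rule capp_lift) (use systemD(1)[OF sys(1)] subgrp_0 in blast)
  then obtain t where t: "t : cochains 0 ?T" "?D t = const z" by blast
  have d: "?d t : cochains (Suc 0) ?T" by (rule diff_cochain[OF sys(1) t(1)])
  have "capp (Suc 0) (%i. bd (q + 1)) (?d t) = diff incl 0 (const z)"
   using diff_capp[OF sys(1) natural_bd t(1)] t(2) by simp
  hence c0: "capp (Suc 0) (%i. bd (q + 1)) (?d t) = 0" by (simp add: const_diff)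
  have "?d t : cochains (Suc 0) ?Z"
  proof (rule cochainsI)
   fix xs assume xs: "xs : chains (Suc 0)"
   have "bd (q + 1) (?d t xs) = 0" using fun_cong[OF c0, of xs] xs by (simp add: capp_def)
   thus "?d t xs : ?Z (hd xs)" using cochainsD[OF d xs] Z_iff by blast
  qed (rule cochains_off[OF d])
  hence c: "?d t : ?C" using C diff_diff[OF sys(1) t(1)] by blast
  hence "rel (?d t) z" unfolding rel_def using z t by blast
  thus "h z : \<theta> ` carrier Q" using \<theta>(2) presentsD(3)[OF Q c] by (metis imageI)
 qed
 show ?thesis using \<theta>(1) inj img by blast
qed

text \<open>A compatible family of cycles is a single cycle, which \<open>cycle_from_L\<close> moves into \<open>L\<close> by a boundary.\<close>

lemma limit_from_L:
 assumes z: "z : cochains 0 (Z q)"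
 shows "(EX y:cochains 0 (Z q). diff incl 0 y = 0 & z - y : cochains 0 (B q)) \<longleftrightarrow>
  (EX w:cone_cycles L q. z - const w : cochains 0 (B q))"
proof
 assume "EX y:cochains 0 (Z q). diff incl 0 y = 0 & z - y : cochains 0 (B q)"
 then obtain y where y: "y : cochains 0 (Z q)" "diff incl 0 y = 0" "z - y : cochains 0 (B q)" by blast
 obtain v where v: "y = const v" "!!i. i : I ==> v : Z q i" using constant_cochain[OF y(1,2)] by blast
 obtain w s where w: "w : cone_cycles L q" "s : cone K_lim (q + 1)" "v = w + bd (q + 1) s" using cycle_from_L[OF v(2)] by blast
 have "const (bd (q + 1) s) : cochains 0 (B q)"
  by (rule const_cochain) (use w(2) cone_lim in \<open>auto simp: B_def T_def cone_boundaries_def\<close>)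
 hence "(z - y) + const (bd (q + 1) s) : cochains 0 (B q)"
  using subgrp_add[OF cochains_subgroups(3) y(3)] by blast
 moreover have "(z - y) + const (bd (q + 1) s) = z - const w" by (auto simp: v(1) w(3) const_def fun_eq_iff)
 ultimately show "EX w:cone_cycles L q. z - const w : cochains 0 (B q)" using w(1) by auto
next
 assume "EX w:cone_cycles L q. z - const w : cochains 0 (B q)"
 then obtain w where w: "w : cone_cycles L q" "z - const w : cochains 0 (B q)" by blast
 have "const w : cochains 0 (Z q)" by (rule const_cochain) (rule cycles_L_Z[OF w(1)])
 thus "EX y:cochains 0 (Z q). diff incl 0 y = 0 & z - y : cochains 0 (B q)" using w(2) const_diff by blast
qed

definition cocycle_group :: "nat => int => ('i list => ('p => 'e) \<times> ('p => 'f)) set monoid"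
 where "cocycle_group k q = group_of (rcocycles (Z q) (%i. {0}) incl (Suc k)) Mod rboundaries (Z q) (%i. {0}) incl k"

lemma cocycle_group_presented:
 "EX u. presents (cocycle_group k q) (rcocycles (Z q) (%i. {0}) incl (Suc k)) (rboundaries (Z q) (%i. {0}) incl k) u"
proof -
 let ?d = "diff incl"
 have C: "rcocycles (Z q) (%i. {0}) incl (Suc k) = {c : cochains (Suc k) (Z q). ?d (Suc k) c = 0}"
  by (auto simp: rcocycles_def cochains_zero)
 have R: "rboundaries (Z q) (%i. {0}) incl k = ?d k ` cochains k (Z q)"
  using diff_cochain[OF sys(2), of _ k q] by (auto simp: rboundaries_def cochains_zero)
 have "subgrp (?d k ` cochains k (Z q))"
  by (rule subgrp_image[OF cochains_subgroups(2) diff_additive[OF sys(2)]])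
 moreover have "?d k ` cochains k (Z q) <= rcocycles (Z q) (%i. {0}) incl (Suc k)"
  unfolding C using diff_cochain[OF sys(2)] diff_diff[OF sys(2)] by blast
 ultimately show ?thesis unfolding cocycle_group_def R
  using presents_FactGroup[OF rcocycles_subgroup[OF zero_subsystem[OF sys(2)]]] by blast
qed

text \<open>The group \<open>Q\<close>, a derived limit of homology, is the sum of the cohomology of \<open>Z\<close> in its own degree, embedded by \<open>\<iota>\<close>
 with retraction \<open>\<rho>\<close>, and of the cohomology of the cycles one degree higher, onto which \<open>p\<close> projects with section \<open>s\<close>.\<close>

lemma derived_limit_splitting:
 assumes Q: "presents Q (rcocycles (Z q) (B q) incl (Suc k)) (rboundaries (Z q) (B q) incl k) h"
 shows "EX \<iota> \<rho> p s. \<iota> : hom (cocycle_group k q) Q & \<rho> : hom Q (cocycle_group k q) &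
  p : hom Q (cocycle_group (k + 2) (q + 1)) & s : hom (cocycle_group (k + 2) (q + 1)) Q &
  (ALL c:carrier (cocycle_group k q). \<rho> (\<iota> c) = c) &
  p ` carrier Q = carrier (cocycle_group (k + 2) (q + 1)) &
  (ALL y:carrier Q. p y = \<one>\<^bsub>cocycle_group (k + 2) (q + 1)\<^esub> \<longleftrightarrow> y : \<iota> ` carrier (cocycle_group k q)) &
  (ALL c:carrier (cocycle_group (k + 2) (q + 1)). s c = \<one>\<^bsub>Q\<^esub> \<longleftrightarrow> c = \<one>\<^bsub>cocycle_group (k + 2) (q + 1)\<^esub>) &
  (ALL y:carrier Q. \<rho> y = \<one>\<^bsub>cocycle_group k q\<^esub> \<longleftrightarrow> y : s ` carrier (cocycle_group (k + 2) (q + 1)))"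
proof -
 let ?A = "cocycle_group k q" and ?C = "cocycle_group (Suc (Suc k)) (q + 1)"
 let ?Z0 = "rcocycles (Z q) (%i. {0}) incl (Suc k)" and ?ZB = "rcocycles (Z q) (B q) incl (Suc k)"
 obtain u where u: "presents ?A ?Z0 (rboundaries (Z q) (%i. {0}) incl k) u" using cocycle_group_presented by blast
 obtain u' where u': "presents ?C (rcocycles (Z (q + 1)) (%i. {0}) incl (Suc (Suc (Suc k))))
   (rboundaries (Z (q + 1)) (%i. {0}) incl (Suc (Suc k))) u'" using cocycle_group_presented by blast
 have "EX \<iota>:hom ?A Q. EX \<rho>:hom Q ?A. (ALL z:?Z0. \<iota> (u z) = h z) & (ALL c:carrier ?A. \<rho> (\<iota> c) = c)"
  by (rule split_presentation[OF sys(2,3,4) acyclic_N _ _ Q u]) (rule BN NZ, assumption?)+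
 then obtain \<iota> \<rho> where \<iota>: "\<iota> : hom ?A Q" "!!z. z : ?Z0 ==> \<iota> (u z) = h z" and \<rho>: "\<rho> : hom Q ?A" "!!c. c : carrier ?A ==> \<rho> (\<iota> c) = c"
  by (elim bexE conjE) metis
 have Z0: "y : ?Z0 \<longleftrightarrow> y : cochains (Suc k) (Z q) & diff incl (Suc k) y = 0" for y
  by (simp add: rcocycles_def cochains_zero)
 have B0: "0 : cochains m (B q)" for m by (rule subgrp_0[OF cochains_subgroups(3)])
 have Z0B: "?Z0 <= ?ZB" unfolding rcocycles_def using B0 by (auto simp: cochains_zero)
 have im: "bd (q + 1) ` T (q + 1) i = B q i" for i by (simp add: T_def B_def cone_boundaries_def)
 have ker: "{t : T (q + 1) i. bd (q + 1) t = 0} = Z (q + 1) i" for i by (simp add: T_def Z_def cone_cycles_def)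
 have Bd: "EX y:cochains (Suc k) (Z q). diff incl (Suc k) y = 0 & z - y : cochains (Suc k) (B q)"
  if z: "z : rboundaries (Z q) (B q) incl k" "z : ?ZB" for z
 proof -
  obtain g where g: "g : cochains k (Z q)" "z - diff incl k g : cochains (Suc k) (B q)"
   using z(1) unfolding rboundaries_def by blast
  thus ?thesis using diff_cochain[OF sys(2) g(1)] diff_diff[OF sys(2) g(1)] by blast
 qed
 have "EX p:hom Q ?C. p ` carrier Q = carrier ?C & (ALL z:?ZB. p (h z) = \<one>\<^bsub>?C\<^esub> \<longleftrightarrow>
   (EX y:cochains (Suc k) (Z q). diff incl (Suc k) y = 0 & z - y : cochains (Suc k) (B q)))"
  by (rule double_connecting_hom[where bdry="bd (q + 1)" and T="T (q + 1)" and Z'="Z (q + 1)",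
    OF sys(2,3,4) acyclic_N _ _ sys(1) acyclic_T sys(2) bd_additive im ker Q _ u'])
   (rule BN Bd, assumption+ | rule NZ)+
 then obtain p where p: "p : hom Q ?C" "p ` carrier Q = carrier ?C" "!!z. z : ?ZB ==> p (h z) = \<one>\<^bsub>?C\<^esub> \<longleftrightarrow>
   (EX y:cochains (Suc k) (Z q). diff incl (Suc k) y = 0 & z - y : cochains (Suc k) (B q))"
  by (elim bexE conjE) metis
 have pk: "p x = \<one>\<^bsub>?C\<^esub> \<longleftrightarrow> x : \<iota> ` carrier ?A" if x: "x : carrier Q" for x
 proof -
  obtain z where z: "z : ?ZB" "h z = x" using presentsD(4)[OF Q x] by blast
  have "p x = \<one>\<^bsub>?C\<^esub> \<longleftrightarrow> (EX y:cochains (Suc k) (Z q). diff incl (Suc k) y = 0 & z - y : cochains (Suc k) (B q))"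
   using p(3)[OF z(1)] z(2) by simp
  also have "\<dots> \<longleftrightarrow> x : \<iota> ` carrier ?A"
  proof
   assume "EX y:cochains (Suc k) (Z q). diff incl (Suc k) y = 0 & z - y : cochains (Suc k) (B q)"
   then obtain y where y: "y : ?Z0" "z - y : cochains (Suc k) (B q)" using Z0 by blast
   have yB: "y : ?ZB" using y(1) Z0B by blast
   have "z - y : cochains (Suc k) (Z q)" using y(2) cochains_mono[of "B q" "Z q" "Suc k"] BN NZ by blast
   moreover have "diff incl k (0 :: 'i list => ('p => 'e) \<times> ('p => 'f)) = 0" using additive_0[OF cochains_subgroups(2) diff_additive[OF sys(2)]] by blast
   moreover have "0 : cochains k (Z q)" by (rule subgrp_0[OF cochains_subgroups(2)])
   ultimately have "z - y : rboundaries (Z q) (B q) incl k"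
    unfolding rboundaries_def using y(2) by force
   hence "x = \<iota> (u y)" using presents_eq_iff[OF Q z(1) yB] \<iota>(2)[OF y(1)] z(2) by simp
   thus "x : \<iota> ` carrier ?A" using presentsD(3)[OF u y(1)] by blast
  next
   assume "x : \<iota> ` carrier ?A"
   then obtain a where a: "a : carrier ?A" "x = \<iota> a" by blast
   obtain y where y: "y : ?Z0" "u y = a" using presentsD(4)[OF u a(1)] by blast
   have yB: "y : ?ZB" using y(1) Z0B by blast
   have "x = h y" using \<iota>(2)[OF y(1)] a(2) y(2) by simp
   hence "p x = \<one>\<^bsub>?C\<^esub>" using p(3)[OF yB] y(1) Z0 B0 by (metis diff_self)
   thus "EX y:cochains (Suc k) (Z q). diff incl (Suc k) y = 0 & z - y : cochains (Suc k) (B q)"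
    using p(3)[OF z(1)] z(2) by simp
  qed
  finally show ?thesis .
 qed
 have "EX s:hom ?C Q. (ALL c:carrier ?C. s c = \<one>\<^bsub>Q\<^esub> \<longleftrightarrow> c = \<one>\<^bsub>?C\<^esub>) &
   (ALL y:carrier Q. \<rho> y = \<one>\<^bsub>?A\<^esub> \<longleftrightarrow> y : s ` carrier ?C)"
  by (rule section_into_complement[OF presentsD(1)[OF u] presentsD(1)[OF Q] presentsD(1)[OF u'] \<iota>(1) \<rho>(1) _ p(1,2)])
   (rule \<rho>(2) pk, assumption)+
 then obtain s where s: "s : hom ?C Q" "ALL c:carrier ?C. s c = \<one>\<^bsub>Q\<^esub> \<longleftrightarrow> c = \<one>\<^bsub>?C\<^esub>"
   "ALL y:carrier Q. \<rho> y = \<one>\<^bsub>?A\<^esub> \<longleftrightarrow> y : s ` carrier ?C" by blast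
 show ?thesis using \<iota>(1) \<rho> p(1,2) pk s
  by (intro exI[of _ \<iota>] exI[of _ \<rho>] exI[of _ p] exI[of _ s]) simp
qed

text \<open>With these splittings each map of odd index is \<open>s \<circ> \<rho>\<close> and each of even index is \<open>\<iota> \<circ> p\<close>. Consecutive ones
 are exact because \<open>ker \<rho> = im s\<close> and \<open>ker p = im \<iota>\<close>.\<close>

theorem exact_sequence:
 fixes D :: "nat => int => 'd monoid"
 assumes D: "!!k q. EX d. presents (D (Suc k) q) (rcocycles (Z q) (B q) incl (Suc k)) (rboundaries (Z q) (B q) incl k) d"
  and M: "presents M (rcocycles (Z n) (B n) incl 0) (cochains 0 (B n)) l"
  and H: "presents H (cone_cycles L n) (cone_boundaries L n) h"
  and res: "res : hom H M" "!!z. z : cone_cycles L n ==> res (h z) = l (const z)"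
 shows "EX \<alpha> \<theta> \<beta>0 \<beta>.
  (ALL k. exact_at (D (2 * k + 5) (n + int k + 3)) (\<alpha> (Suc k)) (D (2 * k + 3) (n + int k + 2)) (\<alpha> k) (D (2 * k + 1) (n + int k + 1))) &
  exact_at (D 3 (n + 2)) (\<alpha> 0) (D 1 (n + 1)) \<theta> H & exact_at (D 1 (n + 1)) \<theta> H res M &
  exact_at H res M \<beta>0 (D 2 (n + 1)) & exact_at M \<beta>0 (D 2 (n + 1)) (\<beta> 0) (D 4 (n + 2)) &
  (ALL k. exact_at (D (2 * k + 2) (n + int k + 1)) (\<beta> k) (D (2 * k + 4) (n + int k + 2)) (\<beta> (Suc k)) (D (2 * k + 6) (n + int k + 3)))"
proof -
 let ?a = cocycle_group
 define good where "good k q \<iota> \<rho> p s \<longleftrightarrow> \<iota> : hom (?a k q) (D (Suc k) q) & \<rho> : hom (D (Suc k) q) (?a k q) &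
  p : hom (D (Suc k) q) (?a (k + 2) (q + 1)) & s : hom (?a (k + 2) (q + 1)) (D (Suc k) q) &
  (ALL c:carrier (?a k q). \<rho> (\<iota> c) = c) & p ` carrier (D (Suc k) q) = carrier (?a (k + 2) (q + 1)) &
  (ALL y:carrier (D (Suc k) q). p y = \<one>\<^bsub>?a (k + 2) (q + 1)\<^esub> \<longleftrightarrow> y : \<iota> ` carrier (?a k q)) &
  (ALL c:carrier (?a (k + 2) (q + 1)). s c = \<one>\<^bsub>D (Suc k) q\<^esub> \<longleftrightarrow> c = \<one>\<^bsub>?a (k + 2) (q + 1)\<^esub>) &
  (ALL y:carrier (D (Suc k) q). \<rho> y = \<one>\<^bsub>?a k q\<^esub> \<longleftrightarrow> y : s ` carrier (?a (k + 2) (q + 1)))" for k q \<iota> \<rho> p s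
 have "ALL k q. EX \<iota> \<rho> p s. good k q \<iota> \<rho> p s"
 proof (intro allI)
  fix k q
  obtain d where d: "presents (D (Suc k) q) (rcocycles (Z q) (B q) incl (Suc k)) (rboundaries (Z q) (B q) incl k) d"
   using D by blast
  show "EX \<iota> \<rho> p s. good k q \<iota> \<rho> p s" unfolding good_def by (rule derived_limit_splitting[OF d])
 qed
 then obtain \<iota> \<rho> p s where good: "!!k q. good k q (\<iota> k q) (\<rho> k q) (p k q) (s k q)"
  unfolding choice_iff by blast
 define q where "q k = n + int k + 1" for k
 have e: "2 * k + 2 = 2 * Suc k" "Suc (2 * k) + 2 = Suc (2 * Suc k)" "q k + 1 = q (Suc k)" for k
  by (simp_all add: q_def)
 have gD: "group (D (Suc k) q)" for k q using D[of k q] presentsD(1) comm_group.axioms(2) by blast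
 have ga: "group (?a k q)" for k q using cocycle_group_presented[of k q] presentsD(1) comm_group.axioms(2) by blast
 have gH: "group H" and gM: "group M" using presentsD(1)[OF H] presentsD(1)[OF M] comm_group.axioms(2) by blast+
 note g = good[unfolded good_def]
 note \<iota> = g[THEN conjunct1] and \<rho> = g[THEN conjunct2, THEN conjunct1] and \<rho>\<iota> = g[THEN conjunct2, THEN conjunct2, THEN conjunct2, THEN conjunct2, THEN conjunct1, THEN bspec]
 have \<rho>_surj: "\<rho> k q ` carrier (D (Suc k) q) = carrier (?a k q)" for k q
  by (rule retraction_hom(1)[OF ga gD \<iota> \<rho> \<rho>\<iota>])
 have \<iota>_inj: "\<iota> k q c = \<one>\<^bsub>D (Suc k) q\<^esub> \<longleftrightarrow> c = \<one>\<^bsub>?a k q\<^esub>" if c: "c : carrier (?a k q)" for k q c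
  by (rule retraction_hom(2)[OF ga gD \<iota> \<rho> \<rho>\<iota> c])
 note p = g[THEN conjunct2, THEN conjunct2, THEN conjunct1] g[THEN conjunct2, THEN conjunct2, THEN conjunct2, THEN conjunct2, THEN conjunct2, THEN conjunct1]
  and p_ker = g[THEN conjunct2, THEN conjunct2, THEN conjunct2, THEN conjunct2, THEN conjunct2, THEN conjunct2, THEN conjunct1, THEN bspec]
 note s = g[THEN conjunct2, THEN conjunct2, THEN conjunct2, THEN conjunct1]
  and s_inj = g[THEN conjunct2, THEN conjunct2, THEN conjunct2, THEN conjunct2, THEN conjunct2, THEN conjunct2, THEN conjunct2, THEN conjunct1, THEN bspec]
  and \<rho>_ker = g[THEN conjunct2, THEN conjunct2, THEN conjunct2, THEN conjunct2, THEN conjunct2, THEN conjunct2, THEN conjunct2, THEN conjunct2, THEN bspec]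
 note s' = s[of "2 * k" "q k" for k, unfolded e] and s_inj' = s_inj[of _ "2 * k" "q k" for k, unfolded e]
  and \<rho>_ker' = \<rho>_ker[of _ "2 * k" "q k" for k, unfolded e]
  and p' = p[of "Suc (2 * k)" "q k" for k, unfolded e] and p_ker' = p_ker[of _ "Suc (2 * k)" "q k" for k, unfolded e]
 obtain u0 where u0: "presents (?a 0 (n + 1)) (rcocycles (Z (n + 1)) (%i. {0}) incl (Suc 0))
   (rboundaries (Z (n + 1)) (%i. {0}) incl 0) u0" using cocycle_group_presented by blast
 obtain u1 where u1: "presents (?a (Suc 0) (n + 1)) (rcocycles (Z (n + 1)) (%i. {0}) incl (Suc (Suc 0)))
   (rboundaries (Z (n + 1)) (%i. {0}) incl (Suc 0)) u1" using cocycle_group_presented by blast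
 have q0: "n + 1 = q 0" by (simp add: q_def)
 obtain \<theta>' where \<theta>': "\<theta>' : hom (?a 0 (q 0)) H" "!!c. c : carrier (?a 0 (q 0)) ==> \<theta>' c = \<one>\<^bsub>H\<^esub> \<longleftrightarrow> c = \<one>\<^bsub>?a 0 (q 0)\<^esub>"
  "!!z. z : cone_cycles L n ==> h z : \<theta>' ` carrier (?a 0 (q 0)) \<longleftrightarrow> (ALL i:I. z : B n i)"
  using lim1_to_homology[OF u0 H] unfolding q0 by (elim bexE conjE) metis
 have im: "bd (n + 1) ` T (n + 1) i = B n i" for i by (simp add: T_def B_def cone_boundaries_def)
 have ker: "{t : T (n + 1) i. bd (n + 1) t = 0} = Z (n + 1) i" for i by (simp add: T_def Z_def cone_cycles_def)
 have Bd: "EX y:cochains 0 (Z n). diff incl 0 y = 0 & z - y : cochains 0 (B n)" if "z : cochains 0 (B n)" for z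
  using that subgrp_0[OF cochains_subgroups(2)] additive_0[OF cochains_subgroups(2) diff_additive[OF sys(2)]]
  by (intro bexI[of _ 0]) simp_all
 have "EX p:hom M (?a (Suc 0) (n + 1)). p ` carrier M = carrier (?a (Suc 0) (n + 1)) &
   (ALL z:rcocycles (Z n) (B n) incl 0. p (l z) = \<one>\<^bsub>?a (Suc 0) (n + 1)\<^esub> \<longleftrightarrow>
   (EX y:cochains 0 (Z n). diff incl 0 y = 0 & z - y : cochains 0 (B n)))"
  by (rule double_connecting_hom[where bdry="bd (n + 1)" and T="T (n + 1)" and Z'="Z (n + 1)",
    OF sys(2,3,4) acyclic_N _ _ sys(1) acyclic_T sys(2) bd_additive im ker M _ u1])
   (rule BN Bd, assumption+ | rule NZ)+
 then obtain p0 where p0: "p0 : hom M (?a (Suc 0) (q 0))" "p0 ` carrier M = carrier (?a (Suc 0) (q 0))"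
   "!!z. z : rcocycles (Z n) (B n) incl 0 ==> p0 (l z) = \<one>\<^bsub>?a (Suc 0) (q 0)\<^esub> \<longleftrightarrow>
   (EX y:cochains 0 (Z n). diff incl 0 y = 0 & z - y : cochains 0 (B n))"
  unfolding q0 by (elim bexE conjE) metis
 have constZ: "const z : rcocycles (Z n) (B n) incl 0" if z: "z : cone_cycles L n" for z
  using const_cochain[of z "Z n"] cycles_L_Z[OF z] subgrp_0[OF cochains_subgroups(3)] by (simp add: rcocycles_def const_diff)
 have res_ker: "res x = \<one>\<^bsub>M\<^esub> \<longleftrightarrow> x : \<theta>' ` carrier (?a 0 (q 0))" if x: "x : carrier H" for x
 proof -
  obtain z where z: "z : cone_cycles L n" "h z = x" using presentsD(4)[OF H x] by blast
  have "res x = \<one>\<^bsub>M\<^esub> \<longleftrightarrow> const z : cochains 0 (B n)" using res(2)[OF z(1)] presentsD(6)[OF M constZ[OF z(1)]] z(2) by simp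
  also have "\<dots> \<longleftrightarrow> (ALL i:I. z : B n i)" using const_cochain[of z "B n"] cochain_0_in[of "const z" "B n"] const_at by metis
  finally show ?thesis using \<theta>'(3)[OF z(1)] z(2) by simp
 qed
 have p0_ker: "p0 x = \<one>\<^bsub>?a (Suc 0) (q 0)\<^esub> \<longleftrightarrow> x : res ` carrier H" if x: "x : carrier M" for x
 proof -
  obtain z where z: "z : rcocycles (Z n) (B n) incl 0" "l z = x" using presentsD(4)[OF M x] by blast
  have zZ: "z : cochains 0 (Z n)" using z(1) by (simp add: rcocycles_def)
  have "p0 x = \<one>\<^bsub>?a (Suc 0) (q 0)\<^esub> \<longleftrightarrow> (EX w:cone_cycles L n. z - const w : cochains 0 (B n))"
   using p0(3)[OF z(1)] limit_from_L[OF zZ] z(2) by simp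
  also have "\<dots> \<longleftrightarrow> (EX w:cone_cycles L n. x = res (h w))"
   using presents_eq_iff[OF M z(1) constZ] res(2) z(2) by auto
  also have "\<dots> \<longleftrightarrow> x : res ` carrier H"
  proof -
   have "carrier H = h ` cone_cycles L n" using H by (simp add: presents_def)
   thus ?thesis by auto
  qed
  finally show ?thesis .
 qed
 define \<alpha> where "\<alpha> = (%k x. s (2 * k) (q k) (\<rho> (2 * Suc k) (q (Suc k)) x))"
 define \<beta> where "\<beta> = (%k x. \<iota> (Suc (2 * Suc k)) (q (Suc k)) (p (Suc (2 * k)) (q k) x))"
 define \<theta> where "\<theta> = (%x. \<theta>' (\<rho> 0 (q 0) x))"
 define \<beta>0 where "\<beta>0 = (%x. \<iota> (Suc 0) (q 0) (p0 x))"
 have h\<alpha>: "\<alpha> k : hom (D (Suc (2 * Suc k)) (q (Suc k))) (D (Suc (2 * k)) (q k))" for k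
  unfolding \<alpha>_def by (rule hom_comp[OF \<rho> s'])
 have h\<beta>: "\<beta> k : hom (D (Suc (Suc (2 * k))) (q k)) (D (Suc (Suc (2 * Suc k))) (q (Suc k)))" for k
  unfolding \<beta>_def by (rule hom_comp[OF p'(1) \<iota>])
 have h\<theta>: "\<theta> : hom (D (Suc 0) (q 0)) H" unfolding \<theta>_def by (rule hom_comp[OF \<rho> \<theta>'(1)])
 have h\<beta>0: "\<beta>0 : hom M (D (Suc (Suc 0)) (q 0))" unfolding \<beta>0_def by (rule hom_comp[OF p0(1) \<iota>])
 have im_\<alpha>: "y : \<alpha> k ` carrier (D (Suc (2 * Suc k)) (q (Suc k))) \<longleftrightarrow> \<rho> (2 * k) (q k) y = \<one>\<^bsub>?a (2 * k) (q k)\<^esub>"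
  if "y : carrier (D (Suc (2 * k)) (q k))" for k y
  unfolding \<rho>_ker'[OF that] \<rho>_surj[symmetric] image_image \<alpha>_def ..
 have ker_\<beta>: "\<beta> k y = \<one>\<^bsub>D (Suc (Suc (2 * Suc k))) (q (Suc k))\<^esub> \<longleftrightarrow> y : \<iota> (Suc (2 * k)) (q k) ` carrier (?a (Suc (2 * k)) (q k))"
  if y: "y : carrier (D (Suc (Suc (2 * k))) (q k))" for k y
  unfolding \<beta>_def \<iota>_inj[OF hom_in_carrier[OF p'(1) y]] by (rule p_ker'[OF y])
 have X1: "exact_at (D (Suc (2 * Suc (Suc k))) (q (Suc (Suc k)))) (\<alpha> (Suc k)) (D (Suc (2 * Suc k)) (q (Suc k))) (\<alpha> k) (D (Suc (2 * k)) (q k))" for k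
 proof (rule exact_atI[OF gD gD gD h\<alpha> h\<alpha>])
  fix y assume y: "y : carrier (D (Suc (2 * Suc k)) (q (Suc k)))"
  show "\<alpha> k y = \<one>\<^bsub>D (Suc (2 * k)) (q k)\<^esub> \<longleftrightarrow> y : \<alpha> (Suc k) ` carrier (D (Suc (2 * Suc (Suc k))) (q (Suc (Suc k))))"
   unfolding im_\<alpha>[OF y] unfolding \<alpha>_def by (rule s_inj'[OF hom_in_carrier[OF \<rho> y]])
 qed
 have X2: "exact_at (D (Suc (2 * Suc 0)) (q (Suc 0))) (\<alpha> 0) (D (Suc (2 * 0)) (q 0)) \<theta> H"
 proof (rule exact_atI[OF gD gD gH h\<alpha>])
  fix y assume y: "y : carrier (D (Suc (2 * 0)) (q 0))"
  show "\<theta> y = \<one>\<^bsub>H\<^esub> \<longleftrightarrow> y : \<alpha> 0 ` carrier (D (Suc (2 * Suc 0)) (q (Suc 0)))"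
   unfolding im_\<alpha>[OF y] unfolding \<theta>_def using \<theta>'(2)[OF hom_in_carrier[OF \<rho>, of y]] y by simp
 qed (use h\<theta> in simp)
 have X3: "exact_at (D (Suc 0) (q 0)) \<theta> H res M"
 proof (rule exact_atI[OF gD gH gM h\<theta> res(1)])
  fix y assume y: "y : carrier H"
  show "res y = \<one>\<^bsub>M\<^esub> \<longleftrightarrow> y : \<theta> ` carrier (D (Suc 0) (q 0))"
   unfolding res_ker[OF y] \<rho>_surj[symmetric] image_image \<theta>_def ..
 qed
 have X4: "exact_at H res M \<beta>0 (D (Suc (Suc 0)) (q 0))"
 proof (rule exact_atI[OF gH gM gD res(1) h\<beta>0])
  fix y assume y: "y : carrier M"
  show "\<beta>0 y = \<one>\<^bsub>D (Suc (Suc 0)) (q 0)\<^esub> \<longleftrightarrow> y : res ` carrier H"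
   unfolding \<beta>0_def \<iota>_inj[OF hom_in_carrier[OF p0(1) y]] by (rule p0_ker[OF y])
 qed
 have X5: "exact_at M \<beta>0 (D (Suc (Suc (2 * 0))) (q 0)) (\<beta> 0) (D (Suc (Suc (2 * Suc 0))) (q (Suc 0)))"
 proof (rule exact_atI[OF gM gD gD _ h\<beta>])
  fix y assume y: "y : carrier (D (Suc (Suc (2 * 0))) (q 0))"
  have "\<beta>0 ` carrier M = \<iota> (Suc 0) (q 0) ` carrier (?a (Suc 0) (q 0))"
   unfolding p0(2)[symmetric] image_image \<beta>0_def ..
  thus "\<beta> 0 y = \<one>\<^bsub>D (Suc (Suc (2 * Suc 0))) (q (Suc 0))\<^esub> \<longleftrightarrow> y : \<beta>0 ` carrier M"
   using ker_\<beta>[OF y] by simp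
 qed (use h\<beta>0 in simp)
 have X6: "exact_at (D (Suc (Suc (2 * k))) (q k)) (\<beta> k) (D (Suc (Suc (2 * Suc k))) (q (Suc k))) (\<beta> (Suc k)) (D (Suc (Suc (2 * Suc (Suc k)))) (q (Suc (Suc k))))" for k
 proof (rule exact_atI[OF gD gD gD h\<beta> h\<beta>])
  fix y assume y: "y : carrier (D (Suc (Suc (2 * Suc k))) (q (Suc k)))"
  show "\<beta> (Suc k) y = \<one>\<^bsub>D (Suc (Suc (2 * Suc (Suc k)))) (q (Suc (Suc k)))\<^esub> \<longleftrightarrow> y : \<beta> k ` carrier (D (Suc (Suc (2 * k))) (q k))"
   unfolding ker_\<beta>[OF y] unfolding p'(2)[symmetric] image_image \<beta>_def ..
 qed
 have E: "D (2 * k + 5) (n + int k + 3) = D (Suc (2 * Suc (Suc k))) (q (Suc (Suc k)))"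
  "D (2 * k + 3) (n + int k + 2) = D (Suc (2 * Suc k)) (q (Suc k))" "D (2 * k + 1) (n + int k + 1) = D (Suc (2 * k)) (q k)"
  "D (2 * k + 6) (n + int k + 3) = D (Suc (Suc (2 * Suc (Suc k)))) (q (Suc (Suc k)))"
  "D (2 * k + 4) (n + int k + 2) = D (Suc (Suc (2 * Suc k))) (q (Suc k))" "D (2 * k + 2) (n + int k + 1) = D (Suc (Suc (2 * k))) (q k)" for k
  by (rule arg_cong2[where f=D]; simp add: q_def)+
 have E0: "D 3 (n + 2) = D (Suc (2 * Suc 0)) (q (Suc 0))" "D 1 (n + 1) = D (Suc 0) (q 0)"
  "D 2 (n + 1) = D (Suc (Suc 0)) (q 0)" "D 4 (n + 2) = D (Suc (Suc (2 * Suc 0))) (q (Suc 0))"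
  by (rule arg_cong2[where f=D]; simp add: q_def)+
 have z: "2 * (0::nat) = 0" by simp
 show ?thesis unfolding E E0
  by (rule exI[of _ \<alpha>], rule exI[of _ \<theta>], rule exI[of _ \<beta>0], rule exI[of _ \<beta>], intro conjI allI,
    rule X1, rule X2[unfolded z], rule X3, rule X4, rule X5[unfolded z], rule X6)
qed

end

section \<open>Locally vanishing functions on tuples\<close>

fun prism :: "('a => 'a) => ('a list => 'b::ab_group_add) => 'a list => 'b" where
 "prism f ph [] = 0"
| "prism f ph (x # xs) = ph (x # f x # map f xs) - prism f (%ys. ph (x # ys)) xs"

fun prisms :: "('a => 'a) => 'a list => 'a list set" where
 "prisms f [] = {}"
| "prisms f (x # xs) = insert (x # f x # map f xs) ((#) x ` prisms f xs)"

lemma prism_cong: "(!!ys. ys : prisms f xs ==> ph ys = ps ys) ==> prism f ph xs = prism f ps xs"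
proof (induction xs arbitrary: ph ps)
 case (Cons x xs)
 have "prism f (%ys. ph (x # ys)) xs = prism f (%ys. ps (x # ys)) xs" by (rule Cons.IH) (simp add: Cons.prems)
 thus ?case using Cons.prems by simp
qed simp

lemma prism_zero_fun: "prism f (%ys. 0) xs = 0"
 by (induction xs) simp_all

lemma prism_zero: "(!!ys. ys : prisms f xs ==> ph ys = 0) ==> prism f ph xs = 0"
 using prism_cong[of f xs ph "%ys. 0"] prism_zero_fun by simp

lemma prism_diff: "prism f (%ys. ph ys - ps ys) xs = prism f ph xs - prism f ps xs"
 by (induction xs arbitrary: ph ps) simp_all

lemma prismsD: "ys : prisms f xs ==> length ys = Suc (length xs) & set ys <= set xs Un f ` set xs"
proof (induction xs arbitrary: ys)
 case (Cons x xs)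
 then consider "ys = x # f x # map f xs" | zs where "ys = x # zs" "zs : prisms f xs" by auto
 thus ?case
 proof cases
  case (2 zs)
  thus ?thesis using Cons.IH[of zs] by auto
 qed auto
qed simp

text \<open>The triangulation of the prism over a simplex: the coboundary of its dual compares \<open>ph \<circ> f\<close>
 with \<open>ph\<close> for an arbitrary, possibly discontinuous, map \<open>f\<close>.\<close>

lemma prism_homotopy: "alt_del (prism f ph) xs + prism f (alt_del ph) xs = ph (map f xs) - ph xs"
proof (induction xs arbitrary: ph)
 case (Cons x xs)
 show ?case using Cons.IH[of "%zs. ph (x # zs)"]
  by (simp add: alt_del_diff prism_diff alt_del_map algebra_simps)
qed simp

lemma finite_alternating_sums: "finite R ==> finite (((%F. {a - b | a b. a : R & b : F}) ^^ m) {0 :: 'b::ab_group_add})"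
proof (induction m)
 case (Suc m)
 have "{a - b | a b. a : R & b : F} = (%(a, b). a - b) ` (R \<times> F)" for F by auto
 thus ?case using Suc by simp
qed simp

lemma alt_del_alternating_sum:
 "range f <= R ==> alt_del f xs : ((%F. {a - b | a b. a : R & b : F}) ^^ length xs) {0 :: 'b::ab_group_add}"
proof (induction xs arbitrary: f)
 case (Cons x xs)
 have "alt_del (%ys. f (x # ys)) xs : ((%F. {a - b | a b. a : R & b : F}) ^^ length xs) {0}"
  by (rule Cons.IH) (use Cons.prems in blast)
 hence "f xs - alt_del (%ys. f (x # ys)) xs : {a - b | a b. a : R & b : ((%F. {a - b | a b. a : R & b : F}) ^^ length xs) {0}}"
  using Cons.prems by blast
 thus ?case by simp
qed simp

lemma prism_alternating_sum:
 "range ph <= R ==> prism f ph xs : ((%F. {a - b | a b. a : R & b : F}) ^^ length xs) {0 :: 'b::ab_group_add}"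
proof (induction xs arbitrary: ph)
 case (Cons x xs)
 have "prism f (%ys. ph (x # ys)) xs : ((%F. {a - b | a b. a : R & b : F}) ^^ length xs) {0}"
  by (rule Cons.IH) (use Cons.prems in blast)
 hence "ph (x # f x # map f xs) - prism f (%ys. ph (x # ys)) xs :
   {a - b | a b. a : R & b : ((%F. {a - b | a b. a : R & b : F}) ^^ length xs) {0}}"
  using Cons.prems by blast
 thus ?case by simp
qed simp

definition vanishes_near :: "'a topology => 'a set => ('a list => 'b::zero) => 'a => bool"
 where "vanishes_near X N ph x \<longleftrightarrow> (EX U. openin X U & x : U & (ALL xs. set xs <= U Int N --> ph xs = 0))"

definition tuple_support :: "'a topology => ('a list => 'b::zero) => 'a set"
 where "tuple_support X ph = {x : topspace X. \<not> vanishes_near X (topspace X) ph x}"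

text \<open>A function is nonzero only on tuples of \<open>q + 1\<close> points; in negative degrees this leaves only \<open>0\<close>, since the empty tuple
 is excluded.\<close>

definition tuple_funs :: "'a topology => int => ('a list => int) set"
 where "tuple_funs X q = {ph. (ALL xs. ph xs ~= 0 --> xs ~= [] & int (length xs) = q + 1 & set xs <= topspace X) &
  finite (range ph) & compactin X (tuple_support X ph)}"

definition vanishing_on :: "'a topology => 'a set => int => ('a list => int) set"
 where "vanishing_on X N q = {ph : tuple_funs X q. ALL x:N. vanishes_near X N ph x}"

definition cobdry :: "'a topology => ('a list => int) => 'a list => int"
 where "cobdry X ph = (%xs. if set xs <= topspace X then alt_del ph xs else 0)"

lemma tuple_funsD:
 assumes "ph : tuple_funs X q"
 shows "ph xs ~= 0 ==> xs ~= []" "ph xs ~= 0 ==> int (length xs) = q + 1" "ph xs ~= 0 ==> set xs <= topspace X"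
  "finite (range ph)" "compactin X (tuple_support X ph)"
 using assms by (auto simp: tuple_funs_def)

lemma vanishes_near_diff:
 assumes "vanishes_near X N ph x" "vanishes_near X N ps x"
 shows "vanishes_near X N (ph - ps :: 'a list => int) x"
proof -
 obtain U V where "openin X U" "x : U" "!!xs. set xs <= U Int N ==> ph xs = 0"
  "openin X V" "x : V" "!!xs. set xs <= V Int N ==> ps xs = 0" using assms unfolding vanishes_near_def by blast
 thus ?thesis unfolding vanishes_near_def by (intro exI[of _ "U Int V"]) (simp add: openin_Int)
qed

lemma vanishes_near_cobdry: "vanishes_near X N ph x ==> vanishes_near X N (cobdry X ph) x"
proof -
 assume "vanishes_near X N ph x"
 then obtain U where U: "openin X U" "x : U" "!!xs. set xs <= U Int N ==> ph xs = 0" unfolding vanishes_near_def by blast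
 have "cobdry X ph xs = 0" if xs: "set xs <= U Int N" for xs
 proof -
  have "alt_del ph xs = 0" by (rule alt_del_zero, rule U(3)) (use deletionsD[of _ xs] xs in blast)
  thus ?thesis by (simp add: cobdry_def)
 qed
 thus ?thesis using U(1,2) unfolding vanishes_near_def by blast
qed

lemma tuple_support_closed: "closedin X (tuple_support X ph)"
proof -
 have "openin X (topspace X - tuple_support X ph)"
 proof (subst openin_subopen, intro ballI)
  fix x assume "x : topspace X - tuple_support X ph"
  then obtain U where U: "openin X U" "x : U" "ALL xs. set xs <= U Int topspace X --> ph xs = 0"
   by (auto simp: tuple_support_def vanishes_near_def)
  hence "U <= topspace X - tuple_support X ph"
   using openin_subset[OF U(1)] unfolding tuple_support_def vanishes_near_def by blast
  thus "EX T. openin X T & x : T & T <= topspace X - tuple_support X ph" using U by blast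
 qed
 moreover have "tuple_support X ph <= topspace X" by (auto simp: tuple_support_def)
 ultimately show ?thesis by (simp add: closedin_def)
qed

lemma compact_supportI:
 assumes "compactin X S" "!!x. x : topspace X ==> x ~: S ==> vanishes_near X (topspace X) ph x"
 shows "compactin X (tuple_support X ph)"
 by (rule closed_compactin[OF assms(1) _ tuple_support_closed]) (use assms(2) in \<open>auto simp: tuple_support_def\<close>)

lemma outside_support: "x : topspace X ==> x ~: tuple_support X ph ==> vanishes_near X (topspace X) ph x"
 by (simp add: tuple_support_def)

lemma tuple_funs_subgroup: "subgrp (tuple_funs X q)"
 unfolding subgrp_def
proof (intro conjI ballI)
 have "tuple_support X (0 :: 'a list => int) = {}" by (auto simp: tuple_support_def vanishes_near_def)
 thus "0 : tuple_funs X q" by (simp add: tuple_funs_def)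
 fix ph ps assume ph: "ph : tuple_funs X q" and ps: "ps : tuple_funs X q"
 note D = tuple_funsD[OF ph] tuple_funsD[OF ps]
 have "compactin X (tuple_support X (ph - ps))"
  by (rule compact_supportI[OF compactin_Un[OF D(5) D(10)]]) (rule vanishes_near_diff; rule outside_support; blast)
 moreover have "range (ph - ps) <= (%(a, b). a - b) ` (range ph \<times> range ps)" by auto
 hence "finite (range (ph - ps))" using D(4,9) by (meson finite_SigmaI finite_imageI finite_subset)
 moreover have "xs ~= [] & int (length xs) = q + 1 & set xs <= topspace X" if "(ph - ps) xs ~= 0" for xs
  using D(1-3)[of xs] D(6-8)[of xs] that by (cases "ph xs = 0") auto
 ultimately show "ph - ps : tuple_funs X q" by (simp add: tuple_funs_def)
qed

lemma vanishing_on_subgroup: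
 assumes N: "N <= topspace X" shows "subgrp (vanishing_on X N q)"
 unfolding subgrp_def
proof (intro conjI ballI)
 have "vanishes_near X N (0 :: 'a list => int) x" if "x : N" for x
  unfolding vanishes_near_def using that N by (intro exI[of _ "topspace X"]) auto
 thus "0 : vanishing_on X N q" using subgrp_0[OF tuple_funs_subgroup] by (simp add: vanishing_on_def)
 fix ph ps assume "ph : vanishing_on X N q" "ps : vanishing_on X N q"
 thus "ph - ps : vanishing_on X N q"
  using subgrp_diff[OF tuple_funs_subgroup, of ph X q ps] vanishes_near_diff[of X N ph _ ps]
  unfolding vanishing_on_def by blast
qed

lemma cobdry_in:
 assumes ph: "ph : tuple_funs X q" shows "cobdry X ph : tuple_funs X (q + 1)"
proof -
 note D = tuple_funsD[OF ph]
 have nz: "EX ys:deletions xs. ph ys ~= 0" if "cobdry X ph xs ~= 0" for xs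
  using alt_del_zero[of xs ph] that by (auto simp: cobdry_def split: if_splits)
 have supp: "xs ~= [] & int (length xs) = (q + 1) + 1 & set xs <= topspace X" if x: "cobdry X ph xs ~= 0" for xs
 proof -
  obtain ys where ys: "ys : deletions xs" "ph ys ~= 0" using nz[OF x] by blast
  have "length xs = Suc (length ys)" using deletionsD[OF ys(1)] by blast
  thus ?thesis using D(2)[OF ys(2)] x by (auto simp: cobdry_def split: if_splits)
 qed
 have "range (cobdry X ph) <= insert 0 (((%F. {a - b | a b. a : range ph & b : F}) ^^ nat (q + 2)) {0})"
 proof
  fix y assume "y : range (cobdry X ph)"
  then obtain xs where xs: "y = cobdry X ph xs" by blast
  show "y : insert 0 (((%F. {a - b | a b. a : range ph & b : F}) ^^ nat (q + 2)) {0})"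
  proof (cases "y = 0")
   case False
   hence nz: "cobdry X ph xs ~= 0" using xs by simp
   have "length xs = nat (q + 2)" using supp[OF nz] by linarith
   moreover have "y = alt_del ph xs" using supp[OF nz] xs by (simp add: cobdry_def)
   ultimately show ?thesis using alt_del_alternating_sum[of ph "range ph" xs] by simp
  qed simp
 qed
 hence "finite (range (cobdry X ph))" using finite_alternating_sums[OF D(4)] finite_subset by blast
 moreover have "compactin X (tuple_support X (cobdry X ph))"
  by (rule compact_supportI[OF D(5)]) (rule vanishes_near_cobdry, rule outside_support)
 ultimately show ?thesis using supp unfolding tuple_funs_def by blast
qed

lemma cobdry_cobdry: "cobdry X (cobdry X ph) = 0"
proof
 fix xs
 have "alt_del (cobdry X ph) xs = alt_del (alt_del ph) xs" if "set xs <= topspace X"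
  by (rule alt_del_cong) (use that deletionsD[of _ xs] in \<open>auto simp: cobdry_def\<close>)
 thus "cobdry X (cobdry X ph) xs = 0 xs" by (simp add: cobdry_def)
qed

lemma cobdry_add: "cobdry X (ph + ps) = cobdry X ph + cobdry X ps"
proof -
 have "alt_del (ph + ps) xs = alt_del ph xs + alt_del ps xs" for xs
  using alt_del_add[of ph ps xs] by (simp add: plus_fun_def)
 thus ?thesis by (auto simp: cobdry_def fun_eq_iff)
qed

section \<open>Tautness of closed subspaces\<close>

text \<open>Points of the cover that lie close to \<open>A\<close> are moved into \<open>A\<close> without leaving the members of
 the cover \<open>G\<close>; all other points stay.\<close>

lemma small_retraction:
 assumes X: "regular_space X" and A: "closedin X A" and S: "closedin X S" "compactin X S"
  and G: "!!y. y : A Int S ==> openin X (G y) & y : G y"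
 shows "EX f N Y W. closedin X N & neighbourhood X A N & Y <= A Int S & (ALL y:Y. openin X (W y) & W y <= G y) &
  N Int S <= (\<Union>y\<in>Y. W y) & f ` topspace X <= topspace X & (ALL x. x : A \<or> x ~: S --> f x = x) &
  (ALL y:Y. ALL x:W y Int N Int S. f x : A Int G y)"
proof -
 let ?\<kappa> = "A Int S"
 have \<kappa>: "compactin X ?\<kappa>" by (rule closed_Int_compactin[OF A S(2)])
 have "EX W. openin X W & y : W & X closure_of W <= G y" if y: "y : ?\<kappa>" for y
 proof -
  have "closedin X (topspace X - G y)" "y : topspace X - (topspace X - G y)"
   using G[OF y] openin_subset by (auto intro: openin_closedin_eq[THEN iffD1, THEN conjunct2])
  then obtain U where "openin X U" "y : U" "disjnt (topspace X - G y) (X closure_of U)"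
   using X unfolding regular_space by blast
  thus ?thesis using closure_of_subset_topspace[of X U] unfolding disjnt_def by blast
 qed
 hence "ALL y. EX W. y : ?\<kappa> --> openin X W & y : W & X closure_of W <= G y" by blast
 then obtain W where W: "!!y. y : ?\<kappa> ==> openin X (W y) & y : W y & X closure_of W y <= G y"
  unfolding choice_iff by blast
 have "EX F. finite F & F <= W ` ?\<kappa> & ?\<kappa> <= \<Union>F"
  by (rule compactinD[OF \<kappa>]) (use W in blast)+
 then obtain F where F: "finite F" "F <= W ` ?\<kappa>" "?\<kappa> <= \<Union>F" by blast
 obtain Y where Y: "Y <= ?\<kappa>" "finite Y" "F = W ` Y" using finite_subset_image[OF F(1,2)] by blast
 let ?cl = "%y. X closure_of W y"
 have WG: "openin X (W y)" "W y <= ?cl y" "?cl y <= G y" if "y : Y" for y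
  using W[of y] Y(1) that closure_of_subset[OF openin_subset, of X "W y"] by blast+
 define Q where "Q a = ((\<Union>y\<in>Y. W y) - (\<Union>y\<in>{y:Y. a ~: ?cl y}. ?cl y))" for a
 have Q_open: "openin X (Q a)" for a
  unfolding Q_def
  by (rule openin_diff, rule openin_Union, use WG(1) in blast, rule closedin_Union) (use Y(2) in auto)
 let ?\<Omega> = "\<Union>a\<in>?\<kappa>. Q a"
 have \<Omega>: "openin X ?\<Omega>" using Q_open by blast
 have \<kappa>\<Omega>: "?\<kappa> <= ?\<Omega>" using F(3) unfolding Q_def Y(3) by blast
 have "compactin X (S - ?\<Omega>)"
  by (rule closed_compactin[OF S(2) _ closedin_diff[OF S(1) \<Omega>]]) blast
 moreover have "disjnt (S - ?\<Omega>) A" using \<kappa>\<Omega> unfolding disjnt_def by blast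
 ultimately have "EX U V. openin X U & openin X V & S - ?\<Omega> <= U & A <= V & disjnt U V"
  by (rule regular_space_compact_closed_separation[OF X _ A])
 then obtain U V where UV: "openin X U" "openin X V" "S - ?\<Omega> <= U" "A <= V" "disjnt U V"
  by (elim exE conjE)
 define N where "N = topspace X - U"
 have Ncl: "closedin X N" unfolding N_def using UV(1) by blast
 have VN: "V <= N" using UV(2,5) openin_subset[OF UV(2)] unfolding N_def disjnt_def by blast
 have Nnb: "neighbourhood X A N"
  unfolding neighbourhood_def using UV(2,4) interior_of_maximal[OF VN UV(2)] by (auto simp: N_def)
 have NS: "N Int S <= ?\<Omega>" using UV(3) unfolding N_def by blast
 define f where "f x = (if x : A \<or> x ~: ?\<Omega> Int S then x else SOME a. a : ?\<kappa> & x : Q a)" for x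
 have f: "f x : ?\<kappa> & x : Q (f x)" if x: "x : ?\<Omega> Int S" for x
 proof (cases "x : A")
  case True
  thus ?thesis using x by (auto simp: f_def Q_def)
 next
  case False
  have "EX a. a : ?\<kappa> & x : Q a" using x by blast
  thus ?thesis using someI_ex[of "%a. a : ?\<kappa> & x : Q a"] False x unfolding f_def by simp
 qed
 have f1: "f x : A Int G y" if yx: "y : Y" "x : W y Int N Int S" for x y
 proof -
  have "x : ?\<Omega> Int S" using NS yx(2) by blast
  hence fx: "f x : ?\<kappa>" "x : Q (f x)" using f by blast+
  have "x : ?cl y" using WG(2)[OF yx(1)] yx(2) by blast
  hence "f x : ?cl y" using fx(2) yx(1) unfolding Q_def by blast
  thus ?thesis using WG(3)[OF yx(1)] fx(1) by blast
 qed
 have f2: "f x = x" if "x : A \<or> x ~: S" for x using that by (auto simp: f_def)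
 have f3: "f x : topspace X" if "x : topspace X" for x
 proof (cases "x : ?\<Omega> Int S")
  case True
  thus ?thesis using f[OF True] closedin_subset[OF A] by blast
 next
  case False
  hence "f x = x" by (simp only: f_def if_True simp_thms)
  thus ?thesis using that by simp
 qed
 show ?thesis
 proof (rule exI[of _ f], rule exI[of _ N], rule exI[of _ Y], rule exI[of _ W], intro conjI)
  show "N Int S <= (\<Union>y\<in>Y. W y)" using NS unfolding Q_def by blast
  show "ALL y:Y. openin X (W y) & W y <= G y" using WG by blast
  show "ALL y:Y. ALL x:W y Int N Int S. f x : A Int G y" using f1 by blast
  show "ALL x. x : A \<or> x ~: S --> f x = x" using f2 by blast
  show "f ` topspace X <= topspace X" using f3 by blast
 qed (rule Ncl Nnb Y(1))+
qed

text \<open>Let \<open>f\<close> be the retraction of \<open>small_retraction\<close> for a cover on whose members \<open>ph\<close> or its coboundary vanish suitably. The prism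
 operator gives \<open>ps\<close> with \<open>ph - \<delta> ps = ph \<circ> f\<close> up to a term in \<open>\<delta> ph\<close>, and both terms vanish near points close to \<open>A\<close>,
 where \<open>f\<close> moves points into \<open>A\<close>. Far from the support nothing moves, which keeps \<open>ps\<close> compactly supported.\<close>

theorem closed_subspace_taut:
 assumes lc: "locally_compact_space X" and H: "Hausdorff_space X" and A: "closedin X A"
  and ph: "ph : vanishing_on X A q" and N: "N : closed_nbhds X A"
  and \<delta>ph: "cobdry X ph : vanishing_on X N (q + 1)"
 shows "EX ps:vanishing_on X A (q - 1). EX M:closed_nbhds X A. ph - cobdry X ps : vanishing_on X M q"
proof -
 have reg: "regular_space X" using locally_compact_Hausdorff_imp_regular_space[OF lc H] .
 have phP: "ph : tuple_funs X q" and phA: "!!x. x : A ==> vanishes_near X A ph x"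
  using ph by (auto simp: vanishing_on_def)
 note D = tuple_funsD[OF phP]
 let ?S = "tuple_support X ph"
 have A_top: "A <= topspace X" by (rule closedin_subset[OF A])
 obtain V S where VS: "openin X V" "compactin X S" "closedin X S" "?S <= V" "V <= S"
  using locally_compact_space_compact_closed_compact[of X] H lc D(5) by blast
 define ok where "ok G \<longleftrightarrow> (ALL xs. set xs <= G --> ph xs = 0) \<or>
   (G <= S & (ALL xs. set xs <= G Int A --> ph xs = 0) & (ALL xs. set xs <= G --> cobdry X ph xs = 0))" for G
 have "EX G. openin X G & y : G & ok G" if y: "y : A Int S" for y
 proof (cases "y : ?S")
  case False
  hence "vanishes_near X (topspace X) ph y" using y A_top by (auto intro: outside_support)
  then obtain U where "openin X U" "y : U" "ALL xs. set xs <= U Int topspace X --> ph xs = 0" unfolding vanishes_near_def by blast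
  thus ?thesis using openin_subset[of X U] unfolding ok_def by (intro exI[of _ U]) (simp add: Int_absorb2)
 next
  case True
  have yI: "y : X interior_of N" using N y by (auto simp: closed_nbhds_def neighbourhood_def)
  hence yN: "y : N" by (rule subsetD[OF interior_of_subset])
  obtain U1 where U1: "openin X U1" "y : U1" "ALL xs. set xs <= U1 Int A --> ph xs = 0" using phA y unfolding vanishes_near_def by blast
  have "vanishes_near X N (cobdry X ph) y" using \<delta>ph yN by (simp add: vanishing_on_def)
  then obtain U2 where U2: "openin X U2" "y : U2" "ALL xs. set xs <= U2 Int N --> cobdry X ph xs = 0" unfolding vanishes_near_def by blast
  let ?G = "U1 Int U2 Int V Int X interior_of N"
  have "openin X ?G" using U1(1) U2(1) VS(1) by (intro openin_Int openin_interior_of)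
  moreover have "y : ?G" using U1(2) U2(2) VS(4) True yI by blast
  moreover have "?G <= S" "?G Int A <= U1 Int A" "?G <= U2 Int N" using VS(5) interior_of_subset[of X N] by blast+
  hence "ok ?G" unfolding ok_def using U1(3) U2(3) by (meson subset_trans)
  ultimately show ?thesis by blast
 qed
 hence "ALL y. EX G. y : A Int S --> openin X G & y : G & ok G" by blast
 then obtain G where G: "!!y. y : A Int S ==> openin X (G y) & y : G y & ok (G y)" unfolding choice_iff by blast
 have G': "openin X (G y) & y : G y" if "y : A Int S" for y using G[OF that] by blast
 have "EX f M Y W. closedin X M & neighbourhood X A M & Y <= A Int S & (ALL y:Y. openin X (W y) & W y <= G y) &
  M Int S <= (\<Union>y\<in>Y. W y) & f ` topspace X <= topspace X & (ALL x. x : A \<or> x ~: S --> f x = x) &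
  (ALL y:Y. ALL x:W y Int M Int S. f x : A Int G y)"
  by (rule small_retraction[OF reg A VS(3,2) G'])
 then obtain f M Y W where M: "closedin X M" "neighbourhood X A M" and Y: "Y <= A Int S"
  and W: "ALL y:Y. openin X (W y) & W y <= G y" and MS: "M Int S <= (\<Union>y\<in>Y. W y)"
  and f1: "f ` topspace X <= topspace X" and f2: "ALL x. x : A \<or> x ~: S --> f x = x"
  and f3: "ALL y:Y. ALL x:W y Int M Int S. f x : A Int G y" by (elim exE conjE)
 note f = f1 f2[rule_format] f3[rule_format]
 define ps where "ps = (%xs. if set xs <= topspace X then - prism f ph xs else 0)"
 have fixed: "prism f \<theta> xs = 0" if "!!x. x : set xs ==> f x = x" "!!ys. set ys <= set xs ==> \<theta> ys = 0"
  for \<theta> :: "'a list => int" and xs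
 proof (rule prism_zero)
  fix ys assume "ys : prisms f xs"
  moreover have "f ` set xs = set xs" using that(1) by force
  ultimately show "\<theta> ys = 0" using prismsD[of ys f xs] that(2) by auto
 qed
 have outside: "vanishes_near X (topspace X) ps x & vanishes_near X (topspace X) (%xs. ph (map f xs) - prism f (cobdry X ph) xs) x"
  if x: "x : topspace X" "x ~: S" for x
 proof -
  have "vanishes_near X (topspace X) ph x" using x VS(4,5) by (intro outside_support) blast+
  then obtain U where U: "openin X U" "x : U" "!!xs. set xs <= U Int topspace X ==> ph xs = 0" unfolding vanishes_near_def by blast
  have U0: "ph xs = 0" if "set xs <= U - S" for xs by (rule U(3)) (use openin_subset[OF U(1)] that in blast)
  have d0: "cobdry X ph xs = 0" if "set xs <= U - S" for xs
  proof -
   have "alt_del ph xs = 0" by (rule alt_del_zero, rule U0) (use deletionsD[of _ xs] that in blast)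
   thus ?thesis by (simp add: cobdry_def)
  qed
  have fx: "map f xs = xs" "!!x. x : set xs ==> f x = x" if "set xs <= U - S" for xs
   using f(2) that by (auto intro!: map_idI)
  have p: "prism f ph xs = 0" "prism f (cobdry X ph) xs = 0" if "set xs <= U - S" for xs
   by (rule fixed[OF fx(2)[OF that]], assumption, use U0 that in blast, rule fixed[OF fx(2)[OF that]], assumption, use d0 that in blast)
  have "openin X (U - S)" by (rule openin_diff[OF U(1) VS(3)])
  moreover have "x : U - S" using U(2) x(2) by blast
  ultimately show ?thesis unfolding vanishes_near_def
   using p U0 fx(1) by (intro conjI exI[of _ "U - S"]) (auto simp: ps_def)
 qed
 have len: "xs ~= [] & int (length xs) = (q - 1) + 1 & set xs <= topspace X" if x: "ps xs ~= 0" for xs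
 proof -
  have "prism f ph xs ~= 0" using x by (auto simp: ps_def split: if_splits)
  then obtain ys where ys: "ys : prisms f xs" "ph ys ~= 0" using prism_zero[of f xs ph] by blast
  hence "length ys = Suc (length xs)" using prismsD by blast
  thus ?thesis using D(2)[OF ys(2)] ys(1) x by (auto simp: ps_def split: if_splits)
 qed
 have "range ps <= insert 0 (uminus ` ((%F. {a - b | a b. a : range ph & b : F}) ^^ nat q) {0})"
 proof
  fix y assume "y : range ps"
  then obtain xs where xs: "y = ps xs" by blast
  show "y : insert 0 (uminus ` ((%F. {a - b | a b. a : range ph & b : F}) ^^ nat q) {0})"
  proof (cases "y = 0")
   case False
   hence nz: "ps xs ~= 0" using xs by simp
   have "length xs = nat q" using len[OF nz] by linarith
   moreover have "y = - prism f ph xs" using len[OF nz] xs by (simp add: ps_def)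
   ultimately show ?thesis using prism_alternating_sum[of ph "range ph" f xs] by simp
  qed simp
 qed
 hence "finite (range ps)" using finite_alternating_sums[OF D(4)] by (meson finite.insertI finite_imageI finite_subset)
 moreover have "compactin X (tuple_support X ps)" by (rule compact_supportI[OF VS(2)]) (use outside in blast)
 ultimately have psP: "ps : tuple_funs X (q - 1)" using len unfolding tuple_funs_def by blast
 have "vanishes_near X A ps x" if x: "x : A" for x
 proof -
  obtain U where U: "openin X U" "x : U" "!!xs. set xs <= U Int A ==> ph xs = 0" using phA[OF x] unfolding vanishes_near_def by blast
  have "prism f ph xs = 0" if "set xs <= U Int A" for xs
   by (rule fixed) (use f(2) U(3) that in blast)+
  thus ?thesis using U(1,2) unfolding vanishes_near_def ps_def by (intro exI[of _ U]) simp
 qed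
 hence psA: "ps : vanishing_on X A (q - 1)" using psP by (simp add: vanishing_on_def)
 have homotopy: "(ph - cobdry X ps) xs = ph (map f xs) - prism f (cobdry X ph) xs" if xs: "set xs <= topspace X" for xs
 proof -
  have "alt_del ps xs = alt_del (%ys. - prism f ph ys) xs"
   by (rule alt_del_cong) (use deletionsD[of _ xs] xs in \<open>auto simp: ps_def\<close>)
  moreover have "prism f (cobdry X ph) xs = prism f (alt_del ph) xs"
  proof (rule prism_cong)
   fix ys assume "ys : prisms f xs"
   hence "set ys <= topspace X" using prismsD[of ys f xs] xs f(1) by blast
   thus "cobdry X ph ys = alt_del ph ys" by (simp add: cobdry_def)
  qed
  ultimately show ?thesis using prism_homotopy[of f ph xs] xs by (simp add: cobdry_def alt_del_minus)
 qed
 have M_top: "M <= topspace X" by (rule closedin_subset[OF M(1)])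
 have "vanishes_near X M (ph - cobdry X ps) x" if x: "x : M" for x
 proof (cases "x : S")
  case False
  then obtain U where "openin X U" "x : U" "ALL xs. set xs <= U Int topspace X --> ph (map f xs) - prism f (cobdry X ph) xs = 0"
   using outside[of x] M_top x unfolding vanishes_near_def by blast
  moreover have "set xs <= U Int M ==> set xs <= U Int topspace X & set xs <= topspace X" for xs using M_top by blast
  ultimately show ?thesis unfolding vanishes_near_def using homotopy by (intro exI[of _ U]) simp
 next
  case True
  then obtain y where y: "y : Y" "x : W y" using MS x by blast
  have ok: "ok (G y)" using G y(1) Y by blast
  have WG: "W y <= G y" and Wo: "openin X (W y)" using W y(1) by blast+
  have "(ph - cobdry X ps) xs = 0" if xs: "set xs <= W y Int M" for xs
  proof -
   have xtop: "set xs <= topspace X" using xs M_top by blast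
   have fG: "f x : G y" if "x : set xs" for x
    using f(2)[of x] f(3)[OF y(1), of x] xs WG that by (cases "x : S") auto
   have pr: "set ys <= G y" if "ys : prisms f xs" for ys using prismsD[OF that] xs WG fG by blast
   consider "ALL xs. set xs <= G y --> ph xs = 0" | "G y <= S" "ALL xs. set xs <= G y Int A --> ph xs = 0" "ALL xs. set xs <= G y --> cobdry X ph xs = 0"
    using ok unfolding ok_def by blast
   hence "ph (map f xs) = 0 & prism f (cobdry X ph) xs = 0"
   proof cases
    case 1
    have "cobdry X ph ys = 0" if "set ys <= G y" for ys
    proof -
     have "alt_del ph ys = 0" by (rule alt_del_zero, rule 1[rule_format]) (use deletionsD[of _ ys] that in blast)
     thus ?thesis by (simp add: cobdry_def)
    qed
    moreover have "set (map f xs) <= G y" using fG by auto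
    ultimately show ?thesis using 1 pr by (intro conjI prism_zero) auto
   next
    case 2
    have "f x : A Int G y" if "x : set xs" for x by (rule f(3)[OF y(1)]) (use xs WG 2(1) that in blast)
    hence "set (map f xs) <= G y Int A" by auto
    thus ?thesis using 2 pr by (intro conjI prism_zero) auto
   qed
   thus ?thesis using homotopy[OF xtop] by simp
  qed
  thus ?thesis unfolding vanishes_near_def using Wo y(2) by blast
 qed
 moreover have "ph - cobdry X ps : tuple_funs X q"
  using subgrp_diff[OF tuple_funs_subgroup phP] cobdry_in[OF psP] by simp
 ultimately have "ph - cobdry X ps : vanishing_on X M q" by (simp add: vanishing_on_def)
 thus ?thesis using psA M by (auto simp: closed_nbhds_def)
qed

section \<open>Massey cochains and chains of closed subspaces\<close>

text \<open>A map of quotients computed through presentations of its source and target.\<close>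

lemma quotient_map_presented:
 assumes H: "comm_group H" and N: "subgroup N H" and im: "ph ` Z = carrier H"
  and q: "presents (H Mod N) Z B (%z. N #>\<^bsub>H\<^esub> ph z)" and z: "z : Z"
  and f: "!!y. y : Z ==> N' #>\<^bsub>H'\<^esub> f (ph y) = g y"
  and g: "!!y. y : Z ==> y - z : B ==> g y = g z"
 shows "quotient_map H' N' f (N #>\<^bsub>H\<^esub> ph z) = g z"
proof -
 interpret H: comm_group H by (rule H)
 have phz: "ph z : carrier H" using im z by blast
 have "(%x. N' #>\<^bsub>H'\<^esub> f x) ` (N #>\<^bsub>H\<^esub> ph z) = {g z}"
 proof -
  have "N' #>\<^bsub>H'\<^esub> f x = g z" if x: "x : N #>\<^bsub>H\<^esub> ph z" for x
  proof -
   have "x : carrier H" using H.r_coset_subset_G[OF subgroup.subset[OF N] phz] x by blast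
   then obtain y where y: "y : Z" "x = ph y" using im by blast
   have "N #>\<^bsub>H\<^esub> ph y = N #>\<^bsub>H\<^esub> ph z" using H.repr_independence[OF x phz N] y(2) by simp
   hence "y - z : B" using presents_eq_iff[OF q y(1) z] by simp
   thus ?thesis using f[OF y(1)] g[OF y(1)] y(2) by simp
  qed
  moreover have "ph z : N #>\<^bsub>H\<^esub> ph z" by (rule H.rcos_self[OF phz N])
  ultimately show ?thesis by blast
 qed
 thus ?thesis by (simp add: quotient_map_def)
qed

lemma subgroup_group_of:
 assumes "subgrp Z" "subgrp B" "B <= Z" shows "subgroup B (group_of Z)"
proof (rule group.subgroupI[OF comm_group.axioms(2)[OF comm_group_group_of[OF assms(1)]]])
 show "B ~= {}" using subgrp_0[OF assms(2)] by blast
 fix a assume a: "a : B"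
 thus "inv\<^bsub>group_of Z\<^esub> a : B" using inv_group_of[OF assms(1), of a] subgrp_minus[OF assms(2)] assms(3) by auto
 fix b assume "b : B"
 thus "a \<otimes>\<^bsub>group_of Z\<^esub> b : B" using a subgrp_add[OF assms(2)] by simp
qed (use assms(3) in simp)

text \<open>Every parametrization of a group by an additive one presents its quotients.\<close>

lemma presents_parametrized:
 assumes Z: "subgrp Z" and B: "subgrp B" "B <= Z" and im: "ph ` Z = carrier H"
  and mult: "!!x y. x : Z ==> y : Z ==> ph (x + y) = ph x \<otimes>\<^bsub>H\<^esub> ph y" and one: "\<one>\<^bsub>H\<^esub> = ph 0"
  and N: "N <= carrier H" "!!z. z : Z ==> ph z : N \<longleftrightarrow> z : B"
 shows "comm_group H" "subgroup N H" "presents (H Mod N) Z B (%z. N #>\<^bsub>H\<^esub> ph z)"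
proof -
 have "comm_group H"
  by (rule comm_group_image[OF comm_group_group_of[OF Z], of ph]) (use im mult one in simp_all)
 thus H: "comm_group H" .
 have "group_hom (group_of Z) H ph"
  using comm_group.axioms(2)[OF comm_group_group_of[OF Z]] comm_group.axioms(2)[OF H] im mult
  by (auto simp: group_hom_def group_hom_axioms_def hom_def)
 hence "subgroup (ph ` B) H" by (rule group_hom.subgroup_img_is_subgroup) (rule subgroup_group_of[OF Z B])
 moreover have "ph ` B = N"
 proof (intro equalityI subsetI)
  fix x assume x: "x : N"
  then obtain z where "z : Z" "x = ph z" using N(1) im by blast
  thus "x : ph ` B" using N(2) x by blast
 qed (use N(2) B(2) in blast)
 ultimately show sN: "subgroup N H" by simp
 have "presents (H Mod N) Z {z : Z. ph z : N} (%z. N #>\<^bsub>H\<^esub> ph z)"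
  by (rule presents_Mod[where ph=ph, OF H sN Z im mult])
 moreover have "{z : Z. ph z : N} = B" using N(2) B(2) by blast
 ultimately show "presents (H Mod N) Z B (%z. N #>\<^bsub>H\<^esub> ph z)" by simp
qed

lemma finprod_integer_group: "finite A ==> finprod integer_group f A = sum f A"
proof (induction A rule: finite_induct)
 case empty
 show ?case using comm_monoid.finprod_empty[OF comm_group.axioms(1)[OF abelian_integer_group]] by simp
next
 case (insert a A)
 thus ?case
  using comm_monoid.finprod_insert[OF comm_group.axioms(1)[OF abelian_integer_group], of A a f] by simp
qed

lemma alt_del_sum:
 fixes f :: "'a list => int"
 shows "alt_del f xs = (\<Sum>j<length xs. f (take j xs @ drop (Suc j) xs) * (- 1) ^ j)"
proof (induction xs arbitrary: f)
 case (Cons x xs)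
 have "(\<Sum>j<length (x # xs). f (take j (x # xs) @ drop (Suc j) (x # xs)) * (- 1) ^ j) =
  f xs + (\<Sum>j<length xs. f (x # (take j xs @ drop (Suc j) xs)) * (- 1) ^ Suc j)"
  by (simp add: sum.lessThan_Suc_shift del: sum.lessThan_Suc)
 also have "\<dots> = f xs - (\<Sum>j<length xs. f (x # (take j xs @ drop (Suc j) xs)) * (- 1) ^ j)"
  by (simp add: sum_negf)
 also have "\<dots> = f xs - alt_del (%ys. f (x # ys)) xs" unfolding Cons.IH[of "%ys. f (x # ys)"] ..
 finally show ?case by simp
qed simp

abbreviation "mfun X N q == massey_functions (nat q) (subtopology X N) integer_group"
abbreviation "mnull X N q == massey_null (nat q) (subtopology X N) integer_group"

definition restricted :: "int => 'a set => ('a list => int) => 'a list => int"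
 where "restricted q N ph = restrict ph (tuples (nat q) N)"

definition cochain_class :: "'a topology => 'a set => int => ('a list => int) => ('a list => int) set"
 where "cochain_class X N q ph = (if q < 0 then undefined
  else mnull X N q
   #>\<^bsub>mfun X N q\<^esub> restricted q N ph)"

context
 fixes X :: "'a topology" and N :: "'a set"
 assumes N: "closedin X N"
begin

lemma topspace_N: "topspace (subtopology X N) = N" "topspace X Int N = N"
 using closedin_subset[OF N] by auto

lemma N_top: "N <= topspace X" by (rule closedin_subset[OF N])

lemma massey_support_near:
 assumes "!!xs. ph xs ~= 0 ==> length xs = Suc m"
 shows "massey_support m (subtopology X N) integer_group (restrict ph (tuples m N)) = {x : N. \<not> vanishes_near X N ph x}"
proof -
 have "(EX U. neighbourhood (subtopology X N) {x} U & (ALL xs:tuples m U. restrict ph (tuples m N) xs = 0)) \<longleftrightarrow> vanishes_near X N ph x"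
  (is "?L \<longleftrightarrow> _") if x: "x : N" for x
 proof
  assume ?L
  then obtain U where U: "U <= N" "x : (subtopology X N) interior_of U" "ALL xs:tuples m U. restrict ph (tuples m N) xs = 0"
   by (auto simp: neighbourhood_def topspace_N)
  obtain W where W: "openin X W" "x : W" "W Int N <= U"
   using U(2) unfolding interior_of_def openin_subtopology by blast
  have "ph xs = 0" if xs: "set xs <= W Int N" for xs
  proof (rule ccontr)
   assume nz: "ph xs ~= 0"
   hence "xs : tuples m U" "xs : tuples m N" using assms[OF nz] xs W(3) by (auto simp: tuples_def)
   thus False using bspec[OF U(3), of xs] nz by simp
  qed
  thus "vanishes_near X N ph x" using W(1,2) unfolding vanishes_near_def by blast
 next
  assume "vanishes_near X N ph x"
  then obtain U where U: "openin X U" "x : U" "ALL xs. set xs <= U Int N --> ph xs = 0" unfolding vanishes_near_def by blast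
  have "openin (subtopology X N) (U Int N)" using U(1) by (auto simp: openin_subtopology)
  hence "neighbourhood (subtopology X N) {x} (U Int N)"
   using x U(2) interior_of_openin[of "subtopology X N" "U Int N"] by (simp add: neighbourhood_def topspace_N)
  moreover have "ALL xs:tuples m (U Int N). restrict ph (tuples m N) xs = 0" using U(3) by (simp add: tuples_def restrict_def)
  ultimately show ?L by blast
 qed
 thus ?thesis unfolding massey_support_def topspace_N(1) one_integer_group by blast
qed

lemma restricted_in:
 assumes q: "0 \<le> q" and ph: "ph : tuple_funs X q"
 shows "restricted q N ph : carrier (mfun X N q)"
proof -
 note D = tuple_funsD[OF ph]
 have len: "length xs = Suc (nat q)" if "ph xs ~= 0" for xs using D(2)[OF that] q by linarith
 let ?S = "{x : N. \<not> vanishes_near X N ph x}"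
 have "EX U. openin X U & x : U & U <= topspace X - ?S" if x: "x : topspace X - ?S" for x
 proof (cases "x : N")
  case True
  then obtain U where U: "openin X U" "x : U" "ALL xs. set xs <= U Int N --> ph xs = 0" using x unfolding vanishes_near_def by blast
  hence "U <= topspace X - ?S" using openin_subset[OF U(1)] unfolding vanishes_near_def by blast
  thus ?thesis using U by blast
 next
  case False
  thus ?thesis using N x by (intro exI[of _ "topspace X - N"]) auto
 qed
 hence "openin X (topspace X - ?S)" by (subst openin_subopen) blast
 hence cl: "closedin X ?S" using N_top by (auto simp: closedin_def)
 have "?S <= tuple_support X ph"
 proof
  fix x assume x: "x : ?S"
  have "vanishes_near X N ph x" if "vanishes_near X (topspace X) ph x"
   using that N_top unfolding vanishes_near_def by (meson Int_mono order_refl order_trans)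
  thus "x : tuple_support X ph" using x N_top by (auto simp: tuple_support_def)
 qed
 hence "compactin X ?S" by (rule closed_compactin[OF D(5) _ cl])
 hence "compactin (subtopology X N) ?S" by (simp add: compactin_subtopology)
 moreover have "finite (restrict ph (tuples (nat q) N) ` tuples (nat q) N)"
  by (rule finite_subset[OF _ D(4)]) auto
 ultimately show ?thesis using massey_support_near[OF len]
  by (simp add: massey_functions_def restricted_def topspace_N)
qed

text \<open>Extension by zero off \<open>N\<close>; as \<open>N\<close> is closed, this adds nothing to the support.\<close>

lemma restricted_onto:
 assumes q: "0 \<le> q" and ps: "ps : carrier (mfun X N q)"
 shows "EX ph:tuple_funs X q. restricted q N ph = ps"
proof -
 let ?m = "nat q"
 define ph where "ph = (%xs. if xs : tuples ?m N then ps xs else 0)"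
 have ps': "ps : tuples ?m N \<rightarrow>\<^sub>E UNIV" "finite (ps ` tuples ?m N)" "compactin (subtopology X N) (massey_support ?m (subtopology X N) integer_group ps)"
  using ps by (auto simp: massey_functions_def topspace_N)
 have r: "restrict ph (tuples ?m N) = ps" using ps'(1) by (auto simp: ph_def fun_eq_iff PiE_def extensional_def)
 have len: "ph xs ~= 0 ==> xs : tuples ?m N" for xs by (auto simp: ph_def split: if_splits)
 have supp: "massey_support ?m (subtopology X N) integer_group ps = {x : N. \<not> vanishes_near X N ph x}"
  unfolding r[symmetric] by (rule massey_support_near) (use len in \<open>auto simp: tuples_def\<close>)
 have "compactin X {x : N. \<not> vanishes_near X N ph x}" using ps'(3) unfolding supp by (simp add: compactin_subtopology)
 hence "compactin X (tuple_support X ph)"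
 proof (rule compact_supportI)
  fix x assume x: "x : topspace X" "x ~: {x : N. \<not> vanishes_near X N ph x}"
  show "vanishes_near X (topspace X) ph x"
  proof (cases "x : N")
   case True
   then obtain U where U: "openin X U" "x : U" "ALL xs. set xs <= U Int N --> ph xs = 0" using x(2) unfolding vanishes_near_def by blast
   have "ph xs = 0" if "set xs <= U Int topspace X" for xs
    using U(3) len[of xs] that by (auto simp: tuples_def)
   thus ?thesis using U unfolding vanishes_near_def by blast
  next
   case False
   have "ph xs = 0" if "set xs <= (topspace X - N) Int topspace X" for xs
    using len[of xs] that by (cases xs) (auto simp: tuples_def)
   thus ?thesis using False N x(1) unfolding vanishes_near_def by (intro exI[of _ "topspace X - N"]) auto
  qed
 qed
 moreover have "range ph <= insert 0 (ps ` tuples ?m N)" by (auto simp: ph_def)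
 hence "finite (range ph)" using ps'(2) finite_subset by blast
 moreover have "xs ~= [] & int (length xs) = q + 1 & set xs <= topspace X" if "ph xs ~= 0" for xs
  using len[OF that] q N_top by (auto simp: tuples_def)
 ultimately have "ph : tuple_funs X q" by (simp add: tuple_funs_def)
 thus ?thesis using r by (auto simp: restricted_def)
qed

lemma null_subset: "vanishing_on X N q <= tuple_funs X q"
 by (auto simp: vanishing_on_def)

lemma massey_cochains_presented:
 assumes q: "0 \<le> q"
 shows "comm_group (mfun X N q)"
  "subgroup (mnull X N q) (mfun X N q)"
  "restricted q N ` tuple_funs X q = carrier (mfun X N q)"
  "presents (massey_cochains q (subtopology X N) integer_group) (tuple_funs X q) (vanishing_on X N q) (cochain_class X N q)"
proof -
 let ?H = "mfun X N q" and ?K = "mnull X N q"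
 show im: "restricted q N ` tuple_funs X q = carrier ?H" using restricted_in[OF q] restricted_onto[OF q] by blast
 have mult: "restricted q N (ph + ps) = restricted q N ph \<otimes>\<^bsub>?H\<^esub> restricted q N ps" for ph ps
  by (auto simp: massey_functions_def restricted_def topspace_N product_group_def)
 have one: "\<one>\<^bsub>?H\<^esub> = restricted q N 0"
  by (auto simp: massey_functions_def restricted_def topspace_N product_group_def)
 have K: "restricted q N ph : ?K \<longleftrightarrow> ph : vanishing_on X N q" if ph: "ph : tuple_funs X q" for ph
 proof -
  have len: "length xs = Suc (nat q)" if "ph xs ~= 0" for xs using tuple_funsD(2)[OF ph that] q by linarith
  show ?thesis using restricted_in[OF q ph] ph massey_support_near[OF len] by (auto simp: massey_null_def vanishing_on_def restricted_def)
 qed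
 have KH: "?K <= carrier ?H" by (auto simp: massey_null_def)
 note R = presents_parametrized[OF tuple_funs_subgroup vanishing_on_subgroup[OF N_top] null_subset im mult one KH K]
 show "comm_group ?H" by (rule R(1))
 show "subgroup ?K ?H" by (rule R(2))
 show "presents (massey_cochains q (subtopology X N) integer_group) (tuple_funs X q) (vanishing_on X N q) (cochain_class X N q)"
  using R(3) q by (simp add: massey_cochains_def cochain_class_def[abs_def])
qed

lemma tuple_funs_neg: "q < 0 ==> tuple_funs X q = {0}"
proof -
 assume q: "q < 0"
 have "ph = 0" if "ph : tuple_funs X q" for ph
 proof
  fix xs show "ph xs = 0 xs" using tuple_funsD(1,2)[OF that, of xs] q by (cases "ph xs = 0"; cases xs) auto
 qed
 thus ?thesis using subgrp_0[OF tuple_funs_subgroup] by blast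
qed

lemma cochains_presented:
 "presents (massey_cochains q (subtopology X N) integer_group) (tuple_funs X q) (vanishing_on X N q) (cochain_class X N q)"
proof (cases "q < 0")
 case True
 have "0 : vanishing_on X N q" by (rule subgrp_0[OF vanishing_on_subgroup[OF N_top]])
 thus ?thesis using True tuple_funs_neg[OF True]
  by (simp add: presents_def massey_cochains_def cochain_class_def) (simp add: singleton_group_def)
next
 case False
 thus ?thesis using massey_cochains_presented(4) by simp
qed

lemma cochain_class_eq: "ph : tuple_funs X q ==> ps : tuple_funs X q ==> ph - ps : vanishing_on X N q ==>
  cochain_class X N q ph = cochain_class X N q ps"
 using presents_eq_iff[OF cochains_presented] by blast

lemma null_cobdry: "ph : vanishing_on X N q ==> cobdry X ph : vanishing_on X N (q + 1)"
 using cobdry_in[of ph X q] vanishes_near_cobdry[of X N ph] unfolding vanishing_on_def by blast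

lemma cobdry_diff: "cobdry X (ph - ps) = cobdry X ph - cobdry X ps"
 using cobdry_add[of X "ph - ps" ps] by (simp add: algebra_simps)

text \<open>The power with exponent \<open>(-1) ^ j\<close> in the integers is multiplication by that sign, so the coboundary
 is the alternating sum of deletions.\<close>

lemma coboundary_class:
 assumes ph: "ph : tuple_funs X q"
 shows "massey_coboundary q (subtopology X N) integer_group (cochain_class X N q ph) = cochain_class X N (q + 1) (cobdry X ph)"
proof (cases "q < 0")
 case True
 hence "ph = 0" using ph tuple_funs_neg[OF True] by simp
 hence "cobdry X ph = 0" using cobdry_diff[of 0 0] by simp
 moreover have "cochain_class X N (q + 1) 0 = \<one>\<^bsub>massey_cochains (q + 1) (subtopology X N) integer_group\<^esub>"
  using presentsD(6)[OF cochains_presented subgrp_0[OF tuple_funs_subgroup]] subgrp_0[OF vanishing_on_subgroup[OF N_top]] by blast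
 ultimately show ?thesis using True by (simp add: massey_coboundary_def)
next
 case False
 let ?H = "mfun X N q" and ?K = "mnull X N q"
 let ?H' = "massey_functions (Suc (nat q)) (subtopology X N) integer_group" and ?K' = "massey_null (Suc (nat q)) (subtopology X N) integer_group"
 let ?f = "function_coboundary (nat q) (subtopology X N) integer_group"
 have q: "0 \<le> q" and s: "nat (q + 1) = Suc (nat q)" using False by auto
 note R = massey_cochains_presented[OF q]
 have c: "cochain_class X N q = (%z. ?K #>\<^bsub>?H\<^esub> restricted q N z)" using False by (simp add: cochain_class_def fun_eq_iff)
 have P: "presents (?H Mod ?K) (tuple_funs X q) (vanishing_on X N q) (%z. ?K #>\<^bsub>?H\<^esub> restricted q N z)"
  using R(4) False unfolding c by (simp add: massey_cochains_def)
 have f: "?f (restricted q N ps) = restricted (q + 1) N (cobdry X ps)" for ps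
 proof
  fix xs show "?f (restricted q N ps) xs = restricted (q + 1) N (cobdry X ps) xs"
  proof (cases "xs : tuples (Suc (nat q)) N")
   case True
   have "?f (restricted q N ps) xs = (\<Sum>j\<le>Suc (nat q). restricted q N ps (take j xs @ drop (Suc j) xs) * (- 1) ^ j)"
    using True by (simp add: function_coboundary_def topspace_N finprod_integer_group mult.commute del: sum.atMost_Suc)
   also have "\<dots> = (\<Sum>j<length xs. ps (take j xs @ drop (Suc j) xs) * (- 1) ^ j)"
   proof (rule sum.cong)
    show "{..Suc (nat q)} = {..<length xs}" using True by (auto simp: tuples_def)
    fix j assume j: "j : {..<length xs}"
    have "set (take j xs @ drop (Suc j) xs) <= set xs" using set_take_subset[of j xs] set_drop_subset[of "Suc j" xs] by auto
    moreover have "length (take j xs @ drop (Suc j) xs) = Suc (nat q)" using j True by (auto simp: tuples_def)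
    ultimately have "take j xs @ drop (Suc j) xs : tuples (nat q) N" using True unfolding tuples_def by blast
    thus "restricted q N ps (take j xs @ drop (Suc j) xs) * (- 1) ^ j = ps (take j xs @ drop (Suc j) xs) * (- 1) ^ j"
     by (simp add: restricted_def)
   qed
   also have "\<dots> = restricted (q + 1) N (cobdry X ps) xs"
    using True N_top by (auto simp: restricted_def s cobdry_def alt_del_sum tuples_def)
   finally show ?thesis .
  next
   case False
   thus ?thesis by (simp add: function_coboundary_def topspace_N restricted_def s)
  qed
 qed
 have "quotient_map ?H' ?K' ?f (?K #>\<^bsub>?H\<^esub> restricted q N ph) = cochain_class X N (q + 1) (cobdry X ph)"
 proof (rule quotient_map_presented[where ph="restricted q N", OF R(1,2,3) P ph])
  fix ps assume ps: "ps : tuple_funs X q"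
  show "?K' #>\<^bsub>?H'\<^esub> ?f (restricted q N ps) = cochain_class X N (q + 1) (cobdry X ps)"
   using q by (simp add: cochain_class_def f s)
  assume "ps - ph : vanishing_on X N q"
  hence "cobdry X ps - cobdry X ph : vanishing_on X N (q + 1)" using null_cobdry cobdry_diff by metis
  thus "cochain_class X N (q + 1) (cobdry X ps) = cochain_class X N (q + 1) (cobdry X ph)"
   by (rule cochain_class_eq[OF cobdry_in[OF ps] cobdry_in[OF ph]])
 qed
 thus ?thesis using False c by (simp add: massey_coboundary_def)
qed

end

lemma null_functions_antimono:
 assumes "N <= M" shows "vanishing_on X M q <= vanishing_on X N q"
proof -
 have "vanishes_near X N ph x" if "vanishes_near X M ph x" for x and ph :: "'a list => int"
  using that assms unfolding vanishes_near_def by (meson Int_mono order_refl order_trans)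
 thus ?thesis using assms by (auto simp: vanishing_on_def)
qed

lemma pullback_class:
 assumes N: "closedin X N" and M: "closedin X M" and NM: "N <= M" and ph: "ph : tuple_funs X q"
 shows "massey_pullback q (subtopology X N) integer_group id (cochain_class X M q ph) = cochain_class X N q ph"
proof (cases "q < 0")
 case True
 thus ?thesis by (simp add: massey_pullback_def massey_cochains_def cochain_class_def singleton_group_def)
next
 case False
 let ?H = "mfun X M q" and ?K = "mnull X M q"
 let ?H' = "mfun X N q" and ?K' = "mnull X N q"
 let ?f = "%ph. \<lambda>xs\<in>tuples (nat q) (topspace (subtopology X N)). ph (map id xs)"
 have q: "0 \<le> q" using False by auto
 note R = massey_cochains_presented[OF M q]
 have c: "cochain_class X M q = (%z. ?K #>\<^bsub>?H\<^esub> restricted q M z)" using False by (simp add: cochain_class_def fun_eq_iff)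
 have P: "presents (?H Mod ?K) (tuple_funs X q) (vanishing_on X M q) (%z. ?K #>\<^bsub>?H\<^esub> restricted q M z)"
  using R(4) False unfolding c by (simp add: massey_cochains_def)
 have f: "?f (restricted q M ps) = restricted q N ps" for ps
  using NM by (auto simp: restricted_def topspace_N[OF N] fun_eq_iff tuples_def restrict_def)
 have "quotient_map ?H' ?K' ?f (?K #>\<^bsub>?H\<^esub> restricted q M ph) = cochain_class X N q ph"
 proof (rule quotient_map_presented[where ph="restricted q M", OF R(1,2,3) P ph])
  fix ps assume ps: "ps : tuple_funs X q"
  show "?K' #>\<^bsub>?H'\<^esub> ?f (restricted q M ps) = cochain_class X N q ps"
   using q unfolding f by (simp add: cochain_class_def)
  assume "ps - ph : vanishing_on X M q"
  thus "cochain_class X N q ps = cochain_class X N q ph"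
   using null_functions_antimono[OF NM] by (intro cochain_class_eq[OF N ps ph]) blast
 qed
 thus ?thesis using False c by (simp add: massey_pullback_def)
qed

section \<open>Lifting finitely additive measures\<close>

definition set_algebra :: "'w set set => bool"
 where "set_algebra \<A> \<longleftrightarrow> {} : \<A> & (ALL A:\<A>. - A : \<A>) & (ALL A:\<A>. ALL B:\<A>. A Un B : \<A>)"

definition algebra_of :: "'w set set => 'w set set"
 where "algebra_of Gm = \<Inter>{\<A>. set_algebra \<A> & Gm <= \<A>}"

definition simple :: "'w set set => ('w => int) set"
 where "simple \<A> = {ph. finite (range ph) & (ALL v. {w. ph w = v} : \<A>)}"

definition set_ideal :: "'w set set => 'w set set => bool"
 where "set_ideal \<A> \<J> \<longleftrightarrow> \<J> <= \<A> & {} : \<J> & (ALL A:\<J>. ALL B:\<J>. A Un B : \<J>) & (ALL A:\<J>. ALL B:\<A>. B <= A --> B : \<J>)"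

definition null_functions :: "'w set set => 'w set set => ('w => int) set"
 where "null_functions \<A> \<J> = {ph : simple \<A>. {w. ph w ~= 0} : \<J>}"

lemma set_algebraD:
 assumes "set_algebra \<A>"
 shows "{} : \<A>" "A : \<A> ==> - A : \<A>" "A : \<A> ==> B : \<A> ==> A Un B : \<A>"
  "A : \<A> ==> B : \<A> ==> A Int B : \<A>" "UNIV : \<A>"
proof -
 show 1: "{} : \<A>" "A : \<A> ==> - A : \<A>" "A : \<A> ==> B : \<A> ==> A Un B : \<A>" for A B
  using assms unfolding set_algebra_def by blast+
 show "A Int B : \<A>" if "A : \<A>" "B : \<A>" using 1(2)[OF 1(3)[OF 1(2)[OF that(1)] 1(2)[OF that(2)]]] by simp
 show "UNIV : \<A>" using 1(2)[OF 1(1)] by simp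
qed

lemma set_algebra_UN:
 assumes "set_algebra \<A>" "finite F" "!!x. x : F ==> A x : \<A>" shows "(\<Union>x\<in>F. A x) : \<A>"
 using assms(2,3) by (induction F rule: finite_induct) (auto intro: set_algebraD[OF assms(1)])

lemma set_algebra_INT:
 assumes "set_algebra \<A>" "finite F" "!!x. x : F ==> A x : \<A>" shows "(\<Inter>x\<in>F. A x) : \<A>"
 using assms(2,3) by (induction F rule: finite_induct) (auto intro: set_algebraD[OF assms(1)])

lemma algebra_of: "set_algebra (algebra_of Gm)" "Gm <= algebra_of Gm"
 unfolding algebra_of_def set_algebra_def by blast+

lemma algebra_of_least: "set_algebra \<A> ==> Gm <= \<A> ==> algebra_of Gm <= \<A>"
 unfolding algebra_of_def by blast

lemma algebra_of_mono: "Gm <= Gm' ==> algebra_of Gm <= algebra_of Gm'"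
 by (meson algebra_of algebra_of_least order_trans)

lemma simple_mono: "\<A> <= \<B> ==> simple \<A> <= simple \<B>"
 unfolding simple_def by blast

text \<open>A function of finitely many membership conditions is simple.\<close>

lemma simpleI:
 assumes \<A>: "set_algebra \<A>" and V: "finite V" and B: "!!v. v : V ==> B v : \<A>"
 shows "(%w. F {v : V. w : B v}) : simple \<A>"
proof -
 let ?f = "%w. F {v : V. w : B v}"
 have "range ?f <= F ` Pow V" by blast
 hence "finite (range ?f)" using V by (meson finite_Pow_iff finite_imageI finite_subset)
 moreover have "{w. ?f w = c} : \<A>" for c
 proof -
  have "{w. ?f w = c} = (\<Union>T\<in>{T : Pow V. F T = c}. \<Inter>v\<in>V. if v : T then B v else - B v)" (is "?L = ?R")
  proof (intro equalityI subsetI)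
   fix w assume "w : ?L"
   thus "w : ?R" by (intro UN_I[of "{v : V. w : B v}"]) auto
  next
   fix w assume "w : ?R"
   then obtain T where T: "T <= V" "F T = c" "ALL v:V. w : (if v : T then B v else - B v)" by blast
   hence "{v : V. w : B v} = T" by (auto split: if_splits)
   thus "w : ?L" using T by simp
  qed
  also have "\<dots> : \<A>"
   by (intro set_algebra_UN[OF \<A>] set_algebra_INT[OF \<A> V]) (use V B set_algebraD[OF \<A>] in auto)
  finally show ?thesis .
 qed
 ultimately show ?thesis by (simp add: simple_def)
qed

lemma simple_combine:
 assumes \<A>: "set_algebra \<A>" and ph: "ph : simple \<A>" and ps: "ps : simple \<A>"
 shows "(%w. h (ph w) (ps w)) : simple \<A>"
proof -
 let ?R = "range ph \<times> range ps"
 have fin: "finite (range ph)" "finite (range ps)" and lev: "{w. ph w = v} : \<A>" "{w. ps w = v} : \<A>" for v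
  using ph ps by (auto simp: simple_def)
 have "range (%w. h (ph w) (ps w)) <= (%(a, b). h a b) ` ?R" by force
 hence "finite (range (%w. h (ph w) (ps w)))" using fin by (meson finite_SigmaI finite_imageI finite_subset)
 moreover have "{w. h (ph w) (ps w) = v} : \<A>" for v
 proof -
  have "{w. h (ph w) (ps w) = v} = (\<Union>p\<in>{p : ?R. h (fst p) (snd p) = v}. {w. ph w = fst p} Int {w. ps w = snd p})" (is "?L = ?R'")
  proof (intro equalityI subsetI)
   fix w assume "w : ?L"
   thus "w : ?R'" by (intro UN_I[of "(ph w, ps w)"]) auto
  qed auto
  also have "\<dots> : \<A>"
   by (intro set_algebra_UN[OF \<A>] set_algebraD(4)[OF \<A>] lev) (use fin in auto)
  finally show ?thesis .
 qed
 ultimately show ?thesis by (simp add: simple_def)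
qed

lemma simple_Collect:
 assumes \<A>: "set_algebra \<A>" and ph: "ph : simple \<A>" and ps: "ps : simple \<A>"
 shows "{w. Q (ph w) (ps w)} : \<A>"
proof -
 have "(%w. if Q (ph w) (ps w) then 1 else 0) : simple \<A>"
  by (rule simple_combine[OF \<A> ph ps, where h="%a b. if Q a b then 1 else 0"])
 hence "{w. (if Q (ph w) (ps w) then 1 else 0) = (1::int)} : \<A>" unfolding simple_def by blast
 moreover have "{w. (if Q (ph w) (ps w) then 1 else 0) = (1::int)} = {w. Q (ph w) (ps w)}" by auto
 ultimately show ?thesis by simp
qed

lemma simple_subgroup:
 assumes \<A>: "set_algebra \<A>" shows "subgrp (simple \<A>)"
 unfolding subgrp_def
proof (intro conjI ballI)
 show "0 : simple \<A>" using simpleI[OF \<A>, of "{}" _ "%_. 0"] by (simp add: zero_fun_def)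
 show "ph - ps : simple \<A>" if "ph : simple \<A>" "ps : simple \<A>" for ph ps
  using simple_combine[OF \<A> that, of "(-)"] by (simp add: fun_diff_def)
qed

definition cutoff :: "'w set => ('w => int) => 'w => int"
 where "cutoff E ps = (%w. if w : E then ps w else 0)"

lemma cutoff_add: "cutoff E (ph + ps) = cutoff E ph + cutoff E ps" and cutoff_diff: "cutoff E (ph - ps) = cutoff E ph - cutoff E ps"
 by (auto simp: cutoff_def)

lemma cutoff_simple:
 assumes \<A>: "set_algebra \<A>" and E: "E : \<A>" and ps: "ps : simple \<A>"
 shows "cutoff E ps : simple \<A>"
proof -
 have "(%w. if {v : {()}. w : E} = {} then 0 else 1) : simple \<A>"
  using simpleI[OF \<A>, of "{()}" "%_. E" "%T. if T = {} then 0 else 1"] E by simp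
 from simple_combine[OF \<A> this ps, of "%a b. if a = 0 then 0 else b"]
 have "(%w. if (if {v : {()}. w : E} = {} then 0 else 1) = (0::int) then 0 else ps w) : simple \<A>" .
 moreover have "(%w. if (if {v : {()}. w : E} = {} then 0 else 1) = (0::int) then 0 else ps w) = cutoff E ps"
  by (auto simp: cutoff_def fun_eq_iff)
 ultimately show ?thesis by simp
qed

lemma null_functions_subgroup:
 assumes \<A>: "set_algebra \<A>" and \<J>: "set_ideal \<A> \<J>" shows "subgrp (null_functions \<A> \<J>)"
 unfolding subgrp_def
proof (intro conjI ballI)
 show "0 : null_functions \<A> \<J>"
  using subgrp_0[OF simple_subgroup[OF \<A>]] \<J> by (simp add: null_functions_def set_ideal_def)
 fix ph ps assume a: "ph : null_functions \<A> \<J>" "ps : null_functions \<A> \<J>"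
 hence s: "ph : simple \<A>" "ps : simple \<A>" by (auto simp: null_functions_def)
 have "{w. ph w ~= 0} Un {w. ps w ~= 0} : \<J>" using a \<J> by (auto simp: null_functions_def set_ideal_def)
 moreover have "{w. (ph - ps) w ~= 0} : \<A>" using simple_Collect[OF \<A> s, of "%a b. a - b ~= 0"] by simp
 moreover have "{w. (ph - ps) w ~= 0} <= {w. ph w ~= 0} Un {w. ps w ~= 0}" by auto
 ultimately have "{w. (ph - ps) w ~= 0} : \<J>" using \<J> unfolding set_ideal_def by blast
 thus "ph - ps : null_functions \<A> \<J>"
  using subgrp_diff[OF simple_subgroup[OF \<A>] s] by (simp add: null_functions_def)
qed

definition adjoin_set :: "'w set => 'w set set => 'w set set"
 where "adjoin_set E \<A> = {(A Int E) Un (B - E) | A B. A : \<A> & B : \<A>}"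

lemma adjoin_set_algebra:
 assumes \<A>: "set_algebra \<A>"
 shows "set_algebra (adjoin_set E \<A>)" "\<A> <= adjoin_set E \<A>" "E : adjoin_set E \<A>"
proof -
 have I: "(A Int E) Un (B - E) : adjoin_set E \<A>" if "A : \<A>" "B : \<A>" for A B
  using that unfolding adjoin_set_def by blast
 show "set_algebra (adjoin_set E \<A>)"
  unfolding set_algebra_def
 proof (intro conjI ballI)
  show "{} : adjoin_set E \<A>" using I[of "{}" "{}"] set_algebraD(1)[OF \<A>] by simp
  fix X assume "X : adjoin_set E \<A>"
  then obtain A B where X: "X = (A Int E) Un (B - E)" "A : \<A>" "B : \<A>" unfolding adjoin_set_def by blast
  have "- X = (- A Int E) Un (- B - E)" unfolding X(1) by blast
  thus "- X : adjoin_set E \<A>" using I[OF set_algebraD(2)[OF \<A> X(2)] set_algebraD(2)[OF \<A> X(3)]] by simp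
  fix Y assume "Y : adjoin_set E \<A>"
  then obtain A' B' where Y: "Y = (A' Int E) Un (B' - E)" "A' : \<A>" "B' : \<A>" unfolding adjoin_set_def by blast
  have "X Un Y = ((A Un A') Int E) Un ((B Un B') - E)" unfolding X(1) Y(1) by blast
  thus "X Un Y : adjoin_set E \<A>" using I[OF set_algebraD(3)[OF \<A> X(2) Y(2)] set_algebraD(3)[OF \<A> X(3) Y(3)]] by simp
 qed
 show "\<A> <= adjoin_set E \<A>"
 proof
  fix A assume "A : \<A>"
  hence "(A Int E) Un (A - E) : adjoin_set E \<A>" by (intro I)
  moreover have "(A Int E) Un (A - E) = A" by blast
  ultimately show "A : adjoin_set E \<A>" by simp
 qed
 show "E : adjoin_set E \<A>" using I[OF set_algebraD(5)[OF \<A>] set_algebraD(1)[OF \<A>]] by simp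
qed

lemma algebra_of_insert: "algebra_of (insert E Gm) = adjoin_set E (algebra_of Gm)"
proof
 show "algebra_of (insert E Gm) <= adjoin_set E (algebra_of Gm)"
  using adjoin_set_algebra[OF algebra_of(1)[of Gm], of E] algebra_of(2)[of Gm]
  by (intro algebra_of_least) auto
 have a: "set_algebra (algebra_of (insert E Gm))" and E: "E : algebra_of (insert E Gm)"
  using algebra_of[of "insert E Gm"] by auto
 have sub: "algebra_of Gm <= algebra_of (insert E Gm)" by (rule algebra_of_mono) blast
 show "adjoin_set E (algebra_of Gm) <= algebra_of (insert E Gm)"
 proof
  fix X assume "X : adjoin_set E (algebra_of Gm)"
  then obtain A B where X: "X = (A Int E) Un (B - E)" "A : algebra_of (insert E Gm)" "B : algebra_of (insert E Gm)"
   using sub unfolding adjoin_set_def by blast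
  show "X : algebra_of (insert E Gm)"
   unfolding X(1) Diff_eq by (intro set_algebraD(3)[OF a] set_algebraD(4)[OF a] set_algebraD(2)[OF a] X(2,3) E)
 qed
qed

text \<open>On \<open>E\<close> and off \<open>E\<close> a simple function of the enlarged algebra agrees with one of the given algebra.\<close>

lemma adjoin_simple_decompose:
 assumes \<A>: "set_algebra \<A>" and f: "f : simple (adjoin_set E \<A>)"
 shows "EX ph:simple \<A>. EX ps:simple \<A>. f = ph + cutoff E ps"
proof -
 have fin: "finite (range f)" and lev: "{w. f w = v} : adjoin_set E \<A>" for v using f by (auto simp: simple_def)
 have "ALL v. EX A B. A : \<A> & B : \<A> & {w. f w = v} = (A Int E) Un (B - E)" using lev unfolding adjoin_set_def by blast
 then obtain A B where AB: "!!v. A v : \<A>" "!!v. B v : \<A>" "!!v. {w. f w = v} = (A v Int E) Un (B v - E)" by metis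
 define F where "F T = (if T = {} then 0 else Min T)" for T :: "int set"
 define \<alpha> where "\<alpha> w = F {v : range f. w : A v}" for w
 define ph where "ph w = F {v : range f. w : B v}" for w
 have "\<alpha> : simple \<A>" "ph : simple \<A>"
  unfolding \<alpha>_def ph_def by (rule simpleI[OF \<A> fin AB(1)], rule simpleI[OF \<A> fin AB(2)])
 moreover from this have "\<alpha> - ph : simple \<A>" by (rule subgrp_diff[OF simple_subgroup[OF \<A>]])
 moreover have "f = ph + cutoff E (\<alpha> - ph)"
 proof
  fix w
  have on: "w : A v \<longleftrightarrow> f w = v" if "w : E" for v using AB(3)[of v] that by blast
  have off: "w : B v \<longleftrightarrow> f w = v" if "w ~: E" for v using AB(3)[of v] that by blast
  show "f w = (ph + cutoff E (\<alpha> - ph)) w"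
  proof (cases "w : E")
   case True
   hence "{v : range f. w : A v} = {f w}" using on by auto
   thus ?thesis using True by (simp add: cutoff_def \<alpha>_def F_def)
  next
   case False
   hence "{v : range f. w : B v} = {f w}" using off by auto
   thus ?thesis using False by (simp add: cutoff_def ph_def F_def)
  qed
 qed
 ultimately show ?thesis by blast
qed

text \<open>A homomorphism on the group of simple functions is a finitely additive measure. The following
 property says that measures with values in \<open>\<pi> ` D\<close> that vanish on an ideal of null sets lift along \<open>\<pi>\<close>.\<close>

definition measures_lift :: "('e::ab_group_add => 'f::ab_group_add) => 'e set => 'w set set => bool"
 where "measures_lift \<pi> D \<A> \<longleftrightarrow> (ALL \<J> g. set_ideal \<A> \<J> --> additive (simple \<A>) g -->
  g ` simple \<A> <= \<pi> ` D --> (ALL ph:null_functions \<A> \<J>. g ph = 0) -->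
  (EX h. additive (simple \<A>) h & h ` simple \<A> <= D &
   (ALL ph:simple \<A>. \<pi> (h ph) = g ph) & (ALL ph:null_functions \<A> \<J>. h ph = 0)))"

text \<open>Adjoining one set \<open>E\<close>: modulo null functions, the new simple functions modulo the old ones are a group of simple
 functions on the same algebra, with a larger ideal of null sets. This is why the lifting property is
 required for all ideals at once.\<close>

lemma measure_lift_step:
 assumes D: "divisible D" and \<pi>: "additive D \<pi>" and \<A>: "set_algebra \<A>" and lift: "measures_lift \<pi> D \<A>"
  and \<J>: "set_ideal (adjoin_set E \<A>) \<J>"
  and g: "additive (simple (adjoin_set E \<A>)) g" "g ` simple (adjoin_set E \<A>) <= \<pi> ` D"
   "!!ph. ph : null_functions (adjoin_set E \<A>) \<J> ==> g ph = 0"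
  and h0: "additive (simple \<A>) h0" "h0 ` simple \<A> <= D"
   "!!ph. ph : simple \<A> ==> \<pi> (h0 ph) = g ph"
   "!!ph. ph : simple \<A> ==> ph : null_functions (adjoin_set E \<A>) \<J> ==> h0 ph = 0"
 shows "EX h. additive (simple (adjoin_set E \<A>)) h & h ` simple (adjoin_set E \<A>) <= D &
  (ALL ph:simple (adjoin_set E \<A>). \<pi> (h ph) = g ph) &
  (ALL ph:null_functions (adjoin_set E \<A>) \<J>. h ph = 0) & (ALL ph:simple \<A>. h ph = h0 ph)"
proof -
 let ?\<B> = "adjoin_set E \<A>"
 let ?S = "simple \<A>" and ?T = "simple ?\<B>" and ?N = "null_functions ?\<B> \<J>"
 have D0: "subgrp D" using D by (simp add: divisible_def)
 have \<pi>D: "subgrp (\<pi> ` D)" by (rule subgrp_image[OF D0 \<pi>])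
 note \<B> = adjoin_set_algebra[OF \<A>, of E]
 have S: "subgrp ?S" by (rule simple_subgroup[OF \<A>])
 have T: "subgrp ?T" by (rule simple_subgroup[OF \<B>(1)])
 have N: "subgrp ?N" by (rule null_functions_subgroup[OF \<B>(1) \<J>])
 have NT: "?N <= ?T" by (auto simp: null_functions_def)
 have ST: "?S <= ?T" by (rule simple_mono[OF \<B>(2)])
 have cutT: "cutoff E ps : ?T" if "ps : ?S" for ps using cutoff_simple[OF \<B>(1,3)] that ST by blast
 (* h1 extends h0 and already vanishes on null functions, but need not lift g. *)
 have "EX h1. additive ?T h1 & h1 ` ?T <= D & (ALL ph:?S. h1 ph = h0 ph) & (ALL \<nu>:?N. h1 \<nu> = 0)"
  by (rule divisible_extends_along[OF T D S N NT _ _ h0(1,2,4)]) (use ST in \<open>simp_all add: additive_def\<close>)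
 then obtain h1 where h1: "additive ?T h1" "h1 ` ?T <= D" and h1S: "!!ph. ph : ?S ==> h1 ph = h0 ph"
  and h1N: "!!\<nu>. \<nu> : ?N ==> h1 \<nu> = 0" by blast
 (* The defect of h1 on cutoff E ps is a measure on \<A>, null on the trace ideal J', hence lifts. *)
 define k where "k ps = g (cutoff E ps) - \<pi> (h1 (cutoff E ps))" for ps
 define J' where "J' = {Y : \<A>. EX Y':\<A>. (Y Int E - Y') Un (Y' - Y Int E) : \<J>}"
 have sdB: "(Y Int E - Y') Un (Y' - Y Int E) : ?\<B>" if "Y : \<A>" "Y' : \<A>" for Y Y'
  unfolding Diff_eq by (intro set_algebraD(2,3,4)[OF \<B>(1)]) (use that \<B> in auto)
 have \<J>D: "A Un B : \<J>" if "A : \<J>" "B : \<J>" for A B using \<J> that unfolding set_ideal_def by blast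
 have \<J>sub: "B : \<J>" if "A : \<J>" "B : ?\<B>" "B <= A" for A B using \<J> that unfolding set_ideal_def by blast
 have J'I: "Y : J'" if "Y : \<A>" "Y' : \<A>" "(Y Int E - Y') Un (Y' - Y Int E) : \<J>" for Y Y'
  using that unfolding J'_def by blast
 have J': "set_ideal \<A> J'"
  unfolding set_ideal_def
 proof (intro conjI ballI impI)
  show "J' <= \<A>" unfolding J'_def by blast
  show "{} : J'" using J'I[of "{}" "{}"] set_algebraD(1)[OF \<A>] \<J> by (simp add: set_ideal_def)
  fix A assume "A : J'"
  then obtain A' where A: "A : \<A>" "A' : \<A>" "(A Int E - A') Un (A' - A Int E) : \<J>" unfolding J'_def by blast
  show "B : J'" if B: "B : \<A>" "B <= A" for B
  proof (rule J'I[OF B(1)])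
   show AB: "A' Int B : \<A>" by (rule set_algebraD(4)[OF \<A> A(2) B(1)])
   show "(B Int E - (A' Int B)) Un (A' Int B - B Int E) : \<J>"
    by (rule \<J>sub[OF A(3) sdB[OF B(1) AB]]) (use B(2) in blast)
  qed
  fix B assume "B : J'"
  then obtain B' where B: "B : \<A>" "B' : \<A>" "(B Int E - B') Un (B' - B Int E) : \<J>" unfolding J'_def by blast
  show "A Un B : J'"
  proof (rule J'I)
   show u: "A Un B : \<A>" "A' Un B' : \<A>" by (rule set_algebraD(3)[OF \<A>]; fact)+
   show "((A Un B) Int E - (A' Un B')) Un (A' Un B' - (A Un B) Int E) : \<J>"
    by (rule \<J>sub[OF \<J>D[OF A(3) B(3)] sdB[OF u]]) blast
  qed
 qed
 have k: "additive ?S k"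
  unfolding additive_def
 proof (intro ballI)
  fix ph ps assume a: "ph : ?S" "ps : ?S"
  have "h1 (cutoff E ph) : D" "h1 (cutoff E ps) : D" using h1(2) cutT a by blast+
  thus "k (ph + ps) = k ph + k ps"
   using additiveD[OF g(1) cutT[OF a(1)] cutT[OF a(2)]] additiveD[OF h1(1) cutT[OF a(1)] cutT[OF a(2)]]
    additiveD[OF \<pi>] by (simp add: k_def cutoff_add)
 qed
 have kD: "k ` ?S <= \<pi> ` D"
 proof (rule image_subsetI)
  fix ps assume "ps : ?S"
  hence "g (cutoff E ps) : \<pi> ` D" "\<pi> (h1 (cutoff E ps)) : \<pi> ` D" using g(2) h1(2) cutT by blast+
  thus "k ps : \<pi> ` D" unfolding k_def by (rule subgrp_diff[OF \<pi>D])
 qed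
 have kN: "k ps = 0" if "ps : null_functions \<A> J'" for ps
 proof -
  have ps: "ps : ?S" and "{w. ps w ~= 0} : J'" using that by (auto simp: null_functions_def)
  then obtain Y' where Y': "Y' : \<A>" "({w. ps w ~= 0} Int E - Y') Un (Y' - {w. ps w ~= 0} Int E) : \<J>" unfolding J'_def by blast
  define \<nu> where "\<nu> = cutoff E ps - cutoff Y' ps"
  have cS: "cutoff Y' ps : ?S" by (rule cutoff_simple[OF \<A> Y'(1) ps])
  have \<nu>T: "\<nu> : ?T" unfolding \<nu>_def using subgrp_diff[OF T cutT[OF ps]] cS ST by blast
  have "{w. \<nu> w ~= 0} : \<J>"
  proof (rule \<J>sub[OF Y'(2)])
   show "{w. \<nu> w ~= 0} : ?\<B>" using simple_Collect[OF \<B>(1) \<nu>T \<nu>T, of "%a b. a ~= 0"] by simp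
   show "{w. \<nu> w ~= 0} <= ({w. ps w ~= 0} Int E - Y') Un (Y' - {w. ps w ~= 0} Int E)"
    by (auto simp: \<nu>_def cutoff_def split: if_splits)
  qed
  hence \<nu>: "\<nu> : ?N" using \<nu>T by (simp add: null_functions_def)
  have c: "cutoff E ps = cutoff Y' ps + \<nu>" by (simp add: \<nu>_def)
  have cT: "cutoff Y' ps : ?T" using cS ST by blast
  have "g (cutoff E ps) = g (cutoff Y' ps)" unfolding c using additiveD[OF g(1) cT \<nu>T] g(3)[OF \<nu>] by simp
  moreover have "h1 (cutoff E ps) = h0 (cutoff Y' ps)" unfolding c using additiveD[OF h1(1) cT \<nu>T] h1N[OF \<nu>] h1S[OF cS] by simp
  ultimately show ?thesis using h0(3)[OF cS] by (simp add: k_def)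
 qed
 obtain l where l: "additive ?S l" "l ` ?S <= D" "!!ps. ps : ?S ==> \<pi> (l ps) = k ps" "!!ps. ps : null_functions \<A> J' ==> l ps = 0"
  using lift[unfolded measures_lift_def, rule_format, OF J' k kD kN] by blast
 have key: "l ps = 0" if ph: "ph : ?S" and ps: "ps : ?S" and n: "ph + cutoff E ps : ?N" for ph ps
 proof (rule l(4))
  let ?Y = "{w. ps w ~= 0}" and ?Y' = "{w. ps w ~= 0 & ph w = - ps w}"
  have Y: "?Y : \<A>" using simple_Collect[OF \<A> ps ps, of "%a b. a ~= 0"] by simp
  have Y': "?Y' : \<A>" using simple_Collect[OF \<A> ph ps, of "%a b. b ~= 0 & a = - b"] by simp
  have "{w. (ph + cutoff E ps) w ~= 0} : \<J>" using n by (simp add: null_functions_def)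
  hence "(?Y Int E - ?Y') Un (?Y' - ?Y Int E) : \<J>"
   by (rule \<J>sub[OF _ sdB[OF Y Y']]) (auto simp: cutoff_def)
  hence "?Y : J'" by (rule J'I[OF Y Y'])
  thus "ps : null_functions \<A> J'" using ps by (simp add: null_functions_def)
 qed
 have mem: "ph + cutoff E ps : ?T" if "ph : ?S" "ps : ?S" for ph ps using that subgrp_add[OF T] cutT ST by blast
 have lD: "l ps : D" if "ps : ?S" for ps using l(2) that by blast
 have h1D: "h1 x : D" if "x : ?T" for x using h1(2) that by blast
 have e: "(ph + ph') + cutoff E (ps + ps') = (ph + cutoff E ps) + (ph' + cutoff E ps')" for ph ps ph' ps' by (simp add: cutoff_add)
 have "EX h. additive ?T h & h ` ?T <= D & (ALL p:?S \<times> ?S. h (fst p + cutoff E (snd p)) = h1 (fst p + cutoff E (snd p)) + l (snd p)) & (ALL \<nu>:{0}. h \<nu> = 0)"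
 proof (rule divisible_extends_along[OF T D _ subgrp_zero])
  show "subgrp (?S \<times> ?S)" using S by (auto simp: subgrp_def zero_prod_def)
  show "additive (?S \<times> ?S) (%p. fst p + cutoff E (snd p))" by (simp add: additive_def e)
  show "(%p. fst p + cutoff E (snd p)) ` (?S \<times> ?S) <= ?T" using mem by auto
  show "additive (?S \<times> ?S) (%p. h1 (fst p + cutoff E (snd p)) + l (snd p))"
   using additiveD[OF h1(1) mem mem] additiveD[OF l(1)] by (auto simp: additive_def e)
  show "(%p. h1 (fst p + cutoff E (snd p)) + l (snd p)) ` (?S \<times> ?S) <= D"
   using subgrp_add[OF D0 h1D[OF mem] lD] by auto
  show "h1 (fst p + cutoff E (snd p)) + l (snd p) = 0" if p: "p : ?S \<times> ?S" "fst p + cutoff E (snd p) : {0}" for p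
   using key[of "fst p" "snd p"] p subgrp_0[OF N] additive_0[OF T h1(1)] by auto
 qed (use subgrp_0[OF T] in simp)
 then obtain h where h: "additive ?T h" "h ` ?T <= D"
  and hp: "ALL p:?S \<times> ?S. h (fst p + cutoff E (snd p)) = h1 (fst p + cutoff E (snd p)) + l (snd p)" by blast
 have hd: "h (ph + cutoff E ps) = h1 (ph + cutoff E ps) + l ps" if "ph : ?S" "ps : ?S" for ph ps
  using bspec[OF hp, of "(ph, ps)"] that by simp
 have "\<pi> (h x) = g x" if x: "x : ?T" for x
 proof -
  obtain ph ps where p: "ph : ?S" "ps : ?S" "x = ph + cutoff E ps" using adjoin_simple_decompose[OF \<A> x] by blast
  have phT: "ph : ?T" using p(1) ST by blast
  have "\<pi> (h x) = \<pi> (h1 x) + k ps" using hd[OF p(1,2)] additiveD[OF \<pi> h1D[OF x] lD[OF p(2)]] l(3)[OF p(2)] p(3) by simp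
  also have "\<pi> (h1 x) = \<pi> (h1 ph) + \<pi> (h1 (cutoff E ps))"
   unfolding p(3) additiveD[OF h1(1) phT cutT[OF p(2)]]
   by (rule additiveD[OF \<pi> h1D[OF phT] h1D[OF cutT[OF p(2)]]])
  also have "\<pi> (h1 ph) = g ph" using h1S[OF p(1)] h0(3)[OF p(1)] by simp
  finally have eq: "\<pi> (h x) = g ph + \<pi> (h1 (cutoff E ps)) + k ps" .
  have "g x = g ph + g (cutoff E ps)" unfolding p(3) by (rule additiveD[OF g(1) phT cutT[OF p(2)]])
  thus ?thesis using eq by (simp add: k_def)
 qed
 moreover have "h x = 0" if x: "x : ?N" for x
 proof -
  have xT: "x : ?T" using x NT by blast
  obtain ph ps where p: "ph : ?S" "ps : ?S" "x = ph + cutoff E ps" using adjoin_simple_decompose[OF \<A> xT] by blast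
  show ?thesis using hd[OF p(1,2)] h1N[OF x] key[OF p(1,2)] x p(3) by simp
 qed
 moreover have "h ph = h0 ph" if ph: "ph : ?S" for ph
 proof -
  have c0: "cutoff E 0 = 0" by (auto simp: cutoff_def)
  have "h (ph + cutoff E 0) = h1 (ph + cutoff E 0) + l 0" by (rule hd[OF ph subgrp_0[OF S]])
  thus ?thesis using h1S[OF ph] additive_0[OF S l(1)] by (simp add: c0)
 qed
 ultimately show ?thesis using h(1,2) by blast
qed

text \<open>The trivial algebra: its simple functions are the integers, a free group.\<close>

lemma measures_lift_trivial:
 assumes D: "divisible D" and \<pi>: "additive D \<pi>"
 shows "measures_lift \<pi> D (algebra_of ({} :: 'w set set))"
 unfolding measures_lift_def
proof (intro allI impI)
 let ?\<A> = "algebra_of ({} :: 'w set set)"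
 let ?S = "simple ?\<A>"
 fix \<J> g assume \<J>: "set_ideal ?\<A> \<J>" and g: "additive ?S g" "g ` ?S <= \<pi> ` D" "ALL ph:null_functions ?\<A> \<J>. g ph = 0"
 have D0: "subgrp D" using D by (simp add: divisible_def)
 have S: "subgrp ?S" by (rule simple_subgroup[OF algebra_of(1)])
 have "?\<A> <= {{}, UNIV}" by (rule algebra_of_least) (auto simp: set_algebra_def)
 hence const: "ph = (%_. ph undefined)" if "ph : ?S" for ph
 proof -
  have "{w. ph w = ph undefined} : {{}, UNIV}" using that \<open>?\<A> \<subseteq> {{}, UNIV}\<close> unfolding simple_def by blast
  hence "{w. ph w = ph undefined} = UNIV" by blast
  thus ?thesis by blast
 qed
 have constS: "(%_. c) : ?S" for c
  using simpleI[OF algebra_of(1)[of "{}"], of "{}" _ "%_. c"] by simp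
 show "EX h. additive ?S h & h ` ?S <= D & (ALL ph:?S. \<pi> (h ph) = g ph) & (ALL ph:null_functions ?\<A> \<J>. h ph = 0)"
 proof (cases "UNIV : \<J>")
  case True
  have "g ph = 0" if "ph : ?S" for ph
  proof -
   have "{w. ph w ~= 0} : ?\<A>" using simple_Collect[OF algebra_of(1) that that, of "%a b. a ~= 0"] by simp
   hence "{w. ph w ~= 0} : \<J>" using \<J> True unfolding set_ideal_def by blast
   thus ?thesis using g(3) that by (simp add: null_functions_def)
  qed
  thus ?thesis using additive_0[OF D0 \<pi>] subgrp_0[OF D0]
   by (intro exI[of _ "%_. 0"]) (auto simp: additive_def)
 next
  case False
  interpret D: comm_group "group_of D" by (rule comm_group_group_of[OF D0])
  obtain y where y: "y : D" "\<pi> y = g (%_. 1)" using g(2) constS[of 1] by (metis imageE image_subset_iff)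
  define h where "h ph = y [^]\<^bsub>group_of D\<^esub> (ph undefined :: int)" for ph :: "'w => int"
  have pow_add: "y [^]\<^bsub>group_of D\<^esub> (a + b :: int) = y [^]\<^bsub>group_of D\<^esub> a + y [^]\<^bsub>group_of D\<^esub> b" for a b
   using D.int_pow_mult[of y a b] y by simp
  have powD: "y [^]\<^bsub>group_of D\<^esub> (a :: int) : D" for a using D.int_pow_closed[of y a] y by simp
  have pow1: "y [^]\<^bsub>group_of D\<^esub> (1 :: int) = y" using y by simp
  define F where "F k = \<pi> (y [^]\<^bsub>group_of D\<^esub> k) - g (%_. k)" for k :: int
  have Fadd: "F (a + b) = F a + F b" for a b
   using additiveD[OF \<pi> powD[of a] powD[of b]] additiveD[OF g(1) constS[of a] constS[of b]]
   unfolding F_def pow_add plus_fun_def by simp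
  have F1: "F 1 = 0" using pow1 y by (simp add: F_def)
  have F0: "F k = 0" for k
  proof (induction k rule: int_induct[where k=0])
   case base
   show ?case using Fadd[of 0 0] by simp
  next
   case (step1 i)
   thus ?case using Fadd[of i 1] F1 by simp
  next
   case (step2 i)
   thus ?case using Fadd[of "i - 1" 1] F1 by simp
  qed
  have "\<pi> (h ph) = g ph" if "ph : ?S" for ph
   using F0[of "ph undefined"] const[OF that] by (simp add: F_def h_def)
  moreover have "h ph = 0" if "ph : null_functions ?\<A> \<J>" for ph
  proof -
   have "ph : ?S" "{w. ph w ~= 0} : \<J>" using that by (auto simp: null_functions_def)
   hence "ph undefined = 0" using const[of ph] False by (metis (mono_tags, lifting) Collect_cong UNIV_def)
   thus ?thesis by (simp add: h_def)
  qed
  ultimately show ?thesis using pow_add powD by (intro exI[of _ h]) (auto simp: h_def additive_def)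
 qed
qed

lemma algebra_of_chain:
 assumes C: "C ~= {}" and chain: "!!Gm Gm'. Gm : C ==> Gm' : C ==> Gm <= Gm' \<or> Gm' <= Gm"
  and ph: "ph : simple (algebra_of (\<Union>C))"
 shows "EX Gm:C. ph : simple (algebra_of Gm)"
proof -
 let ?U = "\<Union>(algebra_of ` C)"
 have common: "EX Gm:C. A : algebra_of Gm & B : algebra_of Gm" if AB: "A : ?U" "B : ?U" for A B
 proof -
  obtain Gm Gm' where c: "Gm : C" "Gm' : C" "A : algebra_of Gm" "B : algebra_of Gm'" using AB by blast
  thus ?thesis using chain[OF c(1,2)] algebra_of_mono[of Gm Gm'] algebra_of_mono[of Gm' Gm] by blast
 qed
 have "set_algebra ?U"
  unfolding set_algebra_def
 proof (intro conjI ballI)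
  obtain Gm where "Gm : C" using C by blast
  thus "{} : ?U" using set_algebraD(1)[OF algebra_of(1)[of Gm]] by blast
  fix A assume A: "A : ?U"
  then obtain Gm where G: "Gm : C" "A : algebra_of Gm" by blast
  thus "- A : ?U" using set_algebraD(2)[OF algebra_of(1) G(2)] by blast
  fix B assume "B : ?U"
  then obtain Gm where G: "Gm : C" "A : algebra_of Gm" "B : algebra_of Gm" using common A by blast
  thus "A Un B : ?U" using set_algebraD(3)[OF algebra_of(1) G(2,3)] by blast
 qed
 moreover have "\<Union>C <= ?U" using algebra_of(2) by blast
 ultimately have sub: "algebra_of (\<Union>C) <= ?U" by (rule algebra_of_least)
 have fin: "finite (range ph)" and lev: "!!v. {w. ph w = v} : ?U" using ph sub unfolding simple_def by blast+
 have "EX Gm:C. ALL v:F. {w. ph w = v} : algebra_of Gm" if "finite F" for F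
  using that
 proof (induction F rule: finite_induct)
  case empty
  thus ?case using C by blast
 next
  case (insert v F)
  then obtain Gm where G: "Gm : C" "ALL v:F. {w. ph w = v} : algebra_of Gm" by blast
  obtain Gm' where G': "Gm' : C" "{w. ph w = v} : algebra_of Gm'" using lev[of v] by blast
  show ?case using chain[OF G(1) G'(1)]
  proof
   assume "Gm <= Gm'"
   thus ?case using G G' algebra_of_mono[of Gm Gm'] by (intro bexI[of _ Gm']) auto
  next
   assume "Gm' <= Gm"
   thus ?case using G G' algebra_of_mono[of Gm' Gm] by (intro bexI[of _ Gm]) auto
  qed
 qed
 from this[OF fin] obtain Gm where G: "Gm : C" "!!v. v : range ph ==> {w. ph w = v} : algebra_of Gm" by blast
 have "{w. ph w = v} : algebra_of Gm" for v
 proof (cases "v : range ph")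
  case False
  hence "{w. ph w = v} = {}" by blast
  thus ?thesis using set_algebraD(1)[OF algebra_of(1)] by simp
 qed (rule G(2))
 thus ?thesis using G(1) fin by (auto simp: simple_def)
qed

text \<open>Transfinite construction: well-order all sets and adjoin them one at a time. At each stage the algebra generated by
 the earlier sets has the lifting property for all ideals.\<close>

lemma measures_lift_initial_segment:
 fixes Gm0 :: "'w set set"
 assumes D: "divisible D" and \<pi>: "additive D \<pi>"
  and wf: "wfP lt" and total: "!!E E'. lt E E' \<or> E = E' \<or> lt E' E"
  and down0: "!!E E'. E : Gm0 ==> lt E' E ==> E' : Gm0"
  and IH: "!!E. E : Gm0 ==> measures_lift \<pi> D (algebra_of {E'. lt E' E})"
 shows "measures_lift \<pi> D (algebra_of Gm0)"
 unfolding measures_lift_def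
proof (intro allI impI)
 let ?a = "algebra_of :: 'w set set => 'w set set"
 let ?s = "%Gm. simple (?a Gm)"
 fix \<J> g assume \<J>: "set_ideal (?a Gm0) \<J>" and g: "additive (?s Gm0) g" "g ` ?s Gm0 <= \<pi> ` D"
  "ALL ph:null_functions (?a Gm0) \<J>. g ph = 0"
 have D0: "subgrp D" using D by (simp add: divisible_def)
 have s: "subgrp (?s Gm)" for Gm by (rule simple_subgroup[OF algebra_of(1)])
 have smono: "?s Gm <= ?s Gm'" if "Gm <= Gm'" for Gm Gm' by (rule simple_mono[OF algebra_of_mono[OF that]])
 define down where "down Gm \<longleftrightarrow> Gm <= Gm0 & (ALL E:Gm. ALL E'. lt E' E --> E' : Gm)" for Gm
 define lifting where "lifting Gm G \<longleftrightarrow> subgrp G & G <= ?s Gm \<times> D & (ALL y. (0, y) : G --> y = 0) &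
  (ALL ph:?s Gm. EX y. (ph, y) : G) & (ALL ph y. (ph, y) : G --> \<pi> y = g ph & ({w. ph w ~= 0} : \<J> --> y = 0))" for Gm G
 (* A partial lift is an initial segment together with the graph of a lift on the algebra it generates. *)
 define good where "good M \<longleftrightarrow> down (Inl -` M) & lifting (Inl -` M) (Inr -` M)" for M :: "('w set + (('w => int) \<times> 'a)) set"
 have LD: "subgrp G" "G <= ?s Gm \<times> D" "ALL y. (0, y) : G --> y = 0" "ALL ph:?s Gm. EX y. (ph, y) : G"
  "ALL ph y. (ph, y) : G --> \<pi> y = g ph & ({w. ph w ~= 0} : \<J> --> y = 0)" if L: "lifting Gm G" for Gm G
 proof -
  note l = L[unfolded lifting_def]
  show "subgrp G" using l by (elim conjE)
  show "G <= ?s Gm \<times> D" using l by (elim conjE)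
  show "ALL y. (0, y) : G --> y = 0" using l by (elim conjE)
  show "ALL ph:?s Gm. EX y. (ph, y) : G" using l by (elim conjE)
  show "ALL ph y. (ph, y) : G --> \<pi> y = g ph & ({w. ph w ~= 0} : \<J> --> y = 0)" using l by (elim conjE)
 qed
 have lift_fun: "EX h. additive (?s Gm) h & h ` ?s Gm <= D & (ALL ph:?s Gm. (ph, h ph) : G) & (ALL ph y. (ph, y) : G --> h ph = y)"
  if L: "lifting Gm G" for Gm G
 proof -
  obtain h where h: "additive (?s Gm) h" "h ` ?s Gm <= D" "!!x y. (x, y) : G ==> h x = y"
   using divisible_extends_graph[OF s D LD(1,2)[OF L] LD(3)[OF L, rule_format]] by blast
  have "(ph, h ph) : G" if ph: "ph : ?s Gm" for ph
  proof -
   obtain y where y: "(ph, y) : G" using LD(4)[OF L] ph by blast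
   thus ?thesis using h(3)[OF y] by simp
  qed
  thus ?thesis using h by blast
 qed
 have fun_lift: "lifting Gm ((%ph. (ph, h ph)) ` ?s Gm)"
  if h: "additive (?s Gm) h" "h ` ?s Gm <= D" "!!ph. ph : ?s Gm ==> \<pi> (h ph) = g ph"
   "!!ph. ph : ?s Gm ==> {w. ph w ~= 0} : \<J> ==> h ph = 0" for h Gm
 proof -
  have "subgrp ((%ph. (ph, h ph)) ` ?s Gm)"
   by (rule subgrp_image[OF s]) (use h(1) in \<open>auto simp: additive_def\<close>)
  moreover have "(%ph. (ph, h ph)) ` ?s Gm <= ?s Gm \<times> D" using h(2) by blast
  moreover have "ALL y. (0, y) : (%ph. (ph, h ph)) ` ?s Gm --> y = 0" using additive_0[OF s h(1)] by auto
  moreover have "ALL ph:?s Gm. EX y. (ph, y) : (%ph. (ph, h ph)) ` ?s Gm" by blast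
  moreover have "\<pi> y = g ph & ({w. ph w ~= 0} : \<J> --> y = 0)" if "(ph, y) : (%ph. (ph, h ph)) ` ?s Gm" for ph y
  proof -
   have "ph : ?s Gm" "y = h ph" using that by auto
   thus ?thesis using h(3,4)[of ph] by simp
  qed
  ultimately show ?thesis unfolding lifting_def by (intro conjI allI impI) simp_all
 qed
 have nul: "{w. ph w ~= 0} : \<J> ==> g ph = 0" if "ph : ?s Gm0" for ph using g(3) that by (simp add: null_functions_def)
 let ?A = "Collect good"
 have "EX M:?A. ALL M':?A. M <= M' --> M' = M"
 proof (rule subset_Zorn_nonempty)
  have sub: "?s {} <= ?s Gm0" by (rule smono) blast
  have id: "set_ideal (?a {}) (\<J> Int ?a {})"
   using \<J> set_algebraD(1,3)[OF algebra_of(1)[of "{}"]] algebra_of_mono[of "{}" Gm0] unfolding set_ideal_def by blast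
  have g0: "additive (?s {}) g" "g ` ?s {} <= \<pi> ` D" using additive_subset[OF g(1) sub] g(2) sub by blast+
  have gn: "g ph = 0" if ph: "ph : null_functions (?a {}) (\<J> Int ?a {})" for ph
   by (rule nul) (use ph sub in \<open>auto simp: null_functions_def\<close>)
  from measures_lift_trivial[OF D \<pi>, where ?'w='w, unfolded measures_lift_def, rule_format, OF id g0 gn]
  obtain h where h: "additive (?s {}) h" "h ` ?s {} <= D" "ALL ph:?s {}. \<pi> (h ph) = g ph"
   "ALL ph:null_functions (?a {}) (\<J> Int ?a {}). h ph = 0"
   by blast
  have "lifting {} ((%ph. (ph, h ph)) ` ?s {})"
  proof (rule fun_lift[OF h(1,2)])
   fix ph assume ph: "ph : ?s {}"
   show "\<pi> (h ph) = g ph" using h(3) ph by blast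
   assume "{w. ph w ~= 0} : \<J>"
   moreover have "{w. ph w ~= 0} : ?a {}" using simple_Collect[OF algebra_of(1) ph ph, of "%a b. a ~= 0"] by simp
   ultimately show "h ph = 0" using h(4) ph by (simp add: null_functions_def)
  qed
  moreover define M0 :: "('w set + (('w => int) \<times> 'a)) set" where "M0 = Inr ` ((%ph. (ph, h ph)) ` ?s {})"
  moreover have "Inl -` M0 = {}" "Inr -` M0 = (%ph. (ph, h ph)) ` ?s {}" unfolding M0_def by auto
  ultimately have "good M0" unfolding good_def by (simp add: down_def)
  thus "?A ~= {}" by blast
 next
  fix C assume C: "C ~= {}" "subset.chain ?A C"
  have gd: "good M" if "M : C" for M using C(2) that unfolding subset.chain_def by blast
  have lin: "M <= M' \<or> M' <= M" if "M : C" "M' : C" for M M' using C(2) that unfolding subset.chain_def by blast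
  have common: "EX M:C. x : M & y : M" if xy: "x : \<Union>C" "y : \<Union>C" for x y
  proof -
   obtain M M' where "M : C" "M' : C" "x : M" "y : M'" using xy by blast
   thus ?thesis using lin[of M M'] by blast
  qed
  have L: "lifting (Inl -` M) (Inr -` M)" if "M : C" for M using gd[OF that] by (simp add: good_def)
  let ?Gm = "Inl -` \<Union>C" and ?G = "Inr -` \<Union>C"
  have GmC: "?Gm = \<Union>((-`) Inl ` C)" by blast
  have "down ?Gm" using gd unfolding good_def down_def by blast
  moreover have "lifting ?Gm ?G"
   unfolding lifting_def
  proof (intro conjI allI ballI impI)
   show "subgrp ?G"
    unfolding subgrp_def
   proof (intro conjI ballI)
    obtain M where M: "M : C" using C(1) by blast
    have "0 : Inr -` M" by (rule subgrp_0[OF LD(1)[OF L[OF M]]])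
    thus "0 : ?G" using M by blast
    fix x y assume "x : ?G" "y : ?G"
    then obtain M where M: "M : C" "x : Inr -` M" "y : Inr -` M" using common[of "Inr x" "Inr y"] by blast
    have "x - y : Inr -` M" by (rule subgrp_diff[OF LD(1)[OF L[OF M(1)]] M(2,3)])
    thus "x - y : ?G" using M(1) by blast
   qed
   show "?G <= ?s ?Gm \<times> D"
   proof
    fix p assume "p : ?G"
    then obtain M where M: "M : C" "p : Inr -` M" by blast
    have "?s (Inl -` M) <= ?s ?Gm" by (rule smono) (use M(1) in blast)
    thus "p : ?s ?Gm \<times> D" using LD(2)[OF L[OF M(1)]] M(2) by blast
   qed
   show "y = 0" if "(0, y) : ?G" for y
   proof -
    obtain M where M: "M : C" "(0, y) : Inr -` M" using \<open>(0, y) \<in> ?G\<close> by blast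
    show ?thesis using LD(3)[OF L[OF M(1)]] M(2) by blast
   qed
   show "EX y. (ph, y) : ?G" if ph: "ph : ?s ?Gm" for ph
   proof -
    have "EX Gm:(-`) Inl ` C. ph : ?s Gm"
    proof (rule algebra_of_chain)
     show "(-`) Inl ` C ~= {}" using C(1) by blast
     show "ph : ?s (\<Union>((-`) Inl ` C))" using ph unfolding GmC .
     fix A B assume "A : (-`) Inl ` C" "B : (-`) Inl ` C"
     then obtain M M' where MM: "M : C" "M' : C" "A = Inl -` M" "B = Inl -` M'" by blast
     thus "A <= B \<or> B <= A" using lin[OF MM(1,2)] by blast
    qed
    then obtain M where M: "M : C" "ph : ?s (Inl -` M)" by blast
    then obtain y where "(ph, y) : Inr -` M" using LD(4)[OF L[OF M(1)]] by blast
    thus ?thesis using M(1) by blast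
   qed
   fix ph y assume "(ph, y) : ?G"
   then obtain M where M: "M : C" "(ph, y) : Inr -` M" by blast
   show "\<pi> y = g ph" using LD(5)[OF L[OF M(1)]] M(2) by blast
   show "y = 0" if "{w. ph w ~= 0} : \<J>" using LD(5)[OF L[OF M(1)]] M(2) that by blast
  qed
  ultimately show "\<Union>C : ?A" by (simp add: good_def)
 qed
 then obtain M where M: "good M" and max: "!!M'. good M' ==> M <= M' ==> M' = M" by blast
 let ?Gm = "Inl -` M" and ?G = "Inr -` M"
 have down: "?Gm <= Gm0" "!!E E'. E : ?Gm ==> lt E' E ==> E' : ?Gm" and L: "lifting ?Gm ?G"
  using M unfolding good_def down_def by blast+
 obtain h0 where h0: "additive (?s ?Gm) h0" "h0 ` ?s ?Gm <= D" "!!ph. ph : ?s ?Gm ==> (ph, h0 ph) : ?G" "!!ph y. (ph, y) : ?G ==> h0 ph = y"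
  using lift_fun[OF L] by blast
 have h0g: "\<pi> (h0 ph) = g ph" "{w. ph w ~= 0} : \<J> ==> h0 ph = 0" if "ph : ?s ?Gm" for ph
  using LD(5)[OF L, rule_format, OF h0(3)[OF that]] by blast+
 have "?Gm = Gm0"
 proof (rule ccontr)
  assume "?Gm ~= Gm0"
  then obtain E1 where "E1 : Gm0 - ?Gm" using down(1) by blast
  then obtain E where E: "E : Gm0 - ?Gm" and min: "!!E'. lt E' E ==> E' ~: Gm0 - ?Gm"
   using wfp_eq_minimal[of lt] wf by metis
  have GmE: "?Gm = {E'. lt E' E}"
  proof (intro equalityI subsetI)
   fix E' assume "E' : ?Gm"
   hence "E' ~= E" "\<not> lt E E'" using E down(2) by blast+
   thus "E' : {E'. lt E' E}" using total[of E' E] by blast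
  next
   fix E' assume "E' : {E'. lt E' E}"
   hence "lt E' E" by blast
   thus "E' : ?Gm" using min[of E'] down0[of E E'] E by blast
  qed
  have lift: "measures_lift \<pi> D (?a ?Gm)" unfolding GmE using IH E by blast
  let ?B = "adjoin_set E (?a ?Gm)"
  have B: "?B = ?a (insert E ?Gm)" by (rule algebra_of_insert[symmetric])
  have B0: "?B <= ?a Gm0" unfolding B by (rule algebra_of_mono) (use E down(1) in blast)
  have sB: "simple ?B <= ?s Gm0" by (rule simple_mono[OF B0])
  have algB: "set_algebra ?B" unfolding B by (rule algebra_of(1))
  have id: "set_ideal ?B (\<J> Int ?B)"
   using \<J> set_algebraD(1,3)[OF algB] B0 unfolding set_ideal_def by blast
  have nulB: "ph : null_functions ?B (\<J> Int ?B) \<longleftrightarrow> ph : simple ?B & {w. ph w ~= 0} : \<J>" for ph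
   using simple_Collect[OF algB, of ph ph "%a b. a ~= 0"] by (auto simp: null_functions_def)
  have "EX h. additive (simple ?B) h & h ` simple ?B <= D &
   (ALL ph:simple ?B. \<pi> (h ph) = g ph) &
   (ALL ph:null_functions ?B (\<J> Int ?B). h ph = 0) & (ALL ph:?s ?Gm. h ph = h0 ph)"
  proof (rule measure_lift_step[OF D \<pi> algebra_of(1) lift id _ _ _ h0(1,2)])
   show "additive (simple ?B) g" by (rule additive_subset[OF g(1) sB])
   show "g ` simple ?B <= \<pi> ` D" using g(2) sB by blast
   show "g ph = 0" if "ph : null_functions ?B (\<J> Int ?B)" for ph
   proof (rule nul)
    show "ph : ?s Gm0" "{w. ph w ~= 0} : \<J>" using that[unfolded nulB] sB by blast+
   qed
   show "\<pi> (h0 ph) = g ph" if "ph : ?s ?Gm" for ph by (rule h0g(1)[OF that])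
   show "h0 ph = 0" if "ph : ?s ?Gm" "ph : null_functions ?B (\<J> Int ?B)" for ph
    by (rule h0g(2)[OF that(1)]) (use that(2)[unfolded nulB] in blast)
  qed
  then obtain h where h: "additive (simple ?B) h" "h ` simple ?B <= D"
   "!!ph. ph : simple ?B ==> \<pi> (h ph) = g ph" "!!ph. ph : null_functions ?B (\<J> Int ?B) ==> h ph = 0"
   "!!ph. ph : ?s ?Gm ==> h ph = h0 ph" by blast
  let ?G' = "(%ph. (ph, h ph)) ` simple ?B"
  have L': "lifting (insert E ?Gm) ?G'" unfolding B
  proof (rule fun_lift)
   fix ph assume "ph : ?s (insert E ?Gm)" "{w. ph w ~= 0} : \<J>"
   thus "h ph = 0" unfolding B[symmetric] by (intro h(4)) (simp add: nulB)
  qed (use h(1-3) in \<open>simp_all only: B\<close>)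
  define M' where "M' = Inl ` insert E ?Gm Un Inr ` ?G'"
  have MM: "Inl -` M' = insert E ?Gm" "Inr -` M' = ?G'" unfolding M'_def by auto
  have "down (insert E ?Gm)" unfolding down_def using E(1) down GmE by auto
  hence "good M'" unfolding good_def MM using L' by simp
  moreover have "M <= M'"
  proof
   fix x assume x: "x : M"
   show "x : M'"
   proof (cases x)
    case (Inl e)
    thus ?thesis using x unfolding M'_def by blast
   next
    case (Inr p)
    obtain ph y where p: "p = (ph, y)" by (cases p)
    have G: "(ph, y) : ?G" using x Inr p by simp
    hence ph: "ph : ?s ?Gm" using LD(2)[OF L] by blast
    have "y = h ph" using h0(4)[OF G] h(5)[OF ph] by simp
    moreover have "ph : simple ?B" using ph smono[of ?Gm "insert E ?Gm"] unfolding B by blast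
    ultimately show ?thesis unfolding M'_def Inr p by blast
   qed
  qed
  ultimately have "M' = M" by (rule max)
  thus False using MM(1) E by blast
 qed
 thus "EX h. additive (?s Gm0) h & h ` ?s Gm0 <= D & (ALL ph:?s Gm0. \<pi> (h ph) = g ph) &
   (ALL ph:null_functions (?a Gm0) \<J>. h ph = 0)"
  using h0(1,2) h0g by (intro exI[of _ h0]) (auto simp: null_functions_def)
qed

theorem measures_lift_all_sets:
 assumes D: "divisible D" and \<pi>: "additive D \<pi>"
 shows "measures_lift \<pi> D (UNIV :: 'w set set)"
proof -
 obtain R :: "'w set rel" where R: "well_order_on UNIV R" using well_order_on by blast
 define lt where "lt E E' \<longleftrightarrow> (E, E') : R - Id" for E E'
 have "{(E, E'). lt E E'} = R - Id" unfolding lt_def by auto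
 hence wf: "wfP lt" using R by (simp add: well_order_on_def wfp_def)
 have lin: "linear_order_on UNIV R" using R by (simp add: well_order_on_def)
 have total: "lt E E' \<or> E = E' \<or> lt E' E" for E E'
  using lin unfolding linear_order_on_def total_on_def lt_def by blast
 have tr: "lt E E''" if "lt E E'" "lt E' E''" for E E' E''
  using lin that unfolding linear_order_on_def partial_order_on_def preorder_on_def trans_def antisym_def lt_def by blast
 have "measures_lift \<pi> D (algebra_of {E'. lt E' E})" for E
  using wf
 proof (induction E rule: wfp_induct_rule)
  case (less E)
  show ?case
   by (rule measures_lift_initial_segment[OF D \<pi> wf total]) (use less.IH tr in blast)+
 qed
 note segments = this
 have "measures_lift \<pi> D (algebra_of (UNIV :: 'w set set))"
  by (rule measures_lift_initial_segment[OF D \<pi> wf total UNIV_I segments])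
 moreover have "algebra_of (UNIV :: 'w set set) = UNIV" using algebra_of(2) by blast
 ultimately show ?thesis by simp
qed

text \<open>A group of finitely valued functions modulo its null functions embeds into that of all such functions, so that a
 homomorphism into the divisible image first extends and then lifts.\<close>

corollary hom_lifts:
 fixes P :: "('w => int) set"
 assumes D: "divisible D" and \<pi>: "additive D \<pi>" "divisible (\<pi> ` D)"
  and P: "subgrp P" and fin: "!!ph. ph : P ==> finite (range ph)"
  and \<N>: "{} : \<N>" "!!A B. A : \<N> ==> B : \<N> ==> A Un B : \<N>" "!!A B. A : \<N> ==> B <= A ==> B : \<N>"
  and g: "additive P g" "g ` P <= \<pi> ` D" "!!ph. ph : P ==> {w. ph w ~= 0} : \<N> ==> g ph = 0"
 shows "EX h. additive P h & h ` P <= D & (ALL ph:P. \<pi> (h ph) = g ph) & (ALL ph:P. {w. ph w ~= 0} : \<N> --> h ph = 0)"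
proof -
 let ?S = "simple (UNIV :: 'w set set)" and ?N = "null_functions UNIV \<N>"
 have alg: "set_algebra (UNIV :: 'w set set)" by (simp add: set_algebra_def)
 have id: "set_ideal UNIV \<N>" unfolding set_ideal_def using \<N> by blast
 have S: "subgrp ?S" by (rule simple_subgroup[OF alg])
 have N: "subgrp ?N" by (rule null_functions_subgroup[OF alg id])
 have PS: "P <= ?S" using fin by (auto simp: simple_def)
 have NS: "?N <= ?S" by (auto simp: null_functions_def)
 have "EX G. additive ?S G & G ` ?S <= \<pi> ` D & (ALL ph:P. G ph = g ph) & (ALL \<nu>:?N. G \<nu> = 0)"
  by (rule divisible_extends_along[OF S \<pi>(2) P N NS _ _ g(1,2)])
   (use PS g(3) in \<open>auto simp: additive_def null_functions_def\<close>)
 then obtain G where G: "additive ?S G" "G ` ?S <= \<pi> ` D" and GP: "!!ph. ph : P ==> G ph = g ph" and GN: "!!\<nu>. \<nu> : ?N ==> G \<nu> = 0" by blast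
 obtain h where h: "additive ?S h" "h ` ?S <= D" "ALL ph:?S. \<pi> (h ph) = G ph" "ALL ph:?N. h ph = 0"
  using measures_lift_all_sets[OF D \<pi>(1), unfolded measures_lift_def, rule_format, OF id G(1,2) GN] by blast
 have "additive P h" by (rule additive_subset[OF h(1) PS])
 moreover have "h ` P <= D" using h(2) PS by blast
 moreover have "ALL ph:P. \<pi> (h ph) = g ph" using h(3) PS GP by (metis subsetD)
 moreover have "ALL ph:P. {w. ph w ~= 0} : \<N> --> h ph = 0" using h(4) PS by (auto simp: null_functions_def)
 ultimately show ?thesis by blast
qed

section \<open>Massey homology through functions on tuples\<close>

definition coeff_image :: "('g, 'm) monoid_scheme => (('g => circle) => circle) set"
 where "coeff_image G = char_embed G ` carrier G"

text \<open>The quotient of the divisible group by the coefficients, embedded again into a group given by its type.\<close>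

definition coeff_quot :: "('g, 'm) monoid_scheme => (('g => circle) => circle) => ((('g => circle) => circle) set => circle) => circle"
 where "coeff_quot G x = char_embed (group_of UNIV Mod coeff_image G) (coeff_image G #>\<^bsub>group_of UNIV\<^esub> x)"

lemma coeff_image_subgroup:
 assumes G: "comm_group G" shows "subgrp (coeff_image G)"
proof -
 interpret G: comm_group G by (rule G)
 have "char_embed G a - char_embed G b : coeff_image G" if "a : carrier G" "b : carrier G" for a b
 proof -
  have "char_embed G ((a \<otimes>\<^bsub>G\<^esub> inv\<^bsub>G\<^esub> b) \<otimes>\<^bsub>G\<^esub> b) = char_embed G (a \<otimes>\<^bsub>G\<^esub> inv\<^bsub>G\<^esub> b) + char_embed G b"
   by (rule char_embed_mult) (use that in simp_all)
  hence "char_embed G a - char_embed G b = char_embed G (a \<otimes>\<^bsub>G\<^esub> inv\<^bsub>G\<^esub> b)" using that by (simp add: G.m_assoc)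
  thus ?thesis using that by (simp add: coeff_image_def)
 qed
 moreover have "0 = char_embed G \<one>\<^bsub>G\<^esub>" using char_embed_eq_0[OF G G.one_closed] by simp
 hence "0 : coeff_image G" unfolding coeff_image_def by (metis G.one_closed imageI)
 ultimately show ?thesis unfolding subgrp_def coeff_image_def by blast
qed

lemma divisible_image:
 assumes D: "divisible D" and \<pi>: "additive D \<pi>" shows "divisible (\<pi> ` D)"
proof -
 have sD: "subgrp D" and dD: "divisible_group (group_of D)" using D by (auto simp: divisible_def)
 have sI: "subgrp (\<pi> ` D)" by (rule subgrp_image[OF sD \<pi>])
 interpret h: group_hom "group_of D" "group_of (\<pi> ` D)" \<pi>
  using comm_group.axioms(2)[OF comm_group_group_of[OF sD]] comm_group.axioms(2)[OF comm_group_group_of[OF sI]] \<pi>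
  by (auto simp: group_hom_def group_hom_axioms_def hom_group_of)
 have "EX y:\<pi> ` D. y [^]\<^bsub>group_of (\<pi> ` D)\<^esub> n = \<pi> x" if x: "x : D" and n: "n > 0" for x and n :: nat
 proof -
  obtain y where y: "y : D" "y [^]\<^bsub>group_of D\<^esub> n = x" using dD x n unfolding divisible_group_def by auto
  thus ?thesis using h.hom_nat_pow[of y n] by auto
 qed
 thus ?thesis using sI comm_group_group_of[OF sI] by (auto simp: divisible_def divisible_group_def)
qed

lemma
 fixes G :: "('g, 'm) monoid_scheme"
 assumes G: "comm_group G"
 shows coeff_quot_additive: "additive UNIV (coeff_quot G)"
  and coeff_quot_eq_0: "coeff_quot G x = 0 \<longleftrightarrow> x : coeff_image G"
  and coeff_quot_divisible: "divisible (range (coeff_quot G))"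
proof -
 let ?Gm = "coeff_image G" and ?Q = "group_of (UNIV :: (('g => circle) => circle) set) Mod coeff_image G"
 have P: "presents ?Q UNIV ?Gm (%z. ?Gm #>\<^bsub>group_of UNIV\<^esub> z)"
  by (rule presents_FactGroup[OF subgrp_UNIV coeff_image_subgroup[OF G] subset_UNIV])
 note P' = presentsD[OF P]
 show add: "additive UNIV (coeff_quot G)"
  unfolding additive_def coeff_quot_def using P'(3,5) char_embed_mult[of _ ?Q] by simp
 show "coeff_quot G x = 0 \<longleftrightarrow> x : ?Gm"
  unfolding coeff_quot_def using char_embed_eq_0[OF P'(1) P'(3)[OF UNIV_I]] P'(6)[OF UNIV_I] by blast
 show "divisible (range (coeff_quot G))" by (rule divisible_image[OF divisible_char_type add])
qed

lemma presents_homI: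
 assumes P: "presents Q Z B q" and P': "presents Q' Z' B' q'"
  and m: "!!z. z : Z ==> m z : Z'" "!!x y. x : Z ==> y : Z ==> m (x + y) = m x + m y"
  and F: "!!z. z : Z ==> F (q z) = q' (m z)"
 shows "F : hom Q Q'"
proof (rule homI)
 fix a assume a: "a : carrier Q"
 then obtain x where x: "x : Z" "q x = a" using presentsD(4)[OF P] by blast
 show "F a : carrier Q'" using F[OF x(1)] presentsD(3)[OF P' m(1)[OF x(1)]] x(2) by simp
 fix b assume "b : carrier Q"
 then obtain y where y: "y : Z" "q y = b" using presentsD(4)[OF P] by blast
 have "F (q (x + y)) = q' (m x + m y)" using F[OF subgrp_add[OF presentsD(2)[OF P] x(1) y(1)]] m(2)[OF x(1) y(1)] by simp
 thus "F (a \<otimes>\<^bsub>Q\<^esub> b) = F a \<otimes>\<^bsub>Q'\<^esub> F b"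
  using presentsD(5)[OF P x(1) y(1)] presentsD(5)[OF P' m(1)[OF x(1)] m(1)[OF y(1)]] F[OF x(1)] F[OF y(1)] x(2) y(2) by simp
qed

lemma tuple_function_complex:
 assumes G: "comm_group G" shows "cochain_complex (tuple_funs X) (cobdry X) (coeff_quot G)"
 by unfold_locales
  (use tuple_funs_subgroup cobdry_in cobdry_cobdry coeff_quot_additive[OF G] coeff_quot_divisible[OF G] divisible_char_type
   in \<open>auto simp: additive_def cobdry_add\<close>)

locale massey_pair =
 fixes X :: "'a topology" and A :: "'a set" and G :: "('g, 'm) monoid_scheme"
 assumes lc: "locally_compact_space X" and hd: "Hausdorff_space X" and A: "closedin X A" and G: "comm_group G"

sublocale massey_pair \<subseteq> fc: filtered_complex "tuple_funs X" "cobdry X" "coeff_quot G" "closed_nbhds X A" "(\<supseteq>)"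
  "vanishing_on X" "vanishing_on X A"
proof -
 interpret c: cochain_complex "tuple_funs X" "cobdry X" "coeff_quot G" by (rule tuple_function_complex[OF G])
 have cl: "closedin X N" "A <= N" if "N : closed_nbhds X A" for N
  using that interior_of_subset[of X N] by (auto simp: closed_nbhds_def neighbourhood_def)
 have sub: "c.subcomplex (vanishing_on X N)" if N: "closedin X N" for N
  unfolding c.subcomplex_def
  using vanishing_on_subgroup[OF closedin_subset[OF N]] null_subset[OF N] null_cobdry[OF N] by blast
 show "filtered_complex (tuple_funs X) (cobdry X) (coeff_quot G) (closed_nbhds X A) (\<supseteq>) (vanishing_on X) (vanishing_on X A)"
 proof unfold_locales
  have "topspace X : closed_nbhds X A" using closedin_subset[OF A] by (simp add: closed_nbhds_def neighbourhood_def)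
  thus "closed_nbhds X A ~= {}" by blast
  show "EX k:closed_nbhds X A. k <= i & k <= j" if "i : closed_nbhds X A" "j : closed_nbhds X A" for i j
  proof -
   have "i Int j : closed_nbhds X A" using that by (auto simp: closed_nbhds_def neighbourhood_def interior_of_Int)
   thus ?thesis by blast
  qed
  show "c.subcomplex (vanishing_on X i)" if "i : closed_nbhds X A" for i by (rule sub[OF cl(1)[OF that]])
  show "c.subcomplex (vanishing_on X A)" by (rule sub[OF A])
  show "vanishing_on X i q <= vanishing_on X j q" if "j <= i" for i j q by (rule null_functions_antimono[OF that])
  show "vanishing_on X i q <= vanishing_on X A q" if "i : closed_nbhds X A" for i q
   by (rule null_functions_antimono[OF cl(2)[OF that]])
  show "EX ps:vanishing_on X A (q - 1). EX j:closed_nbhds X A. ph - cobdry X ps : vanishing_on X j q"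
   if "ph : vanishing_on X A q" "i : closed_nbhds X A" "cobdry X ph : vanishing_on X i (q + 1)" for ph q i
   by (rule closed_subspace_taut[OF lc hd A that])
 qed auto
qed

context massey_pair
begin

abbreviation "cls N q \<equiv> cochain_class X N q"
abbreviation "kills N q \<equiv> annih (tuple_funs X q) (vanishing_on X N q) {x. coeff_quot G x = 0}"
abbreviation "chains_on N q \<equiv> massey_chains q (subtopology X N) G"
abbreviation "zcyc N q == fc.cone_cycles (vanishing_on X N) q"
abbreviation "zbdr N q == fc.cone_boundaries (vanishing_on X N) q"
abbreviation "homol N q == fc.homologous (vanishing_on X N) q"
abbreviation "cochains_on N q \<equiv> massey_cochains q (subtopology X N) integer_group"

lemma kernel_coeff: "coeff_quot G x = 0 \<longleftrightarrow> (EX g:carrier G. x = char_embed G g)"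
 using coeff_quot_eq_0[OF G] by (auto simp: coeff_image_def)

lemma chains_on_carrier: "u : carrier (chains_on N q) \<longleftrightarrow> u : hom (cochains_on N q) G & u : extensional (carrier (cochains_on N q))"
 by (simp add: massey_chains_def hom_group_def)

definition hom_fun :: "'a set => int => (('a list => int) set => 'g) => ('a list => int) => ('g => circle) => circle"
 where "hom_fun N q u = (%ph. if ph : tuple_funs X q then char_embed G (u (cls N q ph)) else 0)"

lemma embed_inj: "x : carrier G ==> y : carrier G ==> char_embed G x = char_embed G y \<longleftrightarrow> x = y"
 using inj_on_eq_iff[OF char_embed_inj[OF G]] .

lemma embed_one: "char_embed G \<one>\<^bsub>G\<^esub> = 0"
 using char_embed_eq_0[OF G monoid.one_closed[OF group.is_monoid[OF comm_group.axioms(2)[OF G]]]] by simp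

context
 fixes N :: "'a set"
 assumes N: "closedin X N"
begin

lemma subN: "fc.subcomplex (vanishing_on X N)"
 unfolding fc.subcomplex_def
 using vanishing_on_subgroup[OF closedin_subset[OF N]] null_subset[OF N] null_cobdry[OF N] by blast

lemmas cl_presented = cochains_presented[OF N]

lemma chain_at: "u : carrier (chains_on N q) ==> ph : tuple_funs X q ==> u (cls N q ph) : carrier G"
 using chains_on_carrier hom_in_carrier presentsD(3)[OF cl_presented] by metis

lemma chain_eqI:
 assumes u: "u : carrier (chains_on N q)" and w: "w : extensional (carrier (cochains_on N q))"
  and eq: "!!ph. ph : tuple_funs X q ==> w (cls N q ph) : carrier G & char_embed G (w (cls N q ph)) = char_embed G (u (cls N q ph))"
 shows "w = u"
proof (rule extensionalityI[OF w])
 show "u : extensional (carrier (cochains_on N q))" using u chains_on_carrier by blast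
 fix x assume "x : carrier (cochains_on N q)"
 then obtain ph where ph: "ph : tuple_funs X q" "cls N q ph = x" using presentsD(4)[OF cl_presented] by blast
 thus "w x = u x" using eq[OF ph(1)] embed_inj[of "w x" "u x"] chain_at[OF u ph(1)] by simp
qed

lemma hom_fun_in:
 assumes u: "u : carrier (chains_on N q)" shows "hom_fun N q u : kills N q"
proof (rule annihI)
 have uh: "u : hom (cochains_on N q) G" using u chains_on_carrier by blast
 note C = presentsD[OF cl_presented]
 show "additive (tuple_funs X q) (hom_fun N q u)"
  unfolding additive_def
 proof (intro ballI)
  fix ph ps assume p: "ph : tuple_funs X q" "ps : tuple_funs X q"
  have "u (cls N q (ph + ps)) = u (cls N q ph) \<otimes>\<^bsub>G\<^esub> u (cls N q ps)"
   using C(5)[OF p] hom_mult[OF uh C(3)[OF p(1)] C(3)[OF p(2)]] by simp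
  thus "hom_fun N q u (ph + ps) = hom_fun N q u ph + hom_fun N q u ps"
   using p subgrp_add[OF C(2) p] char_embed_mult[OF chain_at[OF u p(1)] chain_at[OF u p(2)]] by (simp add: hom_fun_def)
 qed
 show "hom_fun N q u ph : {x. coeff_quot G x = 0}" if "ph : tuple_funs X q" for ph
  using chain_at[OF u that] that kernel_coeff by (auto simp: hom_fun_def)
 show "hom_fun N q u ph = 0" if ph: "ph : vanishing_on X N q" for ph
 proof -
  have phP: "ph : tuple_funs X q" using ph null_subset[OF N] by blast
  have "u \<one>\<^bsub>cochains_on N q\<^esub> = \<one>\<^bsub>G\<^esub>" by (rule hom_one[OF uh comm_group.axioms(2)[OF C(1)] comm_group.axioms(2)[OF G]])
  hence "u (cls N q ph) = \<one>\<^bsub>G\<^esub>" using C(6)[OF phP] ph by simp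
  thus ?thesis by (simp add: hom_fun_def embed_one)
 qed
qed (simp add: hom_fun_def)

lemma hom_fun_onto:
 assumes f: "f : kills N q" shows "EX u:carrier (chains_on N q). hom_fun N q u = f"
proof -
 note C = presentsD[OF cl_presented] and F = annihD[OF f]
 define u where "u = (\<lambda>x\<in>carrier (cochains_on N q). SOME g. g : carrier G & (EX ph:tuple_funs X q. cls N q ph = x & char_embed G g = f ph))"
 have fc: "f ph = f ps" if p: "ph : tuple_funs X q" "ps : tuple_funs X q" "cls N q ph = cls N q ps" for ph ps
 proof -
  have "ph - ps : vanishing_on X N q" using presents_eq_iff[OF cl_presented p(1,2)] p(3) by simp
  thus ?thesis using F(4) additive_diff[OF C(2) F(1) p(1,2)] by simp
 qed
 have uc: "u (cls N q ph) : carrier G & char_embed G (u (cls N q ph)) = f ph" if ph: "ph : tuple_funs X q" for ph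
 proof -
  obtain g where "g : carrier G" "f ph = char_embed G g" using F(2)[OF ph] kernel_coeff by auto
  hence ex: "EX g. g : carrier G & (EX ps:tuple_funs X q. cls N q ps = cls N q ph & char_embed G g = f ps)" using ph by metis
  have "u (cls N q ph) : carrier G & (EX ps:tuple_funs X q. cls N q ps = cls N q ph & char_embed G (u (cls N q ph)) = f ps)"
   unfolding u_def restrict_apply'[OF C(3)[OF ph]] by (rule someI_ex[OF ex])
  thus ?thesis using fc ph by metis
 qed
 have "u : hom (cochains_on N q) G"
 proof (rule homI)
  fix x assume "x : carrier (cochains_on N q)"
  then obtain ph where ph: "ph : tuple_funs X q" "cls N q ph = x" using C(4) by blast
  show "u x : carrier G" using uc[OF ph(1)] ph(2) by simp
  fix y assume "y : carrier (cochains_on N q)"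
  then obtain ps where ps: "ps : tuple_funs X q" "cls N q ps = y" using C(4) by blast
  have "char_embed G (u (cls N q (ph + ps))) = char_embed G (u x \<otimes>\<^bsub>G\<^esub> u y)"
   using uc[OF subgrp_add[OF C(2) ph(1) ps(1)]] uc[OF ph(1)] uc[OF ps(1)] additiveD[OF F(1) ph(1) ps(1)] ph(2) ps(2)
    char_embed_mult[of "u x" G "u y"] by simp
  moreover have "u x \<otimes>\<^bsub>G\<^esub> u y : carrier G"
   using uc[OF ph(1)] uc[OF ps(1)] ph(2) ps(2) monoid.m_closed[OF group.is_monoid[OF comm_group.axioms(2)[OF G]]] by blast
  ultimately show "u (x \<otimes>\<^bsub>cochains_on N q\<^esub> y) = u x \<otimes>\<^bsub>G\<^esub> u y"
   using embed_inj[of "u (x \<otimes>\<^bsub>cochains_on N q\<^esub> y)" "u x \<otimes>\<^bsub>G\<^esub> u y"] uc[OF subgrp_add[OF C(2) ph(1) ps(1)]] C(5)[OF ph(1) ps(1)] ph(2) ps(2) by simp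
 qed
 hence "u : carrier (chains_on N q)" using chains_on_carrier by (simp add: u_def)
 moreover have "hom_fun N q u = f" using uc F(3) by (auto simp: hom_fun_def fun_eq_iff)
 ultimately show ?thesis by blast
qed

definition fun_hom :: "int => (('a list => int) => ('g => circle) => circle) => ('a list => int) set => 'g"
 where "fun_hom q f = (SOME u. u : carrier (chains_on N q) & hom_fun N q u = f)"

lemma fun_hom:
 assumes "f : kills N q" shows "fun_hom q f : carrier (chains_on N q)" "hom_fun N q (fun_hom q f) = f"
proof -
 have "EX u. u : carrier (chains_on N q) & hom_fun N q u = f" using hom_fun_onto[OF assms] by blast
 hence "fun_hom q f : carrier (chains_on N q) & hom_fun N q (fun_hom q f) = f" unfolding fun_hom_def by (rule someI_ex)
 thus "fun_hom q f : carrier (chains_on N q)" "hom_fun N q (fun_hom q f) = f" by blast+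
qed

lemma fun_hom_at:
 assumes "f : kills N q" "ph : tuple_funs X q" shows "char_embed G (fun_hom q f (cls N q ph)) = f ph"
 using fun_cong[OF fun_hom(2)[OF assms(1)], of ph] assms(2) by (simp add: hom_fun_def)

lemma fun_hom_eqI:
 assumes f: "f : kills N q" and w: "w : extensional (carrier (cochains_on N q))"
  and eq: "!!ph. ph : tuple_funs X q ==> w (cls N q ph) : carrier G & char_embed G (w (cls N q ph)) = f ph"
 shows "w = fun_hom q f"
 by (rule chain_eqI[OF fun_hom(1)[OF f] w]) (use eq fun_hom_at[OF f] in simp)

lemma fun_hom_hom_fun: "u : carrier (chains_on N q) ==> fun_hom q (hom_fun N q u) = u"
 using fun_hom_eqI[OF hom_fun_in, of u q u] chain_at by (simp add: hom_fun_def chains_on_carrier)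

lemma codiff_kills: "f : kills N (q + 1) ==> fc.codiff q f : kills N q"
 by (rule fc.codiff_in[OF subN]) (simp_all add: fc.\<pi>0)

lemma boundary_fun:
 assumes u: "u : carrier (chains_on N (q + 1))"
 shows "massey_boundary (q + 1) (subtopology X N) u = fun_hom q (fc.codiff q (hom_fun N (q + 1) u))"
proof (rule fun_hom_eqI[OF codiff_kills[OF hom_fun_in[OF u]]])
 show "massey_boundary (q + 1) (subtopology X N) u : extensional (carrier (cochains_on N q))" by (simp add: massey_boundary_def)
 fix ph assume ph: "ph : tuple_funs X q"
 have "massey_boundary (q + 1) (subtopology X N) u (cls N q ph) = u (cls N (q + 1) (cobdry X ph))"
  using presentsD(3)[OF cl_presented ph] coboundary_class[OF N ph] by (simp add: massey_boundary_def)
 thus "massey_boundary (q + 1) (subtopology X N) u (cls N q ph) : carrier G &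
  char_embed G (massey_boundary (q + 1) (subtopology X N) u (cls N q ph)) = fc.codiff q (hom_fun N (q + 1) u) ph"
  using chain_at[OF u cobdry_in[OF ph]] ph cobdry_in[OF ph] by (simp add: fc.codiff_def hom_fun_def)
qed

lemma zero_kills: "0 : kills N q"
 by (rule annihI) (simp_all add: additive_def fc.\<pi>0)

lemma one_fun: "\<one>\<^bsub>chains_on N q\<^esub> = fun_hom q 0"
proof (rule fun_hom_eqI[OF zero_kills])
 have one: "\<one>\<^bsub>chains_on N q\<^esub> = (\<lambda>c\<in>carrier (cochains_on N q). \<one>\<^bsub>G\<^esub>)"
  by (simp add: massey_chains_def hom_group_def product_group_def)
 show "\<one>\<^bsub>chains_on N q\<^esub> : extensional (carrier (cochains_on N q))" unfolding one by simp
 show "\<one>\<^bsub>chains_on N q\<^esub> (cls N q ph) : carrier G & char_embed G (\<one>\<^bsub>chains_on N q\<^esub> (cls N q ph)) = 0 ph"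
  if "ph : tuple_funs X q" for ph
  using presentsD(3)[OF cl_presented that] embed_one monoid.one_closed[OF group.is_monoid[OF comm_group.axioms(2)[OF G]]]
  by (simp add: one)
qed

lemma fun_hom_inj: "f : kills N q ==> g : kills N q ==> fun_hom q f = fun_hom q g \<longleftrightarrow> f = g"
 using fun_hom(2) by metis

abbreviation "cycles_on q \<equiv> fc.dual_cycles (vanishing_on X N) q"
abbreviation "boundaries_on q \<equiv> fc.dual_boundaries (vanishing_on X N) q"

lemma kernel_subgroup: "subgrp {x. coeff_quot G x = 0}"
 using subgrp_kernel[OF subgrp_UNIV fc.\<pi>_add] by simp

lemma codiff_additive: "additive S (fc.codiff q)"
 by (auto simp: additive_def fc.codiff_def fun_eq_iff)

lemma dual_subgroups: "subgrp (cycles_on q)" "subgrp (boundaries_on q)" "boundaries_on q <= cycles_on q" "cycles_on q <= kills N q"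
proof -
 show "subgrp (cycles_on q)" unfolding fc.dual_cycles_def
  by (rule subgrp_kernel[OF annih_subgroup[OF kernel_subgroup] codiff_additive])
 show "subgrp (boundaries_on q)" unfolding fc.dual_boundaries_def
  by (rule subgrp_image[OF annih_subgroup[OF kernel_subgroup] codiff_additive])
 show "cycles_on q <= kills N q" by (auto simp: fc.dual_cycles_def)
 have "fc.codiff (q - 1) (fc.codiff q f) = 0" if f: "f : kills N (q + 1)" for f
 proof
  have f0: "f 0 = 0" by (rule additive_0[OF fc.P annihD(1)[OF f]])
  fix ph show "fc.codiff (q - 1) (fc.codiff q f) ph = 0 ph"
   using fc.\<delta>_\<delta>[of ph "q - 1"] f0 by (simp add: fc.codiff_def)
 qed
 thus "boundaries_on q <= cycles_on q" using codiff_kills by (auto simp: fc.dual_boundaries_def fc.dual_cycles_def)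
qed

definition homology_class :: "int => (('a list => int) => ('g => circle) => circle) => (('a list => int) set => 'g) set"
 where "homology_class q f = massey_boundaries q (subtopology X N) G #>\<^bsub>massey_cycles q (subtopology X N) G\<^esub> fun_hom q f"

lemma homology_presented:
 "comm_group (massey_cycles q (subtopology X N) G)"
 "subgroup (massey_boundaries q (subtopology X N) G) (massey_cycles q (subtopology X N) G)"
 "fun_hom q ` cycles_on q = carrier (massey_cycles q (subtopology X N) G)"
 "presents (massey_homology q (subtopology X N) G) (cycles_on q) (boundaries_on q) (homology_class q)"
proof -
 let ?H = "massey_cycles q (subtopology X N) G" and ?B = "massey_boundaries q (subtopology X N) G"
 note S = dual_subgroups[of q]
 have H: "u : carrier ?H \<longleftrightarrow> u : carrier (chains_on N q) & massey_boundary q (subtopology X N) u = \<one>\<^bsub>chains_on N (q - 1)\<^esub>" for u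
  by (simp add: massey_cycles_def kernel_def)
 have cyc: "u : carrier ?H \<longleftrightarrow> hom_fun N q u : cycles_on q" if u: "u : carrier (chains_on N q)" for u
 proof -
  have u': "u : carrier (chains_on N (q - 1 + 1))" using u by simp
  have "massey_boundary q (subtopology X N) u = fun_hom (q - 1) (fc.codiff (q - 1) (hom_fun N q u))"
   using boundary_fun[OF u'] by simp
  moreover have "fc.codiff (q - 1) (hom_fun N q u) : kills N (q - 1)" using codiff_kills[OF hom_fun_in[OF u']] by simp
  ultimately show ?thesis using H u hom_fun_in[OF u] fun_hom_inj[OF _ zero_kills] one_fun
   by (simp add: fc.dual_cycles_def)
 qed
 show im: "fun_hom q ` cycles_on q = carrier ?H"
 proof (intro equalityI subsetI)
  fix u assume "u : fun_hom q ` cycles_on q"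
  then obtain f where f: "f : cycles_on q" "u = fun_hom q f" by blast
  have "f : kills N q" using f(1) S(4) by blast
  thus "u : carrier ?H" using cyc fun_hom f by simp
 next
  fix u assume u: "u : carrier ?H"
  hence "u : carrier (chains_on N q)" using H by blast
  thus "u : fun_hom q ` cycles_on q" using cyc u fun_hom_hom_fun by (metis imageI)
 qed
 have mult: "fun_hom q (f + g) = fun_hom q f \<otimes>\<^bsub>?H\<^esub> fun_hom q g" if "f : cycles_on q" "g : cycles_on q" for f g
 proof (rule fun_hom_eqI[symmetric])
  have f: "f : kills N q" and g: "g : kills N q" using that S(4) by blast+
  show "f + g : kills N q" using subgrp_add[OF annih_subgroup[OF kernel_subgroup] f g] .
  have m: "fun_hom q f \<otimes>\<^bsub>?H\<^esub> fun_hom q g = (\<lambda>c\<in>carrier (cochains_on N q). fun_hom q f c \<otimes>\<^bsub>G\<^esub> fun_hom q g c)"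
   by (simp add: massey_cycles_def massey_chains_def hom_group_def product_group_def)
  show "fun_hom q f \<otimes>\<^bsub>?H\<^esub> fun_hom q g : extensional (carrier (cochains_on N q))" unfolding m by simp
  fix ph assume ph: "ph : tuple_funs X q"
  note c = chain_at[OF fun_hom(1)[OF f] ph] chain_at[OF fun_hom(1)[OF g] ph]
  show "(fun_hom q f \<otimes>\<^bsub>?H\<^esub> fun_hom q g) (cls N q ph) : carrier G &
   char_embed G ((fun_hom q f \<otimes>\<^bsub>?H\<^esub> fun_hom q g) (cls N q ph)) = (f + g) ph"
   unfolding m using c presentsD(3)[OF cl_presented ph] char_embed_mult[OF c] fun_hom_at[OF f ph] fun_hom_at[OF g ph]
    monoid.m_closed[OF group.is_monoid[OF comm_group.axioms(2)[OF G]] c] by simp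
 qed
 have one: "\<one>\<^bsub>?H\<^esub> = fun_hom q 0" using one_fun by (simp add: massey_cycles_def)
 have B: "fun_hom q z : ?B \<longleftrightarrow> z : boundaries_on q" if z: "z : kills N q" for z
 proof
  assume "fun_hom q z : ?B"
  then obtain w where w: "w : carrier (chains_on N (q + 1))" "fun_hom q z = massey_boundary (q + 1) (subtopology X N) w"
   unfolding massey_boundaries_def by blast
  have "z = fc.codiff q (hom_fun N (q + 1) w)"
   using w(2) boundary_fun[OF w(1)] fun_hom_inj[OF z codiff_kills[OF hom_fun_in[OF w(1)]]] by simp
  thus "z : boundaries_on q" using hom_fun_in[OF w(1)] by (auto simp: fc.dual_boundaries_def)
 next
  assume "z : boundaries_on q"
  then obtain a where a: "a : kills N (q + 1)" "z = fc.codiff q a" by (auto simp: fc.dual_boundaries_def)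
  have "fun_hom q z = massey_boundary (q + 1) (subtopology X N) (fun_hom (q + 1) a)"
   using boundary_fun[OF fun_hom(1)[OF a(1)]] fun_hom(2)[OF a(1)] a(2) by simp
  thus "fun_hom q z : ?B" using fun_hom(1)[OF a(1)] unfolding massey_boundaries_def by blast
 qed
 have BH: "?B <= carrier ?H"
 proof
  fix u assume u: "u : ?B"
  then obtain w where w: "w : carrier (chains_on N (q + 1))" "u = massey_boundary (q + 1) (subtopology X N) w"
   unfolding massey_boundaries_def by blast
  have "fc.codiff q (hom_fun N (q + 1) w) : cycles_on q" using hom_fun_in[OF w(1)] S(3) by (auto simp: fc.dual_boundaries_def)
  thus "u : carrier ?H" using boundary_fun[OF w(1)] w(2) im by blast
 qed
 have Bc: "fun_hom q z : ?B \<longleftrightarrow> z : boundaries_on q" if "z : cycles_on q" for z by (rule B) (use that S(4) in blast)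
 note R = presents_parametrized[OF S(1,2,3) im mult one BH Bc]
 show "comm_group ?H" by (rule R(1))
 show "subgroup ?B ?H" by (rule R(2))
 show "presents (massey_homology q (subtopology X N) G) (cycles_on q) (boundaries_on q) (homology_class q)"
  using R(3) by (simp add: massey_homology_def homology_class_def[abs_def])
qed

text \<open>The null sets here are the sets of tuples that avoid a neighbourhood of the diagonal of \<open>N\<close>; a function vanishes near the
 diagonal exactly if its support is such a set.\<close>

lemma coefficient_lift:
 assumes g: "g : annih (tuple_funs X m) (vanishing_on X N m) (range (coeff_quot G))"
 shows "EX f:annih (tuple_funs X m) (vanishing_on X N m) UNIV. fc.push m f = g"
proof -
 let ?P = "tuple_funs X m"
 define null where "null = {W :: 'a list set. ALL x:N. EX U. openin X U & x : U & (ALL xs. set xs <= U Int N --> xs ~: W)}"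
 have null_iff: "{w. ph w ~= 0} : null \<longleftrightarrow> ph : vanishing_on X N m" if "ph : ?P" for ph
  using that by (auto simp: null_def vanishing_on_def vanishes_near_def)
 note A = annihD[OF g]
 have "EX h. additive ?P h & h ` ?P <= UNIV & (ALL ph:?P. coeff_quot G (h ph) = g ph) & (ALL ph:?P. {w. ph w ~= 0} : null --> h ph = 0)"
 proof (rule hom_lifts[where \<pi>="coeff_quot G" and D=UNIV and \<N>=null, OF divisible_char_type fc.\<pi>_add fc.divF fc.P])
  show "finite (range ph)" if "ph : ?P" for ph by (rule tuple_funsD(4)[OF that])
  have "EX U. openin X U & x : U" if "x : N" for x using closedin_subset[OF N] that by (intro exI[of _ "topspace X"]) auto
  thus "{} : null" by (simp add: null_def)
  show "V Un W : null" if V: "V : null" and W: "W : null" for V W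
   unfolding null_def
  proof (intro CollectI ballI)
   fix x assume x: "x : N"
   obtain U1 where U1: "openin X U1" "x : U1" "ALL xs. set xs <= U1 Int N --> xs ~: V" using V x by (auto simp: null_def)
   obtain U2 where U2: "openin X U2" "x : U2" "ALL xs. set xs <= U2 Int N --> xs ~: W" using W x by (auto simp: null_def)
   have "ALL xs. set xs <= (U1 Int U2) Int N --> xs ~: V Un W" using U1(3) U2(3) by blast
   thus "EX U. openin X U & x : U & (ALL xs. set xs <= U Int N --> xs ~: V Un W)"
    using U1(1,2) U2(1,2) by (intro exI[of _ "U1 Int U2"]) (simp add: openin_Int)
  qed
  show "W : null" if V: "V : null" and WV: "W <= V" for V W
   using V WV unfolding null_def by blast
  show "additive ?P g" by (rule A(1))
  show "g ` ?P <= range (coeff_quot G)" using A(2) by blast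
  show "g ph = 0" if "ph : ?P" "{w. ph w ~= 0} : null" for ph using null_iff[OF that(1)] that(2) A(4) by blast
 qed
 then obtain h where h: "additive ?P h" "ALL ph:?P. coeff_quot G (h ph) = g ph" "ALL ph:?P. {w. ph w ~= 0} : null --> h ph = 0"
  by (elim exE conjE)
 define f where "f = (%ph. if ph : ?P then h ph else 0)"
 have "f : annih ?P (vanishing_on X N m) UNIV"
 proof (rule annihI)
  show "additive ?P f" using h(1) subgrp_add[OF fc.P] unfolding additive_def f_def by simp
  show "f ph = 0" if "ph : vanishing_on X N m" for ph
  proof -
   have ph: "ph : ?P" using that null_subset[OF N] by blast
   hence "h ph = 0" using h(3) null_iff[OF ph] that by blast
   thus ?thesis by (simp add: f_def)
  qed
 qed (simp_all add: f_def)
 moreover have "fc.push m f = g" using h(2) A(3) by (auto simp: fc.push_def f_def fun_eq_iff)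
 ultimately show ?thesis by blast
qed

definition cone_class :: "int => ((('a list => int) => ('g => circle) => circle) \<times> (('a list => int) => ((('g => circle) => circle) set => circle) => circle)) => (('a list => int) set => 'g) set"
 where "cone_class q = (SOME h. presents (massey_homology q (subtopology X N) G)
   (zcyc N q) (zbdr N q) h &
  (ALL f t. homol N q f t --> h t = homology_class q f) &
  (ALL t:zcyc N q. EX f. homol N q f t))"

lemma cone_class:
 "presents (massey_homology q (subtopology X N) G) (zcyc N q) (zbdr N q) (cone_class q)"
 "homol N q f t ==> cone_class q t = homology_class q f"
 "t : zcyc N q ==> EX f. homol N q f t"
proof -
 let ?\<Phi> = "%h. presents (massey_homology q (subtopology X N) G)
   (zcyc N q) (zbdr N q) h &
  (ALL f t. homol N q f t --> h t = homology_class q f) &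
  (ALL t:zcyc N q. EX f. homol N q f t)"
 have "EX h. ?\<Phi> h" by (rule fc.cone_homology_presented[OF subN coefficient_lift homology_presented(4)])
 hence S: "?\<Phi> (cone_class q)" unfolding cone_class_def by (rule someI_ex)
 show "presents (massey_homology q (subtopology X N) G) (zcyc N q) (zbdr N q) (cone_class q)"
  by (rule S[THEN conjunct1])
 show "cone_class q t = homology_class q f" if "homol N q f t"
  by (rule S[THEN conjunct2, THEN conjunct1, rule_format, OF that])
 show "EX f. homol N q f t" if "t : zcyc N q"
  by (rule S[THEN conjunct2, THEN conjunct2, THEN bspec, OF that])
qed

end

text \<open>For \<open>M \<subseteq> N\<close> the induced map is represented by the identity: a homomorphism killing \<open>K M\<close> also kills the smaller group
 \<open>K N\<close>.\<close>

lemma induced_homology_class: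
 assumes N: "closedin X N" and M: "closedin X M" and MN: "M <= N"
  and f: "f : fc.dual_cycles (vanishing_on X M) q"
 shows "massey_induced q (subtopology X M) (subtopology X N) G id (homology_class M q f) = homology_class N q f"
proof -
 note R = homology_presented[OF M, of q]
 have K: "vanishing_on X N q' <= vanishing_on X M q'" for q' by (rule null_functions_antimono[OF MN])
 have kills: "kills M q' <= kills N q'" for q' by (rule fc.annih_antimono[OF K])
 have cyc: "fc.dual_cycles (vanishing_on X M) q <= fc.dual_cycles (vanishing_on X N) q"
  using kills by (auto simp: fc.dual_cycles_def)
 have bdr: "fc.dual_boundaries (vanishing_on X M) q <= fc.dual_boundaries (vanishing_on X N) q"
  using kills by (auto simp: fc.dual_boundaries_def)
 have P: "presents (massey_cycles q (subtopology X M) G Mod massey_boundaries q (subtopology X M) G)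
   (fc.dual_cycles (vanishing_on X M) q) (fc.dual_boundaries (vanishing_on X M) q)
   (%f. massey_boundaries q (subtopology X M) G #>\<^bsub>massey_cycles q (subtopology X M) G\<^esub> fun_hom M q f)"
  using R(4) by (simp add: massey_homology_def homology_class_def[OF M, abs_def])
 let ?f = "%u. \<lambda>c\<in>carrier (cochains_on N q). u (massey_pullback q (subtopology X M) integer_group id c)"
 have fh: "?f (fun_hom M q y) = fun_hom N q y" if y: "y : fc.dual_cycles (vanishing_on X M) q" for y
 proof (rule fun_hom_eqI[OF N])
  have yM: "y : kills M q" using y dual_subgroups(4)[OF M] by blast
  thus "y : kills N q" using kills by blast
  fix ph assume ph: "ph : tuple_funs X q"
  have "?f (fun_hom M q y) (cls N q ph) = fun_hom M q y (cls M q ph)"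
   using presentsD(3)[OF cochains_presented[OF N] ph] pullback_class[OF M N MN ph] by simp
  thus "?f (fun_hom M q y) (cls N q ph) : carrier G & char_embed G (?f (fun_hom M q y) (cls N q ph)) = y ph"
   using chain_at[OF M fun_hom(1)[OF M yM] ph] fun_hom_at[OF M yM ph] by simp
 qed simp
 show ?thesis
  unfolding massey_induced_def homology_class_def[OF M]
 proof (rule quotient_map_presented[where ph="fun_hom M q", OF R(1,2,3) P f])
  fix y assume y: "y : fc.dual_cycles (vanishing_on X M) q"
  show "massey_boundaries q (subtopology X N) G #>\<^bsub>massey_cycles q (subtopology X N) G\<^esub> ?f (fun_hom M q y) = homology_class N q y"
   unfolding fh[OF y] by (simp add: homology_class_def[OF N])
  assume "y - f : fc.dual_boundaries (vanishing_on X M) q"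
  thus "homology_class N q y = homology_class N q f"
   using presents_eq_iff[OF homology_presented(4)[OF N], of y q f] cyc bdr y f by blast
 qed
qed

lemma induced_cone_class:
 assumes N: "closedin X N" and M: "closedin X M" and MN: "M <= N"
  and t: "t : zcyc M q"
 shows "massey_induced q (subtopology X M) (subtopology X N) G id (cone_class M q t) = cone_class N q t"
proof -
 obtain f where f: "homol M q f t" using cone_class(3)[OF M t] by blast
 have fN: "homol N q f t"
  by (rule fc.homologous_antimono[OF f null_functions_antimono[OF MN]])
 have "f : fc.dual_cycles (vanishing_on X M) q" using f by (simp add: fc.homologous_def)
 thus ?thesis
  using induced_homology_class[OF N M MN] cone_class(2)[OF M f] cone_class(2)[OF N fN] by simp
qed

lemma cl: "N : closed_nbhds X A ==> closedin X N" and nbhd: "N : closed_nbhds X A ==> A <= N"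
 using interior_of_subset[of X N] by (auto simp: closed_nbhds_def neighbourhood_def)

lemma cone_cycles_mono: "M <= N ==> t : zcyc M q ==> t : zcyc N q"
 using fc.cone_cycles_antimono[of "vanishing_on X N" "vanishing_on X M" q] null_functions_antimono by blast

lemma massey_inverse_system: "inverse_system (closed_nbhds X A) (\<supseteq>) (massey_system q X G)"
 unfolding inverse_system_def
proof (intro conjI ballI impI)
 note [simp] = massey_system_def
 fix N assume N: "N : closed_nbhds X A"
 note PN = cone_class(1)[OF cl[OF N], of q]
 show "comm_group (grp (massey_system q X G) N)" using presentsD(1)[OF PN] by simp
 show "bond (massey_system q X G) N N x = x" if "x : carrier (grp (massey_system q X G) N)" for x
  using presentsD(4)[OF PN, of x] that induced_cone_class[OF cl[OF N] cl[OF N] subset_refl] by auto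
 fix M assume M: "M : closed_nbhds X A"
 note PM = cone_class(1)[OF cl[OF M], of q]
 show "bond (massey_system q X G) N M : hom (grp (massey_system q X G) M) (grp (massey_system q X G) N)" if MN: "M <= N"
 proof -
  have "massey_induced q (subtopology X M) (subtopology X N) G id : hom (massey_homology q (subtopology X M) G) (massey_homology q (subtopology X N) G)"
   by (rule presents_homI[where m="%t. t", OF PM PN cone_cycles_mono[OF MN] refl induced_cone_class[OF cl[OF N] cl[OF M] MN]])
  thus ?thesis by simp
 qed
 fix L x assume L: "L : closed_nbhds X A" and sub: "M <= N & L <= M" and x: "x : carrier (grp (massey_system q X G) L)"
 have LM: "L <= M" and MN: "M <= N" and LN: "L <= N" using sub by blast+
 obtain t where t: "t : zcyc L q" "cone_class L q t = x"
  using presentsD(4)[OF cone_class(1)[OF cl[OF L], of q], of x] x by auto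
 show "bond (massey_system q X G) N L x = bond (massey_system q X G) N M (bond (massey_system q X G) M L x)"
  using induced_cone_class[OF cl[OF N] cl[OF L] LN t(1)] induced_cone_class[OF cl[OF M] cl[OF L] LM t(1)]
   induced_cone_class[OF cl[OF N] cl[OF M] MN cone_cycles_mono[OF LM t(1)]] t(2) by simp
qed

lemma cone_subsystem: "fc.subsystem (fc.Z q) (fc.B q) incl"
 unfolding fc.subsystem_def using fc.sys(2,3) fc.BN fc.NZ by blast

lemma cone_class_system:
 assumes "N : closed_nbhds X A"
 shows "presents (grp (massey_system q X G) N) (fc.Z q N) (fc.B q N) (cone_class N q)"
 using cone_class(1)[OF cl[OF assms]] by (simp add: massey_system_def fc.Z_def fc.B_def)

lemma cone_class_natural:
 assumes "N : closed_nbhds X A" "M : closed_nbhds X A" "M <= N" "x : fc.Z q M"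
 shows "cone_class N q x = bond (massey_system q X G) N M (cone_class M q x)"
 using induced_cone_class[OF cl[OF assms(1)] cl[OF assms(2)] assms(3)] assms(4) by (simp add: massey_system_def fc.Z_def)

lemma nbhd_restriction_cone:
 assumes z: "z : zcyc A n"
 shows "nbhd_restriction n X A G (cone_class A n z) = (\<lambda>N\<in>closed_nbhds X A. cone_class N n (fc.const z [N]))"
 unfolding nbhd_restriction_def
proof (rule restrict_ext)
 fix N assume N: "N : closed_nbhds X A"
 show "massey_induced n (subtopology X A) (subtopology X N) G id (cone_class A n z) = cone_class N n (fc.const z [N])"
  using induced_cone_class[OF cl[OF N] A nbhd[OF N] z] by (simp add: fc.const_at[OF N])
qed

end

theorem theorem2:
  fixes X :: "'a topology" and A :: "'a set" and G :: "('g, 'm) monoid_scheme" and n :: int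
  assumes "locally_compact_space X" and "Hausdorff_space X"
    and "closedin X A"
    and "comm_group G"
  shows "\<exists>\<alpha> \<theta> \<beta>0 \<beta>.
    (\<forall>k. exact_at
           (nbhd_derived_limit (2 * k + 5) (n + int k + 3) X A G) (\<alpha> (Suc k))
           (nbhd_derived_limit (2 * k + 3) (n + int k + 2) X A G) (\<alpha> k)
           (nbhd_derived_limit (2 * k + 1) (n + int k + 1) X A G)) \<and>
    exact_at
      (nbhd_derived_limit 3 (n + 2) X A G) (\<alpha> 0)
      (nbhd_derived_limit 1 (n + 1) X A G) \<theta>
      (massey_homology n (subtopology X A) G) \<and>
    exact_at
      (nbhd_derived_limit 1 (n + 1) X A G) \<theta>
      (massey_homology n (subtopology X A) G) (nbhd_restriction n X A G)
      (nbhd_limit n X A G) \<and>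
    exact_at
      (massey_homology n (subtopology X A) G) (nbhd_restriction n X A G)
      (nbhd_limit n X A G) \<beta>0
      (nbhd_derived_limit 2 (n + 1) X A G) \<and>
    exact_at
      (nbhd_limit n X A G) \<beta>0
      (nbhd_derived_limit 2 (n + 1) X A G) (\<beta> 0)
      (nbhd_derived_limit 4 (n + 2) X A G) \<and>
    (\<forall>k. exact_at
           (nbhd_derived_limit (2 * k + 2) (n + int k + 1) X A G) (\<beta> k)
           (nbhd_derived_limit (2 * k + 4) (n + int k + 2) X A G) (\<beta> (Suc k))
           (nbhd_derived_limit (2 * k + 6) (n + int k + 3) X A G))"
proof -
 interpret massey_pair X A G by (rule massey_pair.intro[OF assms])
 have M: "presents (nbhd_limit n X A G) (fc.rcocycles (fc.Z n) (fc.B n) incl 0) (fc.cochains 0 (fc.B n))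
   (%c. \<lambda>N\<in>closed_nbhds X A. cone_class N n (c [N]))"
  unfolding nbhd_limit_def
  by (rule fc.inverse_limit_presented[OF massey_inverse_system cone_subsystem cone_class_system cone_class_natural])
 note H = cone_class(1)[OF A, of n]
 have constZ: "fc.const z : fc.rcocycles (fc.Z n) (fc.B n) incl 0" if "z : zcyc A n" for z
  using fc.const_cochain[of z "fc.Z n"] fc.cycles_L_Z[OF that] subgrp_0[OF fc.cochains_subgroups(3)] by (simp add: fc.rcocycles_def fc.const_diff)
 have const_add: "fc.const (x + y) = fc.const x + fc.const y" for x y :: "(('a list => int) => ('g => circle) => circle) \<times> (('a list => int) => ((('g => circle) => circle) set => circle) => circle)"
  by (auto simp: fc.const_def fun_eq_iff)
 have res: "nbhd_restriction n X A G : hom (massey_homology n (subtopology X A) G) (nbhd_limit n X A G)"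
  by (rule presents_homI[where m=fc.const, OF H M constZ const_add nbhd_restriction_cone])
 have D: "EX d. presents (nbhd_derived_limit (Suc k) q X A G) (fc.rcocycles (fc.Z q) (fc.B q) incl (Suc k)) (fc.rboundaries (fc.Z q) (fc.B q) incl k) d" for k q
  unfolding nbhd_derived_limit_def
  by (rule fc.derived_limit_presented[OF massey_inverse_system cone_subsystem cone_class_system cone_class_natural])
 show ?thesis
  by (rule fc.exact_sequence[where D="%k q. nbhd_derived_limit k q X A G", OF D M H res nbhd_restriction_cone])
qed

end
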